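(* Let $E=E_1\times E_2$ with $E_1$ a finite set and $E_2$ a metric space. Let $\{P(u,\cdot,\cdot;z):u\in[0,1],z\in E_2\}$ be a family of stochastic matrices on $E_1$ (measurable in $z$), and $\{\overline Q_u:u\in[0,1]\}$ Markov kernels on $E_2$ of the form $\overline Q_u(z_1,dz_2)=\overline f(u,z_1,z_2)\overline\gamma(z_1,dz_2)$ with $\overline f:[0,1]\times E_2^2\to[0,\infty)$ measurable and $\overline\gamma$ a (nonnegative measure) kernel on $E_2$. Define Markov kernels on $E$ by $$Q_u((y_1,z_1),(dy_2,dz_2))=P(u,y_1,y_2;z_2)\,c(dy_2)\,\overline Q_u(z_1,dz_2),$$ $c$ being the counting measure on $E_1$. Let $k\ge1$ be an integer and assume: (E41) For all $(y_1,y_2,z_2)\in E_1^2\times E_2$, $u\mapsto P(u,y_1,y_2;z_2)$ is $k$-times continuously differentiable and positive on $[0,1]$. (E42) There is a measurable $\overline\phi:E_2\to[1,\infty)$ such that: (i) there exist an integer $\overline m\ge1$, real numbers $\overline d_0\ge1$, $\overline\epsilon,\overline K,\overline b>0$, $\overline\lambda\in(0,1)$, positive numbers $\{\overline\eta_r:r>0\}$ and probability measures $\{\overline\nu_r:r>0\}$ on $E_2$ such that for all $r>0$ and all $(u_1,\ldots,u_{\overline m})\in[0,1]^{\overline m}$ with $|u_i-u_j|<\overline\epsilon$ for all $i,j$, the kernel $\overline P=\overline Q_{u_1}\cdots\overline Q_{u_{\overline m}}$ satisfies $\overline P\,\overline\phi^{\overline d_0}\le\overline\lambda\,\overline\phi^{\overline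 d_0}+\overline b$ and $\overline P(z,A)\ge\overline\eta_r\overline\nu_r(A)$ for all Borel $A$ and all $z$ with $\overline\phi(z)^{\overline d_0}\le r$; moreover $\overline Q_u\overline\phi^{\overline d_0}\le\overline K\,\overline\phi^{\overline d_0}$ for all $u\in[0,1]$; (ii) for all $(z,z')\in E_2^2$, $u\mapsto\overline f(u,z,z')$ is $k$-times continuously differentiable; (iii) there exist $\overline d_1>0$, $\overline q\ge0$, $\overline C>0$ with $\overline d_1+k\overline q\le\overline d_0$ such that for all $1\le\ell\le k$, $0\le d\le\overline d_1+(k-\ell)\overline q$, $u\in[0,1]$, $z\in E_2$, $\int\overline\phi^d(z')|\partial_1^{(\ell)}\overline f(u,z,z')|\overline\gamma(z,dz')\le\overline C\,\overline\phi^{d+\overline q\ell}(z)$; and for $s=0,\ldots,k$, $u\in[0,1]$, $z\in E_2$, $\lim_{h\to0}\int\overline\phi^{\overline d_1+\overline qs}(z')|\partial_1^{(k-s)}\overline f(u+h,z,z')-\partial_1^{(k-s)}\overline f(u,z,z')|\overline\gamma(z,dz')=0$. (E43) There is $C>0$ such that for $\ell=0,\ldots,k$ and $z\in E_2$, $\sup_{u\in[0,1]}\max_{y,y'\in E_1}|\partial_1^{(\ell)}P(u,y,y';z)|\le C\,\overline\phi(z)^{\overline q\ell}$. Set $V_0(y,z)=\overline\phi(z)^{\overline d_1}$ for $(y,z)\in E$. Then the triangular array of Markov chains $\{X_{n,t}:1\le t\le n,n\ge1\}$ on $E$ with transition kernel $Q_{t/n}$ at time $t$ (see context) is $V_0$-locally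 stationary, and for every integer $j\ge1$ the map $u\mapsto\pi_{u,j}$ from $[0,1]$ to $\mathcal{M}_{V_0}(E^j)$ is $k$-times continuously differentiable.
   Context: $\partial_1^{(\ell)}$ denotes the $\ell$-th partial derivative with respect to $u$. $\pi_u$ is the (unique) invariant probability measure of $Q_u$. The array satisfies $X_{n,0}\sim\pi_0$ and $\mathbb{P}(X_{n,t}\in A\mid X_{n,t-1}=x)=Q_{t/n}(x,A)$ for $1\le t\le n$ (Markov chains). For measurable $V:E\to[1,\infty)$ and $j\ge1$, $\mathcal{M}_V(E^j)$ is the Banach space of signed measures $\mu$ on $E^j$ with $\|\mu\|_V:=\sup\{\int g\,d\mu: g\text{ measurable},\ |g(x_1,\ldots,x_j)|\le V(x_1)+\cdots+V(x_j)\}<\infty$. $\pi_{u,j}(dx_1,\ldots,dx_j)=\pi_u(dx_1)Q_u(x_1,dx_2)\cdots Q_u(x_{j-1},dx_j)$, and $\pi^{(n)}_{t,j}$ is the law of $(X_{n,t},\ldots,X_{n,t+j-1})$. The array is $V$-locally stationary if for every $j\ge1$ there is $C_j>0$, not depending on $u,n,t$, such that $\|\pi^{(n)}_{t,j}-\pi_{u,j}\|_V\le C_j\left[|u-\frac tn|+\frac1n\right]$ for all $u\in[0,1]$, $n\ge1$, $1\le t\le n-j+1$. Derivatives and limits at the endpoints of $[0,1]$ are one-sided. *)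

theory Defs
  imports "HOL-Probability.Probability"
begin

(* Differentiation is relative to [0,1], hence one-sided at the endpoints. *)
primrec nth_deriv01 :: "nat \<Rightarrow> (real \<Rightarrow> real) \<Rightarrow> real \<Rightarrow> real" where
  "nth_deriv01 0 g = g"
| "nth_deriv01 (Suc l) g = (\<lambda>u. vector_derivative (nth_deriv01 l g) (at u within {0..1}))"

definition Ck01 :: "nat \<Rightarrow> (real \<Rightarrow> real) \<Rightarrow> bool" where
  "Ck01 k g \<longleftrightarrow>
     (\<forall>l<k. nth_deriv01 l g differentiable_on {0..1}) \<and>
     (\<forall>l\<le>k. continuous_on {0..1} (nth_deriv01 l g))"

(* Kernels of nonnegative, possibly infinite, measures; Markov kernels are the elements of
   measurable M (prob_algebra N). *)
definition nonneg_kernel :: "'a measure \<Rightarrow> 'b measure \<Rightarrow> ('a \<Rightarrow> 'b measure) \<Rightarrow> bool" where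
  "nonneg_kernel M N K \<longleftrightarrow>
     (\<forall>x\<in>space M. sets (K x) = sets N) \<and>
     (\<forall>A\<in>sets N. (\<lambda>x. emeasure (K x) A) \<in> borel_measurable M)"

definition density_kernel ::
  "(real \<Rightarrow> 'z \<Rightarrow> 'z \<Rightarrow> real) \<Rightarrow> ('z \<Rightarrow> 'z measure) \<Rightarrow> real \<Rightarrow> 'z \<Rightarrow> 'z measure" where
  "density_kernel f \<gamma> u z1 = density (\<gamma> z1) (\<lambda>z2. ennreal (f u z1 z2))"

definition joint_kernel ::
  "(real \<Rightarrow> 'y \<Rightarrow> 'y \<Rightarrow> 'z \<Rightarrow> real) \<Rightarrow> (real \<Rightarrow> 'z \<Rightarrow> 'z measure) \<Rightarrow>
   real \<Rightarrow> 'y \<times> 'z \<Rightarrow> ('y \<times> 'z) measure" where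
  "joint_kernel P Qb u = (\<lambda>(y1, z1).
     density (count_space UNIV \<Otimes>\<^sub>M Qb u z1) (\<lambda>(y2, z2). ennreal (P u y1 y2 z2)))"

(* The composition (Q u_1)(Q u_2)...(Q u_m) for us = [u_1, ..., u_m]. *)
primrec kernel_prod :: "'a measure \<Rightarrow> ('i \<Rightarrow> 'a \<Rightarrow> 'a measure) \<Rightarrow> 'i list \<Rightarrow> 'a \<Rightarrow> 'a measure" where
  "kernel_prod M Q [] = return M"
| "kernel_prod M Q (u # us) = (\<lambda>x. Q u x \<bind> kernel_prod M Q us)"

definition invariant_prob :: "'a measure \<Rightarrow> ('a \<Rightarrow> 'a measure) \<Rightarrow> 'a measure \<Rightarrow> bool" where
  "invariant_prob M K \<pi> \<longleftrightarrow> \<pi> \<in> space (prob_algebra M) \<and> \<pi> \<bind> K = \<pi>"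

definition invariant_law :: "'a measure \<Rightarrow> ('a \<Rightarrow> 'a measure) \<Rightarrow> 'a measure" where
  "invariant_law M K = (THE \<pi>. invariant_prob M K \<pi>)"

(* M^j: tuples (x_1, ..., x_j) are extensional functions on {0..<j}, with indices shifted by one. *)
abbreviation power_space :: "'a measure \<Rightarrow> nat \<Rightarrow> (nat \<Rightarrow> 'a) measure" where
  "power_space M j \<equiv> PiM {0..<j} (\<lambda>_. M)"

(* \<pi>(dx_1) K(x_1, dx_2) ... K(x_{j-1}, dx_j).  Ionescu_Tulcea.C P _ 0 j is the law of the first j
   coordinates when coordinate i is drawn from P i, given the coordinates before it. *)
definition path_law ::
  "'a measure \<Rightarrow> 'a measure \<Rightarrow> ('a \<Rightarrow> 'a measure) \<Rightarrow> nat \<Rightarrow> (nat \<Rightarrow> 'a) measure" where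
  "path_law M \<pi> K j =
     Ionescu_Tulcea.C (\<lambda>i x. case i of 0 \<Rightarrow> \<pi> | Suc i' \<Rightarrow> K (x i')) (\<lambda>_. M) 0 j (\<lambda>_. undefined)"

definition stationary_path_law ::
  "'a measure \<Rightarrow> (real \<Rightarrow> 'a \<Rightarrow> 'a measure) \<Rightarrow> real \<Rightarrow> nat \<Rightarrow> (nat \<Rightarrow> 'a) measure" where
  "stationary_path_law M Q u j = path_law M (invariant_law M (Q u)) (Q u) j"

definition window_law ::
  "'a measure \<Rightarrow> (nat \<Rightarrow> 'w measure) \<Rightarrow> (nat \<Rightarrow> nat \<Rightarrow> 'w \<Rightarrow> 'a) \<Rightarrow> nat \<Rightarrow> nat \<Rightarrow> nat \<Rightarrow>
   (nat \<Rightarrow> 'a) measure" where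
  "window_law M \<Omega> X n t j =
     distr (\<Omega> n) (power_space M j) (\<lambda>\<omega>. \<lambda>i\<in>{0..<j}. X n (t + i) \<omega>)"

(* The sigma-algebra generated by X_{n,0}, ..., X_{n,t-1}. *)
definition past_algebra ::
  "'a measure \<Rightarrow> (nat \<Rightarrow> 'w measure) \<Rightarrow> (nat \<Rightarrow> nat \<Rightarrow> 'w \<Rightarrow> 'a) \<Rightarrow> nat \<Rightarrow> nat \<Rightarrow> 'w measure" where
  "past_algebra M \<Omega> X n t =
     vimage_algebra (space (\<Omega> n)) (\<lambda>\<omega>. \<lambda>s\<in>{0..<t}. X n s \<omega>) (power_space M t)"

definition markov_array ::
  "'a measure \<Rightarrow> (real \<Rightarrow> 'a \<Rightarrow> 'a measure) \<Rightarrow>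
   (nat \<Rightarrow> 'w measure) \<Rightarrow> (nat \<Rightarrow> nat \<Rightarrow> 'w \<Rightarrow> 'a) \<Rightarrow> bool" where
  "markov_array M Q \<Omega> X \<longleftrightarrow> (\<forall>n\<ge>1.
     prob_space (\<Omega> n) \<and>
     (\<forall>t\<le>n. X n t \<in> measurable (\<Omega> n) M) \<and>
     distr (\<Omega> n) M (X n 0) = invariant_law M (Q 0) \<and>
     (\<forall>t\<in>{1..n}. \<forall>A\<in>sets M. AE \<omega> in \<Omega> n.
        real_cond_exp (\<Omega> n) (past_algebra M \<Omega> X n t) (\<lambda>\<omega>'. indicator A (X n t \<omega>')) \<omega>
          = measure (Q (real t / real n) (X n (t - 1) \<omega>)) A))"

(* A finite signed measure is represented by its set function, extended by 0 outside the
   sigma-algebra; a finite measure N gives the signed measure measure N. *)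
definition signed_measure :: "'a measure \<Rightarrow> ('a set \<Rightarrow> real) \<Rightarrow> bool" where
  "signed_measure M \<mu> \<longleftrightarrow>
     (\<forall>A. A \<notin> sets M \<longrightarrow> \<mu> A = 0) \<and> \<mu> {} = 0 \<and>
     (\<forall>A :: nat \<Rightarrow> 'a set. range A \<subseteq> sets M \<longrightarrow> disjoint_family A \<longrightarrow>
        (\<lambda>i. \<mu> (A i)) sums \<mu> (\<Union>i. A i))"

(* Positive part of the Jordan decomposition; the negative part is that of -\<mu>. *)
definition positive_variation :: "'a measure \<Rightarrow> ('a set \<Rightarrow> real) \<Rightarrow> 'a measure" where
  "positive_variation M \<mu> =
     measure_of (space M) (sets M) (\<lambda>A. SUP B\<in>{B \<in> sets M. B \<subseteq> A}. ennreal (\<mu> B))"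

definition signed_integral :: "'a measure \<Rightarrow> ('a set \<Rightarrow> real) \<Rightarrow> ('a \<Rightarrow> real) \<Rightarrow> real" where
  "signed_integral M \<mu> g =
     integral\<^sup>L (positive_variation M \<mu>) g - integral\<^sup>L (positive_variation M (\<lambda>A. - \<mu> A)) g"

(* Non-integrable g contribute junk values, but these do not affect the supremum: if W is not
   integrable for the total variation, bounded measurable g already make it infinite. *)
definition weighted_norm :: "'a measure \<Rightarrow> ('a \<Rightarrow> real) \<Rightarrow> ('a set \<Rightarrow> real) \<Rightarrow> ereal" where
  "weighted_norm M W \<mu> =
     (SUP g\<in>{g \<in> borel_measurable M. \<forall>x\<in>space M. \<bar>g x\<bar> \<le> W x}. ereal (signed_integral M \<mu> g))"

definition weighted_measures :: "'a measure \<Rightarrow> ('a \<Rightarrow> real) \<Rightarrow> ('a set \<Rightarrow> real) set" where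
  "weighted_measures M W = {\<mu>. signed_measure M \<mu> \<and> weighted_norm M W \<mu> < \<infinity>}"

definition sum_weight :: "('a \<Rightarrow> real) \<Rightarrow> nat \<Rightarrow> (nat \<Rightarrow> 'a) \<Rightarrow> real" where
  "sum_weight V j x = (\<Sum>i<j. V (x i))"

(* F : [0,1] \<rightarrow> weighted_measures M W is k times continuously differentiable in norm; D l is the
   l-th derivative. *)
definition Ck01_weighted ::
  "nat \<Rightarrow> 'a measure \<Rightarrow> ('a \<Rightarrow> real) \<Rightarrow> (real \<Rightarrow> 'a set \<Rightarrow> real) \<Rightarrow> bool" where
  "Ck01_weighted k M W F \<longleftrightarrow> (\<exists>D :: nat \<Rightarrow> real \<Rightarrow> 'a set \<Rightarrow> real.
     (\<forall>u\<in>{0..1}. D 0 u = F u) \<and>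
     (\<forall>l\<le>k. \<forall>u\<in>{0..1}. D l u \<in> weighted_measures M W) \<and>
     (\<forall>l\<le>k. \<forall>u\<in>{0..1}.
        ((\<lambda>v. weighted_norm M W (\<lambda>A. D l v A - D l u A)) \<longlongrightarrow> 0) (at u within {0..1})) \<and>
     (\<forall>l<k. \<forall>u\<in>{0..1}.
        ((\<lambda>v. weighted_norm M W (\<lambda>A. (D l v A - D l u A) / (v - u) - D (Suc l) u A)) \<longlongrightarrow> 0)
          (at u within {0..1})))"

definition locally_stationary ::
  "'a measure \<Rightarrow> ('a \<Rightarrow> real) \<Rightarrow> (real \<Rightarrow> 'a \<Rightarrow> 'a measure) \<Rightarrow>
   (nat \<Rightarrow> 'w measure) \<Rightarrow> (nat \<Rightarrow> nat \<Rightarrow> 'w \<Rightarrow> 'a) \<Rightarrow> bool" where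
  "locally_stationary M V Q \<Omega> X \<longleftrightarrow> (\<forall>j\<ge>1. \<exists>C>0. \<forall>u\<in>{0..1}. \<forall>n\<ge>1. \<forall>t\<ge>1. t + j \<le> n + 1 \<longrightarrow>
     weighted_norm (power_space M j) (sum_weight V j)
       (\<lambda>A. measure (window_law M \<Omega> X n t j) A - measure (stationary_path_law M Q u j) A)
     \<le> ereal (C * (\<bar>u - real t / real n\<bar> + 1 / real n)))"

abbreviation state_space :: "('y \<times> 'z::metric_space) measure" where
  "state_space \<equiv> count_space UNIV \<Otimes>\<^sub>M borel"

end

theory Submission
  imports Defs
begin

text \<open>Let \<open>V\<^sub>s = \<phi> powr (d1 + s q)\<close>. The drift and minorization conditions, interpolated by Jensen's
  inequality and a coupling, contract the \<open>V\<^sub>s\<close>-oscillation of \<open>Q\<^bsub>u1\<^esub> \<dots> Q\<^bsub>un\<^esub> g\<close> geometrically, uniformly over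
  slowly varying parameters. Hence \<open>S\<^sub>u g = Q\<^sub>u g - g(x\<^sub>0)\<close> has a Neumann series \<open>Y\<^sub>u = (1 - S\<^sub>u)\<^sup>-\<^sup>1\<close>, and
  \<open>\<pi>\<^sub>u(g) = (Y\<^sub>u g)(x\<^sub>0)\<close>. Each derivative of \<open>Q\<^sub>u\<close> in \<open>u\<close> maps functions bounded by \<open>V\<^sub>s\<close> to functions bounded
  by \<open>V\<^bsub>s+1\<^esub>\<close>; such families are closed under composition and, by the resolvent identity, under
  \<open>S \<mapsto> (1 - S)\<^sup>-\<^sup>1\<close>, so \<open>u \<mapsto> \<pi>\<^bsub>u,j\<^esub>\<close> is as smooth as \<open>Q\<close> after at most \<open>k\<close> steps of the scale. Local
  stationarity follows by telescoping \<open>\<pi>\<^bsub>i/n\<^esub> Q\<^bsub>(i+1)/n\<^esub> \<dots> Q\<^bsub>t/n\<^esub>\<close> over \<open>i\<close>: consecutive terms differ by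
  \<open>O(1/n)\<close> times a geometrically small factor.\<close>

section \<open>Functionals on weighted spaces of functions\<close>

text \<open>What survives is convergence at each state, uniform over the unit ball of test
  functions. It is stable under composition: the outer operator integrates against a signed measure,
  and dominated convergence turns pointwise convergence of the inner functions into convergence of
  its values. Hence the functionals with a dominated continuity property below. It also suffices,
  because the invariant law is read off at the single state \<open>base\<close>, where convergence
  uniform over the ball is convergence in the weighted norm. By (E42)(iii) and (E43) each derivative
  costs a factor \<open>\<phi> powr q\<close>; k of them lead from \<open>V 0\<close> to
  \<open>V k\<close>, whose exponent is at most \<open>d0\<close>, so the contraction is proved at
  every level. Subtracting the value at a fixed state, and not the invariant mean, keeps the
  perturbation independent of u, so the smoothness of the invariant law is not presupposed.\<close>

definition wball :: "'a measure \<Rightarrow> ('a \<Rightarrow> real) \<Rightarrow> ('a \<Rightarrow> real) set" where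
  "wball M w = {g \<in> borel_measurable M. \<forall>x\<in>space M. \<bar>g x\<bar> \<le> w x}"

text \<open>For a nonnegative weight this is the linear span of the ball. The constant is strictly
  positive so that functions can be rescaled into the ball.\<close>

definition wspace :: "'a measure \<Rightarrow> ('a \<Rightarrow> real) \<Rightarrow> ('a \<Rightarrow> real) set" where
  "wspace M w = {g. \<exists>c>0. g \<in> wball M (\<lambda>x. c * w x)}"

lemma wballI: "g \<in> borel_measurable M \<Longrightarrow> (\<And>x. x \<in> space M \<Longrightarrow> \<bar>g x\<bar> \<le> w x) \<Longrightarrow> g \<in> wball M w"
  by (auto simp: wball_def)

lemma wball_meas: "g \<in> wball M w \<Longrightarrow> g \<in> borel_measurable M"
  by (auto simp: wball_def)

lemma wball_bound: "g \<in> wball M w \<Longrightarrow> x \<in> space M \<Longrightarrow> \<bar>g x\<bar> \<le> w x"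
  by (auto simp: wball_def)

lemma wball_mono: "g \<in> wball M w \<Longrightarrow> (\<And>x. x \<in> space M \<Longrightarrow> w x \<le> w' x) \<Longrightarrow> g \<in> wball M w'"
  by (fastforce simp: wball_def)

lemma wball_lin:
  assumes "g \<in> wball M w" "h \<in> wball M w'"
  shows "(\<lambda>x. a * g x + b * h x) \<in> wball M (\<lambda>x. \<bar>a\<bar> * w x + \<bar>b\<bar> * w' x)"
proof (rule wballI)
  show "(\<lambda>x. a * g x + b * h x) \<in> borel_measurable M"
    using assms[THEN wball_meas] by measurable
  fix x assume x: "x \<in> space M"
  have "\<bar>a * g x + b * h x\<bar> \<le> \<bar>a\<bar> * \<bar>g x\<bar> + \<bar>b\<bar> * \<bar>h x\<bar>"
    by (metis abs_mult abs_triangle_ineq)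
  also have "\<dots> \<le> \<bar>a\<bar> * w x + \<bar>b\<bar> * w' x"
    using wball_bound[OF assms(1) x] wball_bound[OF assms(2) x]
    by (intro add_mono mult_left_mono) auto
  finally show "\<bar>a * g x + b * h x\<bar> \<le> \<bar>a\<bar> * w x + \<bar>b\<bar> * w' x" .
qed

lemma wball_scale:
  assumes "g \<in> wball M w" shows "(\<lambda>x. a * g x) \<in> wball M (\<lambda>x. \<bar>a\<bar> * w x)"
  using wball_lin[OF assms assms, of a 0] by simp

lemma wball_nonneg: "g \<in> wball M w \<Longrightarrow> x \<in> space M \<Longrightarrow> 0 \<le> w x"
  using wball_bound by (metis abs_ge_zero order_trans)

lemma wspaceE:
  assumes "g \<in> wspace M w" obtains c where "c > 0" "g \<in> wball M (\<lambda>x. c * w x)"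
  using assms by (auto simp: wspace_def)

lemma wspaceI: "c > 0 \<Longrightarrow> g \<in> wball M (\<lambda>x. c * w x) \<Longrightarrow> g \<in> wspace M w"
  by (auto simp: wspace_def)

lemma wball_wspace: "g \<in> wball M w \<Longrightarrow> g \<in> wspace M w"
  by (rule wspaceI[of 1]) auto

lemma wspaceI':
  assumes "g \<in> wball M (\<lambda>x. c * w x)" "\<And>x. x \<in> space M \<Longrightarrow> 0 \<le> w x" shows "g \<in> wspace M w"
  by (rule wspaceI[of "\<bar>c\<bar> + 1"]) (auto intro!: wball_mono[OF assms(1)] mult_right_mono assms(2))

lemma wspace_meas: "g \<in> wspace M w \<Longrightarrow> g \<in> borel_measurable M"
  by (auto elim!: wspaceE dest: wball_meas)

lemma wspace_lin:
  assumes "g \<in> wspace M w" "h \<in> wspace M w"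
  shows "(\<lambda>x. a * g x + b * h x) \<in> wspace M w"
proof -
  obtain c where c: "c > 0" "g \<in> wball M (\<lambda>x. c * w x)" using assms(1) by (rule wspaceE)
  obtain d where d: "d > 0" "h \<in> wball M (\<lambda>x. d * w x)" using assms(2) by (rule wspaceE)
  have w: "0 \<le> w x" if "x \<in> space M" for x
    using wball_nonneg[OF c(2) that] c(1) by (simp add: zero_le_mult_iff)
  show ?thesis
    by (rule wspaceI'[of _ _ "\<bar>a\<bar> * c + \<bar>b\<bar> * d"])
       (auto intro!: wball_mono[OF wball_lin[OF c(2) d(2)]] w simp: algebra_simps)
qed

lemma wspace_scale: "g \<in> wspace M w \<Longrightarrow> (\<lambda>x. a * g x) \<in> wspace M w"
  using wspace_lin[of g M w g a 0] by simp

lemma wspace_add: "g \<in> wspace M w \<Longrightarrow> h \<in> wspace M w \<Longrightarrow> (\<lambda>x. g x + h x) \<in> wspace M w"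
  using wspace_lin[of g M w h 1 1] by simp

lemma wspace_diff: "g \<in> wspace M w \<Longrightarrow> h \<in> wspace M w \<Longrightarrow> (\<lambda>x. g x - h x) \<in> wspace M w"
  using wspace_lin[of g M w h 1 "-1"] by simp

lemma wspace_mono:
  assumes "g \<in> wspace M w" "\<And>x. x \<in> space M \<Longrightarrow> w x \<le> w' x"
  shows "g \<in> wspace M w'"
proof -
  obtain c where c: "c > 0" "g \<in> wball M (\<lambda>x. c * w x)" using assms(1) by (rule wspaceE)
  show ?thesis
    by (rule wspaceI[OF c(1)], rule wball_mono[OF c(2)]) (use c(1) assms(2) in auto)
qed

text \<open>Continuity along dominated pointwise convergent sequences makes such a functional the integral
  against a signed measure.\<close>

definition regfun :: "'a measure \<Rightarrow> ('a \<Rightarrow> real) \<Rightarrow> (('a \<Rightarrow> real) \<Rightarrow> real) \<Rightarrow> bool" where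
  "regfun M w L \<longleftrightarrow>
     (\<forall>g\<in>wspace M w. \<forall>h\<in>wspace M w. \<forall>a b. L (\<lambda>x. a * g x + b * h x) = a * L g + b * L h) \<and>
     (\<forall>gs g. (\<forall>n. gs n \<in> wball M w) \<longrightarrow> g \<in> wball M w \<longrightarrow>
        (\<forall>x\<in>space M. (\<lambda>n. gs n x) \<longlonglongrightarrow> g x) \<longrightarrow> (\<lambda>n. L (gs n)) \<longlonglongrightarrow> L g)"

lemma regfunI:
  assumes "\<And>g h a b. g \<in> wspace M w \<Longrightarrow> h \<in> wspace M w \<Longrightarrow>
             L (\<lambda>x. a * g x + b * h x) = a * L g + b * L h"
    and "\<And>gs g. (\<And>n. gs n \<in> wball M w) \<Longrightarrow> g \<in> wball M w \<Longrightarrow>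
        (\<And>x. x \<in> space M \<Longrightarrow> (\<lambda>n. gs n x) \<longlonglongrightarrow> g x) \<Longrightarrow> (\<lambda>n. L (gs n)) \<longlonglongrightarrow> L g"
  shows "regfun M w L"
  using assms unfolding regfun_def by blast

context
  fixes M :: "'a measure" and w L
  assumes L: "regfun M w L"
begin

lemma regfun_lin:
  "g \<in> wspace M w \<Longrightarrow> h \<in> wspace M w \<Longrightarrow> L (\<lambda>x. a * g x + b * h x) = a * L g + b * L h"
  using L unfolding regfun_def by blast

lemma regfun_scale: "g \<in> wspace M w \<Longrightarrow> L (\<lambda>x. a * g x) = a * L g"
  using regfun_lin[of g g a 0] by simp

lemma regfun_add: "g \<in> wspace M w \<Longrightarrow> h \<in> wspace M w \<Longrightarrow> L (\<lambda>x. g x + h x) = L g + L h"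
  using regfun_lin[of g h 1 1] by simp

lemma regfun_diff: "g \<in> wspace M w \<Longrightarrow> h \<in> wspace M w \<Longrightarrow> L (\<lambda>x. g x - h x) = L g - L h"
  using regfun_lin[of g h 1 "-1"] by simp

lemma regfun_zero: "g \<in> wspace M w \<Longrightarrow> L (\<lambda>x. 0) = 0"
  using regfun_scale[of g 0] by simp

lemma regfun_tendsto:
  assumes c: "c > 0" and gs: "\<And>n. gs n \<in> wball M (\<lambda>x. c * w x)" "g \<in> wball M (\<lambda>x. c * w x)"
    and lim: "\<And>x. x \<in> space M \<Longrightarrow> (\<lambda>n. gs n x) \<longlonglongrightarrow> g x"
  shows "(\<lambda>n. L (gs n)) \<longlonglongrightarrow> L g"
proof -
  have sc: "(\<lambda>x. (1/c) * h x) \<in> wball M w" if "h \<in> wball M (\<lambda>x. c * w x)" for h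
    using wball_scale[OF that, of "1/c"] c by simp
  have "(\<lambda>n. L (\<lambda>x. (1/c) * gs n x)) \<longlonglongrightarrow> L (\<lambda>x. (1/c) * g x)"
  proof -
    have cont: "(\<lambda>n. L (fs n)) \<longlonglongrightarrow> L f" if "\<forall>n. fs n \<in> wball M w" "f \<in> wball M w"
      "\<forall>x\<in>space M. (\<lambda>n. fs n x) \<longlonglongrightarrow> f x" for fs f
      using L that unfolding regfun_def by blast
    show ?thesis
      by (rule cont) (use sc[OF gs(1)] sc[OF gs(2)] in \<open>auto intro!: tendsto_divide lim c\<close>, use c in auto)
  qed
  moreover have "L (\<lambda>x. (1/c) * h x) = (1/c) * L h" if "h \<in> wball M (\<lambda>x. c * w x)" for h
    using that c by (intro regfun_scale wspaceI)
  ultimately have "(\<lambda>n. (1/c) * L (gs n)) \<longlonglongrightarrow> (1/c) * L g"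
    using gs by simp
  from tendsto_mult[OF tendsto_const[of c] this] show ?thesis
    using c by simp
qed

lemma regfun_null:
  assumes c: "c > 0" and gs: "\<And>n. gs n \<in> wball M (\<lambda>x. c * w x)"
    and lim: "\<And>x. x \<in> space M \<Longrightarrow> (\<lambda>n. gs n x) \<longlonglongrightarrow> 0"
  shows "(\<lambda>n. L (gs n)) \<longlonglongrightarrow> 0"
proof -
  have "(\<lambda>x. 0) \<in> wball M (\<lambda>x. c * w x)"
    using wball_nonneg[OF gs[of 0]] by (intro wballI) auto
  from regfun_tendsto[OF c gs this lim] regfun_zero[OF wspaceI[OF c gs[of 0]]]
  show ?thesis by simp
qed

lemma regfun_cong:
  assumes g: "g \<in> wspace M w" and eq: "\<And>x. x \<in> space M \<Longrightarrow> h x = g x"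
  shows "L h = L g"
proof -
  obtain c where c: "c > 0" "g \<in> wball M (\<lambda>x. c * w x)" using g by (rule wspaceE)
  have h: "h \<in> wball M (\<lambda>x. c * w x)"
    using c(2) eq measurable_cong[of M h g borel] by (auto simp: wball_def)
  have "(\<lambda>n::nat. L h) \<longlonglongrightarrow> L g"
    by (rule regfun_tendsto[OF c(1) h c(2)]) (simp add: eq)
  then show ?thesis by (simp add: LIMSEQ_const_iff)
qed

text \<open>Were the functional unbounded on the ball, suitable \<open>g n / sqrt n\<close> would contradict continuity.\<close>

lemma regfun_bounded: "\<exists>c>0. \<forall>g\<in>wball M w. \<bar>L g\<bar> \<le> c"
proof (rule ccontr)
  assume neg: "\<not> ?thesis"
  have "\<exists>g\<in>wball M w. \<bar>L g\<bar> > real (Suc n)" for n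
    using neg by (metis of_nat_0_less_iff not_le zero_less_Suc)
  then obtain g where g: "\<And>n. g n \<in> wball M w" "\<And>n. \<bar>L (g n)\<bar> > real (Suc n)" by metis
  define h where "h n = (\<lambda>x. (1 / sqrt (real (Suc n))) * g n x)" for n
  have hb: "h n \<in> wball M (\<lambda>x. 1 * w x)" for n
  proof -
    have "(\<lambda>x. (1 / sqrt (real (Suc n))) * g n x) \<in> wball M (\<lambda>x. \<bar>1 / sqrt (real (Suc n))\<bar> * w x)"
      by (rule wball_scale[OF g(1)])
    then show ?thesis unfolding h_def
    proof (rule wball_mono)
      fix x assume "x \<in> space M"
      then show "\<bar>1 / sqrt (real (Suc n))\<bar> * w x \<le> 1 * w x"
        using wball_nonneg[OF g(1)] by (intro mult_right_mono) (auto simp: divide_simps)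
    qed
  qed
  have lim0: "(\<lambda>n. 1 / sqrt (real (Suc n))) \<longlonglongrightarrow> 0"
    using tendsto_real_sqrt[OF LIMSEQ_inverse_real_of_nat]
    by (simp add: real_sqrt_inverse divide_inverse)
  have "(\<lambda>n. h n x) \<longlonglongrightarrow> 0" if x: "x \<in> space M" for x
  proof (rule Lim_null_comparison)
    show "\<forall>\<^sub>F n in sequentially. norm (h n x) \<le> (1 / sqrt (real (Suc n))) * w x"
      using wball_bound[OF g(1) x] by (intro always_eventually) (auto simp: h_def abs_mult intro!: divide_right_mono)
    show "(\<lambda>n. (1 / sqrt (real (Suc n))) * w x) \<longlonglongrightarrow> 0"
      using tendsto_mult_left_zero[OF lim0, of "w x"] .
  qed
  from regfun_null[OF _ hb this] have "(\<lambda>n. L (h n)) \<longlonglongrightarrow> 0" by simp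
  then have "\<forall>\<^sub>F n in sequentially. \<bar>L (h n)\<bar> < 1"
    by (intro order_tendstoD(2)[OF tendsto_rabs_zero]) auto
  then obtain n where n: "\<bar>L (h n)\<bar> < 1" by (auto simp: eventually_sequentially)
  have eq: "L (h n) = (1 / sqrt (real (Suc n))) * L (g n)"
    unfolding h_def by (rule regfun_scale) (rule wball_wspace[OF g(1)])
  have s1: "1 \<le> sqrt (real (Suc n))" by simp
  have "\<bar>L (g n)\<bar> < sqrt (real (Suc n))"
    using n s1 unfolding eq by (simp add: abs_mult divide_simps del: of_nat_Suc split: if_splits)
  moreover have "sqrt (real (Suc n)) \<le> real (Suc n)"
    by (rule real_le_lsqrt) (auto simp: power2_eq_square)
  ultimately show False using g(2)[of n] by linarith
qed

lemma regfun_bound_scaled: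
  assumes "\<And>g. g \<in> wball M w \<Longrightarrow> \<bar>L g\<bar> \<le> c" "d > 0" "g \<in> wball M (\<lambda>x. d * w x)"
  shows "\<bar>L g\<bar> \<le> d * c"
proof -
  have "(\<lambda>x. (1/d) * g x) \<in> wball M w"
    using wball_scale[OF assms(3), of "1/d"] assms(2) by simp
  from assms(1)[OF this] regfun_scale[OF wspaceI[OF assms(2,3)], of "1/d"] show ?thesis
    using assms(2) by (simp add: abs_mult pos_divide_le_eq mult.commute)
qed

lemma regfun_weaken:
  assumes le: "\<And>x. x \<in> space M \<Longrightarrow> v x \<le> c * w x" and c: "c > 0"
  shows "regfun M v L"
proof (rule regfunI)
  have sub: "g \<in> wspace M w" if "g \<in> wspace M v" for g
  proof -
    obtain d where d: "d > 0" "g \<in> wball M (\<lambda>x. d * v x)" using \<open>g \<in> wspace M v\<close> by (rule wspaceE)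
    show ?thesis
      by (rule wspaceI[of "d * c"], use d c in simp, rule wball_mono[OF d(2)])
         (use le d(1) in \<open>auto simp: mult.assoc\<close>)
  qed
  show "g \<in> wspace M v \<Longrightarrow> h \<in> wspace M v \<Longrightarrow>
    L (\<lambda>x. a * g x + b * h x) = a * L g + b * L h" for g h a b
    by (intro regfun_lin sub)
  show "(\<lambda>n. L (gs n)) \<longlonglongrightarrow> L g" if "\<And>n. gs n \<in> wball M v" "g \<in> wball M v"
    "\<And>x. x \<in> space M \<Longrightarrow> (\<lambda>n. gs n x) \<longlonglongrightarrow> g x" for gs g
    using that by (intro regfun_tendsto[OF c]) (auto intro: wball_mono le)
qed

end

lemma wspace_integrable:
  assumes N: "sets N = sets M" and w: "integrable N w" and g: "g \<in> wspace M w"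
  shows "integrable N g"
proof -
  have sp: "space N = space M" using N by (rule sets_eq_imp_space_eq)
  obtain c where c: "c > 0" "g \<in> wball M (\<lambda>x. c * w x)" using g by (rule wspaceE)
  have "g \<in> borel_measurable N"
    using wball_meas[OF c(2)] N by (simp cong: measurable_cong_sets)
  then show ?thesis
    using wball_bound[OF c(2)] sp
    by (intro Bochner_Integration.integrable_bound[OF integrable_mult_right[OF w, of c]])
       (auto intro!: AE_I2 intro: order_trans[OF _ abs_ge_self])
qed

lemma regfun_integral:
  assumes N: "sets N = sets M" and w: "integrable N w"
  shows "regfun M w (\<lambda>g. \<integral>x. g x \<partial>N)"
proof (rule regfunI)
  have sp: "space N = space M" using N by (rule sets_eq_imp_space_eq)
  note int = wspace_integrable[OF N w]
  show "(\<integral>x. a * g x + b * h x \<partial>N) = a * (\<integral>x. g x \<partial>N) + b * (\<integral>x. h x \<partial>N)"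
    if "g \<in> wspace M w" "h \<in> wspace M w" for g h a b
    using int[OF that(1)] int[OF that(2)] by simp
  show "(\<lambda>n. \<integral>x. gs n x \<partial>N) \<longlonglongrightarrow> (\<integral>x. g x \<partial>N)" if gs: "\<And>n. gs n \<in> wball M w" "g \<in> wball M w"
    "\<And>x. x \<in> space M \<Longrightarrow> (\<lambda>n. gs n x) \<longlonglongrightarrow> g x" for gs g
  proof (rule integral_dominated_convergence[OF _ _ w])
    show "g \<in> borel_measurable N" "gs i \<in> borel_measurable N" for i
      using wball_meas[OF gs(2)] wball_meas[OF gs(1)] N by (simp_all cong: measurable_cong_sets)
    show "AE x in N. (\<lambda>i. gs i x) \<longlonglongrightarrow> g x" using gs(3) sp by auto
    show "AE x in N. norm (gs i x) \<le> w x" for i using wball_bound[OF gs(1)] sp by auto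
  qed
qed

lemma regfun_lincomb:
  assumes "regfun M w L" "regfun M w K"
  shows "regfun M w (\<lambda>g. a * L g + b * K g)"
proof (rule regfunI)
  show "a * L (\<lambda>x. c * g x + d * h x) + b * K (\<lambda>x. c * g x + d * h x) =
      c * (a * L g + b * K g) + d * (a * L h + b * K h)"
    if "g \<in> wspace M w" "h \<in> wspace M w" for g h c d
    using regfun_lin[OF assms(1) that] regfun_lin[OF assms(2) that] by (simp add: algebra_simps)
  show "(\<lambda>n. a * L (gs n) + b * K (gs n)) \<longlonglongrightarrow> a * L g + b * K g"
    if "\<And>n. gs n \<in> wball M w" "g \<in> wball M w" "\<And>x. x \<in> space M \<Longrightarrow> (\<lambda>n. gs n x) \<longlonglongrightarrow> g x" for gs g
    using that by (intro tendsto_intros regfun_tendsto[OF assms(1), of 1] regfun_tendsto[OF assms(2), of 1]) auto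
qed

lemma regfun_diff_fun:
  "regfun M w L \<Longrightarrow> regfun M w K \<Longrightarrow> regfun M w (\<lambda>g. L g - K g)"
  using regfun_lincomb[of M w L K 1 "-1"] by simp

text \<open>Truncation reduces the identity to bounded functions.\<close>

lemma regfun_eqI:
  assumes L: "regfun M w L" and K: "regfun M w K" and w: "\<And>x. x \<in> space M \<Longrightarrow> 0 \<le> w x"
    and eq: "\<And>g c. g \<in> wball M w \<Longrightarrow> (\<And>x. x \<in> space M \<Longrightarrow> \<bar>g x\<bar> \<le> c) \<Longrightarrow> L g = K g"
    and g: "g \<in> wspace M w"
  shows "L g = K g"
proof -
  obtain c where c: "c > 0" "g \<in> wball M (\<lambda>x. c * w x)" using g by (rule wspaceE)
  define h where "h = (\<lambda>x. (1/c) * g x)"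
  have h: "h \<in> wball M w" using wball_scale[OF c(2), of "1/c"] c(1) by (simp add: h_def)
  have hw: "h \<in> wspace M w" by (rule wball_wspace[OF h])
  define t where "t n x = max (- real n) (min (real n) (h x))" for n x
  have t: "t n \<in> wball M w" for n
  proof (rule wballI)
    show "t n \<in> borel_measurable M" unfolding t_def using wball_meas[OF h] by measurable
    show "\<bar>t n x\<bar> \<le> w x" if "x \<in> space M" for x
      using wball_bound[OF h that] unfolding t_def by (auto simp: max_def min_def)
  qed
  have lim: "(\<lambda>n. t n x) \<longlonglongrightarrow> h x" for x
  proof (rule tendsto_eventually)
    obtain N where "\<bar>h x\<bar> \<le> real N" using real_arch_simple by blast
    then show "\<forall>\<^sub>F n in sequentially. t n x = h x"
      by (intro eventually_sequentiallyI[of N]) (auto simp: t_def max_def min_def)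
  qed
  have "L (t n) = K (t n)" for n by (rule eq[OF t, where c = "real n"]) (auto simp: t_def)
  moreover have "(\<lambda>n. L (t n)) \<longlonglongrightarrow> L h" by (rule regfun_tendsto[OF L, of 1]) (use t h lim in auto)
  moreover have "(\<lambda>n. K (t n)) \<longlonglongrightarrow> K h" by (rule regfun_tendsto[OF K, of 1]) (use t h lim in auto)
  ultimately have "L h = K h" by (auto intro: LIMSEQ_unique)
  moreover have "L (\<lambda>x. c * h x) = c * L h" "K (\<lambda>x. c * h x) = c * K h"
    using regfun_scale[OF L hw] regfun_scale[OF K hw] by auto
  moreover have "(\<lambda>x. c * h x) = g" using c(1) by (auto simp: h_def)
  ultimately show ?thesis by simp
qed

text \<open>A signed kernel seen through its action on functions: each \<open>x\<close> carries a
  signed measure on \<open>M\<close> whose \<open>w\<close>-norm is at most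
  \<open>c * w' x\<close>.\<close>

definition regop :: "'a measure \<Rightarrow> ('a \<Rightarrow> real) \<Rightarrow> 'b measure \<Rightarrow> ('b \<Rightarrow> real) \<Rightarrow> real \<Rightarrow>
    (('a \<Rightarrow> real) \<Rightarrow> 'b \<Rightarrow> real) \<Rightarrow> bool" where
  "regop M w N w' c A \<longleftrightarrow>
     (\<forall>g\<in>wball M w. A g \<in> wball N (\<lambda>x. c * w' x)) \<and> (\<forall>x\<in>space N. regfun M w (\<lambda>g. A g x))"

lemma regopD:
  assumes "regop M w N w' c A"
  shows "g \<in> wball M w \<Longrightarrow> A g \<in> wball N (\<lambda>x. c * w' x)"
    and "x \<in> space N \<Longrightarrow> regfun M w (\<lambda>g. A g x)"
  using assms by (auto simp: regop_def)

lemma regop_bound: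
  assumes A: "regop M w N w' c A" and g: "g \<in> wball M (\<lambda>x. d * w x)" and d: "d > 0" and x: "x \<in> space N"
  shows "\<bar>A g x\<bar> \<le> d * (c * w' x)"
  by (rule regfun_bound_scaled[OF regopD(2)[OF A x] _ d g])
     (use wball_bound[OF regopD(1)[OF A] x] in auto)

lemma regop_wball:
  assumes A: "regop M w N w' c A" and g: "g \<in> wball M (\<lambda>x. d * w x)" and d: "d > 0"
  shows "A g \<in> wball N (\<lambda>x. (d * c) * w' x)"
proof (rule wballI)
  have "(\<lambda>x. (1/d) * g x) \<in> wball M w" using wball_scale[OF g, of "1/d"] d by simp
  then have m: "A (\<lambda>x. (1/d) * g x) \<in> borel_measurable N" by (rule wball_meas[OF regopD(1)[OF A]])
  have "A g y = d * A (\<lambda>x. (1/d) * g x) y" if "y \<in> space N" for y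
    using regfun_scale[OF regopD(2)[OF A that] wspaceI[OF d g], of "1/d"] d by simp
  then show "A g \<in> borel_measurable N"
    by (subst measurable_cong[of N _ "\<lambda>y. d * A (\<lambda>x. (1/d) * g x) y"]) (use m in auto)
  show "\<bar>A g x\<bar> \<le> (d * c) * w' x" if "x \<in> space N" for x
    using regop_bound[OF A g d that] by (simp add: mult.assoc)
qed

lemma regop_wspace:
  assumes A: "regop M w N w' c A" and c: "c \<ge> 0" and g: "g \<in> wspace M w"
    and w': "\<And>x. x \<in> space N \<Longrightarrow> 0 \<le> w' x"
  shows "A g \<in> wspace N w'"
proof -
  obtain d where d: "d > 0" "g \<in> wball M (\<lambda>x. d * w x)" using g by (rule wspaceE)
  show ?thesis by (rule wspaceI'[OF regop_wball[OF A d(2,1)] w'])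
qed

text \<open>Dominated convergence twice: at each state for \<open>A\<close>, then for
  \<open>L\<close> with a multiple of \<open>w'\<close> as dominating function.\<close>

lemma regfun_comp:
  assumes L: "regfun N w' L" and A: "regop M w N w' c A" and c: "c \<ge> 0"
    and w': "\<And>x. x \<in> space N \<Longrightarrow> 0 \<le> w' x"
  shows "regfun M w (\<lambda>g. L (A g))"
proof (rule regfunI)
  fix g h a b assume gh: "g \<in> wspace M w" "h \<in> wspace M w"
  note ws = regop_wspace[OF A c _ w']
  have "L (A (\<lambda>x. a * g x + b * h x)) = L (\<lambda>y. a * A g y + b * A h y)"
    by (rule regfun_cong[OF L]) (use regfun_lin[OF regopD(2)[OF A] gh] in \<open>auto intro!: wspace_lin ws gh\<close>)
  then show "L (A (\<lambda>x. a * g x + b * h x)) = a * L (A g) + b * L (A h)"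
    using regfun_lin[OF L ws[OF gh(1)] ws[OF gh(2)]] by simp
next
  fix gs g assume gs: "\<And>n. gs n \<in> wball M w" "g \<in> wball M w"
    and lim: "\<And>x. x \<in> space M \<Longrightarrow> (\<lambda>n. gs n x) \<longlonglongrightarrow> g x"
  \<comment> \<open>\<open>c\<close> may vanish, while the dominating constant in
    \<open>regfun_tendsto\<close> has to be positive.\<close>
  have b: "A h \<in> wball N (\<lambda>x. (c + 1) * w' x)" if "h \<in> wball M w" for h
    by (rule wball_mono[OF regopD(1)[OF A that]]) (auto intro: mult_right_mono w')
  show "(\<lambda>n. L (A (gs n))) \<longlonglongrightarrow> L (A g)"
  proof (rule regfun_tendsto[OF L _ b[OF gs(1)] b[OF gs(2)]])
    show "(\<lambda>n. A (gs n) x) \<longlonglongrightarrow> A g x" if "x \<in> space N" for x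
      by (rule regfun_tendsto[OF regopD(2)[OF A that], of 1]) (use gs lim in auto)
  qed (use c in simp)
qed

lemma regop_comp:
  assumes A: "regop N w' K w'' a A" and B: "regop M w N w' b B" and b: "b > 0"
    and w': "\<And>x. x \<in> space N \<Longrightarrow> 0 \<le> w' x"
  shows "regop M w K w'' (b * a) (\<lambda>g. A (B g))"
  unfolding regop_def
  using regop_wball[OF A regopD(1)[OF B] b] regfun_comp[OF regopD(2)[OF A] B _ w'] b by auto

lemma regop_weaken_const:
  assumes A: "regop M w N w' c A" and c: "c \<le> d" and w': "\<And>x. x \<in> space N \<Longrightarrow> 0 \<le> w' x"
  shows "regop M w N w' d A"
  using A wball_mono[OF regopD(1)[OF A], of _ "\<lambda>x. d * w' x"] c w'
  unfolding regop_def by (auto intro: mult_right_mono)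

lemma regop_lincomb:
  assumes A: "regop M w N w' c A" and B: "regop M w N w' d B"
  shows "regop M w N w' (\<bar>a\<bar> * c + \<bar>b\<bar> * d) (\<lambda>g x. a * A g x + b * B g x)"
  unfolding regop_def
proof safe
  fix g assume "g \<in> wball M w"
  from wball_lin[OF regopD(1)[OF A this] regopD(1)[OF B this], of a b]
  show "(\<lambda>x. a * A g x + b * B g x) \<in> wball N (\<lambda>x. (\<bar>a\<bar> * c + \<bar>b\<bar> * d) * w' x)"
    by (simp add: algebra_simps)
next
  fix x assume "x \<in> space N"
  from regfun_lincomb[OF regopD(2)[OF A this] regopD(2)[OF B this], of a b]
  show "regfun M w (\<lambda>g. a * A g x + b * B g x)" .
qed

lemma regfun_sum:
  fixes n :: nat
  assumes L: "regfun M w L" and g: "\<And>i. i < n \<Longrightarrow> g i \<in> wspace M w" and ne: "wspace M w \<noteq> {}"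
  shows "L (\<lambda>x. \<Sum>i<n. g i x) = (\<Sum>i<n. L (g i)) \<and> (\<lambda>x. \<Sum>i<n. g i x) \<in> wspace M w"
  using g
proof (induction n)
  case 0
  obtain h where h: "h \<in> wspace M w" using ne by blast
  show ?case using regfun_zero[OF L h] wspace_scale[OF h, of 0] by simp
next
  case (Suc n)
  then have IH: "L (\<lambda>x. \<Sum>i<n. g i x) = (\<Sum>i<n. L (g i))" "(\<lambda>x. \<Sum>i<n. g i x) \<in> wspace M w" by auto
  show ?case
    using regfun_add[OF L IH(2) Suc.prems[of n]] wspace_add[OF IH(2) Suc.prems[of n]] IH(1) by simp
qed

section \<open>Functionals as signed measures\<close>

lemma nn_integral_le_truncI:
  assumes [measurable]: "w \<in> borel_measurable N" and c: "\<And>n::nat. (\<integral>\<^sup>+x. ennreal (min (real n) (w x)) \<partial>N) \<le> c"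
  shows "(\<integral>\<^sup>+x. ennreal (w x) \<partial>N) \<le> c"
proof -
  have "(\<lambda>n. ennreal (min (real n) (w x))) \<longlonglongrightarrow> ennreal (w x)" for x
  proof (rule tendsto_eventually)
    obtain K where "w x \<le> real K" using real_arch_simple by blast
    then show "\<forall>\<^sub>F n in sequentially. ennreal (min (real n) (w x)) = ennreal (w x)"
      by (intro eventually_sequentiallyI[of K]) auto
  qed
  then have "(\<integral>\<^sup>+x. ennreal (w x) \<partial>N) = (\<integral>\<^sup>+x. liminf (\<lambda>n. ennreal (min (real n) (w x))) \<partial>N)"
    by (intro nn_integral_cong lim_imp_Liminf[symmetric]) auto
  also have "\<dots> \<le> liminf (\<lambda>n. \<integral>\<^sup>+x. ennreal (min (real n) (w x)) \<partial>N)"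
    by (rule nn_integral_liminf) measurable
  also have "\<dots> \<le> liminf (\<lambda>n. c)" by (rule Liminf_mono) (auto simp: c)
  finally show ?thesis by (simp add: Liminf_const)
qed

text \<open>Meant for signed terms: \<open>ennreal\<close> sends negative numbers to 0, so the right
  side adds up the positive parts only.\<close>

lemma ennreal_sums_le:
  assumes "x sums s" shows "ennreal s \<le> (\<Sum>i. ennreal (x i))"
proof -
  have fin: "ennreal (\<Sum>i<n. x i) \<le> (\<Sum>i<n. ennreal (x i))" for n
  proof (induction n)
    case (Suc n)
    have "ennreal ((\<Sum>i<n. x i) + x n) \<le> ennreal (\<Sum>i<n. x i) + ennreal (x n)"
      by (auto simp: ennreal_plus_if ennreal_neg intro!: ennreal_leI)
    with Suc show ?case by (auto intro: order_trans add_right_mono)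
  qed simp
  have "(\<lambda>n. ennreal (\<Sum>i<n. x i)) \<longlonglongrightarrow> ennreal s"
    using assms unfolding sums_def by (rule tendsto_ennrealI)
  then show ?thesis
    by (rule LIMSEQ_le_const2) (auto intro!: exI[of _ 0] order_trans[OF fin] sum_le_suminf)
qed

section \<open>Jordan decomposition of a bounded signed measure\<close>

context
  fixes M :: "'a measure" and \<mu> :: "'a set \<Rightarrow> real" and c :: real
  assumes sm: "signed_measure M \<mu>" and bd: "\<And>A. \<bar>\<mu> A\<bar> \<le> c"
begin

lemma signed_measure_Un:
  assumes "A \<in> sets M" "B \<in> sets M" "A \<inter> B = {}"
  shows "\<mu> (A \<union> B) = \<mu> A + \<mu> B"
proof -
  define F where "F = (\<lambda>i::nat. if i = 0 then A else if i = 1 then B else {})"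
  have F: "range F \<subseteq> sets M" "disjoint_family F" "(\<Union>i. F i) = A \<union> B"
    using assms by (auto simp: F_def disjoint_family_on_def split: if_splits)
  then have "(\<lambda>i. \<mu> (F i)) sums \<mu> (A \<union> B)" using sm unfolding signed_measure_def by metis
  moreover have "(\<lambda>i. \<mu> (F i)) sums (\<Sum>i\<in>{0,1}. \<mu> (F i))"
    using sm by (intro sums_finite) (auto simp: F_def signed_measure_def)
  ultimately show ?thesis by (auto simp: F_def dest: sums_unique2)
qed

text \<open>\<open>measure_of\<close> returns the prescribed values only once they are known to form
  a measure. Additivity of the supremum has two halves: subsets of disjoint sets can be glued, and a
  subset of a union can be cut along the partition.\<close>

lemma emeasure_positive_variation:
  assumes A: "A \<in> sets M"
  shows "emeasure (positive_variation M \<mu>) A = (SUP B\<in>{B \<in> sets M. B \<subseteq> A}. ennreal (\<mu> B))" (is "_ = ?p A")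
  unfolding positive_variation_def
proof (rule emeasure_measure_of_sigma[OF _ _ _ A])
  have empty: "\<mu> {} = 0" using sm by (simp add: signed_measure_def)
  have "{B \<in> sets M. B \<subseteq> {}} = {{}}" by auto
  then show "positive (sets M) ?p" by (simp add: positive_def empty)
  have mono: "?p A \<le> ?p B" if "A \<subseteq> B" for A B using that by (intro SUP_subset_mono) auto
  have super: "?p A + ?p B \<le> ?p (A \<union> B)" if "A \<inter> B = {}" "A \<in> sets M" "B \<in> sets M" for A B
  proof -
    have le: "ennreal (\<mu> A1) + ennreal (\<mu> B1) \<le> ?p (A \<union> B)"
      if "A1 \<in> sets M" "A1 \<subseteq> A" "B1 \<in> sets M" "B1 \<subseteq> B" for A1 B1
    proof -
      have "\<mu> (A1 \<union> B1) = \<mu> A1 + \<mu> B1"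
        using that \<open>A \<inter> B = {}\<close> by (intro signed_measure_Un) auto
      \<comment> \<open>A piece of negative measure contributes 0 under \<open>ennreal\<close>; it
        is dropped, and the other piece alone competes in the supremum.\<close>
      then have "ennreal (\<mu> A1) + ennreal (\<mu> B1) =
          (if 0 \<le> \<mu> A1 then (if 0 \<le> \<mu> B1 then ennreal (\<mu> (A1 \<union> B1)) else ennreal (\<mu> A1)) else ennreal (\<mu> B1))"
        by (simp add: ennreal_plus_if del: ennreal_plus)
      note eq = this
      have D: "ennreal (\<mu> D) \<le> ?p (A \<union> B)" if "D \<in> sets M" "D \<subseteq> A \<union> B" for D
        using that by (intro SUP_upper) auto
      have "ennreal (\<mu> (A1 \<union> B1)) \<le> ?p (A \<union> B)" "ennreal (\<mu> A1) \<le> ?p (A \<union> B)" "ennreal (\<mu> B1) \<le> ?p (A \<union> B)"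
        using that by (auto intro!: D)
      then show ?thesis unfolding eq by presburger
    qed
    have "?p A + ?p B = (SUP A1\<in>{B \<in> sets M. B \<subseteq> A}. SUP B1\<in>{C \<in> sets M. C \<subseteq> B}. ennreal (\<mu> A1) + ennreal (\<mu> B1))"
    proof -
      have ne: "{C \<in> sets M. C \<subseteq> A} \<noteq> {}" "{C \<in> sets M. C \<subseteq> B} \<noteq> {}" by auto
      show ?thesis
        unfolding ennreal_SUP_add_left[OF ne(1), symmetric]
        by (intro SUP_cong refl) (rule ennreal_SUP_add_right[OF ne(2)])
    qed
    also have "\<dots> \<le> ?p (A \<union> B)" using le by (intro SUP_least) auto
    finally show ?thesis .
  qed
  show "countably_additive (sets M) ?p"
    unfolding countably_additive_def
  proof safe
    fix A :: "nat \<Rightarrow> 'a set" assume A: "range A \<subseteq> sets M" "disjoint_family A" "\<Union> (range A) \<in> sets M"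
    have fin: "(\<Sum>i<n. ?p (A i)) \<le> ?p (\<Union>i<n. A i)" for n
    proof (induction n)
      case (Suc n)
      have "(\<Sum>i<Suc n. ?p (A i)) \<le> ?p (\<Union>i<n. A i) + ?p (A n)"
        using add_right_mono[OF Suc, of "?p (A n)"] by simp
      also have "\<dots> \<le> ?p ((\<Union>i<n. A i) \<union> A n)"
      proof (rule super)
        have "A i \<inter> A n = {}" if "i < n" for i
          using that by (intro disjoint_family_onD[OF A(2)]) auto
        then show "(\<Union>i<n. A i) \<inter> A n = {}" by auto
        have Am: "A i \<in> sets M" for i using A(1) by auto
        then show "(\<Union>i<n. A i) \<in> sets M" "A n \<in> sets M" by auto
      qed
      also have "(\<Union>i<n. A i) \<union> A n = (\<Union>i<Suc n. A i)" by (auto simp: less_Suc_eq)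
      finally show ?case .
    qed simp
    show "(\<Sum>i. ?p (A i)) = ?p (\<Union> (range A))"
    proof (rule antisym)
      show "(\<Sum>i. ?p (A i)) \<le> ?p (\<Union> (range A))"
      proof -
        have "(\<Sum>i<n. ?p (A i)) + 0 \<le> ?p (\<Union> (range A))" for n
          using order_trans[OF fin mono[of "\<Union>i<n. A i" "\<Union> (range A)"]] by (simp add: UN_subset_iff UN_upper)
        from ennreal_suminf_bound_add[OF this] show ?thesis by simp
      qed
      show "?p (\<Union> (range A)) \<le> (\<Sum>i. ?p (A i))"
      proof (rule SUP_least, safe)
        fix B assume B: "B \<in> sets M" "B \<subseteq> \<Union> (range A)"
        have "range (\<lambda>i. B \<inter> A i) \<subseteq> sets M" "disjoint_family (\<lambda>i. B \<inter> A i)" "(\<Union>i. B \<inter> A i) = B"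
          using A B by (auto simp: disjoint_family_on_def)
        then have "(\<lambda>i. \<mu> (B \<inter> A i)) sums \<mu> B" using sm unfolding signed_measure_def by metis
        then have "ennreal (\<mu> B) \<le> (\<Sum>i. ennreal (\<mu> (B \<inter> A i)))" by (rule ennreal_sums_le)
        also have "\<dots> \<le> (\<Sum>i. ?p (A i))" using A B by (intro suminf_le) (auto intro!: SUP_upper)
        finally show "ennreal (\<mu> B) \<le> (\<Sum>i. ?p (A i))" .
      qed
    qed
  qed
qed (simp add: sets.sigma_algebra_axioms)

lemma sets_positive_variation [simp]: "sets (positive_variation M \<mu>) = sets M"
  by (simp add: positive_variation_def)

lemma space_positive_variation [simp]: "space (positive_variation M \<mu>) = space M"
  by (simp add: positive_variation_def)

lemma finite_measure_positive_variation: "finite_measure (positive_variation M \<mu>)"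
proof
  have "emeasure (positive_variation M \<mu>) (space M) \<le> ennreal c"
    unfolding emeasure_positive_variation[OF sets.top]
    using bd by (intro SUP_least ennreal_leI) (meson abs_le_D1)
  then show "emeasure (positive_variation M \<mu>) (space (positive_variation M \<mu>)) \<noteq> \<infinity>"
    by (auto simp: top_unique)
qed

lemma positive_variation_le:
  assumes "A \<in> sets M" "\<And>B. B \<in> sets M \<Longrightarrow> B \<subseteq> A \<Longrightarrow> \<mu> B \<le> r" "0 \<le> r"
  shows "measure (positive_variation M \<mu>) A \<le> r"
  unfolding measure_def emeasure_positive_variation[OF assms(1)]
  by (rule enn2real_leI) (auto intro!: SUP_least ennreal_leI assms)

lemma positive_variation_ge:
  assumes "A \<in> sets M" "B \<in> sets M" "B \<subseteq> A"
  shows "\<mu> B \<le> measure (positive_variation M \<mu>) A"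
proof -
  interpret finite_measure "positive_variation M \<mu>" by (rule finite_measure_positive_variation)
  have "ennreal (\<mu> B) \<le> emeasure (positive_variation M \<mu>) A"
    unfolding emeasure_positive_variation[OF assms(1)] using assms by (auto intro!: SUP_upper)
  then show ?thesis by (simp add: emeasure_eq_measure)
qed

end

lemma signed_measure_uminus: "signed_measure M \<mu> \<Longrightarrow> signed_measure M (\<lambda>A. - \<mu> A)"
  by (auto simp: signed_measure_def intro!: sums_minus)

text \<open>One inequality suffices, since it can be applied to \<mu> and to its negative: for
  \<open>B\<close> inside \<open>A\<close>, \<mu>(B) = \<mu>(A) - \<mu>(A - B), and -\<mu>(A - B) is
  at most the negative variation of \<open>A\<close>.\<close>

lemma jordan_diff:
  assumes sm: "signed_measure M \<mu>" and bd: "\<And>A. \<bar>\<mu> A\<bar> \<le> c" and A: "A \<in> sets M"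
  shows "\<mu> A = measure (positive_variation M \<mu>) A - measure (positive_variation M (\<lambda>A. - \<mu> A)) A"
proof -
  have le: "measure (positive_variation M \<mu>) A \<le> \<mu> A + measure (positive_variation M (\<lambda>A. - \<mu> A)) A"
    if sm: "signed_measure M \<mu>" and bd: "\<And>A. \<bar>\<mu> A\<bar> \<le> c" for \<mu>
  proof -
    note sm' = signed_measure_uminus[OF sm]
    have bd': "\<bar>- \<mu> A\<bar> \<le> c" for A using bd by simp
    have *: "\<mu> B \<le> \<mu> A + measure (positive_variation M (\<lambda>A. - \<mu> A)) A" if B: "B \<in> sets M" "B \<subseteq> A" for B
    proof -
      have "\<mu> A = \<mu> B + \<mu> (A - B)"
        using signed_measure_Un[OF sm bd, of B "A - B"] B A by (simp add: Un_absorb1)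
      moreover have "- \<mu> (A - B) \<le> measure (positive_variation M (\<lambda>A. - \<mu> A)) A"
        using positive_variation_ge[OF sm' bd' A, of "A - B"] A B by auto
      ultimately show ?thesis by linarith
    qed
    moreover have "\<mu> {} = 0" using sm by (simp add: signed_measure_def)
    ultimately show ?thesis
      using *[of "{}"] by (intro positive_variation_le[OF sm bd A]) auto
  qed
  have bd': "\<bar>- \<mu> A\<bar> \<le> c" for A using bd by simp
  from le[OF sm bd] le[OF signed_measure_uminus[OF sm] bd'] show ?thesis by simp
qed

text \<open>The positive part lives on a Hahn set, so its integrals are values of the functional.\<close>

lemma jordan_hahn:
  assumes sm: "signed_measure M \<mu>" and bd: "\<And>A. \<bar>\<mu> A\<bar> \<le> c"
  obtains Y where "Y \<in> sets M" "AE x in positive_variation M \<mu>. x \<in> Y"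
    "AE x in positive_variation M (\<lambda>A. - \<mu> A). x \<notin> Y"
proof -
  let ?p = "positive_variation M \<mu>" and ?n = "positive_variation M (\<lambda>A. - \<mu> A)"
  note sm' = signed_measure_uminus[OF sm]
  have bd': "\<bar>- \<mu> A\<bar> \<le> c" for A using bd by simp
  interpret p: finite_measure ?p by (rule finite_measure_positive_variation[OF sm bd])
  interpret n: finite_measure ?n by (rule finite_measure_positive_variation[OF sm' bd'])
  note simps = sets_positive_variation[OF sm bd] sets_positive_variation[OF sm' bd']
    space_positive_variation[OF sm bd] space_positive_variation[OF sm' bd']
  obtain Y where Y: "Y \<in> sets M" and Y1: "\<And>X. X \<in> sets M \<Longrightarrow> X \<subseteq> Y \<Longrightarrow> ?n X \<le> ?p X"
    and Y2: "\<And>X. X \<in> sets M \<Longrightarrow> X \<inter> Y = {} \<Longrightarrow> ?p X \<le> ?n X"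
    using finite_unsigned_Hahn_decomposition[OF p.finite_measure_axioms n.finite_measure_axioms]
    by (auto simp: simps)
  \<comment> \<open>Every measurable subset of the complement of \<open>Y\<close> has nonpositive
    \<mu> by \<open>jordan_diff\<close>, so the supremum picks up nothing.\<close>
  have "measure ?p (space M - Y) \<le> 0"
  proof (rule positive_variation_le[OF sm bd])
    fix B assume B: "B \<in> sets M" "B \<subseteq> space M - Y"
    from Y2[OF B(1)] B show "\<mu> B \<le> 0"
      using jordan_diff[OF sm bd B(1)] by (auto simp: p.emeasure_eq_measure n.emeasure_eq_measure)
  qed (use Y in auto)
  then have p0: "?p (space M - Y) = 0" by (simp add: p.emeasure_eq_measure measure_le_0_iff)
  have "measure ?n Y \<le> 0"
  proof (rule positive_variation_le[OF sm' bd'])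
    fix B assume B: "B \<in> sets M" "B \<subseteq> Y"
    from Y1[OF B] show "- \<mu> B \<le> 0"
      using jordan_diff[OF sm bd B(1)] by (auto simp: p.emeasure_eq_measure n.emeasure_eq_measure)
  qed (use Y in auto)
  then have n0: "?n Y = 0" by (simp add: n.emeasure_eq_measure measure_le_0_iff)
  show ?thesis
  proof (rule that[OF Y])
    show "AE x in ?p. x \<in> Y"
      by (rule AE_I[of _ _ "space M - Y"]) (use p0 Y simps in auto)
    show "AE x in ?n. x \<notin> Y"
      by (rule AE_I[of _ _ "Y"]) (use n0 Y simps in auto)
  qed
qed

text \<open>Induction over nonnegative measurable functions. Membership in the weighted space is
  kept as an implication in \<open>pos\<close>, because it passes downwards: summands and
  approximants are dominated by the function that they build up.\<close>

lemma regfun_eq_indicatorI: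
  assumes L: "regfun M w L" and K: "regfun M w K" and w: "\<And>x. x \<in> space M \<Longrightarrow> 1 \<le> w x"
    and eq: "\<And>A. A \<in> sets M \<Longrightarrow> L (indicator A) = K (indicator A)"
    and g: "g \<in> wspace M w"
  shows "L g = K g"
proof -
  have pos: "u \<in> wspace M w \<longrightarrow> L u = K u" if "u \<in> borel_measurable M" "\<And>x. 0 \<le> u x" for u
    using that
  proof (induction rule: borel_measurable_induct_real)
    case (set A) then show ?case using eq by simp
  next
    case (mult u c)
    show ?case
    proof safe
      assume cu: "(\<lambda>x. c * u x) \<in> wspace M w"
      show "L (\<lambda>x. c * u x) = K (\<lambda>x. c * u x)"
      proof (cases "c = 0")
        case True then show ?thesis using regfun_zero[OF L cu] regfun_zero[OF K cu] by simp
      next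
        case False
        have u: "u \<in> wspace M w" using wspace_scale[OF cu, of "1/c"] False by simp
        with mult show ?thesis using regfun_scale[OF L u] regfun_scale[OF K u] by simp
      qed
    qed
  next
    case (add u v)
    show ?case
    proof safe
      assume uv: "(\<lambda>x. v x + u x) \<in> wspace M w"
      then obtain c where c: "c > 0" "(\<lambda>x. v x + u x) \<in> wball M (\<lambda>x. c * w x)" by (rule wspaceE)
      have "u \<in> wspace M w" "v \<in> wspace M w"
      proof -
        have le: "u x \<le> c * w x" "v x \<le> c * w x" if "x \<in> space M" for x
          using wball_bound[OF c(2) that] \<open>\<And>x. 0 \<le> u x\<close>[of x] \<open>\<And>x. 0 \<le> v x\<close>[of x] by auto
        show "u \<in> wspace M w" by (rule wspaceI[OF c(1)], rule wballI) (use add le in auto)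
        show "v \<in> wspace M w" by (rule wspaceI[OF c(1)], rule wballI) (use add le in auto)
      qed
      with add show "L (\<lambda>x. v x + u x) = K (\<lambda>x. v x + u x)"
        using regfun_add[OF L] regfun_add[OF K] by simp
    qed
  next
    case (seq U)
    note lim = \<open>\<And>x. x \<in> space M \<Longrightarrow> (\<lambda>i. U i x) \<longlonglongrightarrow> u x\<close>
    show ?case
    proof safe
      assume u: "u \<in> wspace M w"
      then obtain c where c: "c > 0" "u \<in> wball M (\<lambda>x. c * w x)" by (rule wspaceE)
      have Ub: "U i \<in> wball M (\<lambda>x. c * w x)" for i
      proof (rule wballI)
        fix x assume x: "x \<in> space M"
        have "U i x \<le> u x"
          using lim[OF x] \<open>incseq U\<close> by (intro incseq_le) (auto simp: incseq_def le_fun_def)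
        then show "\<bar>U i x\<bar> \<le> c * w x" using wball_bound[OF c(2) x] \<open>\<And>i x. 0 \<le> U i x\<close>[of i x] by simp
      qed (use seq in auto)
      have "L (U i) = K (U i)" for i using \<open>\<And>i. U i \<in> wspace M w \<longrightarrow> L (U i) = K (U i)\<close> wspaceI[OF c(1) Ub] by blast
      then show "L u = K u"
        using regfun_tendsto[OF L c(1) Ub c(2) lim] regfun_tendsto[OF K c(1) Ub c(2) lim]
        by (auto intro: LIMSEQ_unique)
    qed
  qed
  obtain c where c: "c > 0" "g \<in> wball M (\<lambda>x. c * w x)" using g by (rule wspaceE)
  have gm: "g \<in> borel_measurable M" by (rule wspace_meas[OF g])
  have pm: "(\<lambda>x. max 0 (g x)) \<in> wspace M w" "(\<lambda>x. max 0 (- g x)) \<in> wspace M w"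
    using wball_bound[OF c(2)] gm by (auto intro!: wspaceI[OF c(1)] wballI) fastforce+
  have "(\<lambda>x. max 0 (g x) - max 0 (- g x)) = g" by auto
  with pos[of "\<lambda>x. max 0 (g x)"] pos[of "\<lambda>x. max 0 (- g x)"] pm gm
    regfun_diff[OF L pm] regfun_diff[OF K pm] show ?thesis by simp
qed

section \<open>From functionals to signed measures and their weighted norms\<close>

definition lmeas :: "'a measure \<Rightarrow> (('a \<Rightarrow> real) \<Rightarrow> real) \<Rightarrow> 'a set \<Rightarrow> real" where
  "lmeas M L A = (if A \<in> sets M then L (indicator A) else 0)"

lemma indicator_wball:
  assumes "\<And>x. x \<in> space M \<Longrightarrow> 1 \<le> w x" "A \<in> sets M" shows "(indicator A :: _ \<Rightarrow> real) \<in> wball M w"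
  by (rule wballI) (use assms in \<open>auto simp: indicator_def intro: order_trans[OF _ assms(1)]\<close>)

lemma signed_measure_lmeas:
  assumes L: "regfun M w L" and w: "\<And>x. x \<in> space M \<Longrightarrow> 1 \<le> w x"
  shows "signed_measure M (lmeas M L)"
  unfolding signed_measure_def
proof (intro conjI allI impI)
  have iw: "indicator A \<in> wball M w" if "A \<in> sets M" for A by (rule indicator_wball[OF w that])
  show "lmeas M L A = 0" if "A \<notin> sets M" for A using that by (simp add: lmeas_def)
  have "indicator {} = (\<lambda>x::'a. 0 :: real)" by auto
  with regfun_zero[OF L wball_wspace[OF iw[of "{}"]]] show "lmeas M L {} = 0" by (simp add: lmeas_def)
  fix A :: "nat \<Rightarrow> 'a set" assume A: "range A \<subseteq> sets M" "disjoint_family A"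
  have Am: "A i \<in> sets M" for i using A by auto
  have eq: "(\<Sum>i<n. indicator (A i) x) = (indicator (\<Union>i<n. A i) x :: real)" for n x
    using A(2) by (intro indicator_UN_disjoint[symmetric]) (auto simp: disjoint_family_on_def)
  have part: "(\<Sum>i<n. lmeas M L (A i)) = L (indicator (\<Union>i<n. A i))" for n
  proof -
    have "L (\<lambda>x. \<Sum>i<n. indicator (A i) x) = (\<Sum>i<n. L (indicator (A i)))"
      using regfun_sum[OF L, of n "\<lambda>i. indicator (A i)"] wball_wspace[OF iw[OF Am]]
      by (metis empty_iff)
    moreover have "(\<lambda>x. \<Sum>i<n. indicator (A i) x) = (indicator (\<Union>i<n. A i) :: _ \<Rightarrow> real)" using eq by auto
    ultimately show ?thesis using Am by (simp add: lmeas_def)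
  qed
  have "(\<lambda>n. L (indicator (\<Union>i<n. A i))) \<longlonglongrightarrow> L (indicator (\<Union>i. A i))"
  proof (rule regfun_tendsto[OF L, of 1])
    show "(\<lambda>n. indicator (\<Union>i<n. A i) x) \<longlonglongrightarrow> (indicator (\<Union>i. A i) x :: real)" for x
      by (rule LIMSEQ_indicator_UN)
    show "indicator (\<Union>i<n. A i) \<in> wball M (\<lambda>x. 1 * w x)" for n
      using iw[of "\<Union>i<n. A i"] Am by auto
    show "indicator (\<Union>i. A i) \<in> wball M (\<lambda>x. 1 * w x)"
      using iw[of "\<Union>i. A i"] Am by auto
  qed simp
  then show "(\<lambda>i. lmeas M L (A i)) sums lmeas M L (\<Union>i. A i)"
    unfolding sums_def part using Am by (auto simp: lmeas_def)
qed

lemma lmeas_bounded: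
  assumes L: "regfun M w L" and w: "\<And>x. x \<in> space M \<Longrightarrow> 1 \<le> w x"
  obtains c where "\<And>A. \<bar>lmeas M L A\<bar> \<le> c"
proof -
  obtain c where "c > 0" "\<forall>g\<in>wball M w. \<bar>L g\<bar> \<le> c" using regfun_bounded[OF L] by blast
  then show ?thesis using that[of c] indicator_wball[of M w, OF w] by (auto simp: lmeas_def)
qed

lemma lmeas_uminus: "(\<lambda>A. - lmeas M L A) = lmeas M (\<lambda>g. - L g)"
  by (auto simp: lmeas_def)

lemma regfun_uminus: "regfun M w L \<Longrightarrow> regfun M w (\<lambda>g. - L g)"
  using regfun_lincomb[of M w L L "-1" 0] by simp

text \<open>Bounded functions come first: they are integrable for the finite variations at once,
  whereas integrability of \<open>w\<close> is deduced from this case.\<close>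

lemma lmeas_bounded_eq:
  assumes L: "regfun M w L" and w: "\<And>x. x \<in> space M \<Longrightarrow> 1 \<le> w x"
    and g: "g \<in> borel_measurable M" "\<And>x. x \<in> space M \<Longrightarrow> \<bar>g x\<bar> \<le> r"
  shows "signed_integral M (lmeas M L) g = L g"
proof -
  let ?\<mu> = "lmeas M L"
  have sm: "signed_measure M ?\<mu>" by (rule signed_measure_lmeas[OF L w])
  obtain c where bd: "\<And>A. \<bar>?\<mu> A\<bar> \<le> c" by (rule lmeas_bounded[OF L w]) blast+
  note sm' = signed_measure_uminus[OF sm]
  have bd': "\<bar>- ?\<mu> A\<bar> \<le> c" for A using bd by simp
  interpret p: finite_measure "positive_variation M ?\<mu>" by (rule finite_measure_positive_variation[OF sm bd])
  interpret n: finite_measure "positive_variation M (\<lambda>A. - ?\<mu> A)" by (rule finite_measure_positive_variation[OF sm' bd'])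
  note simps = sets_positive_variation[OF sm bd] sets_positive_variation[OF sm' bd']
  have K: "regfun M (\<lambda>_. 1) (signed_integral M ?\<mu>)"
    unfolding signed_integral_def
    by (intro regfun_diff_fun regfun_integral) (simp_all add: simps)
  have L1: "regfun M (\<lambda>_. 1) L" by (rule regfun_weaken[OF L, of _ 1]) (use w in auto)
  have "signed_integral M ?\<mu> (indicator A) = L (indicator A)" if A: "A \<in> sets M" for A
  proof -
    have "?\<mu> A = L (indicator A)" using A by (simp add: lmeas_def)
    then show ?thesis
      using jordan_diff[OF sm bd A] A sets.sets_into_space[OF A]
        space_positive_variation[OF sm bd] space_positive_variation[OF sm' bd']
      by (simp add: signed_integral_def Int_absorb2)
  qed
  note eq = this
  have "g \<in> wspace M (\<lambda>_. 1)"
    by (rule wspaceI[of "\<bar>r\<bar> + 1"], simp, rule wballI) (use g in \<open>auto dest!: g(2)\<close>)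
  from regfun_eq_indicatorI[OF K L1 _ eq this] show ?thesis by simp
qed

text \<open>Truncations of \<open>w\<close>, cut to the Hahn set, are test functions that the
  negative part does not see. Their integrals against the positive part are therefore values of
  \<open>L\<close> on the ball, bounded by one constant, and the truncation level can tend to
  infinity.\<close>

lemma lmeas_integrable:
  assumes L: "regfun M w L" and w: "\<And>x. x \<in> space M \<Longrightarrow> 1 \<le> w x" and wm: "w \<in> borel_measurable M"
  shows "integrable (positive_variation M (lmeas M L)) w"
proof -
  let ?\<mu> = "lmeas M L"
  have sm: "signed_measure M ?\<mu>" by (rule signed_measure_lmeas[OF L w])
  obtain c where bd: "\<And>A. \<bar>?\<mu> A\<bar> \<le> c" by (rule lmeas_bounded[OF L w]) blast+
  note sm' = signed_measure_uminus[OF sm]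
  have bd': "\<bar>- ?\<mu> A\<bar> \<le> c" for A using bd by simp
  let ?p = "positive_variation M ?\<mu>" and ?n = "positive_variation M (\<lambda>A. - ?\<mu> A)"
  interpret p: finite_measure ?p by (rule finite_measure_positive_variation[OF sm bd])
  note simps [simp] = sets_positive_variation[OF sm bd] sets_positive_variation[OF sm' bd']
     space_positive_variation[OF sm bd] space_positive_variation[OF sm' bd']
  note [measurable_cong] = simps(1,2)
  obtain Y where Y: "Y \<in> sets M" "AE x in ?p. x \<in> Y" "AE x in ?n. x \<notin> Y"
    by (rule jordan_hahn[OF sm bd])
  obtain d where d: "d > 0" "\<forall>g\<in>wball M w. \<bar>L g\<bar> \<le> d" using regfun_bounded[OF L] by blast
  have [measurable]: "Y \<in> sets M" "w \<in> borel_measurable M" using Y wm by auto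
  have "(\<integral>\<^sup>+x. ennreal (min (real k) (w x)) \<partial>?p) \<le> ennreal d" for k
  proof -
    define g where "g x = min (real k) (w x) * indicator Y x" for x
    have gm [measurable]: "g \<in> borel_measurable M" unfolding g_def by measurable
    have g0: "0 \<le> g x" "g x \<le> real k" "g x \<le> w x" if "x \<in> space M" for x
      using w[OF that] by (auto simp: g_def indicator_def)
    have int: "integrable ?p g"
      using g0 by (intro p.integrable_const_bound[of _ "real k"]) auto
    have "(\<integral>\<^sup>+x. ennreal (min (real k) (w x)) \<partial>?p) = (\<integral>\<^sup>+x. ennreal (g x) \<partial>?p)"
      using Y(2) by (intro nn_integral_cong_AE) (auto simp: g_def)
    also have "\<dots> = ennreal (\<integral>x. g x \<partial>?p)"
      using g0 by (intro nn_integral_eq_integral[OF int]) auto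
    also have "(\<integral>x. g x \<partial>?p) = signed_integral M ?\<mu> g"
    proof -
      have "(\<integral>x. g x \<partial>?n) = (\<integral>x. 0 \<partial>?n)"
        using Y(3) by (intro integral_cong_AE) (auto simp: g_def)
      then show ?thesis by (simp add: signed_integral_def)
    qed
    also have "\<dots> = L g" using g0 by (intro lmeas_bounded_eq[OF L w gm, of "real k"]) auto
    also have "L g \<le> d"
    proof -
      have "g \<in> wball M w" using g0 gm by (intro wballI) auto
      then show ?thesis using d(2) by fastforce
    qed
    finally show ?thesis by (simp add: ennreal_leI)
  qed
  note bnd = this
  have le: "(\<integral>\<^sup>+x. ennreal (w x) \<partial>?p) \<le> ennreal d"
    by (rule nn_integral_le_truncI[OF _ bnd]) measurable
  have "(\<integral>\<^sup>+x. ennreal (norm (w x)) \<partial>?p) = (\<integral>\<^sup>+x. ennreal (w x) \<partial>?p)"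
  proof (rule nn_integral_cong)
    fix x assume "x \<in> space ?p"
    then have "1 \<le> w x" using w by simp
    then show "ennreal (norm (w x)) = ennreal (w x)" by simp
  qed
  with le have "(\<integral>\<^sup>+x. ennreal (norm (w x)) \<partial>?p) < \<infinity>"
    by (simp add: le_less_trans[OF _ ennreal_less_top])
  then show ?thesis by (intro integrableI_bounded) measurable
qed

text \<open>Since \<open>w\<close> is integrable for both variations, no junk value of the integral
  enters on the weighted space. The negative variation is covered by the same lemma applied to the
  negated functional.\<close>

theorem signed_integral_lmeas:
  assumes L: "regfun M w L" and w: "\<And>x. x \<in> space M \<Longrightarrow> 1 \<le> w x" and wm: "w \<in> borel_measurable M"
    and g: "g \<in> wspace M w"
  shows "signed_integral M (lmeas M L) g = L g"
proof (rule regfun_eqI[OF _ L _ _ g])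
  let ?\<mu> = "lmeas M L"
  have sm: "signed_measure M ?\<mu>" by (rule signed_measure_lmeas[OF L w])
  obtain c where bd: "\<And>A. \<bar>?\<mu> A\<bar> \<le> c" by (rule lmeas_bounded[OF L w]) blast+
  note sm' = signed_measure_uminus[OF sm]
  have bd': "\<bar>- ?\<mu> A\<bar> \<le> c" for A using bd by simp
  show "regfun M w (signed_integral M ?\<mu>)"
    unfolding signed_integral_def
    using lmeas_integrable[OF L w wm] lmeas_integrable[OF regfun_uminus[OF L] w wm]
    by (intro regfun_diff_fun regfun_integral)
       (simp_all add: lmeas_uminus sets_positive_variation[OF sm bd] sets_positive_variation[OF sm' bd', unfolded lmeas_uminus])
  show "0 \<le> w x" if "x \<in> space M" for x using w[OF that] by simp
  show "signed_integral M ?\<mu> g = L g" if "g \<in> wball M w" "\<And>x. x \<in> space M \<Longrightarrow> \<bar>g x\<bar> \<le> c" for g c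
    using that by (intro lmeas_bounded_eq[OF L w]) (auto dest: wball_meas)
qed

lemma weighted_norm_lmeas:
  assumes L: "regfun M w L" and w: "\<And>x. x \<in> space M \<Longrightarrow> 1 \<le> w x" and wm: "w \<in> borel_measurable M"
  shows "weighted_norm M w (lmeas M L) = (SUP g\<in>wball M w. ereal (L g))"
  unfolding weighted_norm_def wball_def[symmetric]
  using signed_integral_lmeas[OF L w wm] wball_wspace by (intro SUP_cong) auto

lemma lmeas_in_weighted_measures:
  assumes L: "regfun M w L" and w: "\<And>x. x \<in> space M \<Longrightarrow> 1 \<le> w x" and wm: "w \<in> borel_measurable M"
  shows "lmeas M L \<in> weighted_measures M w"
proof -
  obtain d where d: "d > 0" "\<forall>g\<in>wball M w. \<bar>L g\<bar> \<le> d" using regfun_bounded[OF L] by blast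
  have "weighted_norm M w (lmeas M L) \<le> ereal d"
    by (subst weighted_norm_lmeas[OF L w wm]) (use d(2) in \<open>auto intro!: SUP_least dest!: bspec intro: order_trans[OF abs_ge_self]\<close>)
  then show ?thesis
    using signed_measure_lmeas[OF L w] by (auto simp: weighted_measures_def intro: le_less_trans)
qed

section \<open>Smooth families of operators on a scale of weights\<close>

lemma wball_diff:
  assumes "g \<in> wball M (\<lambda>x. c * w x)" "h \<in> wball M (\<lambda>x. c * w x)"
  shows "(\<lambda>x. g x - h x) \<in> wball M (\<lambda>x. 2 * c * w x)"
  using wball_lin[OF assms, of 1 "-1"] by (simp add: algebra_simps)

definition mono_weights :: "'a measure \<Rightarrow> (nat \<Rightarrow> 'a \<Rightarrow> real) \<Rightarrow> bool" where
  "mono_weights M W \<longleftrightarrow> (\<forall>s. W s \<in> borel_measurable M) \<and> (\<forall>s. \<forall>x\<in>space M. 1 \<le> W s x \<and> W s x \<le> W (Suc s) x)"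

text \<open>\<open>opC k M W N W' n e A\<close>: the family \<open>u \<mapsto> A u\<close> is \<open>n\<close> times continuously differentiable, where
  the first \<open>e\<close> steps of the scale \<open>W' 0 \<le> \<dots> \<le> W' k\<close> of weights are already used up and every further
  derivative costs one more step. Uniformity over the unit ball is expressed by letting the test
  function vary along the sequence; this keeps dominated convergence applicable without
  measurability of suprema.\<close>

definition opB :: "nat \<Rightarrow> 'a measure \<Rightarrow> (nat \<Rightarrow> 'a \<Rightarrow> real) \<Rightarrow> 'b measure \<Rightarrow> (nat \<Rightarrow> 'b \<Rightarrow> real) \<Rightarrow> nat \<Rightarrow>
    (real \<Rightarrow> ('a \<Rightarrow> real) \<Rightarrow> 'b \<Rightarrow> real) \<Rightarrow> bool" where
  "opB k M W N W' e A \<longleftrightarrow>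
     (\<exists>c>0. \<forall>s u. s + e \<le> k \<longrightarrow> u \<in> {0..1} \<longrightarrow> regop M (W s) N (W' (s + e)) c (A u)) \<and>
     (\<forall>s u x v g. s + e \<le> k \<longrightarrow> u \<in> {0..1} \<longrightarrow> x \<in> space N \<longrightarrow> (\<forall>n. v n \<in> {0..1}) \<longrightarrow> v \<longlonglongrightarrow> u \<longrightarrow>
        (\<forall>n. g n \<in> wball M (W s)) \<longrightarrow> (\<lambda>n. A (v n) (g n) x - A u (g n) x) \<longlonglongrightarrow> 0)"

text \<open>No target weight occurs: only convergence at each state is demanded, and the size of
  \<open>A'\<close> is recorded by the \<open>opB\<close> condition that \<open>opC\<close> attaches
  to it.\<close>

definition opD :: "nat \<Rightarrow> 'a measure \<Rightarrow> (nat \<Rightarrow> 'a \<Rightarrow> real) \<Rightarrow> 'b measure \<Rightarrow> nat \<Rightarrow>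
    (real \<Rightarrow> ('a \<Rightarrow> real) \<Rightarrow> 'b \<Rightarrow> real) \<Rightarrow> (real \<Rightarrow> ('a \<Rightarrow> real) \<Rightarrow> 'b \<Rightarrow> real) \<Rightarrow> bool" where
  "opD k M W N e A A' \<longleftrightarrow>
     (\<forall>s u x v g. s + Suc e \<le> k \<longrightarrow> u \<in> {0..1} \<longrightarrow> x \<in> space N \<longrightarrow> (\<forall>n. v n \<in> {0..1} - {u}) \<longrightarrow> v \<longlonglongrightarrow> u \<longrightarrow>
        (\<forall>n. g n \<in> wball M (W s)) \<longrightarrow>
        (\<lambda>n. (A (v n) (g n) x - A u (g n) x) / (v n - u) - A' u (g n) x) \<longlonglongrightarrow> 0)"

primrec opC :: "nat \<Rightarrow> 'a measure \<Rightarrow> (nat \<Rightarrow> 'a \<Rightarrow> real) \<Rightarrow> 'b measure \<Rightarrow> (nat \<Rightarrow> 'b \<Rightarrow> real) \<Rightarrow> nat \<Rightarrow> nat \<Rightarrow>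
    (real \<Rightarrow> ('a \<Rightarrow> real) \<Rightarrow> 'b \<Rightarrow> real) \<Rightarrow> bool" where
  "opC k M W N W' 0 e A \<longleftrightarrow> opB k M W N W' e A"
| "opC k M W N W' (Suc n) e A \<longleftrightarrow> opB k M W N W' e A \<and>
     (\<exists>A'. opD k M W N e A A' \<and> opC k M W N W' n (Suc e) A')"

lemma opC_opB: "opC k M W N W' n e A \<Longrightarrow> opB k M W N W' e A"
  by (cases n) auto

lemma mono_weightsD:
  assumes "mono_weights M W"
  shows "W s \<in> borel_measurable M" "x \<in> space M \<Longrightarrow> 1 \<le> W s x" "x \<in> space M \<Longrightarrow> 0 \<le> W s x"
    "x \<in> space M \<Longrightarrow> s \<le> t \<Longrightarrow> W s x \<le> W t x"
proof -
  show "W s \<in> borel_measurable M" "x \<in> space M \<Longrightarrow> 1 \<le> W s x"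
    using assms by (auto simp: mono_weights_def)
  then show "x \<in> space M \<Longrightarrow> 0 \<le> W s x" by force
  show "x \<in> space M \<Longrightarrow> s \<le> t \<Longrightarrow> W s x \<le> W t x"
  proof (induction t)
    case (Suc t)
    have "W t x \<le> W (Suc t) x" if "x \<in> space M" using assms that unfolding mono_weights_def by blast
    with Suc show ?case by (cases "s = Suc t") auto
  qed simp
qed

lemma opB_regop:
  assumes "opB k M W N W' e A"
  obtains c where "c > 0" "\<And>s u. s + e \<le> k \<Longrightarrow> u \<in> {0..1} \<Longrightarrow> regop M (W s) N (W' (s + e)) c (A u)"
  using assms unfolding opB_def by blast

lemma opB_contD:
  "opB k M W N W' e A \<Longrightarrow> s + e \<le> k \<Longrightarrow> u \<in> {0..1} \<Longrightarrow> x \<in> space N \<Longrightarrow> (\<And>n. v n \<in> {0..1}) \<Longrightarrow>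
    v \<longlonglongrightarrow> u \<Longrightarrow> (\<And>n. g n \<in> wball M (W s)) \<Longrightarrow> (\<lambda>n. A (v n) (g n) x - A u (g n) x) \<longlonglongrightarrow> 0"
  by (simp add: opB_def)

lemma opDD:
  "opD k M W N e A A' \<Longrightarrow> s + Suc e \<le> k \<Longrightarrow> u \<in> {0..1} \<Longrightarrow> x \<in> space N \<Longrightarrow> (\<And>n. v n \<in> {0..1} - {u}) \<Longrightarrow>
    v \<longlonglongrightarrow> u \<Longrightarrow> (\<And>n. g n \<in> wball M (W s)) \<Longrightarrow>
    (\<lambda>n. (A (v n) (g n) x - A u (g n) x) / (v n - u) - A' u (g n) x) \<longlonglongrightarrow> 0"
  by (simp add: opD_def)

lemma opB_cont:
  assumes "opB k M W N W' e A" and mw: "mono_weights M W"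
    and "s + e \<le> k" "u \<in> {0..1}" "x \<in> space N" "\<And>n. v n \<in> {0..1}" "v \<longlonglongrightarrow> u"
    and d: "d > 0" and g: "\<And>n. g n \<in> wball M (\<lambda>y. d * W s y)"
  shows "(\<lambda>n. A (v n) (g n) x - A u (g n) x) \<longlonglongrightarrow> 0"
proof -
  obtain c where "c > 0" and c: "\<And>s u. s + e \<le> k \<Longrightarrow> u \<in> {0..1} \<Longrightarrow> regop M (W s) N (W' (s + e)) c (A u)"
    using assms(1) by (rule opB_regop) blast
  have g': "(\<lambda>y. (1/d) * g n y) \<in> wball M (W s)" for n using wball_scale[OF g, of "1/d"] d by simp
  have "(\<lambda>n. A (v n) (\<lambda>y. (1/d) * g n y) x - A u (\<lambda>y. (1/d) * g n y) x) \<longlonglongrightarrow> 0"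
    by (rule opB_contD[OF assms(1,3-7) g'])
  moreover have "A w (\<lambda>y. (1/d) * g n y) x = (1/d) * A w (g n) x" if "w \<in> {0..1}" for w n
    by (rule regfun_scale[OF regopD(2)[OF c[OF assms(3) that] assms(5)] wspaceI[OF d g]])
  ultimately have "(\<lambda>n. (1/d) * A (v n) (g n) x - (1/d) * A u (g n) x) \<longlonglongrightarrow> 0"
    using assms(4,6) by simp
  from tendsto_mult_right_zero[OF this, of d] show ?thesis using d by (simp add: algebra_simps)
qed

lemma opD_lim:
  assumes "opD k M W N e A A'" and B: "opB k M W N W' e A" "opB k M W N W'' (Suc e) A'"
    and "s + Suc e \<le> k" "u \<in> {0..1}" "x \<in> space N" "\<And>n. v n \<in> {0..1} - {u}" "v \<longlonglongrightarrow> u"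
    and d: "d > 0" and g: "\<And>n. g n \<in> wball M (\<lambda>y. d * W s y)"
  shows "(\<lambda>n. (A (v n) (g n) x - A u (g n) x) / (v n - u) - A' u (g n) x) \<longlonglongrightarrow> 0"
proof -
  obtain c where "c > 0" and c: "\<And>s u. s + e \<le> k \<Longrightarrow> u \<in> {0..1} \<Longrightarrow> regop M (W s) N (W' (s + e)) c (A u)"
    using B(1) by (rule opB_regop) blast
  obtain c' where "c' > 0" and c': "\<And>s u. s + Suc e \<le> k \<Longrightarrow> u \<in> {0..1} \<Longrightarrow> regop M (W s) N (W'' (s + Suc e)) c' (A' u)"
    using B(2) by (rule opB_regop) blast
  have g': "(\<lambda>y. (1/d) * g n y) \<in> wball M (W s)" for n using wball_scale[OF g, of "1/d"] d by simp
  have "(\<lambda>n. (A (v n) (\<lambda>y. (1/d) * g n y) x - A u (\<lambda>y. (1/d) * g n y) x) / (v n - u) - A' u (\<lambda>y. (1/d) * g n y) x) \<longlonglongrightarrow> 0"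
    by (rule opDD[OF assms(1,4-8) g'])
  moreover have "A w (\<lambda>y. (1/d) * g n y) x = (1/d) * A w (g n) x" if "w \<in> {0..1}" for w n
    by (rule regfun_scale[OF regopD(2)[OF c[OF _ that] assms(6)] wspaceI[OF d g]]) (use assms(4) in simp)
  moreover have "A' w (\<lambda>y. (1/d) * g n y) x = (1/d) * A' w (g n) x" if "w \<in> {0..1}" for w n
    by (rule regfun_scale[OF regopD(2)[OF c'[OF assms(4) that] assms(6)] wspaceI[OF d g]])
  ultimately have "(\<lambda>n. ((1/d) * A (v n) (g n) x - (1/d) * A u (g n) x) / (v n - u) - (1/d) * A' u (g n) x) \<longlonglongrightarrow> 0"
    using assms(5,7) by simp
  then have "(\<lambda>n. d * (((1/d) * A (v n) (g n) x - (1/d) * A u (g n) x) / (v n - u) - (1/d) * A' u (g n) x)) \<longlonglongrightarrow> 0"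
    by (rule tendsto_mult_right_zero)
  moreover have "d * (((1/d) * p - (1/d) * q) / r - (1/d) * t) = (p - q) / r - t" for p q r t :: real
    using d by (cases "r = 0") (simp_all add: field_simps)
  ultimately show ?thesis by simp
qed

lemma tendsto_within_sequentiallyI:
  fixes f :: "real \<Rightarrow> 'b::metric_space"
  assumes "\<And>v. (\<And>n. v n \<in> S - {u}) \<Longrightarrow> v \<longlonglongrightarrow> u \<Longrightarrow> (\<lambda>n. f (v n)) \<longlonglongrightarrow> l"
  shows "(f \<longlongrightarrow> l) (at u within S)"
  using assms by (auto simp: tendsto_at_iff_sequentially o_def)

text \<open>Mean value inequality at a fixed state and for a fixed test function. It makes
  difference quotients dominated by a weight one step higher, which is what dominated convergence
  asks for in the product rule.\<close>

lemma opD_lipschitz: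
  assumes D: "opD k M W N e A A'" and se: "s + Suc e \<le> k"
    and A': "\<And>u. u \<in> {0..1} \<Longrightarrow> regop M (W s) N w c (A' u)"
    and g: "g \<in> wball M (W s)" and uv: "u \<in> {0..1}" "v \<in> {0..1}" and x: "x \<in> space N"
  shows "\<bar>A v g x - A u g x\<bar> \<le> c * w x * \<bar>v - u\<bar>"
proof -
  have "((\<lambda>u. A u g x) has_field_derivative A' u g x) (at u within {0..1})" if u: "u \<in> {0..1}" for u
    unfolding has_field_derivative_iff
  proof (rule tendsto_within_sequentiallyI)
    fix v assume v: "\<And>n::nat. v n \<in> {0..1} - {u}" "v \<longlonglongrightarrow> u"
    have "(\<lambda>n. (A (v n) g x - A u g x) / (v n - u) - A' u g x) \<longlonglongrightarrow> 0"
      by (rule opDD[OF D se u x v g])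
    then show "(\<lambda>n. (A (v n) g x - A u g x) / (v n - u)) \<longlonglongrightarrow> A' u g x"
      by (simp add: LIM_zero_iff)
  qed
  moreover have "\<bar>A' u g x\<bar> \<le> c * w x" if "u \<in> {0..1}" for u
    using wball_bound[OF regopD(1)[OF A'[OF that] g] x] .
  ultimately have "norm (A v g x - A u g x) \<le> c * w x * norm (v - u)"
    using uv by (intro field_differentiable_bound[of "{0..1}" "\<lambda>u. A u g x" "\<lambda>u. A' u g x"]) auto
  then show ?thesis by simp
qed

lemma opC_mono:
  "opC k M W N W' (Suc n) e A \<Longrightarrow> opC k M W N W' n e A"
proof (induction n arbitrary: e A)
  case (Suc n) then show ?case by (metis opC.simps(2))
qed simp

section \<open>Composition and sums of smooth families\<close>

context
  fixes k :: nat and M :: "'a measure" and W and N :: "'b measure" and W' and K :: "'c measure" and W''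
  assumes mM: "mono_weights M W" and mN: "mono_weights N W'" and mK: "mono_weights K W''"
begin

text \<open>Add and subtract \<open>A u (B v g)\<close>. In the first difference the functions
  \<open>B v g\<close> move with the sequence, and for these \<open>opB\<close> allows a sequence of
  test functions; the second difference is dominated convergence under the fixed functional given by
  \<open>A u\<close> at \<open>x\<close>.\<close>

lemma opB_comp:
  assumes A: "opB k N W' K W'' e A" and B: "opB k M W N W' f B"
  shows "opB k M W K W'' (e + f) (\<lambda>u g. A u (B u g))"
  unfolding opB_def
proof safe
  obtain a where a: "a > 0" "\<And>s u. s + e \<le> k \<Longrightarrow> u \<in> {0..1} \<Longrightarrow> regop N (W' s) K (W'' (s + e)) a (A u)"
    using A by (rule opB_regop) blast
  obtain b where b: "b > 0" "\<And>s u. s + f \<le> k \<Longrightarrow> u \<in> {0..1} \<Longrightarrow> regop M (W s) N (W' (s + f)) b (B u)"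
    using B by (rule opB_regop) blast
  show "\<exists>c>0. \<forall>s u. s + (e + f) \<le> k \<longrightarrow> u \<in> {0..1} \<longrightarrow>
      regop M (W s) K (W'' (s + (e + f))) c (\<lambda>g. A u (B u g))"
  proof (intro exI[of _ "b * a"] conjI allI impI)
    fix s u assume "s + (e + f) \<le> k" and u: "u \<in> {0..1::real}"
    then have s: "s + f + e \<le> k" "s + f \<le> k" by auto
    from regop_comp[OF a(2)[OF s(1) u] b(2)[OF s(2) u] b(1) mono_weightsD(3)[OF mN]]
    show "regop M (W s) K (W'' (s + (e + f))) (b * a) (\<lambda>g. A u (B u g))" by (simp add: ac_simps)
  qed (use a b in simp)
  fix s u x v and g :: "nat \<Rightarrow> _" assume s': "s + (e + f) \<le> k" and u: "u \<in> {0..1::real}" and x: "x \<in> space K"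
    and v: "\<forall>n::nat. v n \<in> {0..1::real}" "v \<longlonglongrightarrow> u" and g: "\<forall>n. g n \<in> wball M (W s)"
  from s' have s: "s + f + e \<le> k" "s + f \<le> k" by auto
  have v': "v n \<in> {0..1}" for n using v by auto
  have Bg: "B (v n) (g n) \<in> wball N (\<lambda>y. b * W' (s + f) y)" "B u (g n) \<in> wball N (\<lambda>y. b * W' (s + f) y)" for n
    using regopD(1)[OF b(2)[OF s(2)]] v' u g by auto
  have 1: "(\<lambda>n. A (v n) (B (v n) (g n)) x - A u (B (v n) (g n)) x) \<longlonglongrightarrow> 0"
    by (rule opB_cont[OF A mN s(1) u x v' v(2) b(1) Bg(1)])
  have rA: "regfun N (W' (s + f)) (\<lambda>g. A u g x)" by (rule regopD(2)[OF a(2)[OF s(1) u] x])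
  have "(\<lambda>n. A u (\<lambda>y. B (v n) (g n) y - B u (g n) y) x) \<longlonglongrightarrow> 0"
  proof (rule regfun_null[OF rA, of "2 * b"])
    show "(\<lambda>y. B (v n) (g n) y - B u (g n) y) \<in> wball N (\<lambda>y. 2 * b * W' (s + f) y)" for n
      by (rule wball_diff[OF Bg(1) Bg(2)])
    show "(\<lambda>n. B (v n) (g n) y - B u (g n) y) \<longlonglongrightarrow> 0" if "y \<in> space N" for y
      by (rule opB_contD[OF B s(2) u that]) (use v g in auto)
  qed (use b in simp)
  moreover have "A u (\<lambda>y. B (v n) (g n) y - B u (g n) y) x = A u (B (v n) (g n)) x - A u (B u (g n)) x" for n
    by (rule regfun_diff[OF rA wspaceI[OF b(1) Bg(1)] wspaceI[OF b(1) Bg(2)]])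
  ultimately have 2: "(\<lambda>n. A u (B (v n) (g n)) x - A u (B u (g n)) x) \<longlonglongrightarrow> 0" by simp
  from tendsto_add[OF 1 2] show "(\<lambda>n. A (v n) (B (v n) (g n)) x - A u (B u (g n)) x) \<longlonglongrightarrow> 0" by simp
qed

text \<open>The product rule as three limits: the quotient of \<open>A\<close> along the moving
  functions \<open>B v g\<close>, the replacement of \<open>B v g\<close> by \<open>B u g\<close>
  under \<open>A'\<close>, and the quotient of \<open>B\<close> under the fixed
  \<open>A u\<close>.\<close>

lemma opD_comp:
  assumes A: "opB k N W' K W'' e A" "opD k N W' K e A A'" "opB k N W' K W'' (Suc e) A'"
    and B: "opB k M W N W' f B" "opD k M W N f B B'" "opB k M W N W' (Suc f) B'"
  shows "opD k M W K (e + f) (\<lambda>u g. A u (B u g)) (\<lambda>u g x. A' u (B u g) x + A u (B' u g) x)"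
  unfolding opD_def
proof safe
  obtain a where a: "a > 0" "\<And>s u. s + e \<le> k \<Longrightarrow> u \<in> {0..1} \<Longrightarrow> regop N (W' s) K (W'' (s + e)) a (A u)"
    using A(1) by (rule opB_regop) blast
  obtain a' where a': "a' > 0" "\<And>s u. s + Suc e \<le> k \<Longrightarrow> u \<in> {0..1} \<Longrightarrow> regop N (W' s) K (W'' (s + Suc e)) a' (A' u)"
    using A(3) by (rule opB_regop) blast
  obtain b where b: "b > 0" "\<And>s u. s + f \<le> k \<Longrightarrow> u \<in> {0..1} \<Longrightarrow> regop M (W s) N (W' (s + f)) b (B u)"
    using B(1) by (rule opB_regop) blast
  obtain b' where b': "b' > 0" "\<And>s u. s + Suc f \<le> k \<Longrightarrow> u \<in> {0..1} \<Longrightarrow> regop M (W s) N (W' (s + Suc f)) b' (B' u)"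
    using B(3) by (rule opB_regop) blast
  fix s u x v and g :: "nat \<Rightarrow> _" assume s': "s + Suc (e + f) \<le> k" and u: "u \<in> {0..1::real}" and x: "x \<in> space K"
    and v: "\<forall>n::nat. v n \<in> {0..1::real} - {u}" "v \<longlonglongrightarrow> u" and g: "\<forall>n. g n \<in> wball M (W s)"
  from s' have s: "s + f + Suc e \<le> k" "s + f \<le> k" "s + Suc f + e \<le> k" "s + Suc f \<le> k" by auto
  have v': "v n \<in> {0..1} - {u}" "v n \<in> {0..1}" "v n \<noteq> u" for n using v by auto
  have g': "g n \<in> wball M (W s)" for n using g by simp
  have Bg: "B (v n) (g n) \<in> wball N (\<lambda>y. b * W' (s + f) y)" "B u (g n) \<in> wball N (\<lambda>y. b * W' (s + f) y)" for n
    using regopD(1)[OF b(2)[OF s(2)]] v' u g by auto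
  have B'g: "B' u (g n) \<in> wball N (\<lambda>y. b' * W' (s + Suc f) y)" for n
    by (rule regopD(1)[OF b'(2)[OF s(4) u] g'])
  have Bg': "h \<in> wspace N (W' (s + Suc f))" if "h \<in> wball N (\<lambda>y. b * W' (s + f) y)" for h
    by (rule wspace_mono[OF wspaceI[OF b(1) that]]) (auto intro: mono_weightsD(4)[OF mN])
  define q where "q n y = (B (v n) (g n) y - B u (g n) y) / (v n - u)" for n y
  have 1: "(\<lambda>n. (A (v n) (B (v n) (g n)) x - A u (B (v n) (g n)) x) / (v n - u) - A' u (B (v n) (g n)) x) \<longlonglongrightarrow> 0"
    by (rule opD_lim[OF A(2,1,3) s(1) u x v'(1) v(2) b(1) Bg(1)])
  have rA': "regfun N (W' (s + f)) (\<lambda>g. A' u g x)" by (rule regopD(2)[OF a'(2)[OF s(1) u] x])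
  have "(\<lambda>n. A' u (\<lambda>y. B (v n) (g n) y - B u (g n) y) x) \<longlonglongrightarrow> 0"
  proof (rule regfun_null[OF rA', of "2 * b"])
    show "(\<lambda>y. B (v n) (g n) y - B u (g n) y) \<in> wball N (\<lambda>y. 2 * b * W' (s + f) y)" for n
      by (rule wball_diff[OF Bg(1) Bg(2)])
    show "(\<lambda>n. B (v n) (g n) y - B u (g n) y) \<longlonglongrightarrow> 0" if "y \<in> space N" for y
      by (rule opB_contD[OF B(1) s(2) u that]) (use v g in auto)
  qed (use b in simp)
  moreover have "A' u (\<lambda>y. B (v n) (g n) y - B u (g n) y) x = A' u (B (v n) (g n)) x - A' u (B u (g n)) x" for n
    by (rule regfun_diff[OF rA' wspaceI[OF b(1) Bg(1)] wspaceI[OF b(1) Bg(2)]])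
  ultimately have 2: "(\<lambda>n. A' u (B (v n) (g n)) x - A' u (B u (g n)) x) \<longlonglongrightarrow> 0" by simp
  have rA: "regfun N (W' (s + Suc f)) (\<lambda>g. A u g x)" by (rule regopD(2)[OF a(2)[OF s(3) u] x])
  \<comment> \<open>Domination of the quotients costs one step of the scale; \<open>A u\<close> acts
    on that higher level too, because the total index still stays within \<open>k\<close>.\<close>
  have qb: "q n \<in> wball N (\<lambda>y. b' * W' (s + Suc f) y)" for n
  proof (rule wballI)
    show "q n \<in> borel_measurable N" unfolding q_def
      using wball_meas[OF Bg(1)] wball_meas[OF Bg(2)] by measurable
    fix y assume y: "y \<in> space N"
    have "\<bar>B (v n) (g n) y - B u (g n) y\<bar> \<le> b' * W' (s + Suc f) y * \<bar>v n - u\<bar>"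
      by (rule opD_lipschitz[OF B(2) s(4) b'(2)[OF s(4)] g' u v'(2) y])
    then show "\<bar>q n y\<bar> \<le> b' * W' (s + Suc f) y"
      using v'(3) by (simp add: q_def abs_divide divide_le_eq)
  qed
  have "(\<lambda>n. A u (\<lambda>y. q n y - B' u (g n) y) x) \<longlonglongrightarrow> 0"
  proof (rule regfun_null[OF rA, of "2 * b'"])
    show "(\<lambda>y. q n y - B' u (g n) y) \<in> wball N (\<lambda>y. 2 * b' * W' (s + Suc f) y)" for n
      by (rule wball_diff[OF qb B'g])
    show "(\<lambda>n. q n y - B' u (g n) y) \<longlonglongrightarrow> 0" if "y \<in> space N" for y
      unfolding q_def by (rule opDD[OF B(2) s(4) u that]) (use v g in auto)
  qed (use b' in simp)
  moreover have "A u (\<lambda>y. q n y - B' u (g n) y) x =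
      (A u (B (v n) (g n)) x - A u (B u (g n)) x) / (v n - u) - A u (B' u (g n)) x" for n
  proof -
    have "A u (q n) x = (1 / (v n - u)) * A u (\<lambda>y. B (v n) (g n) y - B u (g n) y) x"
      using regfun_scale[OF rA wspace_diff[OF Bg'[OF Bg(1)] Bg'[OF Bg(2)]], of "1 / (v n - u)"]
      by (simp add: q_def[abs_def])
    also have "A u (\<lambda>y. B (v n) (g n) y - B u (g n) y) x = A u (B (v n) (g n)) x - A u (B u (g n)) x"
      by (rule regfun_diff[OF rA Bg'[OF Bg(1)] Bg'[OF Bg(2)]])
    finally show ?thesis
      using regfun_diff[OF rA wspaceI[OF b'(1) qb] wspaceI[OF b'(1) B'g]] by simp
  qed
  ultimately have 3: "(\<lambda>n. (A u (B (v n) (g n)) x - A u (B u (g n)) x) / (v n - u) - A u (B' u (g n)) x) \<longlonglongrightarrow> 0" by simp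
  from tendsto_add[OF tendsto_add[OF 1 2] 3]
  show "(\<lambda>n. (A (v n) (B (v n) (g n)) x - A u (B u (g n)) x) / (v n - u) -
      (A' u (B u (g n)) x + A u (B' u (g n)) x)) \<longlonglongrightarrow> 0"
    by (simp add: diff_divide_distrib algebra_simps)
qed

end

lemma opB_add:
  assumes mN: "mono_weights N W'" and A: "opB k M W N W' e A" and B: "opB k M W N W' e B"
  shows "opB k M W N W' e (\<lambda>u g x. A u g x + B u g x)"
  unfolding opB_def
proof safe
  obtain a where a: "a > 0" "\<And>s u. s + e \<le> k \<Longrightarrow> u \<in> {0..1} \<Longrightarrow> regop M (W s) N (W' (s + e)) a (A u)"
    using A by (rule opB_regop) blast
  obtain b where b: "b > 0" "\<And>s u. s + e \<le> k \<Longrightarrow> u \<in> {0..1} \<Longrightarrow> regop M (W s) N (W' (s + e)) b (B u)"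
    using B by (rule opB_regop) blast
  show "\<exists>c>0. \<forall>s u. s + e \<le> k \<longrightarrow> u \<in> {0..1} \<longrightarrow>
      regop M (W s) N (W' (s + e)) c (\<lambda>g x. A u g x + B u g x)"
    using a b regop_lincomb[OF a(2) b(2), where a = 1 and b = 1] by (intro exI[of _ "a + b"]) auto
  fix s u x v and g :: "nat \<Rightarrow> _" assume "s + e \<le> k" "u \<in> {0..1::real}" "x \<in> space N"
    "\<forall>n::nat. v n \<in> {0..1::real}" "v \<longlonglongrightarrow> u" "\<forall>n. g n \<in> wball M (W s)"
  then have "(\<lambda>n. A (v n) (g n) x - A u (g n) x) \<longlonglongrightarrow> 0" "(\<lambda>n. B (v n) (g n) x - B u (g n) x) \<longlonglongrightarrow> 0"
    by (auto intro!: opB_contD[OF A] opB_contD[OF B])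
  from tendsto_add[OF this]
  show "(\<lambda>n. A (v n) (g n) x + B (v n) (g n) x - (A u (g n) x + B u (g n) x)) \<longlonglongrightarrow> 0"
    by (simp add: algebra_simps)
qed

lemma opD_add:
  assumes "opD k M W N e A A'" "opD k M W N e B B'"
  shows "opD k M W N e (\<lambda>u g x. A u g x + B u g x) (\<lambda>u g x. A' u g x + B' u g x)"
  unfolding opD_def
proof safe
  fix s u x v and g :: "nat \<Rightarrow> _" assume "s + Suc e \<le> k" "u \<in> {0..1::real}" "x \<in> space N"
    "\<forall>n::nat. v n \<in> {0..1::real} - {u}" "v \<longlonglongrightarrow> u" "\<forall>n. g n \<in> wball M (W s)"
  then have "(\<lambda>n. (A (v n) (g n) x - A u (g n) x) / (v n - u) - A' u (g n) x) \<longlonglongrightarrow> 0"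
    "(\<lambda>n. (B (v n) (g n) x - B u (g n) x) / (v n - u) - B' u (g n) x) \<longlonglongrightarrow> 0"
    by (auto intro!: opDD[OF assms(1)] opDD[OF assms(2)])
  from tendsto_add[OF this]
  show "(\<lambda>n. (A (v n) (g n) x + B (v n) (g n) x - (A u (g n) x + B u (g n) x)) / (v n - u) -
      (A' u (g n) x + B' u (g n) x)) \<longlonglongrightarrow> 0"
    by (simp add: diff_divide_distrib add_divide_distrib algebra_simps)
qed

lemma opC_add:
  assumes "mono_weights N W'"
  shows "opC k M W N W' n e A \<Longrightarrow> opC k M W N W' n e B \<Longrightarrow> opC k M W N W' n e (\<lambda>u g x. A u g x + B u g x)"
proof (induction n arbitrary: e A B)
  case 0 then show ?case using opB_add[OF assms] by simp
next
  case (Suc n)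
  then obtain A' B' where "opD k M W N e A A'" "opC k M W N W' n (Suc e) A'"
    "opD k M W N e B B'" "opC k M W N W' n (Suc e) B'" by auto
  with Suc opB_add[OF assms] opD_add show ?case by (auto intro!: exI[of _ "\<lambda>u g x. A' u g x + B' u g x"])
qed

lemma opC_comp:
  assumes m: "mono_weights M W" "mono_weights N W'" "mono_weights K W''"
  shows "opC k N W' K W'' n e A \<Longrightarrow> opC k M W N W' n f B \<Longrightarrow>
    opC k M W K W'' n (e + f) (\<lambda>u g. A u (B u g))"
proof (induction n arbitrary: e f A B)
  case 0 then show ?case using opB_comp[OF m] by simp
next
  case (Suc n)
  then obtain A' B' where A': "opD k N W' K e A A'" "opC k N W' K W'' n (Suc e) A'"
    and B': "opD k M W N f B B'" "opC k M W N W' n (Suc f) B'" by auto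
  have AB: "opB k N W' K W'' e A" "opB k M W N W' f B" using Suc.prems by auto
  \<comment> \<open>In each summand one factor has a derivative to spare; \<open>opC_mono\<close>
    gives it up so that the induction hypothesis applies.\<close>
  have "opC k M W K W'' n (Suc (e + f)) (\<lambda>u g x. A' u (B u g) x + A u (B' u g) x)"
    using Suc.IH[OF A'(2) opC_mono[OF Suc.prems(2)]] Suc.IH[OF opC_mono[OF Suc.prems(1)] B'(2)]
    by (intro opC_add[OF m(3)]) simp_all
  with opB_comp[OF m AB] opD_comp[OF m AB(1) A'(1) opC_opB[OF A'(2)] AB(2) B'(1) opC_opB[OF B'(2)]]
  show ?case by auto
qed

lemma opC_seqI:
  assumes "\<And>l. l \<le> e + n \<Longrightarrow> opB k M W N W' l (A l)" "\<And>l. l < e + n \<Longrightarrow> opD k M W N l (A l) (A (Suc l))"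
  shows "opC k M W N W' n e (A e)"
  using assms
proof (induction n arbitrary: e)
  case (Suc n)
  then show ?case by (auto intro!: exI[of _ "A (Suc e)"] Suc.IH)
qed simp

lemma opC_seqE:
  assumes "opC k M W N W' n e A"
  shows "\<exists>D. D 0 = A \<and> (\<forall>l\<le>n. opB k M W N W' (e + l) (D l)) \<and> (\<forall>l<n. opD k M W N (e + l) (D l) (D (Suc l)))"
  using assms
proof (induction n arbitrary: e A)
  case 0 then show ?case by auto
next
  case (Suc n)
  then obtain A' where A': "opB k M W N W' e A" "opD k M W N e A A'" "opC k M W N W' n (Suc e) A'" by auto
  from Suc.IH[OF A'(3)] obtain D where D: "D 0 = A'" "\<And>l. l \<le> n \<Longrightarrow> opB k M W N W' (Suc e + l) (D l)"
    "\<And>l. l < n \<Longrightarrow> opD k M W N (Suc e + l) (D l) (D (Suc l))" by blast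
  show ?case
  proof (intro exI[of _ "case_nat A D"] conjI allI impI)
    show "opB k M W N W' (e + l) (case l of 0 \<Rightarrow> A | Suc x \<Rightarrow> D x)" if "l \<le> Suc n" for l
      using that A'(1) D(2)[of "l - 1"] by (cases l) auto
    show "opD k M W N (e + l) (case l of 0 \<Rightarrow> A | Suc x \<Rightarrow> D x) (case Suc l of 0 \<Rightarrow> A | Suc x \<Rightarrow> D x)" if "l < Suc n" for l
      using that A'(2) D(1) D(3)[of "l - 1"] by (cases l) auto
  qed simp
qed

text \<open>Since \<open>Y v - Y u = Y u (S v - S u) Y v\<close>, the inverse \<open>Y\<close> of \<open>1 - S\<close> inherits the smoothness of
  \<open>S\<close>, with derivative \<open>Y S' Y\<close>.\<close>

lemma opC_inverse:
  assumes mM: "mono_weights M W"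
    and Y: "\<And>s u. s \<le> k \<Longrightarrow> u \<in> {0..1} \<Longrightarrow> regop M (W s) M (W s) c (Y u)" and c: "c > 0"
    and res: "\<And>s u v g x. s \<le> k \<Longrightarrow> u \<in> {0..1} \<Longrightarrow> v \<in> {0..1} \<Longrightarrow> g \<in> wspace M (W s) \<Longrightarrow> x \<in> space M \<Longrightarrow>
        Y v g x - Y u g x = Y u (\<lambda>y. S v (Y v g) y - S u (Y v g) y) x"
  shows "opC k M W M W n 0 S \<Longrightarrow> opC k M W M W n 0 Y"
proof -
  have B: "opB k M W M W 0 Y" if S: "opB k M W M W 0 S"
    unfolding opB_def
  proof safe
    show "\<exists>c>0. \<forall>s u. s + 0 \<le> k \<longrightarrow> u \<in> {0..1} \<longrightarrow> regop M (W s) M (W (s + 0)) c (Y u)"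
      using Y c by auto
    obtain d where d: "d > 0" "\<And>s u. s + 0 \<le> k \<Longrightarrow> u \<in> {0..1} \<Longrightarrow> regop M (W s) M (W (s + 0)) d (S u)"
      using S by (rule opB_regop) blast
    fix s u x v and g :: "nat \<Rightarrow> _" assume s: "s + 0 \<le> k" and u: "u \<in> {0..1::real}" and x: "x \<in> space M"
      and v: "\<forall>n::nat. v n \<in> {0..1::real}" "v \<longlonglongrightarrow> u" and g: "\<forall>n. g n \<in> wball M (W s)"
    have v': "v n \<in> {0..1}" for n using v by auto
    have Yg: "Y (v n) (g n) \<in> wball M (\<lambda>y. c * W s y)" for n
      by (rule regopD(1)[OF Y[OF _ v'[of n]]]) (use s g in auto)
    have SY: "S w (Y (v n) (g n)) \<in> wball M (\<lambda>y. (c * d) * W s y)" if "w \<in> {0..1}" for w n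
      using regop_wball[OF d(2)[OF s that] _ c] Yg by simp
    \<comment> \<open>With the fixed \<open>Y u\<close> outside, only its continuity as a functional
      enters; the moving \<open>Y (v n) (g n)\<close> merely serve as test functions for
      \<open>S\<close>. So no continuity of \<open>Y\<close> is presupposed.\<close>
    have "(\<lambda>n. Y u (\<lambda>y. S (v n) (Y (v n) (g n)) y - S u (Y (v n) (g n)) y) x) \<longlonglongrightarrow> 0"
    proof (rule regfun_null[OF regopD(2)[OF Y[of s u]], of x "2 * c * d"])
      show "(\<lambda>y. S (v n) (Y (v n) (g n)) y - S u (Y (v n) (g n)) y) \<in> wball M (\<lambda>x. 2 * c * d * W s x)" for n
        using wball_diff[OF SY[OF v'] SY[OF u]] by (simp add: mult.assoc)
      show "(\<lambda>n. S (v n) (Y (v n) (g n)) y - S u (Y (v n) (g n)) y) \<longlonglongrightarrow> 0" if "y \<in> space M" for y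
        by (rule opB_cont[OF S mM s u that v' v(2) c Yg])
    qed (use s u x c d in auto)
    then show "(\<lambda>n. Y (v n) (g n) x - Y u (g n) x) \<longlonglongrightarrow> 0"
      using res[OF _ u v' wball_wspace x, of s] s g by simp
  qed
  show "opC k M W M W n 0 S \<Longrightarrow> opC k M W M W n 0 Y"
  proof (induction n)
    case 0 then show ?case using B by simp
  next
    case (Suc n)
    then obtain S' where S': "opD k M W M 0 S S'" "opC k M W M W n (Suc 0) S'" and S: "opB k M W M W 0 S" by auto
    \<comment> \<open>Bootstrapping: \<open>Y\<close> of order \<open>n\<close> makes
      \<open>Y S' Y\<close> of order \<open>n\<close>, and this is the derivative that order
      \<open>Suc n\<close> asks for.\<close>
    have Yn: "opC k M W M W n 0 Y" by (rule Suc.IH[OF opC_mono[OF Suc.prems]])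
    have YB: "opB k M W M W 0 Y" by (rule B[OF S])
    have YSY: "opC k M W M W n (Suc 0) (\<lambda>u g. Y u (S' u (Y u g)))"
      using opC_comp[OF mM mM mM opC_comp[OF mM mM mM Yn S'(2)] Yn] by simp
    have "opD k M W M 0 Y (\<lambda>u g. Y u (S' u (Y u g)))"
      unfolding opD_def
    proof safe
      have S'B: "opB k M W M W (Suc 0) S'" by (rule opC_opB[OF S'(2)])
      obtain d where d: "d > 0" "\<And>s u. s + 0 \<le> k \<Longrightarrow> u \<in> {0..1} \<Longrightarrow> regop M (W s) M (W (s + 0)) d (S u)"
        using S by (rule opB_regop) blast
      obtain d' where d': "d' > 0" "\<And>s u. s + Suc 0 \<le> k \<Longrightarrow> u \<in> {0..1} \<Longrightarrow> regop M (W s) M (W (s + Suc 0)) d' (S' u)"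
        using S'B by (rule opB_regop) blast
      fix s u x v and g :: "nat \<Rightarrow> _" assume s: "s + Suc 0 \<le> k" and u: "u \<in> {0..1::real}" and x: "x \<in> space M"
        and v: "\<forall>n::nat. v n \<in> {0..1::real} - {u}" "v \<longlonglongrightarrow> u" and g: "\<forall>n. g n \<in> wball M (W s)"
      have v': "v n \<in> {0..1}" "v n \<noteq> u" "v n \<in> {0..1} - {u}" for n using v by auto
      have sk: "s \<le> k" using s by simp
      have Yg: "Y w (g n) \<in> wball M (\<lambda>y. c * W s y)" if "w \<in> {0..1}" for w n
        by (rule regopD(1)[OF Y[OF sk that]]) (use g in auto)
      have SY: "S w (Y (v n) (g n)) \<in> wball M (\<lambda>y. (c * d) * W s y)" if "w \<in> {0..1}" for w n
        using regop_wball[OF d(2)[OF _ that] _ c, of s] Yg[OF v'(1)] sk by simp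
      define q where "q n y = (S (v n) (Y (v n) (g n)) y - S u (Y (v n) (g n)) y) / (v n - u)" for n y
      have qb: "q n \<in> wball M (\<lambda>y. (c * d') * W (s + Suc 0) y)" for n
      proof (rule wballI)
        show "q n \<in> borel_measurable M" unfolding q_def
          using wball_meas[OF SY[OF v'(1)]] wball_meas[OF SY[OF u]] by measurable
        fix y assume y: "y \<in> space M"
        let ?h = "\<lambda>y. (1/c) * Y (v n) (g n) y"
        have h: "?h \<in> wball M (W s)" using wball_scale[OF Yg[OF v'(1)], of "1/c"] c by simp
        have "\<bar>S (v n) ?h y - S u ?h y\<bar> \<le> d' * W (s + Suc 0) y * \<bar>v n - u\<bar>"
          by (rule opD_lipschitz[OF S'(1) s d'(2)[OF s] h u v'(1) y])
        moreover have "S w ?h y = (1/c) * S w (Y (v n) (g n)) y" if "w \<in> {0..1}" for w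
          by (rule regfun_scale[OF regopD(2)[OF d(2)[OF _ that] y] wspaceI[OF c Yg[OF v'(1)]]]) (use sk in simp)
        ultimately have "\<bar>S (v n) (Y (v n) (g n)) y - S u (Y (v n) (g n)) y\<bar> \<le> c * (d' * W (s + Suc 0) y * \<bar>v n - u\<bar>)"
          using u v'(1) c by (simp add: right_diff_distrib[symmetric] abs_mult abs_divide diff_divide_distrib[symmetric] divide_le_eq mult.commute)
        then show "\<bar>q n y\<bar> \<le> (c * d') * W (s + Suc 0) y"
          using v'(2) by (simp add: q_def abs_divide divide_le_eq mult.assoc)
      qed
      have lim1: "(\<lambda>n. Y u (\<lambda>y. q n y - S' u (Y (v n) (g n)) y) x) \<longlonglongrightarrow> 0"
      proof (rule regfun_null[OF regopD(2)[OF Y[OF s u] x], of "2 * c * d'"])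
        have "S' u (Y (v n) (g n)) \<in> wball M (\<lambda>y. (c * d') * W (s + Suc 0) y)" for n
          by (rule regop_wball[OF d'(2)[OF s u] Yg[OF v'(1)] c])
        from wball_diff[OF qb this]
        show "(\<lambda>y. q n y - S' u (Y (v n) (g n)) y) \<in> wball M (\<lambda>x. 2 * c * d' * W (s + Suc 0) x)" for n
          by (simp add: mult.assoc)
        show "(\<lambda>n. q n y - S' u (Y (v n) (g n)) y) \<longlonglongrightarrow> 0" if "y \<in> space M" for y
          unfolding q_def by (rule opD_lim[OF S'(1) S S'B s u that v'(3) v(2) c Yg[OF v'(1)]])
      qed (use c d' in auto)
      \<comment> \<open>Continuity of \<open>Y\<close>, already established as \<open>YB\<close>,
        replaces \<open>Y (v n)\<close> by \<open>Y u\<close> in the innermost place.\<close>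
      have lim2: "(\<lambda>n. Y u (S' u (\<lambda>y. Y (v n) (g n) y - Y u (g n) y)) x) \<longlonglongrightarrow> 0"
      proof -
        have "regfun M (W s) (\<lambda>g. Y u (S' u g) x)"
          by (rule regfun_comp[OF regopD(2)[OF Y[OF s u] x] d'(2)[OF s u]]) (use d' mono_weightsD(3)[OF mM] in auto)
        then show ?thesis
        proof (rule regfun_null[of _ _ _ "2 * c"])
          show "(\<lambda>y. Y (v n) (g n) y - Y u (g n) y) \<in> wball M (\<lambda>x. 2 * c * W s x)" for n
            by (rule wball_diff[OF Yg[OF v'(1)] Yg[OF u]])
          show "(\<lambda>n. Y (v n) (g n) y - Y u (g n) y) \<longlonglongrightarrow> 0" if "y \<in> space M" for y
            by (rule opB_contD[OF YB _ u that v'(1) v(2)]) (use sk g in auto)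
        qed (use c in simp)
      qed
      have ws: "q n \<in> wspace M (W (s + Suc 0))" "S' u (Y w (g n)) \<in> wspace M (W (s + Suc 0))"
        if "w \<in> {0..1}" for n w
      proof -
        show "q n \<in> wspace M (W (s + Suc 0))" by (rule wspaceI[OF _ qb]) (use c d' in simp)
        show "S' u (Y w (g n)) \<in> wspace M (W (s + Suc 0))"
          by (rule wspaceI[OF _ regop_wball[OF d'(2)[OF s u] Yg[OF that] c]]) (use c d' in simp)
      qed
      have rY: "regfun M (W (s + Suc 0)) (\<lambda>g. Y u g x)" by (rule regopD(2)[OF Y[OF s u] x])
      have e1: "Y u (\<lambda>y. q n y - S' u (Y (v n) (g n)) y) x = (Y (v n) (g n) x - Y u (g n) x) / (v n - u) - Y u (S' u (Y (v n) (g n))) x" for n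
      proof -
        have "Y u (q n) x = (1 / (v n - u)) * Y u (\<lambda>y. S (v n) (Y (v n) (g n)) y - S u (Y (v n) (g n)) y) x"
          using regfun_scale[OF regopD(2)[OF Y[OF sk u] x] wspace_diff[OF wspaceI[OF _ SY[OF v'(1)[of n], of n]] wspaceI[OF _ SY[OF u, of n]]], where a = "1 / (v n - u)"] c d
          by (simp add: q_def[abs_def])
        also have "\<dots> = (1 / (v n - u)) * (Y (v n) (g n) x - Y u (g n) x)"
          using res[OF sk u v'(1) wball_wspace x, of "g n"] g by simp
        finally show ?thesis using regfun_diff[OF rY ws(1)[OF u] ws(2)[OF v'(1)]] by simp
      qed
      have e2: "Y u (S' u (\<lambda>y. Y (v n) (g n) y - Y u (g n) y)) x = Y u (S' u (Y (v n) (g n))) x - Y u (S' u (Y u (g n))) x" for n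
      proof -
        have "Y u (S' u (\<lambda>y. Y (v n) (g n) y - Y u (g n) y)) x = Y u (\<lambda>y. S' u (Y (v n) (g n)) y - S' u (Y u (g n)) y) x"
          by (rule regfun_cong[OF rY wspace_diff[OF ws(2)[OF v'(1)] ws(2)[OF u]]])
             (rule regfun_diff[OF regopD(2)[OF d'(2)[OF s u]] wspaceI[OF c Yg[OF v'(1)]] wspaceI[OF c Yg[OF u]]])
        then show ?thesis using regfun_diff[OF rY ws(2)[OF v'(1)] ws(2)[OF u]] by simp
      qed
      from tendsto_add[OF lim1 lim2]
      show "(\<lambda>n. (Y (v n) (g n) x - Y u (g n) x) / (v n - u) - Y u (S' u (Y u (g n))) x) \<longlonglongrightarrow> 0"
        unfolding e1 e2 by simp
    qed
    with YB YSY show ?case by auto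
  qed
qed

section \<open>Return to signed measures and the weighted norm\<close>

lemma weighted_norm_nonneg: "(\<And>x. x \<in> space M \<Longrightarrow> 0 \<le> w x) \<Longrightarrow> 0 \<le> weighted_norm M w \<mu>"
  unfolding weighted_norm_def
  by (rule SUP_upper2[of "\<lambda>_. 0"]) (auto simp: signed_integral_def)

text \<open>A sequence of near-maximizers, the n-th within 1/(n+1) of the supremum, converts
  convergence along arbitrary sequences of test functions into convergence in norm.\<close>

lemma weighted_norm_tendsto_0I:
  assumes w: "\<And>x. x \<in> space M \<Longrightarrow> 1 \<le> w x" and wm: "w \<in> borel_measurable M"
    and L: "\<And>v. v \<in> S - {u} \<Longrightarrow> regfun M w (L v)"
    and \<mu>: "\<And>v. v \<in> S - {u} \<Longrightarrow> \<mu> v = lmeas M (L v)"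
    and lim: "\<And>v g. (\<And>n::nat. v n \<in> S - {u}) \<Longrightarrow> v \<longlonglongrightarrow> u \<Longrightarrow> (\<And>n. g n \<in> wball M w) \<Longrightarrow> (\<lambda>n. L (v n) (g n)) \<longlonglongrightarrow> 0"
  shows "((\<lambda>v::real. weighted_norm M w (\<mu> v)) \<longlongrightarrow> 0) (at u within S)"
  unfolding tendsto_at_iff_sequentially o_def
proof safe
  fix v :: "nat \<Rightarrow> real" assume v: "\<forall>n. v n \<in> S - {u}" "v \<longlonglongrightarrow> u"
  have wn: "weighted_norm M w (\<mu> (v n)) = (SUP g\<in>wball M w. ereal (L (v n) g))" for n
    using v \<mu> weighted_norm_lmeas[OF L w wm] by auto
  have "\<exists>g\<in>wball M w. weighted_norm M w (\<mu> (v n)) \<le> ereal (L (v n) g + inverse (real (Suc n)))" for n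
  proof -
    \<comment> \<open>Only a finite supremum becomes strictly smaller when 1/(n+1) is
      subtracted.\<close>
    have fin: "\<bar>weighted_norm M w (\<mu> (v n))\<bar> \<noteq> \<infinity>"
      using lmeas_in_weighted_measures[OF L w wm, of "v n"] v \<mu> weighted_norm_nonneg[of M w "\<mu> (v n)"] w
      by (auto simp: weighted_measures_def) force+
    then have "weighted_norm M w (\<mu> (v n)) - ereal (inverse (real (Suc n))) < (SUP g\<in>wball M w. ereal (L (v n) g))"
      unfolding wn[symmetric] by (cases "weighted_norm M w (\<mu> (v n))") auto
    then obtain g where "g \<in> wball M w" "weighted_norm M w (\<mu> (v n)) - ereal (inverse (real (Suc n))) < ereal (L (v n) g)"
      unfolding less_SUP_iff by blast
    then show ?thesis using fin by (intro bexI[of _ g]) (cases "weighted_norm M w (\<mu> (v n))", auto)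
  qed
  then obtain g where g: "\<And>n. g n \<in> wball M w"
    "\<And>n. weighted_norm M w (\<mu> (v n)) \<le> ereal (L (v n) (g n) + inverse (real (Suc n)))" by metis
  have "(\<lambda>n. L (v n) (g n) + inverse (real (Suc n))) \<longlonglongrightarrow> 0 + 0"
    using v g by (intro tendsto_add lim LIMSEQ_inverse_real_of_nat) auto
  then have "(\<lambda>n. ereal (L (v n) (g n) + inverse (real (Suc n)))) \<longlonglongrightarrow> 0"
    by (simp add: zero_ereal_def)
  note lim0 = this
  show "(\<lambda>n. weighted_norm M w (\<mu> (v n))) \<longlonglongrightarrow> 0"
  proof (rule tendsto_sandwich[OF _ _ tendsto_const lim0])
    show "\<forall>\<^sub>F n in sequentially. 0 \<le> weighted_norm M w (\<mu> (v n))"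
      using w by (intro always_eventually allI weighted_norm_nonneg) force
  qed (use g in auto)
qed

lemma lmeas_diff: "lmeas M L A - lmeas M K A = lmeas M (\<lambda>g. L g - K g) A"
  by (simp add: lmeas_def)

lemma lmeas_divide: "lmeas M L A / r = lmeas M (\<lambda>g. L g / r) A"
  by (simp add: lmeas_def)

text \<open>Evaluating at one state \<open>x\<close> freezes the target weights into constants. Test
  functions are taken at level \<open>s = 0\<close>, which leaves all \<open>k\<close> steps of the
  scale for derivatives.\<close>

lemma opC_Ck01_weighted:
  assumes mM: "mono_weights M W" and A: "opC k M W N W' k 0 A" and x: "x \<in> space N"
    and F: "\<And>u. u \<in> {0..1} \<Longrightarrow> F u = lmeas M (\<lambda>g. A u g x)"
  shows "Ck01_weighted k M (W 0) F"
proof -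
  obtain D where D: "D 0 = A" "\<And>l. l \<le> k \<Longrightarrow> opB k M W N W' l (D l)"
     "\<And>l. l < k \<Longrightarrow> opD k M W N l (D l) (D (Suc l))"
    using opC_seqE[OF A] by auto
  note w1 = mono_weightsD(2)[OF mM] and wm = mono_weightsD(1)[OF mM]
  have reg: "regfun M (W 0) (\<lambda>g. D l u g x)" if lk: "l \<le> k" and ul: "u \<in> {0..1}" for l u
  proof -
    obtain c where "c > 0" and c: "\<And>s u. s + l \<le> k \<Longrightarrow> u \<in> {0..1} \<Longrightarrow> regop M (W s) N (W' (s + l)) c (D l u)"
      using D(2)[OF lk] by (rule opB_regop) blast
    from regopD(2)[OF c[of 0, OF _ ul] x] lk show ?thesis by simp
  qed
  show ?thesis
    unfolding Ck01_weighted_def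
  proof (intro exI[of _ "\<lambda>l u. lmeas M (\<lambda>g. D l u g x)"] conjI ballI allI impI)
    show "lmeas M (\<lambda>g. D 0 u g x) = F u" if "u \<in> {0..1}" for u using F that D(1) by simp
    show "lmeas M (\<lambda>g. D l u g x) \<in> weighted_measures M (W 0)" if "l \<le> k" "u \<in> {0..1}" for l u
      by (rule lmeas_in_weighted_measures[OF reg[OF that] w1 wm])
    show "((\<lambda>v. weighted_norm M (W 0) (\<lambda>A. lmeas M (\<lambda>g. D l v g x) A - lmeas M (\<lambda>g. D l u g x) A)) \<longlongrightarrow> 0)
        (at u within {0..1})" if l: "l \<le> k" and u: "u \<in> {0..1}" for l u
    proof (rule weighted_norm_tendsto_0I[where L = "\<lambda>v g. D l v g x - D l u g x", OF w1 wm])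
      show "regfun M (W 0) (\<lambda>g. D l v g x - D l u g x)" if "v \<in> {0..1} - {u}" for v
        using that u l by (intro regfun_diff_fun reg) auto
      show "(\<lambda>n. D l (v n) (g n) x - D l u (g n) x) \<longlonglongrightarrow> 0"
        if "\<And>n. v n \<in> {0..1} - {u}" "v \<longlonglongrightarrow> u" "\<And>n. g n \<in> wball M (W 0)" for v g
        by (rule opB_cont[OF D(2)[OF l] mM, of 0 _ _ _ 1]) (use that l u x in auto)
    qed (auto simp: lmeas_diff)
    show "((\<lambda>v. weighted_norm M (W 0) (\<lambda>A. (lmeas M (\<lambda>g. D l v g x) A - lmeas M (\<lambda>g. D l u g x) A) / (v - u)
        - lmeas M (\<lambda>g. D (Suc l) u g x) A)) \<longlongrightarrow> 0)
        (at u within {0..1})" if l: "l < k" and u: "u \<in> {0..1}" for l u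
    proof (rule weighted_norm_tendsto_0I[where L = "\<lambda>v g. (D l v g x - D l u g x) / (v - u) - D (Suc l) u g x", OF w1 wm])
      show "regfun M (W 0) (\<lambda>g. (D l v g x - D l u g x) / (v - u) - D (Suc l) u g x)" if v: "v \<in> {0..1} - {u}" for v
      proof (rule regfun_diff_fun)
        have "regfun M (W 0) (\<lambda>g. D l v g x - D l u g x)" using v u l by (intro regfun_diff_fun reg) auto
        from regfun_lincomb[OF this this, of "1 / (v - u)" 0]
        show "regfun M (W 0) (\<lambda>g. (D l v g x - D l u g x) / (v - u))" by simp
      qed (use l u in \<open>auto intro: reg\<close>)
      show "(\<lambda>n. (D l (v n) (g n) x - D l u (g n) x) / (v n - u) - D (Suc l) u (g n) x) \<longlonglongrightarrow> 0"
        if "\<And>n. v n \<in> {0..1} - {u}" "v \<longlonglongrightarrow> u" "\<And>n. g n \<in> wball M (W 0)" for v g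
        by (rule opD_lim[OF D(3)[OF l] D(2) D(2), of 0 _ _ _ 1]) (use that l u x in auto)
    qed (auto simp: lmeas_diff lmeas_divide)
  qed
qed

section \<open>Coupling and Neumann series\<close>

text \<open>Jensen's inequality for the concave power, in the form of the tangent line at
  \<open>c\<close>: this works directly with an upper bound \<open>c\<close> for the mean and with
  extended integrals.\<close>

lemma prob_powr_moment:
  assumes P: "prob_space N" and X: "X \<in> borel_measurable N" "\<And>x. x \<in> space N \<Longrightarrow> 0 \<le> X x"
    and t: "0 < t" "t \<le> 1" and c: "c > 0"
    and le: "(\<integral>\<^sup>+x. ennreal (X x) \<partial>N) \<le> ennreal c"
  shows "(\<integral>\<^sup>+x. ennreal (X x powr t) \<partial>N) \<le> ennreal (c powr t)"
proof -
  interpret prob_space N by fact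
  note [measurable] = X(1)
  have pw: "y powr t \<le> c powr t * (t / c * y + (1 - t))" if "y \<ge> 0" for y :: real
  proof (cases "y = 0")
    case True then show ?thesis using t c by simp
  next
    case False
    have "(y / c) powr t * 1 powr (1 - t) \<le> t * (y / c) + (1 - t) * 1"
      using t c that False by (intro Youngs_inequality_0) auto
    then have "y powr t / c powr t \<le> t / c * y + (1 - t)"
      using c that by (simp add: powr_divide)
    then show ?thesis using c by (simp add: divide_le_eq mult.commute)
  qed
  have "(\<integral>\<^sup>+x. ennreal (X x powr t) \<partial>N) \<le> (\<integral>\<^sup>+x. ennreal (c powr t) * (ennreal (t / c) * ennreal (X x) + ennreal (1 - t)) \<partial>N)"
  proof (rule nn_integral_mono)
    fix x assume x: "x \<in> space N"
    have "ennreal (X x powr t) \<le> ennreal (c powr t * (t / c * X x + (1 - t)))"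
      by (rule ennreal_leI[OF pw[OF X(2)[OF x]]])
    also have "\<dots> = ennreal (c powr t) * (ennreal (t / c) * ennreal (X x) + ennreal (1 - t))"
    proof -
      have "ennreal (t / c * X x + (1 - t)) = ennreal (t / c) * ennreal (X x) + ennreal (1 - t)"
        using X(2)[OF x] t c by (subst ennreal_plus) (auto simp: ennreal_mult[symmetric])
      then show ?thesis using X(2)[OF x] t c by (subst ennreal_mult) auto
    qed
    finally show "ennreal (X x powr t) \<le> ennreal (c powr t) * (ennreal (t / c) * ennreal (X x) + ennreal (1 - t))" .
  qed
  also have "\<dots> = ennreal (c powr t) * (ennreal (t / c) * (\<integral>\<^sup>+x. ennreal (X x) \<partial>N) + ennreal (1 - t))"
    by (simp add: nn_integral_cmult nn_integral_add emeasure_space_1)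
  also have "\<dots> \<le> ennreal (c powr t) * (ennreal (t / c) * ennreal c + ennreal (1 - t))"
    by (intro mult_left_mono add_right_mono le) auto
  also have "\<dots> = ennreal (c powr t)"
    using t c by (simp add: ennreal_mult[symmetric] ennreal_plus[symmetric] del: ennreal_plus)
  finally show ?thesis .
qed

lemma powr_subadd:
  fixes x y t :: real assumes "0 \<le> x" "0 \<le> y" "0 < t" "t \<le> 1"
  shows "(x + y) powr t \<le> x powr t + y powr t"
proof (cases "x + y = 0")
  case False
  then have xy: "x + y > 0" using assms by simp
  have le: "z * (x + y) powr (t - 1) \<le> z powr t" if "0 \<le> z" "z \<le> x + y" for z
  proof (cases "z = 0")
    case False
    then have z: "z > 0" using that by simp
    have "(x + y) powr (t - 1) \<le> z powr (t - 1)" using that z assms by (intro powr_mono2') auto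
    then have "z * (x + y) powr (t - 1) \<le> z * z powr (t - 1)" using z by simp
    also have "\<dots> = z powr t" using z by (simp add: powr_diff)
    finally show ?thesis .
  qed simp
  have "(x + y) powr t = x * (x + y) powr (t - 1) + y * (x + y) powr (t - 1)"
    using xy unfolding distrib_right[symmetric] by (simp add: powr_diff)
  also have "\<dots> \<le> x powr t + y powr t" using assms by (intro add_mono le) auto
  finally show ?thesis .
qed (use assms in auto)

text \<open>The Hairer--Mattingly coupling estimate: the common part \<open>\<nu>\<close> of \<open>P\<close> and \<open>Q\<close> cancels.\<close>

lemma oscillation_bound:
  assumes P: "prob_space P" "sets P = sets M" and Q: "prob_space Q" "sets Q = sets M"
    and N: "sets N = sets M" "measure N (space M) = a" "a < 1"
    and NP: "\<And>h. h \<in> borel_measurable M \<Longrightarrow> (\<integral>\<^sup>+x. h x \<partial>N) \<le> (\<integral>\<^sup>+x. h x \<partial>P)"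
    and NQ: "\<And>h. h \<in> borel_measurable M \<Longrightarrow> (\<integral>\<^sup>+x. h x \<partial>N) \<le> (\<integral>\<^sup>+x. h x \<partial>Q)"
    and V: "integrable P V" "integrable Q V" "\<And>x. x \<in> space M \<Longrightarrow> 0 \<le> V x"
    and g: "g \<in> borel_measurable M"
      "\<And>x y. x \<in> space M \<Longrightarrow> y \<in> space M \<Longrightarrow> \<bar>g x - g y\<bar> \<le> c * (2 + b * V x + b * V y)"
    and cb: "c \<ge> 0" "b \<ge> 0"
  shows "\<bar>(\<integral>x. g x \<partial>P) - (\<integral>x. g x \<partial>Q)\<bar> \<le> c * (2 * (1 - a) + b * ((\<integral>x. V x \<partial>P) + (\<integral>x. V x \<partial>Q)))"
proof -
  note [measurable_cong] = P(2) Q(2) N(1)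
  have sp: "space P = space M" "space Q = space M" "space N = space M"
    using P(2) Q(2) N(1) by (auto dest: sets_eq_imp_space_eq)
  interpret P: prob_space P by fact
  interpret Q: prob_space Q by fact
  interpret N: finite_measure N
  proof
    have "emeasure N (space N) = (\<integral>\<^sup>+x. 1 \<partial>N)" by simp
    also have "\<dots> \<le> (\<integral>\<^sup>+x. 1 \<partial>P)" by (rule NP) simp
    finally show "emeasure N (space N) \<noteq> \<infinity>" using P.emeasure_space_1 by (auto simp: top_unique)
  qed
  have Vm [measurable]: "V \<in> borel_measurable M"
    using V(1) P(2) by (simp cong: measurable_cong_sets)
  note gm [measurable] = g(1)
  obtain x0 where x0: "x0 \<in> space M" using P.not_empty sp by auto
  have gint: "integrable R g" if R: "integrable R V" "finite_measure R" "sets R = sets M" for R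
  proof -
    interpret finite_measure R by fact
    have spR: "space R = space M" using R(3) by (rule sets_eq_imp_space_eq)
    have "\<bar>g x\<bar> \<le> \<bar>g x0\<bar> + c * (2 + b * V x + b * V x0)" if "x \<in> space M" for x
      using g(2)[OF that x0] by linarith
    note gb = this
    show ?thesis
    proof (rule Bochner_Integration.integrable_bound)
      show "integrable R (\<lambda>x. \<bar>g x0\<bar> + c * (2 + b * V x + b * V x0))"
        using R(1) by simp
      show "g \<in> borel_measurable R" using g(1) by (simp cong: measurable_cong_sets[OF R(3) refl])
      show "AE x in R. norm (g x) \<le> norm (\<bar>g x0\<bar> + c * (2 + b * V x + b * V x0))"
        using gb spR by (intro AE_I2) (force intro: order_trans[OF _ abs_ge_self])
    qed
  qed
  have Vi: "integrable N V"
  proof -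
    have "(\<integral>\<^sup>+x. ennreal (norm (V x)) \<partial>N) \<le> (\<integral>\<^sup>+x. ennreal (norm (V x)) \<partial>P)" by (rule NP) measurable
    also have "\<dots> < \<infinity>" using V(1) by (simp add: integrable_iff_bounded)
    finally show ?thesis by (intro integrableI_bounded) simp_all
  qed
  \<comment> \<open>Integration against the remainder \<open>R - N\<close>, of mass
    \<open>1 - a\<close> when \<open>R\<close> is a probability; the remainder is never formed as a
    measure.\<close>
  define J where "J R h = (\<integral>x. h x \<partial>R) - (\<integral>x. h x \<partial>N)" for R and h :: "_ \<Rightarrow> real"
  have main: "(\<integral>x. g x \<partial>P) - (\<integral>x. g x \<partial>Q) \<le> c * (2 * (1 - a) + b * ((\<integral>x. V x \<partial>P) + (\<integral>x. V x \<partial>Q)))"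
    if P: "prob_space P" "sets P = sets M" "integrable P V"
      and NP: "\<And>h. h \<in> borel_measurable M \<Longrightarrow> (\<integral>\<^sup>+x. h x \<partial>N) \<le> (\<integral>\<^sup>+x. h x \<partial>P)"
      and Q: "prob_space Q" "sets Q = sets M" "integrable Q V"
      and NQ: "\<And>h. h \<in> borel_measurable M \<Longrightarrow> (\<integral>\<^sup>+x. h x \<partial>N) \<le> (\<integral>\<^sup>+x. h x \<partial>Q)"
    for P Q
  proof -
    interpret A: prob_space P by fact
    interpret B: prob_space Q by fact
    have J_pos: "0 \<le> J R h" if R: "sets R = sets M"
      "\<And>h. h \<in> borel_measurable M \<Longrightarrow> (\<integral>\<^sup>+x. h x \<partial>N) \<le> (\<integral>\<^sup>+x. h x \<partial>R)"
      "integrable R h" "\<And>x. x \<in> space M \<Longrightarrow> 0 \<le> h x" for R h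
    proof -
      have spR: "space R = space M" using R(1) by (rule sets_eq_imp_space_eq)
      have hm: "h \<in> borel_measurable M" using R(1,3) by (simp cong: measurable_cong_sets)
      have "(\<integral>x. h x \<partial>N) \<le> (\<integral>x. h x \<partial>R)"
      proof -
        have "(\<integral>x. h x \<partial>N) = enn2real (\<integral>\<^sup>+x. ennreal (h x) \<partial>N)"
          using hm R(4) N(1) sp by (intro integral_eq_nn_integral) (auto cong: measurable_cong_sets)
        also have "\<dots> \<le> enn2real (\<integral>\<^sup>+x. ennreal (h x) \<partial>R)"
        proof (rule enn2real_mono)
          show "(\<integral>\<^sup>+x. ennreal (h x) \<partial>N) \<le> (\<integral>\<^sup>+x. ennreal (h x) \<partial>R)" using hm by (intro R(2)) measurable
          show "(\<integral>\<^sup>+x. ennreal (h x) \<partial>R) < top"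
            using R(3,4) spR by (subst nn_integral_eq_integral) auto
        qed
        also have "\<dots> = (\<integral>x. h x \<partial>R)"
          using hm R(4) R(1) spR by (intro integral_eq_nn_integral[symmetric]) (auto cong: measurable_cong_sets)
        finally show ?thesis .
      qed
      then show ?thesis by (simp add: J_def)
    qed
    have gi: "integrable P g" "integrable Q g" "integrable N g"
      using gint P Q Vi N(1) N.finite_measure_axioms A.finite_measure_axioms B.finite_measure_axioms by auto
    have fin: "measure P (space P) = 1" "measure Q (space Q) = 1" "measure N (space N) = a"
      using N(2) sp by (simp_all add: A.prob_space B.prob_space)
    \<comment> \<open>This is the product coupling of the two remainders, one variable at a time:
      first the oscillation bound is integrated in \<open>x\<close> for fixed \<open>y\<close>, then
      in \<open>y\<close>.\<close>
    have k: "0 \<le> (1 - a) * (c * (2 + b * V y)) + c * b * J P V - J P g + (1 - a) * g y" if y: "y \<in> space M" for y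
    proof -
      have "0 \<le> J P (\<lambda>x. c * (2 + b * V y) + c * b * V x - (g x - g y))"
        using g(2)[OF _ y] P gi by (intro J_pos NP) (auto simp: algebra_simps abs_le_iff)
      also have "\<dots> = (1 - a) * (c * (2 + b * V y)) + c * b * J P V - J P g + (1 - a) * g y"
        using P(3) gi Vi by (simp add: J_def fin algebra_simps)
      finally show ?thesis .
    qed
    have "0 \<le> J Q (\<lambda>y. (1 - a) * (c * (2 + b * V y)) + c * b * J P V - J P g + (1 - a) * g y)"
      using k Q gi by (intro J_pos NQ) auto
    also have "\<dots> = (1 - a) * (c * (2 * (1 - a) + b * J Q V) + c * b * J P V - J P g + J Q g)"
      using Q(3) gi Vi by (simp add: J_def fin algebra_simps)
    \<comment> \<open>The common factor \<open>1 - a\<close>, the mass of a remainder, is divided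
      out.\<close>
    finally have "J P g - J Q g \<le> c * (2 * (1 - a) + b * J Q V) + c * b * J P V"
      using N(3) by (simp add: zero_le_mult_iff)
    moreover have "J R V \<le> (\<integral>x. V x \<partial>R)" for R
      unfolding J_def using V(3) sp Bochner_Integration.integral_nonneg[of N V] by simp
    then have "c * (2 * (1 - a) + b * J Q V) + c * b * J P V \<le> c * (2 * (1 - a) + b * (\<integral>x. V x \<partial>Q)) + c * b * (\<integral>x. V x \<partial>P)"
      using cb by (intro add_mono mult_left_mono) auto
    ultimately show ?thesis by (simp add: J_def algebra_simps)
  qed
  have "(\<integral>x. g x \<partial>P) - (\<integral>x. g x \<partial>Q) \<le> c * (2 * (1 - a) + b * ((\<integral>x. V x \<partial>P) + (\<integral>x. V x \<partial>Q)))"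
    by (rule main[OF P V(1) _ Q V(2)]) (erule NP, erule NQ)
  moreover have "(\<integral>x. g x \<partial>Q) - (\<integral>x. g x \<partial>P) \<le> c * (2 * (1 - a) + b * ((\<integral>x. V x \<partial>Q) + (\<integral>x. V x \<partial>P)))"
    by (rule main[OF Q V(2) _ P V(1)]) (erule NQ, erule NP)
  ultimately show ?thesis by (simp add: abs_le_iff add.commute)
qed

text \<open>Two regimes for S = V x + V y. For large S the drift alone contracts. For the rest the
  coupled mass \<open>a\<close> pays: it gains 2 a, and \<open>b\<close> is so small that the
  additive drift constant 2 b d takes back at most \<open>a\<close>.\<close>

lemma contraction_constants:
  fixes l d a :: real
  assumes l: "0 < l" "l < 1" and d: "0 \<le> d" and a: "0 < a" "a < 1"
  obtains b \<kappa> where "b > 0" "0 < \<kappa>" "\<kappa> < 1"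
    "\<And>S. 4 * d / (1 - l) + 1 \<le> S \<Longrightarrow> 2 + b * (l * S + 2 * d) \<le> \<kappa> * (2 + b * S)"
    "\<And>S. 0 \<le> S \<Longrightarrow> 2 * (1 - a) + b * (l * S + 2 * d) \<le> \<kappa> * (2 + b * S)"
proof -
  define b where "b = a / (2 * d + 1)"
  define R where "R = 4 * d / (1 - l) + 1"
  define m where "m = (1 + l) / 2"
  \<comment> \<open>The quotient (2 + b m S) / (2 + b S) decreases in S, so its value at the
    threshold \<open>R\<close> serves all larger S; the other two entries serve the coupling
    regime.\<close>
  define \<kappa> where "\<kappa> = max ((2 + b * m * R) / (2 + b * R)) (max (1 - a / 2) l)"
  have b: "b > 0" "2 * d * b \<le> a" using a d by (auto simp: b_def field_simps)
  have R: "R > 0" using l d by (auto simp: R_def intro!: add_nonneg_pos)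
  have R2: "2 * d \<le> (1 - l) / 2 * R" using l unfolding R_def by (simp add: distrib_left)
  have m: "0 < m" "m < 1" using l by (auto simp: m_def)
  have bR: "b * R > 0" using b R by simp
  have "(2 + b * m * R) / (2 + b * R) < 1"
    using mult_strict_right_mono[OF m(2) bR] bR by (simp add: divide_less_eq mult.assoc mult.left_commute)
  then have k: "0 < \<kappa>" "\<kappa> < 1" using l a by (auto simp: \<kappa>_def)
  show ?thesis
  proof (rule that[OF b(1) k])
    fix S assume S: "4 * d / (1 - l) + 1 \<le> S"
    then have RS: "R \<le> S" by (simp add: R_def)
    have "2 * d \<le> (1 - l) / 2 * S" using order_trans[OF R2 mult_left_mono[OF RS, of "(1 - l) / 2"]] l by simp
    then have "l * S + 2 * d \<le> m * S" by (simp add: m_def field_simps)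
    then have "2 + b * (l * S + 2 * d) \<le> 2 + b * (m * S)" using b by simp
    also have "\<dots> \<le> (2 + b * m * R) / (2 + b * R) * (2 + b * S)"
    proof -
      have "0 \<le> b * (1 - m) * (S - R)" using b m RS by simp
      then have "(2 + b * (m * S)) * (2 + b * R) \<le> (2 + b * m * R) * (2 + b * S)"
        by (simp add: algebra_simps)
      then show ?thesis using bR by (simp add: le_divide_eq)
    qed
    also have "\<dots> \<le> \<kappa> * (2 + b * S)"
      using b RS R by (intro mult_right_mono) (auto simp: \<kappa>_def)
    finally show "2 + b * (l * S + 2 * d) \<le> \<kappa> * (2 + b * S)" .
  next
    fix S :: real assume S: "0 \<le> S"
    have "2 * (1 - a) + b * (l * S + 2 * d) \<le> 2 * (1 - a / 2) + l * (b * S)"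
      using b(2) by (simp add: algebra_simps)
    also have "\<dots> \<le> 2 * \<kappa> + \<kappa> * (b * S)"
      using b S by (intro add_mono mult_left_mono mult_right_mono) (auto simp: \<kappa>_def)
    finally show "2 * (1 - a) + b * (l * S + 2 * d) \<le> \<kappa> * (2 + b * S)" by (simp add: algebra_simps)
  qed
qed

section \<open>Neumann series for an operator whose powers contract, though perhaps not the operator
  itself\<close>

definition neumann :: "(('a \<Rightarrow> real) \<Rightarrow> 'a \<Rightarrow> real) \<Rightarrow> ('a \<Rightarrow> real) \<Rightarrow> 'a \<Rightarrow> real" where
  "neumann S g x = (\<Sum>n. (S ^^ n) g x)"

context
  fixes M :: "'a measure" and w S and c r :: real
  assumes w: "\<And>x. x \<in> space M \<Longrightarrow> 0 \<le> w x" and c: "c > 0" and r: "0 < r" "r < 1"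
    and S: "\<And>n. regop M w M w (c * r ^ n) (S ^^ n)"
begin

lemma neumann_term: "g \<in> wball M (\<lambda>x. d * w x) \<Longrightarrow> d > 0 \<Longrightarrow> x \<in> space M \<Longrightarrow> \<bar>(S ^^ n) g x\<bar> \<le> d * c * w x * r ^ n"
  using regop_bound[OF S, of g d x n] by (simp add: ac_simps)

lemma neumann_summable:
  assumes g: "g \<in> wspace M w" and x: "x \<in> space M"
  shows "summable (\<lambda>n. (S ^^ n) g x)"
proof -
  obtain d where d: "d > 0" "g \<in> wball M (\<lambda>x. d * w x)" using g by (rule wspaceE)
  show ?thesis
  proof (rule summable_comparison_test'[of _ 0])
    show "summable (\<lambda>n. d * c * w x * r ^ n)" using r by (intro summable_mult summable_geometric) simp
    show "norm ((S ^^ n) g x) \<le> d * c * w x * r ^ n" for n using neumann_term[OF d(2,1) x] by simp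
  qed
qed

lemma sums_geometric: "(\<lambda>n. b * r ^ n) sums (b / (1 - r))"
  using sums_mult[OF geometric_sums[of r], of b] r by simp

lemma neumann_regop: "regop M w M w (c / (1 - r)) (neumann S)"
  unfolding regop_def
proof safe
  fix g assume g: "g \<in> wball M w"
  show "neumann S g \<in> wball M (\<lambda>x. c / (1 - r) * w x)"
  proof (rule wballI)
    have "(S ^^ n) g \<in> borel_measurable M" for n by (rule wball_meas[OF regopD(1)[OF S g]])
    then show "neumann S g \<in> borel_measurable M" unfolding neumann_def[abs_def] by measurable
    fix x assume x: "x \<in> space M"
    have "\<bar>(S ^^ n) g x\<bar> \<le> (c * w x) * r ^ n" for n using neumann_term[of g 1 x n] g x by simp
    then have "norm (suminf (\<lambda>n. (S ^^ n) g x)) \<le> (\<Sum>n. (c * w x) * r ^ n)"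
      using sums_summable[OF sums_geometric] by (intro norm_suminf_le) auto
    then show "\<bar>neumann S g x\<bar> \<le> c / (1 - r) * w x"
      using sums_unique[OF sums_geometric, of "c * w x"] by (simp add: neumann_def)
  qed
next
  fix x assume x: "x \<in> space M"
  show "regfun M w (\<lambda>g. neumann S g x)"
  proof (rule regfunI)
    fix g h a b assume gh: "g \<in> wspace M w" "h \<in> wspace M w"
    have "(S ^^ n) (\<lambda>x. a * g x + b * h x) x = a * (S ^^ n) g x + b * (S ^^ n) h x" for n
      by (rule regfun_lin[OF regopD(2)[OF S x] gh])
    then show "neumann S (\<lambda>x. a * g x + b * h x) x = a * neumann S g x + b * neumann S h x"
      unfolding neumann_def
      using neumann_summable[OF gh(1) x] neumann_summable[OF gh(2) x]
      by (simp add: suminf_add[symmetric] summable_mult suminf_mult)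
  next
    fix gs g assume gs: "\<And>n. gs n \<in> wball M w" "g \<in> wball M w"
      and lim: "\<And>x. x \<in> space M \<Longrightarrow> (\<lambda>n. gs n x) \<longlonglongrightarrow> g x"
    have "(\<lambda>n. \<Sum>k. (S ^^ k) (gs n) x) \<longlonglongrightarrow> (\<Sum>k. (S ^^ k) g x)"
    proof (intro conjunct2[OF conjunct2[OF tannerys_theorem]])
      show "(\<lambda>n. (S ^^ k) (gs n) x) \<longlonglongrightarrow> (S ^^ k) g x" for k
        by (rule regfun_tendsto[OF regopD(2)[OF S x], of 1]) (use gs lim in auto)
      show "\<forall>\<^sub>F (k, n) in sequentially \<times>\<^sub>F sequentially. norm ((S ^^ k) (gs n) x) \<le> (c * w x) * r ^ k"
        using neumann_term[of "gs _" 1 x] gs x by (intro always_eventually) auto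
      show "summable (\<lambda>k. (c * w x) * r ^ k)" by (rule sums_summable[OF sums_geometric])
    qed simp
    then show "(\<lambda>n. neumann S (gs n) x) \<longlonglongrightarrow> neumann S g x" by (simp add: neumann_def)
  qed
qed

text \<open>\<open>S\<close> may be applied to the series term by term because it is continuous
  along the partial sums, which a multiple of \<open>w\<close> dominates.\<close>

lemma neumann_left:
  assumes g: "g \<in> wspace M w" and x: "x \<in> space M"
  shows "neumann S g x = g x + S (neumann S g) x"
proof -
  obtain d where d: "d > 0" "g \<in> wball M (\<lambda>x. d * w x)" using g by (rule wspaceE)
  have S1: "regfun M w (\<lambda>g. S g x)" using regopD(2)[OF S[of 1] x] by simp
  have ws: "(S ^^ n) g \<in> wspace M w" for n
    by (rule regop_wspace[OF S _ g w]) (use c r in auto)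
  have part: "(\<lambda>y. \<Sum>k<n. (S ^^ k) g y) \<in> wspace M w" "S (\<lambda>y. \<Sum>k<n. (S ^^ k) g y) x = (\<Sum>k<n. (S ^^ Suc k) g x)" for n
    using regfun_sum[OF S1, of n "\<lambda>k. (S ^^ k) g"] ws by auto
  have b: "\<bar>\<Sum>k<n. (S ^^ k) g y\<bar> \<le> (d * c / (1 - r)) * w y" if y: "y \<in> space M" for n y
  proof -
    have "\<bar>\<Sum>k<n. (S ^^ k) g y\<bar> \<le> (\<Sum>k<n. d * c * w y * r ^ k)"
      by (rule order_trans[OF sum_abs sum_mono]) (rule neumann_term[OF d(2,1) y])
    also have "\<dots> \<le> (\<Sum>k. d * c * w y * r ^ k)"
      using r d c w[OF y] by (intro sum_le_suminf summable_mult summable_geometric) auto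
    also have "\<dots> = (d * c / (1 - r)) * w y"
      using r by (simp add: suminf_mult suminf_geometric)
    finally show ?thesis .
  qed
  have lim: "(\<lambda>n. \<Sum>k<n. (S ^^ k) g y) \<longlonglongrightarrow> neumann S g y" if "y \<in> space M" for y
    unfolding neumann_def by (rule summable_LIMSEQ[OF neumann_summable[OF g that]])
  have pos: "d * c / (1 - r) > 0" using d c r by simp
  have "(\<lambda>n. S (\<lambda>y. \<Sum>k<n. (S ^^ k) g y) x) \<longlonglongrightarrow> S (neumann S g) x"
  proof (rule regfun_tendsto[OF S1 pos])
    show "(\<lambda>y. \<Sum>k<n. (S ^^ k) g y) \<in> wball M (\<lambda>x. d * c / (1 - r) * w x)" for n
      using b wspace_meas[OF part(1)] by (intro wballI) auto
    show "neumann S g \<in> wball M (\<lambda>x. d * c / (1 - r) * w x)"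
      using regop_wball[OF neumann_regop d(2,1)] by simp
  qed (rule lim)
  moreover have "(\<lambda>n. \<Sum>k<n. (S ^^ Suc k) g x) \<longlonglongrightarrow> neumann S g x - g x"
  proof -
    have "(\<lambda>n. \<Sum>k<Suc n. (S ^^ k) g x) \<longlonglongrightarrow> neumann S g x" by (rule LIMSEQ_Suc[OF lim[OF x]])
    then have "(\<lambda>n. (\<Sum>k<Suc n. (S ^^ k) g x) - g x) \<longlonglongrightarrow> neumann S g x - g x" by (intro tendsto_intros)
    then show ?thesis by (simp add: sum.lessThan_Suc_shift del: sum.lessThan_Suc)
  qed
  ultimately have "S (neumann S g) x = neumann S g x - g x"
    unfolding part(2) by (rule LIMSEQ_unique)
  then show ?thesis by simp
qed

lemma neumann_right:
  assumes g: "g \<in> wspace M w" and x: "x \<in> space M"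
  shows "neumann S (\<lambda>y. g y - S g y) x = g x"
proof -
  have Sg: "S g \<in> wspace M w" using regop_wspace[OF S[of 1] _ g w] c r by simp
  have sm: "summable (\<lambda>n. (S ^^ n) g x)" by (rule neumann_summable[OF g x])
  have "(S ^^ n) (\<lambda>y. g y - S g y) x = (S ^^ n) g x - (S ^^ Suc n) g x" for n
    using regfun_diff[OF regopD(2)[OF S[of n] x] g Sg] by (simp add: funpow_swap1)
  then have "(\<lambda>n. (S ^^ n) (\<lambda>y. g y - S g y) x) sums ((S ^^ 0) g x - 0)"
    using telescope_sums'[OF summable_LIMSEQ_zero[OF sm]] by simp
  then show ?thesis by (simp add: neumann_def sums_iff)
qed

end

text \<open>For h = \<open>neumann S' g\<close> one has (1 - S') h = g, hence (S' - S) h = (1 - S) h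
  - g; now apply \<open>neumann S\<close>, a left inverse of 1 - S.\<close>

lemma neumann_resolvent:
  assumes w: "\<And>x. x \<in> space M \<Longrightarrow> 0 \<le> w x" and c: "c > 0" and r: "0 < r" "r < 1"
    and S: "\<And>n. regop M w M w (c * r ^ n) (S ^^ n)" and S': "\<And>n. regop M w M w (c * r ^ n) (S' ^^ n)"
    and g: "g \<in> wspace M w" and x: "x \<in> space M"
  shows "neumann S' g x - neumann S g x = neumann S (\<lambda>y. S' (neumann S' g) y - S (neumann S' g) y) x"
proof -
  let ?h = "neumann S' g"
  have cr: "c / (1 - r) \<ge> 0" using c r by simp
  have h: "?h \<in> wspace M w" by (rule regop_wspace[OF neumann_regop[OF w c r S'] cr g w])
  have SS: "S f \<in> wspace M w" "S' f \<in> wspace M w" if "f \<in> wspace M w" for f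
    using regop_wspace[OF S[of 1] _ that w] regop_wspace[OF S'[of 1] _ that w] c r by auto
  note rf = regopD(2)[OF neumann_regop[OF w c r S] x]
  have "neumann S (\<lambda>y. S' ?h y - S ?h y) x = neumann S (\<lambda>y. (?h y - S ?h y) - g y) x"
    by (rule regfun_cong[OF rf])
       (use neumann_left[OF w c r S' g] in \<open>auto intro!: wspace_diff h SS g\<close>)
  also have "\<dots> = neumann S (\<lambda>y. ?h y - S ?h y) x - neumann S g x"
    by (rule regfun_diff[OF rf wspace_diff[OF h SS(1)[OF h]] g])
  also have "neumann S (\<lambda>y. ?h y - S ?h y) x = ?h x" by (rule neumann_right[OF w c r S h x])
  finally show ?thesis by simp
qed

section \<open>Markov kernels\<close>

lemma nn_integral_bind_prob:
  assumes A: "A \<in> space (prob_algebra N)" and B: "B \<in> N \<rightarrow>\<^sub>M prob_algebra L" and f: "f \<in> borel_measurable L"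
  shows "(\<integral>\<^sup>+x. f x \<partial>(A \<bind> B)) = (\<integral>\<^sup>+x. \<integral>\<^sup>+y. f y \<partial>B x \<partial>A)"
proof -
  have "sets A = sets N" using A by (simp add: space_prob_algebra)
  then have "B \<in> measurable A (subprob_algebra L)"
    using measurable_prob_algebraD[OF B] by (simp cong: measurable_cong_sets)
  then show ?thesis by (rule nn_integral_bind[OF f])
qed

lemma kernelD:
  assumes "B \<in> N \<rightarrow>\<^sub>M prob_algebra L" "x \<in> space N"
  shows "prob_space (B x)" "sets (B x) = sets L" "space (B x) = space L" "B x \<in> space (prob_algebra L)"
proof -
  show *: "B x \<in> space (prob_algebra L)" by (rule measurable_space[OF assms])
  then show "prob_space (B x)" "sets (B x) = sets L" by (auto simp: space_prob_algebra)
  then show "space (B x) = space L" by (auto dest: sets_eq_imp_space_eq)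
qed

lemma integrable_kernel:
  assumes "B \<in> N \<rightarrow>\<^sub>M prob_algebra L" "x \<in> space N" "w \<in> borel_measurable L" "\<And>y. y \<in> space L \<Longrightarrow> 0 \<le> w y"
    and "(\<integral>\<^sup>+y. ennreal (w y) \<partial>B x) \<le> ennreal c"
  shows "integrable (B x) w" "0 \<le> c \<Longrightarrow> (\<integral>y. w y \<partial>B x) \<le> c"
proof -
  note B = kernelD[OF assms(1,2)]
  have wm: "w \<in> borel_measurable (B x)" using assms(3) B(2) by (simp cong: measurable_cong_sets)
  have eq: "(\<integral>\<^sup>+y. ennreal (norm (w y)) \<partial>B x) = (\<integral>\<^sup>+y. ennreal (w y) \<partial>B x)"
    using assms(4) B(3) by (intro nn_integral_cong) auto
  have "(\<integral>\<^sup>+y. ennreal (norm (w y)) \<partial>B x) < \<infinity>"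
    unfolding eq using assms(5) by (auto intro: le_less_trans)
  then show i: "integrable (B x) w" by (rule integrableI_bounded[OF wm])
  assume c: "0 \<le> c"
  have "ennreal (\<integral>y. w y \<partial>B x) = (\<integral>\<^sup>+y. ennreal (w y) \<partial>B x)"
    using assms(4) B(3) by (intro nn_integral_eq_integral[symmetric, OF i]) auto
  then show "(\<integral>y. w y \<partial>B x) \<le> c"
    using assms(5) ennreal_le_iff[OF c, of "\<integral>y. w y \<partial>B x"] by (metis (no_types))
qed

lemma kernel_regop:
  assumes B: "B \<in> N \<rightarrow>\<^sub>M prob_algebra L" and w: "w \<in> borel_measurable L" "\<And>y. y \<in> space L \<Longrightarrow> 0 \<le> w y"
    and le: "\<And>x. x \<in> space N \<Longrightarrow> (\<integral>\<^sup>+y. ennreal (w y) \<partial>B x) \<le> ennreal (c * w' x)"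
    and c: "c \<ge> 0" "\<And>x. x \<in> space N \<Longrightarrow> 0 \<le> w' x"
  shows "regop L w N w' c (\<lambda>g x. \<integral>y. g y \<partial>B x)"
  unfolding regop_def
proof safe
  fix g assume g: "g \<in> wball L w"
  show "(\<lambda>x. \<integral>y. g y \<partial>B x) \<in> wball N (\<lambda>x. c * w' x)"
  proof (rule wballI)
    show "(\<lambda>x. \<integral>y. g y \<partial>B x) \<in> borel_measurable N"
      by (rule measurable_compose[OF measurable_prob_algebraD[OF B] integral_measurable_subprob_algebra[OF wball_meas[OF g]]])
    fix x assume x: "x \<in> space N"
    note i = integrable_kernel[OF B x w le[OF x]]
    have "\<bar>\<integral>y. g y \<partial>B x\<bar> \<le> (\<integral>y. w y \<partial>B x)"
    proof (rule order_trans[OF integral_abs_bound integral_mono'[OF i(1)]])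
      show "\<bar>g y\<bar> \<le> w y" if "y \<in> space (B x)" for y
        using wball_bound[OF g] that kernelD(3)[OF B x] by simp
    qed (use w kernelD(3)[OF B x] in auto)
    also have "\<dots> \<le> c * w' x" using i(2) c x by simp
    finally show "\<bar>\<integral>y. g y \<partial>B x\<bar> \<le> c * w' x" .
  qed
next
  fix x assume x: "x \<in> space N"
  show "regfun L w (\<lambda>g. \<integral>y. g y \<partial>B x)"
    by (rule regfun_integral[OF kernelD(2)[OF B x] integrable_kernel(1)[OF B x w le[OF x]]])
qed

text \<open>Fubini for unbounded functions: both sides are functionals with the dominated continuity
  property, so indicators decide.\<close>

lemma integral_bind_kernel:
  assumes A: "A \<in> space (prob_algebra N)" and B: "B \<in> N \<rightarrow>\<^sub>M prob_algebra L"
    and w: "w \<in> borel_measurable L" "\<And>y. y \<in> space L \<Longrightarrow> 1 \<le> w y"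
    and w': "w' \<in> borel_measurable N" "\<And>x. x \<in> space N \<Longrightarrow> 0 \<le> w' x"
    and le: "\<And>x. x \<in> space N \<Longrightarrow> (\<integral>\<^sup>+y. ennreal (w y) \<partial>B x) \<le> ennreal (c * w' x)" and c: "c \<ge> 0"
    and fin: "integrable A w'" and g: "g \<in> wspace L w"
  shows "(\<integral>y. g y \<partial>(A \<bind> B)) = (\<integral>x. (\<integral>y. g y \<partial>B x) \<partial>A)" and "integrable (A \<bind> B) w"
proof -
  have A': "sets A = sets N" "prob_space A" using A by (auto simp: space_prob_algebra)
  have spA: "space A = space N" using A'(1) by (rule sets_eq_imp_space_eq)
  have w0: "0 \<le> w y" if "y \<in> space L" for y using w(2)[OF that] by simp
  have AB: "sets (A \<bind> B) = sets L" "prob_space (A \<bind> B)"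
    using sets_bind'[OF A B] prob_space_bind'[OF A B] by auto
  interpret AB: prob_space "A \<bind> B" by fact
  interpret A: prob_space A by fact
  have spAB: "space (A \<bind> B) = space L" using AB(1) by (rule sets_eq_imp_space_eq)
  have "(\<integral>\<^sup>+y. ennreal (norm (w y)) \<partial>(A \<bind> B)) = (\<integral>\<^sup>+y. ennreal (w y) \<partial>(A \<bind> B))"
    using w0 spAB by (intro nn_integral_cong) auto
  also have "\<dots> = (\<integral>\<^sup>+x. \<integral>\<^sup>+y. ennreal (w y) \<partial>B x \<partial>A)" using w(1) by (intro nn_integral_bind_prob[OF A B]) measurable
  also have "\<dots> \<le> (\<integral>\<^sup>+x. ennreal (c * w' x) \<partial>A)" using le spA by (intro nn_integral_mono) auto
  also have "\<dots> = ennreal (\<integral>x. c * w' x \<partial>A)"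
    using fin w'(2) c spA by (intro nn_integral_eq_integral integrable_mult_right) auto
  also have "\<dots> < \<infinity>" by simp
  finally show iw: "integrable (A \<bind> B) w"
    using w(1) AB(1) by (intro integrableI_bounded) (auto cong: measurable_cong_sets)
  have R: "regop L w N w' c (\<lambda>g x. \<integral>y. g y \<partial>B x)"
    by (rule kernel_regop[OF B w(1) w0 le c w'(2)])
  show "(\<integral>y. g y \<partial>(A \<bind> B)) = (\<integral>x. (\<integral>y. g y \<partial>B x) \<partial>A)"
  proof (rule regfun_eq_indicatorI[OF _ _ w(2) _ g])
    show "regfun L w (\<lambda>g. \<integral>y. g y \<partial>(A \<bind> B))" by (rule regfun_integral[OF AB(1) iw])
    show "regfun L w (\<lambda>g. \<integral>x. (\<integral>y. g y \<partial>B x) \<partial>A)"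
      by (rule regfun_comp[OF regfun_integral[OF A'(1) fin] R c w'(2)])
    fix X assume X: "X \<in> sets L"
    have Bx: "(\<integral>y. (indicator X y :: real) \<partial>B x) = measure (B x) X" if "x \<in> space N" for x
      using X kernelD[OF B that] sets.sets_into_space[OF X] by (simp add: Int_absorb2)
    have "ennreal (measure (A \<bind> B) X) = (\<integral>\<^sup>+x. emeasure (B x) X \<partial>A)"
      using emeasure_bind_prob_algebra[OF A B X] by (simp add: AB.emeasure_eq_measure)
    also have "\<dots> = (\<integral>\<^sup>+x. ennreal (measure (B x) X) \<partial>A)"
      using spA kernelD(1)[OF B] by (intro nn_integral_cong) (simp add: finite_measure.emeasure_eq_measure prob_space.finite_measure)
    also have "\<dots> = ennreal (\<integral>x. measure (B x) X \<partial>A)"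
    proof (rule nn_integral_eq_integral)
      have "(\<lambda>x. measure (B x) X) \<in> borel_measurable A"
        using measurable_compose[OF measurable_prob_algebraD[OF B] measurable_measure_subprob_algebra[OF X]] A'(1)
        by (simp cong: measurable_cong_sets)
      then show "integrable A (\<lambda>x. measure (B x) X)"
        using spA kernelD(1)[OF B] by (intro A.integrable_const_bound[of _ 1]) (auto simp: prob_space.prob_le_1)
    qed simp
    finally have "measure (A \<bind> B) X = (\<integral>x. measure (B x) X \<partial>A)"
      by (simp add: integral_nonneg_AE)
    also have "\<dots> = (\<integral>x. (\<integral>y. (indicator X y :: real) \<partial>B x) \<partial>A)"
      using Bx spA by (intro Bochner_Integration.integral_cong) auto
    finally have eq: "measure (A \<bind> B) X = (\<integral>x. (\<integral>y. (indicator X y :: real) \<partial>B x) \<partial>A)" .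
    have "(\<integral>y. (indicator X y :: real) \<partial>(A \<bind> B)) = measure (A \<bind> B) X"
      using X AB(1) spAB sets.sets_into_space[OF X] by (simp add: Int_absorb2)
    then show "(\<integral>y. (indicator X y :: real) \<partial>(A \<bind> B)) = (\<integral>x. (\<integral>y. (indicator X y :: real) \<partial>B x) \<partial>A)"
      by (rule trans[OF _ eq])
  qed
qed

lemma measurable_kernel_prod:
  assumes "\<And>u. u \<in> set us \<Longrightarrow> Q u \<in> M \<rightarrow>\<^sub>M prob_algebra M"
  shows "kernel_prod M Q us \<in> M \<rightarrow>\<^sub>M prob_algebra M"
  using assms
proof (induction us)
  case (Cons u us)
  then show ?case
    using measurable_bind_prob_space[of "Q u" M M "kernel_prod M Q us" M] by simp
qed (simp add: measurable_return_prob_space)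

lemma SS_measurableI:
  assumes "\<And>y. (\<lambda>z. g (y, z)) \<in> borel \<rightarrow>\<^sub>M N"
  shows "g \<in> (state_space :: ('y::finite \<times> 'z::metric_space) measure) \<rightarrow>\<^sub>M N"
  by (rule measurable_pair_measure_countable1) (use assms in \<open>auto intro: countable_finite\<close>)

lemma SS_measurableD:
  assumes "g \<in> (state_space :: ('y \<times> 'z::metric_space) measure) \<rightarrow>\<^sub>M N"
  shows "(\<lambda>z. g (y, z)) \<in> borel \<rightarrow>\<^sub>M N"
  using assms by measurable

lemma space_SS [simp]: "space (state_space :: ('y \<times> 'z::metric_space) measure) = UNIV"
  by (simp add: space_pair_measure)

lemma nn_integral_SS:
  fixes N :: "'z::metric_space measure" and h :: "'y::finite \<times> 'z \<Rightarrow> ennreal"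
  assumes N: "sigma_finite_measure N" "sets N = sets borel" and h: "h \<in> borel_measurable state_space"
  shows "(\<integral>\<^sup>+x. h x \<partial>(count_space UNIV \<Otimes>\<^sub>M N)) = (\<Sum>y\<in>UNIV. \<integral>\<^sup>+z. h (y, z) \<partial>N)"
proof -
  interpret sigma_finite_measure N by fact
  have "h \<in> borel_measurable (count_space UNIV \<Otimes>\<^sub>M N)"
    using h N(2) by (simp cong: measurable_cong_sets sets_pair_measure_cong)
  from nn_integral_fst[OF this] show ?thesis by (simp add: nn_integral_count_space_finite)
qed

section \<open>The hypotheses, the weights of the scale and the joint kernel\<close>

locale density_chain =
  fixes P :: "real \<Rightarrow> 'y::finite \<Rightarrow> 'y \<Rightarrow> 'z::metric_space \<Rightarrow> real"
    and f :: "real \<Rightarrow> 'z \<Rightarrow> 'z \<Rightarrow> real"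
    and \<gamma> :: "'z \<Rightarrow> 'z measure"
    and Qb :: "real \<Rightarrow> 'z \<Rightarrow> 'z measure"
    and Q :: "real \<Rightarrow> 'y \<times> 'z \<Rightarrow> ('y \<times> 'z) measure"
    and k m :: nat
    and \<phi> :: "'z \<Rightarrow> real"
    and d0 d1 q \<epsilon> \<rho> b K Cb C :: real
    and \<eta> :: "real \<Rightarrow> real"
    and \<nu> :: "real \<Rightarrow> 'z measure"
  assumes P_meas: "\<And>u y y'. u \<in> {0..1} \<Longrightarrow> P u y y' \<in> borel_measurable borel"
    and P_stoch: "\<And>u y z. u \<in> {0..1} \<Longrightarrow> (\<Sum>y'\<in>UNIV. P u y y' z) = 1"
    and f_meas: "(\<lambda>(u, z, z'). f u z z') \<in>
          borel_measurable (restrict_space borel {0..1} \<Otimes>\<^sub>M (borel \<Otimes>\<^sub>M borel))"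
    and f_nonneg: "\<And>u z z'. u \<in> {0..1} \<Longrightarrow> f u z z' \<ge> 0"
    and \<gamma>_kernel: "nonneg_kernel borel borel \<gamma>"
    and Qb_eq: "Qb = density_kernel f \<gamma>"
    and Qb_markov: "\<And>u. u \<in> {0..1} \<Longrightarrow> Qb u \<in> measurable borel (prob_algebra borel)"
    and Q_eq: "Q = joint_kernel P Qb"
    and k: "k \<ge> 1"
    and P_Ck: "\<And>y1 y2 z2. Ck01 k (\<lambda>u. P u y1 y2 z2)"
    and P_pos: "\<And>u y1 y2 z2. u \<in> {0..1} \<Longrightarrow> P u y1 y2 z2 > 0"
    and \<phi>_meas: "\<phi> \<in> borel_measurable borel"
    and \<phi>_ge1: "\<And>z. \<phi> z \<ge> 1"
    and m: "m \<ge> 1" and d0: "d0 \<ge> 1" and \<epsilon>: "\<epsilon> > 0" and K: "K > 0" and b: "b > 0"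
    and \<rho>: "0 < \<rho>" "\<rho> < 1"
    and \<eta>: "\<And>r. r > 0 \<Longrightarrow> \<eta> r > 0"
    and \<nu>: "\<And>r. r > 0 \<Longrightarrow> \<nu> r \<in> space (prob_algebra borel)"
    and drift: "\<And>us z. length us = m \<Longrightarrow> set us \<subseteq> {0..1} \<Longrightarrow>
          (\<forall>u\<in>set us. \<forall>v\<in>set us. \<bar>u - v\<bar> < \<epsilon>) \<Longrightarrow>
          (\<integral>\<^sup>+ z'. ennreal (\<phi> z' powr d0) \<partial>kernel_prod borel Qb us z)
            \<le> ennreal (\<rho> * \<phi> z powr d0 + b)"
    and minor: "\<And>r us z A. r > 0 \<Longrightarrow> length us = m \<Longrightarrow> set us \<subseteq> {0..1} \<Longrightarrow>
          (\<forall>u\<in>set us. \<forall>v\<in>set us. \<bar>u - v\<bar> < \<epsilon>) \<Longrightarrow>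
          \<phi> z powr d0 \<le> r \<Longrightarrow> A \<in> sets borel \<Longrightarrow>
          measure (kernel_prod borel Qb us z) A \<ge> \<eta> r * measure (\<nu> r) A"
    and growth: "\<And>u z. u \<in> {0..1} \<Longrightarrow>
          (\<integral>\<^sup>+ z'. ennreal (\<phi> z' powr d0) \<partial>Qb u z) \<le> ennreal (K * \<phi> z powr d0)"
    and f_Ck: "\<And>z z'. Ck01 k (\<lambda>u. f u z z')"
    and d1: "d1 > 0" and q: "q \<ge> 0" and Cb: "Cb > 0" and dk: "d1 + real k * q \<le> d0"
    and f_bound: "\<And>l d u z. 1 \<le> l \<Longrightarrow> l \<le> k \<Longrightarrow>
          0 \<le> d \<Longrightarrow> d \<le> d1 + real (k - l) * q \<Longrightarrow> u \<in> {0..1} \<Longrightarrow>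
          (\<integral>\<^sup>+ z'. ennreal (\<phi> z' powr d * \<bar>nth_deriv01 l (\<lambda>v. f v z z') u\<bar>) \<partial>\<gamma> z)
            \<le> ennreal (Cb * \<phi> z powr (d + q * real l))"
    and f_cont: "\<And>s u z. s \<le> k \<Longrightarrow> u \<in> {0..1} \<Longrightarrow>
          ((\<lambda>h. \<integral>\<^sup>+ z'. ennreal (\<phi> z' powr (d1 + q * real s) *
                \<bar>nth_deriv01 (k - s) (\<lambda>v. f v z z') (u + h)
                  - nth_deriv01 (k - s) (\<lambda>v. f v z z') u\<bar>) \<partial>\<gamma> z) \<longlongrightarrow> 0)
            (at 0 within {h. u + h \<in> {0..1}})"
    and C: "C > 0"
    and P_bound: "\<And>l u y y' z. l \<le> k \<Longrightarrow> u \<in> {0..1} \<Longrightarrow>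
             \<bar>nth_deriv01 l (\<lambda>v. P v y y' z) u\<bar> \<le> C * \<phi> z powr (q * real l)"
begin

abbreviation SS :: "('y \<times> 'z) measure" where "SS \<equiv> state_space"

definition V :: "nat \<Rightarrow> 'y \<times> 'z \<Rightarrow> real" where "V s = (\<lambda>(y, z). \<phi> z powr (d1 + real s * q))"

lemma V_meas [measurable]: "V s \<in> borel_measurable SS"
  unfolding V_def using \<phi>_meas by measurable

lemma \<phi>_powr_ge1: "d \<ge> 0 \<Longrightarrow> 1 \<le> \<phi> z powr d"
  using \<phi>_ge1 by (simp add: ge_one_powr_ge_zero)

lemma V_ge1: "1 \<le> V s x"
  using d1 q by (auto simp: V_def split: prod.split intro!: \<phi>_powr_ge1)

lemma V_mono: "s \<le> t \<Longrightarrow> V s x \<le> V t x"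
  using q \<phi>_ge1 by (auto simp: V_def split: prod.split intro!: powr_mono mult_right_mono)

lemma mono_weights_V: "mono_weights SS V"
  using V_meas V_ge1 V_mono by (auto simp: mono_weights_def)

lemma sets_\<gamma>: "sets (\<gamma> z) = sets borel"
  using \<gamma>_kernel by (auto simp: nonneg_kernel_def)

lemma f_meas1: "u \<in> {0..1} \<Longrightarrow> (\<lambda>z'. f u z z') \<in> borel_measurable borel"
proof -
  assume u: "u \<in> {0..1}"
  have "(\<lambda>z'. (u, z, z')) \<in> borel \<rightarrow>\<^sub>M restrict_space borel {0..1} \<Otimes>\<^sub>M (borel \<Otimes>\<^sub>M borel)"
    using u by (intro measurable_Pair measurable_const) (auto simp: space_restrict_space)
  from measurable_compose[OF this f_meas] show ?thesis by simp
qed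

lemma nn_integral_Qb:
  assumes "u \<in> {0..1}" "h \<in> borel_measurable borel"
  shows "(\<integral>\<^sup>+z'. h z' \<partial>Qb u z) = (\<integral>\<^sup>+z'. ennreal (f u z z') * h z' \<partial>\<gamma> z)"
  unfolding Qb_eq density_kernel_def using assms f_meas1[OF assms(1)]
  by (intro nn_integral_density) (auto simp: measurable_cong_sets[OF sets_\<gamma> refl])

lemma integral_Qb:
  assumes u: "u \<in> {0..1}" and h: "h \<in> borel_measurable borel"
  shows "(\<integral>z'. h z' \<partial>Qb u z) = (\<integral>z'. f u z z' * h z' \<partial>\<gamma> z)"
  unfolding Qb_eq density_kernel_def using h f_meas1[OF u] f_nonneg[OF u]
  by (subst integral_density) (auto simp: measurable_cong_sets[OF sets_\<gamma> refl])

lemma P_SS: "u \<in> {0..1} \<Longrightarrow> (\<lambda>x. P u y1 (fst x) (snd x)) \<in> borel_measurable SS"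
  by (rule SS_measurableI) (use P_meas in simp)

lemma Qb_prob: "u \<in> {0..1} \<Longrightarrow> prob_space (Qb u z)" "u \<in> {0..1} \<Longrightarrow> sets (Qb u z) = sets borel"
  using kernelD[OF Qb_markov] by auto

lemma nn_integral_Q:
  assumes u: "u \<in> {0..1}" and h: "h \<in> borel_measurable SS"
  shows "(\<integral>\<^sup>+x. h x \<partial>Q u (y, z)) = (\<Sum>y'\<in>UNIV. \<integral>\<^sup>+z'. ennreal (P u y y' z') * h (y', z') \<partial>Qb u z)"
proof -
  have cs: "sets (count_space UNIV \<Otimes>\<^sub>M Qb u z) = sets SS"
    by (rule sets_pair_measure_cong) (use Qb_prob(2)[OF u] in auto)
  have m: "(\<lambda>x. ennreal (P u y (fst x) (snd x))) \<in> borel_measurable SS" using P_SS[OF u] by measurable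
  have "(\<integral>\<^sup>+x. h x \<partial>Q u (y, z)) = (\<integral>\<^sup>+x. ennreal (P u y (fst x) (snd x)) * h x \<partial>(count_space UNIV \<Otimes>\<^sub>M Qb u z))"
    unfolding Q_eq joint_kernel_def using m h
    by (simp add: case_prod_unfold) (intro nn_integral_density, simp_all add: measurable_cong_sets[OF cs refl])
  also have "\<dots> = (\<Sum>y'\<in>UNIV. \<integral>\<^sup>+z'. ennreal (P u y y' z') * h (y', z') \<partial>Qb u z)"
    using m h by (subst nn_integral_SS[OF prob_space_imp_sigma_finite[OF Qb_prob(1)[OF u]] Qb_prob(2)[OF u]]) auto
  finally show ?thesis .
qed

text \<open>The second coordinate is a Markov chain by itself, because the rows of \<open>P\<close>
  sum to 1. Moment bounds on the product space thereby reduce to those for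
  \<open>Qb\<close>.\<close>

lemma nn_integral_Q_snd:
  assumes u: "u \<in> {0..1}" and h: "h \<in> borel_measurable borel"
  shows "(\<integral>\<^sup>+x. h (snd x) \<partial>Q u (y, z)) = (\<integral>\<^sup>+z'. h z' \<partial>Qb u z)"
proof -
  have [measurable]: "P u y y' \<in> borel_measurable (Qb u z)" "h \<in> borel_measurable (Qb u z)" for y'
    using P_meas[OF u] h by (simp_all add: measurable_cong_sets[OF Qb_prob(2)[OF u] refl])
  have "(\<integral>\<^sup>+x. h (snd x) \<partial>Q u (y, z)) = (\<Sum>y'\<in>UNIV. \<integral>\<^sup>+z'. ennreal (P u y y' z') * h z' \<partial>Qb u z)"
    using h by (subst nn_integral_Q[OF u]) auto
  also have "\<dots> = (\<integral>\<^sup>+z'. (\<Sum>y'\<in>UNIV. ennreal (P u y y' z') * h z') \<partial>Qb u z)"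
    by (rule nn_integral_sum[symmetric]) measurable
  also have "\<dots> = (\<integral>\<^sup>+z'. h z' \<partial>Qb u z)"
    using P_pos[OF u] P_stoch[OF u]
    by (intro nn_integral_cong) (simp add: sum_distrib_right[symmetric] less_imp_le)
  finally show ?thesis .
qed

lemma Q_markov: "u \<in> {0..1} \<Longrightarrow> Q u \<in> SS \<rightarrow>\<^sub>M prob_algebra SS"
proof (rule measurable_prob_algebraI)
  assume u: "u \<in> {0..1}"
  have sets_Q: "sets (Q u x) = sets SS" for x
    unfolding Q_eq joint_kernel_def using Qb_prob(2)[OF u]
    by (cases x) (auto intro!: sets_pair_measure_cong)
  show pr: "prob_space (Q u x)" for x
  proof (rule prob_spaceI)
    obtain y z where x: "x = (y, z)" by (cases x)
    interpret prob_space "Qb u z" by (rule Qb_prob[OF u])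
    have "(\<integral>\<^sup>+x. 1 \<partial>Q u (y, z)) = (\<integral>\<^sup>+z'. 1 \<partial>Qb u z)" by (rule nn_integral_Q_snd[OF u]) simp
    then show "emeasure (Q u x) (space (Q u x)) = 1" by (simp add: x emeasure_space_1)
  qed
  show "Q u \<in> SS \<rightarrow>\<^sub>M subprob_algebra SS"
  proof (rule measurable_subprob_algebra)
    show "subprob_space (Q u x)" for x by (rule prob_space_imp_subprob_space[OF pr])
    show "sets (Q u x) = sets SS" for x by (rule sets_Q)
    fix A assume A: "A \<in> sets SS"
    have ind: "(\<lambda>z'. indicator A (y', z') :: ennreal) \<in> borel_measurable borel" for y'
      using A by (intro SS_measurableD) simp
    have "emeasure (Q u (y, z)) A = (\<Sum>y'\<in>UNIV. \<integral>\<^sup>+z'. ennreal (P u y y' z') * indicator A (y', z') \<partial>Qb u z)" for y z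
      using A by (subst nn_integral_Q[OF u, symmetric]) (auto simp: sets_Q)
    moreover have "(\<lambda>z. \<integral>\<^sup>+z'. ennreal (P u y y' z') * indicator A (y', z') \<partial>Qb u z) \<in> borel_measurable borel" for y y'
      by (intro measurable_compose[OF measurable_prob_algebraD[OF Qb_markov[OF u]] nn_integral_measurable_subprob_algebra]
           borel_measurable_times_ennreal measurable_compose[OF P_meas[OF u] measurable_ennreal] ind)
    ultimately show "(\<lambda>x. emeasure (Q u x) A) \<in> borel_measurable SS"
      by (intro SS_measurableI) simp
  qed
qed

lemma kernel_prod_Q: "set us \<subseteq> {0..1} \<Longrightarrow> kernel_prod SS Q us \<in> SS \<rightarrow>\<^sub>M prob_algebra SS"
  by (intro measurable_kernel_prod Q_markov) auto

lemma kernel_prod_Qb: "set us \<subseteq> {0..1} \<Longrightarrow> kernel_prod borel Qb us \<in> borel \<rightarrow>\<^sub>M prob_algebra borel"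
  by (intro measurable_kernel_prod Qb_markov) auto

lemma nn_integral_kernel_prod_Cons:
  assumes "u \<in> {0..1}" "set us \<subseteq> {0..1}" "h \<in> borel_measurable SS"
  shows "(\<integral>\<^sup>+x. h x \<partial>kernel_prod SS Q (u # us) x0) = (\<integral>\<^sup>+x. \<integral>\<^sup>+x'. h x' \<partial>kernel_prod SS Q us x \<partial>Q u x0)"
  using nn_integral_bind_prob[OF kernelD(4)[OF Q_markov[OF assms(1)]] kernel_prod_Q[OF assms(2)] assms(3), of x0] by simp

lemma nn_integral_kernel_prod_Qb_Cons:
  assumes "u \<in> {0..1}" "set us \<subseteq> {0..1}" "h \<in> borel_measurable borel"
  shows "(\<integral>\<^sup>+x. h x \<partial>kernel_prod borel Qb (u # us) x0) = (\<integral>\<^sup>+x. \<integral>\<^sup>+x'. h x' \<partial>kernel_prod borel Qb us x \<partial>Qb u x0)"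
  using nn_integral_bind_prob[OF kernelD(4)[OF Qb_markov[OF assms(1)]] kernel_prod_Qb[OF assms(2)] assms(3), of x0] by simp

lemma kernel_prod_Qb_meas:
  assumes "set us \<subseteq> {0..1}" "h \<in> borel_measurable borel"
  shows "(\<lambda>z. \<integral>\<^sup>+z'. h z' \<partial>kernel_prod borel Qb us z) \<in> borel_measurable borel"
  by (rule measurable_compose[OF measurable_prob_algebraD[OF kernel_prod_Qb[OF assms(1)]] nn_integral_measurable_subprob_algebra[OF assms(2)]])

lemma nn_integral_kernel_prod_snd:
  assumes "set us \<subseteq> {0..1}" and h: "h \<in> borel_measurable borel"
  shows "(\<integral>\<^sup>+x. h (snd x) \<partial>kernel_prod SS Q us (y, z)) = (\<integral>\<^sup>+z'. h z' \<partial>kernel_prod borel Qb us z)"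
  using assms(1)
proof (induction us arbitrary: y z)
  case Nil
  then show ?case using h by (simp add: nn_integral_return)
next
  case (Cons u us)
  then have us: "u \<in> {0..1}" "set us \<subseteq> {0..1}" by auto
  have hs: "(\<lambda>x. h (snd x)) \<in> borel_measurable SS" using h by measurable
  have "(\<integral>\<^sup>+x. h (snd x) \<partial>kernel_prod SS Q (u # us) (y, z)) =
      (\<integral>\<^sup>+x. \<integral>\<^sup>+x'. h (snd x') \<partial>kernel_prod SS Q us x \<partial>Q u (y, z))"
    by (rule nn_integral_kernel_prod_Cons[OF us hs])
  also have "\<dots> = (\<integral>\<^sup>+x. (\<integral>\<^sup>+z'. h z' \<partial>kernel_prod borel Qb us (snd x)) \<partial>Q u (y, z))"
    using Cons.IH[OF us(2)] by (intro nn_integral_cong) (auto simp: split_paired_all)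
  also have "\<dots> = (\<integral>\<^sup>+z1. (\<integral>\<^sup>+z'. h z' \<partial>kernel_prod borel Qb us z1) \<partial>Qb u z)"
    by (rule nn_integral_Q_snd[OF us(1) kernel_prod_Qb_meas[OF us(2) h]])
  also have "\<dots> = (\<integral>\<^sup>+z'. h z' \<partial>kernel_prod borel Qb (u # us) z)"
    by (rule nn_integral_kernel_prod_Qb_Cons[OF us h, symmetric])
  finally show ?case .
qed

text \<open>Rational parameters keep the infimum measurable; by continuity it bounds \<open>P u\<close> for all \<open>u\<close>.\<close>

definition pmin :: "'y \<Rightarrow> 'z \<Rightarrow> real" where
  "pmin y' z = (INF (u, y) \<in> ({0..1} \<inter> \<rat>) \<times> UNIV. P u y y' z)"

lemma P_cont: "continuous_on {0..1} (\<lambda>u. P u y y' z)"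
  using P_Ck[of y y' z] by (auto simp: Ck01_def dest!: spec[of _ 0])

lemma pmin_meas [measurable]: "pmin y' \<in> borel_measurable borel"
  unfolding pmin_def[abs_def]
proof (rule borel_measurable_cINF_real)
  show "countable (({0..1::real} \<inter> \<rat>) \<times> (UNIV :: 'y set))"
    by (intro countable_SIGMA countable_Int2 countable_rat) (auto intro: countable_finite)
qed (use P_meas in auto)

lemma pmin_bdd: "bdd_below ((\<lambda>(u, y). P u y y' z) ` (({0..1} \<inter> \<rat>) \<times> UNIV))"
  using P_pos by (intro bdd_belowI[of _ 0]) (auto intro: less_imp_le)

lemma pmin_le: assumes u: "u \<in> {0..1}" shows "pmin y' z \<le> P u y y' z"
proof -
  \<comment> \<open>Rounding down gives rational approximations that cannot leave [0,1].\<close>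
  define v where "v n = real_of_int \<lfloor>real (Suc n) * u\<rfloor> / real (Suc n)" for n
  have v: "v n \<in> {0..1} \<inter> \<rat>" for n
  proof -
    have "real_of_int \<lfloor>real (Suc n) * u\<rfloor> \<le> real (Suc n) * 1"
      using u by (intro order_trans[OF of_int_floor_le] mult_left_mono) auto
    then show ?thesis using u by (auto simp: v_def divide_le_eq)
  qed
  have "(\<lambda>n. P (v n) y y' z) \<longlonglongrightarrow> P u y y' z"
  proof (rule continuous_on_tendsto_compose[OF P_cont _ u])
    show "v \<longlonglongrightarrow> u"
    proof (rule tendsto_sandwich[of "\<lambda>n. u - inverse (real (Suc n))" _ _ "\<lambda>n. u"])
      have "u - inverse (real (Suc n)) \<le> v n \<and> v n \<le> u" for n
      proof -
        have gen: "u - inverse N \<le> F / N \<and> F / N \<le> u" if "N > 0" "N * u - 1 \<le> F" "F \<le> N * u" for N F :: real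
          using that(1) divide_right_mono[OF that(2), of N] divide_right_mono[OF that(3), of N]
          by (simp add: diff_divide_distrib inverse_eq_divide)
        have "real (Suc n) * u - 1 \<le> real_of_int \<lfloor>real (Suc n) * u\<rfloor>" "real_of_int \<lfloor>real (Suc n) * u\<rfloor> \<le> real (Suc n) * u"
          by linarith+
        then show ?thesis unfolding v_def by (intro gen) auto
      qed
      then show "\<forall>\<^sub>F n in sequentially. u - inverse (real (Suc n)) \<le> v n" "\<forall>\<^sub>F n in sequentially. v n \<le> u"
        by auto
      show "(\<lambda>n. u - inverse (real (Suc n))) \<longlonglongrightarrow> u"
        using tendsto_diff[OF tendsto_const LIMSEQ_inverse_real_of_nat, of u] by simp
    qed simp
  qed (use v in auto)
  moreover have "pmin y' z \<le> P (v n) y y' z" for n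
    unfolding pmin_def using cINF_lower[OF pmin_bdd, of "(v n, y)" y' z] v by simp
  ultimately show ?thesis by (intro LIMSEQ_le_const) auto
qed

text \<open>Positivity survives the infimum by compactness of [0,1] and finiteness of the first
  factor. The lower bound still depends on \<open>z\<close>, which is why the minorizing measure
  carries \<open>pmin\<close> as a density.\<close>

lemma pmin_pos: "pmin y' z > 0"
proof -
  have "\<exists>c>0. \<forall>u\<in>{0..1}. c \<le> P u y y' z" for y
  proof -
    obtain u0 where "u0 \<in> {0..1}" "\<forall>u\<in>{0..1}. P u0 y y' z \<le> P u y y' z"
      using continuous_attains_inf[OF _ _ P_cont, of y y' z] by auto
    then show ?thesis using P_pos by (intro exI[of _ "P u0 y y' z"]) auto
  qed
  then obtain c where c: "\<And>y. c y > 0" "\<And>y u. u \<in> {0..1} \<Longrightarrow> c y \<le> P u y y' z" by metis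
  have "0 < Min (range c)" using c(1) by (subst Min_gr_iff) auto
  also have "Min (range c) \<le> pmin y' z"
    unfolding pmin_def
  proof (rule cINF_greatest)
    show "({0..1::real} \<inter> \<rat>) \<times> (UNIV :: 'y set) \<noteq> {}" 
    proof -
      have "(0, undefined) \<in> ({0..1::real} \<inter> \<rat>) \<times> (UNIV :: 'y set)" by simp
      then show ?thesis by blast
    qed
    fix x assume "x \<in> ({0..1::real} \<inter> \<rat>) \<times> (UNIV :: 'y set)"
    then show "Min (range c) \<le> (case x of (u, y) \<Rightarrow> P u y y' z)"
      by (cases x) (auto intro!: order_trans[OF Min_le[of "range c" "c (snd x)"]] c(2))
  qed
  finally show ?thesis .
qed

text \<open>Only the last transition of the first coordinate is bounded below; the earlier ones are
  integrated out and leave a product of \<open>Qb\<close> alone.\<close>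

lemma kernel_prod_ge_pmin:
  assumes "us \<noteq> []" "set us \<subseteq> {0..1}" and h: "h \<in> borel_measurable SS"
  shows "(\<integral>\<^sup>+z'. (\<Sum>y'\<in>UNIV. ennreal (pmin y' z') * h (y', z')) \<partial>kernel_prod borel Qb us z)
     \<le> (\<integral>\<^sup>+x. h x \<partial>kernel_prod SS Q us (y, z))"
  using assms(1,2)
proof (induction us arbitrary: y z)
  case (Cons u us)
  then have us: "u \<in> {0..1}" "set us \<subseteq> {0..1}" by auto
  have hm [measurable]: "(\<lambda>z. h (y, z)) \<in> borel_measurable borel" for y by (rule SS_measurableD[OF h])
  let ?H = "\<lambda>z'. \<Sum>y'\<in>UNIV. ennreal (pmin y' z') * h (y', z')"
  have Hm: "?H \<in> borel_measurable borel" by measurable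
  show ?case
  proof (cases "us = []")
    case True
    have b1: "kernel_prod borel Qb [u] z = Qb u z" "kernel_prod SS Q [u] (y, z) = Q u (y, z)"
      using Qb_prob(2)[OF us(1), of z] kernelD(2)[OF Q_markov[OF us(1)], of "(y, z)"]
      by (auto simp: bind_return'')
    have "(\<integral>\<^sup>+z'. ?H z' \<partial>Qb u z) = (\<Sum>y'\<in>UNIV. \<integral>\<^sup>+z'. ennreal (pmin y' z') * h (y', z') \<partial>Qb u z)"
      by (rule nn_integral_sum) (use Qb_prob(2)[OF us(1)] in \<open>simp cong: measurable_cong_sets\<close>)
    also have "\<dots> \<le> (\<Sum>y'\<in>UNIV. \<integral>\<^sup>+z'. ennreal (P u y y' z') * h (y', z') \<partial>Qb u z)"
      by (intro sum_mono nn_integral_mono mult_right_mono ennreal_leI pmin_le us) auto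
    also have "\<dots> = (\<integral>\<^sup>+x. h x \<partial>Q u (y, z))" by (rule nn_integral_Q[OF us(1) h, symmetric])
    finally show ?thesis unfolding True b1 .
  next
    case False
    have "(\<integral>\<^sup>+z'. ?H z' \<partial>kernel_prod borel Qb (u # us) z) = (\<integral>\<^sup>+z1. \<integral>\<^sup>+z'. ?H z' \<partial>kernel_prod borel Qb us z1 \<partial>Qb u z)"
      by (rule nn_integral_kernel_prod_Qb_Cons[OF us Hm])
    also have "\<dots> = (\<integral>\<^sup>+x. (\<integral>\<^sup>+z'. ?H z' \<partial>kernel_prod borel Qb us (snd x)) \<partial>Q u (y, z))"
      by (rule nn_integral_Q_snd[OF us(1) kernel_prod_Qb_meas[OF us(2) Hm], symmetric])
    also have "\<dots> \<le> (\<integral>\<^sup>+x. \<integral>\<^sup>+x'. h x' \<partial>kernel_prod SS Q us x \<partial>Q u (y, z))"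
      using Cons.IH[OF False us(2)] by (intro nn_integral_mono) (auto simp: split_paired_all)
    also have "\<dots> = (\<integral>\<^sup>+x. h x \<partial>kernel_prod SS Q (u # us) (y, z))"
      by (rule nn_integral_kernel_prod_Cons[OF us h, symmetric])
    finally show ?thesis .
  qed
qed simp

text \<open>The measure is a multiple of \<open>pmin y' z'\<close> times counting measure times
  \<open>\<nu> r\<close>. It is kept as a subprobability of mass \<open>a\<close>, the form that
  \<open>oscillation_bound\<close> takes.\<close>

lemma minorization:
  assumes r: "r > 0"
  obtains N a where "sets N = sets SS" "measure N (space SS) = a" "0 < a" "a < 1"
    "\<And>us y z h. length us = m \<Longrightarrow> set us \<subseteq> {0..1} \<Longrightarrow> (\<forall>u\<in>set us. \<forall>v\<in>set us. \<bar>u - v\<bar> < \<epsilon>) \<Longrightarrow>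
        \<phi> z powr d0 \<le> r \<Longrightarrow> h \<in> borel_measurable SS \<Longrightarrow> (\<integral>\<^sup>+x. h x \<partial>N) \<le> (\<integral>\<^sup>+x. h x \<partial>kernel_prod SS Q us (y, z))"
proof -
  \<comment> \<open>Capping at 1 and halving keep the mass \<open>a\<close> below 1, so that
    \<open>1 - a\<close> can be divided out in the coupling estimate.\<close>
  define e where "e = min (\<eta> r) 1 / 2"
  have e: "0 < e" "e \<le> \<eta> r" "e < 1" using \<eta>[OF r] by (auto simp: e_def)
  have \<nu>': "prob_space (\<nu> r)" "sets (\<nu> r) = sets borel" using \<nu>[OF r] by (auto simp: space_prob_algebra)
  interpret \<nu>: prob_space "\<nu> r" by fact
  define N where "N = density (count_space UNIV \<Otimes>\<^sub>M \<nu> r) (\<lambda>x. ennreal (e * pmin (fst x) (snd x)))"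
  have cs: "sets (count_space UNIV \<Otimes>\<^sub>M \<nu> r) = sets SS"
    by (rule sets_pair_measure_cong) (use \<nu>' in auto)
  have pm: "(\<lambda>x. ennreal (e * pmin (fst x) (snd x))) \<in> borel_measurable SS"
    by (rule SS_measurableI) simp
  have setsN: "sets N = sets SS" by (simp add: N_def cs)
  have intN: "(\<integral>\<^sup>+x. h x \<partial>N) = ennreal e * (\<integral>\<^sup>+z'. (\<Sum>y'\<in>UNIV. ennreal (pmin y' z') * h (y', z')) \<partial>\<nu> r)"
    if h: "h \<in> borel_measurable SS" for h
  proof -
    have [measurable]: "(\<lambda>z. h (y, z)) \<in> borel_measurable (\<nu> r)" "pmin y \<in> borel_measurable (\<nu> r)" for y
      using SS_measurableD[OF h] by (simp_all add: measurable_cong_sets[OF \<nu>'(2) refl])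
    have "(\<integral>\<^sup>+x. h x \<partial>N) = (\<integral>\<^sup>+x. ennreal (e * pmin (fst x) (snd x)) * h x \<partial>(count_space UNIV \<Otimes>\<^sub>M \<nu> r))"
      unfolding N_def using pm h by (intro nn_integral_density) (simp_all add: measurable_cong_sets[OF cs refl])
    also have "\<dots> = (\<Sum>y'\<in>UNIV. \<integral>\<^sup>+z'. ennreal (e * pmin y' z') * h (y', z') \<partial>\<nu> r)"
      using pm h by (subst nn_integral_SS[OF prob_space_imp_sigma_finite[OF \<nu>'(1)] \<nu>'(2)]) auto
    also have "\<dots> = (\<Sum>y'\<in>UNIV. ennreal e * (\<integral>\<^sup>+z'. ennreal (pmin y' z') * h (y', z') \<partial>\<nu> r))"
      using e pmin_pos by (intro sum.cong refl) (subst nn_integral_cmult[symmetric], auto simp: ennreal_mult less_imp_le mult.assoc)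
    also have "\<dots> = ennreal e * (\<integral>\<^sup>+z'. (\<Sum>y'\<in>UNIV. ennreal (pmin y' z') * h (y', z')) \<partial>\<nu> r)"
      by (subst nn_integral_sum) (auto simp: sum_distrib_left)
    finally show ?thesis .
  qed
  \<comment> \<open>The total mass of the density over the first coordinate; it is at most a row sum
    of \<open>P 0\<close>, hence at most 1.\<close>
  define s where "s z' = (\<Sum>y'\<in>UNIV. pmin y' z')" for z'
  have s: "0 < s z'" "s z' \<le> 1" for z'
  proof -
    show "0 < s z'" unfolding s_def using pmin_pos by (intro sum_pos) auto
    have "s z' \<le> (\<Sum>y'\<in>UNIV. P 0 undefined y' z')" unfolding s_def by (intro sum_mono pmin_le) simp
    then show "s z' \<le> 1" using P_stoch[of 0] by simp
  qed
  have sm: "s \<in> borel_measurable (\<nu> r)" unfolding s_def measurable_cong_sets[OF \<nu>'(2) refl] by measurable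
  have si: "integrable (\<nu> r) s" using s sm by (intro \<nu>.integrable_const_bound[of _ 1]) (auto simp: less_imp_le)
  have mass: "emeasure N (space SS) = ennreal (e * (\<integral>z. s z \<partial>\<nu> r))"
  proof -
    have "emeasure N (space SS) = (\<integral>\<^sup>+x. 1 \<partial>N)" using setsN by (auto dest: sets_eq_imp_space_eq)
    also have "\<dots> = ennreal e * (\<integral>\<^sup>+z. ennreal (s z) \<partial>\<nu> r)"
      using pmin_pos by (subst intN) (auto simp: s_def less_imp_le)
    also have "\<dots> = ennreal e * ennreal (\<integral>z. s z \<partial>\<nu> r)"
      using s by (subst nn_integral_eq_integral[OF si]) (auto simp: less_imp_le)
    also have "\<dots> = ennreal (e * (\<integral>z. s z \<partial>\<nu> r))" using e by (subst ennreal_mult) (auto simp: less_imp_le integral_nonneg_AE s)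
    finally show ?thesis .
  qed
  have I: "0 < (\<integral>z. s z \<partial>\<nu> r)" "(\<integral>z. s z \<partial>\<nu> r) \<le> 1"
  proof -
    show "(\<integral>z. s z \<partial>\<nu> r) \<le> 1"
      using \<nu>.integral_le_const[OF si, of 1] s by auto
    show "0 < (\<integral>z. s z \<partial>\<nu> r)"
      using \<nu>.integral_less_AE_space[of "\<lambda>_. 0" s] s si \<nu>.emeasure_space_1 by simp
  qed
  show ?thesis
  proof (rule that[OF setsN refl])
    have a: "measure N (space SS) = e * (\<integral>z. s z \<partial>\<nu> r)"
      unfolding measure_def mass using e I by (intro enn2real_ennreal) auto
    show "0 < measure N (space SS)" unfolding a using e I by simp
    have "e * (\<integral>z. s z \<partial>\<nu> r) \<le> e * 1" using e I by (intro mult_left_mono) auto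
    also have "\<dots> < 1" using e by simp
    finally show "measure N (space SS) < 1" unfolding a .
    fix us and y :: 'y and z and h :: "'y \<times> 'z \<Rightarrow> ennreal" assume us: "length us = m" "set us \<subseteq> {0..1}" "\<forall>u\<in>set us. \<forall>v\<in>set us. \<bar>u - v\<bar> < \<epsilon>"
      and z: "\<phi> z powr d0 \<le> r" and h: "h \<in> borel_measurable SS"
    let ?kp = "kernel_prod borel Qb us z"
    let ?H = "\<lambda>z'. \<Sum>y'\<in>UNIV. ennreal (pmin y' z') * h (y', z')"
    have hm [measurable]: "(\<lambda>z. h (y, z)) \<in> borel_measurable borel" for y by (rule SS_measurableD[OF h])
    have Hm: "?H \<in> borel_measurable borel" by measurable
    note kp = kernelD[OF kernel_prod_Qb[OF us(2)], of z, simplified]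
    interpret kp: prob_space ?kp by (rule kp(1))
    have "(\<integral>\<^sup>+z'. ?H z' \<partial>scale_measure (ennreal e) (\<nu> r)) \<le> (\<integral>\<^sup>+z'. ?H z' \<partial>?kp)"
    proof (rule nn_integral_mono_measure)
      show "sets (scale_measure (ennreal e) (\<nu> r)) = sets ?kp" using kp(2) \<nu>' by simp
      have "emeasure (scale_measure (ennreal e) (\<nu> r)) A \<le> emeasure ?kp A" for A
      proof (cases "A \<in> sets borel")
        case True
        have "e * measure (\<nu> r) A \<le> measure ?kp A"
          using minor[OF r us z True] e by (intro order_trans[OF mult_right_mono[of e "\<eta> r"]]) auto
        then show ?thesis using e
          by (simp add: kp.emeasure_eq_measure \<nu>.emeasure_eq_measure ennreal_mult[symmetric] ennreal_leI)
      next
        case False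
        then show ?thesis using \<nu>' by (simp add: emeasure_notin_sets)
      qed
      then show "scale_measure (ennreal e) (\<nu> r) \<le> ?kp"
        using kp(2) \<nu>' by (subst le_measure) (auto simp: le_fun_def)
    qed
    then have "(\<integral>\<^sup>+x. h x \<partial>N) \<le> (\<integral>\<^sup>+z'. ?H z' \<partial>?kp)"
      using Hm by (simp add: intN[OF h] nn_integral_scale_measure measurable_cong_sets[OF \<nu>'(2) refl])
    also have "\<dots> \<le> (\<integral>\<^sup>+x. h x \<partial>kernel_prod SS Q us (y, z))"
      using m us by (intro kernel_prod_ge_pmin h) auto
    finally show "(\<integral>\<^sup>+x. h x \<partial>N) \<le> (\<integral>\<^sup>+x. h x \<partial>kernel_prod SS Q us (y, z))" .
  qed
qed

end

section \<open>Uniform contraction\<close>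

lemma regop_cong:
  assumes B: "regop M w N w' c B" and eq: "\<And>g x. g \<in> wspace M w \<Longrightarrow> x \<in> space N \<Longrightarrow> A g x = B g x"
  shows "regop M w N w' c A"
  unfolding regop_def
proof safe
  fix g assume g: "g \<in> wball M w"
  show "A g \<in> wball N (\<lambda>x. c * w' x)"
  proof (rule wballI)
    show "A g \<in> borel_measurable N"
      using wball_meas[OF regopD(1)[OF B g]] eq[OF wball_wspace[OF g]] by (simp cong: measurable_cong)
    show "\<bar>A g x\<bar> \<le> c * w' x" if "x \<in> space N" for x
      using wball_bound[OF regopD(1)[OF B g] that] eq[OF wball_wspace[OF g] that] by simp
  qed
next
  fix x assume x: "x \<in> space N"
  note rB = regopD(2)[OF B x]
  show "regfun M w (\<lambda>g. A g x)"
  proof (rule regfunI)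
    show "A (\<lambda>y. a * g y + b * h y) x = a * A g x + b * A h x" if "g \<in> wspace M w" "h \<in> wspace M w" for g h a b
      using regfun_lin[OF rB that] eq[OF _ x] that wspace_lin[OF that] by simp
    show "(\<lambda>n. A (gs n) x) \<longlonglongrightarrow> A g x" if "\<And>n. gs n \<in> wball M w" "g \<in> wball M w"
      "\<And>x. x \<in> space M \<Longrightarrow> (\<lambda>n. gs n x) \<longlonglongrightarrow> g x" for gs g
      using regfun_tendsto[OF rB, of 1 gs g] that eq[OF wball_wspace x] by simp
  qed
qed

lemma nn_integral_affine_le:
  assumes h: "h \<in> borel_measurable N" and N: "prob_space N" and A: "(\<integral>\<^sup>+x. ennreal (h x) \<partial>N) \<le> ennreal A"
    and pos: "0 \<le> a" "0 \<le> c" "0 \<le> A" "\<And>x. x \<in> space N \<Longrightarrow> 0 \<le> h x"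
  shows "(\<integral>\<^sup>+x. ennreal (a * h x + c) \<partial>N) \<le> ennreal (a * A + c)"
proof -
  interpret prob_space N by fact
  note [measurable] = h
  have "(\<integral>\<^sup>+x. ennreal (a * h x + c) \<partial>N) = (\<integral>\<^sup>+x. ennreal a * ennreal (h x) + ennreal c \<partial>N)"
    using pos by (intro nn_integral_cong) (simp add: ennreal_mult)
  also have "\<dots> = ennreal a * (\<integral>\<^sup>+x. ennreal (h x) \<partial>N) + ennreal c"
    by (simp add: nn_integral_add nn_integral_cmult emeasure_space_1)
  also have "\<dots> \<le> ennreal a * ennreal A + ennreal c" by (intro add_right_mono mult_left_mono A) simp
  also have "\<dots> = ennreal (a * A + c)" using pos by (simp add: ennreal_mult)
  finally show ?thesis .
qed

context density_chain
begin

text \<open>At least 1, so that powers of it increase with the exponent and \<open>K powr t\<close>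
  stays below it for \<open>t \<le> 1\<close>.\<close>

definition K1 :: real where "K1 = max 1 K"

lemma K1: "1 \<le> K1" "0 < K1" by (auto simp: K1_def)

text \<open>The interpolation exponent between the drift function \<open>\<phi> powr d0\<close> and
  the weight \<open>V s\<close>; the condition d1 + k q \<le> d0 is what keeps it at most 1.\<close>

definition \<theta> :: "nat \<Rightarrow> real" where "\<theta> s = (d1 + real s * q) / d0"

lemma level_le: "s \<le> k \<Longrightarrow> d1 + real s * q \<le> d0"
  using dk q mult_right_mono[of "real s" "real k" q] by linarith

lemma \<theta>: "0 < \<theta> s" "s \<le> k \<Longrightarrow> \<theta> s \<le> 1"
proof -
  have "0 < d1 + real s * q" using d1 q by (simp add: add_pos_nonneg)
  then show "0 < \<theta> s" using d0 by (simp add: \<theta>_def)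
  show "\<theta> s \<le> 1" if "s \<le> k" using level_le[OF that] d0 by (simp add: \<theta>_def)
qed

lemma V_powr: "V s x = (\<phi> (snd x) powr d0) powr \<theta> s"
  using d0 by (cases x) (simp add: V_def \<theta>_def powr_powr)

lemma Qb_growth:
  assumes u: "u \<in> {0..1}" and d: "0 \<le> d" "d \<le> d0"
  shows "(\<integral>\<^sup>+z'. ennreal (\<phi> z' powr d) \<partial>Qb u z) \<le> ennreal (K1 * \<phi> z powr d)"
proof (cases "d = 0")
  case True
  interpret prob_space "Qb u z" by (rule Qb_prob[OF u])
  show ?thesis using K1 \<phi>_ge1 by (simp add: True emeasure_space_1 less_le_trans[OF zero_less_one \<phi>_ge1] order.strict_implies_not_eq[OF less_le_trans[OF zero_less_one \<phi>_ge1], symmetric])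
next
  case False
  define t where "t = d / d0"
  have t: "0 < t" "t \<le> 1" "d0 * t = d" using d d0 False by (auto simp: t_def)
  have \<phi>m: "(\<lambda>z'. \<phi> z' powr d0) \<in> borel_measurable (Qb u z)"
    using \<phi>_meas Qb_prob(2)[OF u] by (simp cong: measurable_cong_sets)
  have pos: "K * \<phi> z powr d0 > 0" using K \<phi>_powr_ge1[of d0 z] d0 by (intro mult_pos_pos) auto
  have "(\<integral>\<^sup>+z'. ennreal ((\<phi> z' powr d0) powr t) \<partial>Qb u z) \<le> ennreal ((K * \<phi> z powr d0) powr t)"
    by (rule prob_powr_moment[OF Qb_prob(1)[OF u] \<phi>m _ t(1,2) pos growth[OF u]]) simp
  also have "(K * \<phi> z powr d0) powr t = K powr t * \<phi> z powr d"
    using K t by (simp add: powr_mult powr_powr)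
  also have "\<dots> \<le> K1 * \<phi> z powr d"
  proof (rule mult_right_mono)
    have "K powr t \<le> K1 powr t" using K t by (intro powr_mono2) (auto simp: K1_def)
    also have "\<dots> \<le> K1 powr 1" using K1 t by (intro powr_mono) auto
    finally show "K powr t \<le> K1" using K1 by simp
  qed simp
  finally show ?thesis using t by (simp add: powr_powr ennreal_leI)
qed

lemma V_split: "V s x = \<phi> (snd x) powr (d1 + real s * q)"
  by (cases x) (simp add: V_def)

lemma V_pos: "0 < V s x" "0 \<le> V s x"
  using V_ge1[of s x] by auto

lemma Q_growth:
  assumes u: "u \<in> {0..1}" and s: "s \<le> k"
  shows "(\<integral>\<^sup>+x'. ennreal (V s x') \<partial>Q u x) \<le> ennreal (K1 * V s x)"
proof -
  have "(\<integral>\<^sup>+x'. ennreal (V s x') \<partial>Q u (fst x, snd x)) = (\<integral>\<^sup>+z'. ennreal (\<phi> z' powr (d1 + real s * q)) \<partial>Qb u (snd x))"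
    unfolding V_split using \<phi>_meas by (intro nn_integral_Q_snd[OF u]) measurable
  also have "\<dots> \<le> ennreal (K1 * \<phi> (snd x) powr (d1 + real s * q))"
    using d1 q level_le[OF s] by (intro Qb_growth u) auto
  finally show ?thesis by (simp add: V_split)
qed

text \<open>Jensen's inequality followed by subadditivity of the power: the drift inequality at
  \<open>d0\<close> descends to every level, with its constants raised to the power
  \<open>\<theta> s\<close>.\<close>

lemma block_drift:
  assumes us: "length us = m" "set us \<subseteq> {0..1}" "\<forall>u\<in>set us. \<forall>v\<in>set us. \<bar>u - v\<bar> < \<epsilon>" and s: "s \<le> k"
  shows "(\<integral>\<^sup>+x'. ennreal (V s x') \<partial>kernel_prod SS Q us x) \<le> ennreal (\<rho> powr \<theta> s * V s x + b powr \<theta> s)"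
proof -
  let ?kp = "kernel_prod borel Qb us (snd x)"
  note kp = kernelD[OF kernel_prod_Qb[OF us(2)], of "snd x", simplified]
  have \<phi>m: "(\<lambda>z'. \<phi> z' powr d0) \<in> borel_measurable ?kp"
    using \<phi>_meas kp(2) by (simp cong: measurable_cong_sets)
  have pos: "0 < \<rho> * \<phi> (snd x) powr d0 + b" using \<rho> b by (simp add: add_nonneg_pos)
  have "(\<integral>\<^sup>+x'. ennreal (V s x') \<partial>kernel_prod SS Q us (fst x, snd x)) = (\<integral>\<^sup>+z'. ennreal ((\<phi> z' powr d0) powr \<theta> s) \<partial>?kp)"
    unfolding V_powr using \<phi>_meas by (intro nn_integral_kernel_prod_snd[OF us(2)]) measurable
  also have "\<dots> \<le> ennreal ((\<rho> * \<phi> (snd x) powr d0 + b) powr \<theta> s)"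
    by (rule prob_powr_moment[OF kp(1) \<phi>m _ \<theta>(1) \<theta>(2)[OF s] pos drift[OF us]]) simp
  also have "\<dots> \<le> ennreal ((\<rho> * \<phi> (snd x) powr d0) powr \<theta> s + b powr \<theta> s)"
    using \<rho> b \<theta>(1) \<theta>(2)[OF s] by (intro ennreal_leI powr_subadd) auto
  also have "(\<rho> * \<phi> (snd x) powr d0) powr \<theta> s = \<rho> powr \<theta> s * V s x"
    using \<rho> by (simp add: powr_mult V_powr)
  finally show ?thesis by simp
qed

section \<open>One-step operators, their products and the oscillation seminorm\<close>

definition T :: "real \<Rightarrow> ('y \<times> 'z \<Rightarrow> real) \<Rightarrow> 'y \<times> 'z \<Rightarrow> real" where
  "T u g x = (\<integral>y. g y \<partial>Q u x)"

abbreviation TL :: "real list \<Rightarrow> ('y \<times> 'z \<Rightarrow> real) \<Rightarrow> 'y \<times> 'z \<Rightarrow> real" where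
  "TL us g \<equiv> foldr T us g"

lemma T_regop: "u \<in> {0..1} \<Longrightarrow> s \<le> k \<Longrightarrow> regop SS (V s) SS (V s) K1 (T u)"
  unfolding T_def[abs_def]
  by (rule kernel_regop[OF Q_markov V_meas _ Q_growth]) (use K1 V_pos in auto)

lemma T_wspace: "u \<in> {0..1} \<Longrightarrow> s \<le> k \<Longrightarrow> g \<in> wspace SS (V s) \<Longrightarrow> T u g \<in> wspace SS (V s)"
  by (rule regop_wspace[OF T_regop]) (use K1 V_pos in auto)

lemma TL_wspace: "set us \<subseteq> {0..1} \<Longrightarrow> s \<le> k \<Longrightarrow> g \<in> wspace SS (V s) \<Longrightarrow> TL us g \<in> wspace SS (V s)"
  by (induction us) (auto intro!: T_wspace)

lemma TL_regop: "set us \<subseteq> {0..1} \<Longrightarrow> s \<le> k \<Longrightarrow> regop SS (V s) SS (V s) (K1 ^ length us) (TL us)"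
proof (induction us)
  case Nil
  show ?case by (auto simp: regop_def intro!: regfunI)
next
  case (Cons u us)
  have "regop SS (V s) SS (V s) (K1 ^ length us * K1) (\<lambda>g. T u (TL us g))"
    using Cons by (intro regop_comp[OF T_regop]) (auto simp: K1 V_pos)
  then show ?case by (simp add: mult.commute o_def)
qed

lemma const_wspace: "(\<lambda>_. c) \<in> wspace SS (V s)"
proof (rule wspaceI[of "\<bar>c\<bar> + 1"], simp, rule wballI)
  fix x :: "'y \<times> 'z"
  have "\<bar>c\<bar> \<le> (\<bar>c\<bar> + 1) * 1" by simp
  also have "\<dots> \<le> (\<bar>c\<bar> + 1) * V s x" by (intro mult_left_mono V_ge1) simp
  finally show "\<bar>c\<bar> \<le> (\<bar>c\<bar> + 1) * V s x" .
qed simp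

lemma T_const: "u \<in> {0..1} \<Longrightarrow> T u (\<lambda>_. c) = (\<lambda>_. c)"
  using kernelD(1)[OF Q_markov, THEN prob_space.prob_space] by (auto simp: T_def)

lemma kernel_prod_growth:
  assumes "set us \<subseteq> {0..1}" and s: "s \<le> k"
  shows "(\<integral>\<^sup>+x'. ennreal (V s x') \<partial>kernel_prod SS Q us x) \<le> ennreal (K1 ^ length us * V s x)"
  using assms(1)
proof (induction us arbitrary: x)
  case Nil
  show ?case by (simp add: nn_integral_return)
next
  case (Cons u us)
  then have us: "u \<in> {0..1}" "set us \<subseteq> {0..1}" by auto
  have "(\<integral>\<^sup>+x'. ennreal (V s x') \<partial>kernel_prod SS Q (u # us) x)
      = (\<integral>\<^sup>+x. \<integral>\<^sup>+x'. ennreal (V s x') \<partial>kernel_prod SS Q us x \<partial>Q u x)"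
    by (rule nn_integral_kernel_prod_Cons[OF us]) measurable
  also have "\<dots> \<le> (\<integral>\<^sup>+x. ennreal (K1 ^ length us * V s x + 0) \<partial>Q u x)"
    using Cons.IH[OF us(2)] by (intro nn_integral_mono) simp
  also have "\<dots> \<le> ennreal (K1 ^ length us * (K1 * V s x) + 0)"
    using Q_growth[OF us(1) s] kernelD(1,2)[OF Q_markov[OF us(1)], of x] K1 V_pos
    by (intro nn_integral_affine_le) (auto cong: measurable_cong_sets)
  finally show ?case by (simp add: ac_simps)
qed

lemma TL_kernel_prod:
  assumes "set us \<subseteq> {0..1}" and s: "s \<le> k" and g: "g \<in> wspace SS (V s)"
  shows "TL us g x = (\<integral>y. g y \<partial>kernel_prod SS Q us x)"
  using assms(1)
proof (induction us arbitrary: x)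
  case Nil
  show ?case using wspace_meas[OF g] by (simp add: integral_return)
next
  case (Cons u us)
  then have us: "u \<in> {0..1}" "set us \<subseteq> {0..1}" by auto
  have iV: "integrable (Q u x) (V s)"
    by (rule integrable_kernel(1)[OF Q_markov[OF us(1)] _ V_meas _ Q_growth[OF us(1) s]]) (use V_pos in auto)
  have "(\<integral>y. g y \<partial>kernel_prod SS Q (u # us) x) = (\<integral>x'. (\<integral>y. g y \<partial>kernel_prod SS Q us x') \<partial>Q u x)"
    using integral_bind_kernel(1)[OF kernelD(4)[OF Q_markov[OF us(1)]] kernel_prod_Q[OF us(2)] V_meas V_ge1 V_meas V_pos(2)
       kernel_prod_growth[OF us(2) s] _ iV g] K1 by simp
  also have "\<dots> = (\<integral>x'. TL us g x' \<partial>Q u x)" by (simp add: Cons.IH[OF us(2)])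
  finally have "(\<integral>y. g y \<partial>kernel_prod SS Q (u # us) x) = T u (TL us g) x" by (simp only: T_def)
  then show ?case by simp
qed

text \<open>The Lipschitz condition for the distance 2 + \<beta> V x + \<beta> V y between distinct
  states. Constants have oscillation 0, and \<beta> balances the discrete distance against the
  weight.\<close>

definition osc :: "nat \<Rightarrow> real \<Rightarrow> real \<Rightarrow> ('y \<times> 'z \<Rightarrow> real) \<Rightarrow> bool" where
  "osc s \<beta> c g \<longleftrightarrow> (\<forall>x y. \<bar>g x - g y\<bar> \<le> c * (2 + \<beta> * V s x + \<beta> * V s y))"

lemma oscD: "osc s \<beta> c g \<Longrightarrow> \<bar>g x - g y\<bar> \<le> c * (2 + \<beta> * V s x + \<beta> * V s y)"
  unfolding osc_def by blast

lemma osc_mono: "osc s \<beta> c g \<Longrightarrow> c \<le> d \<Longrightarrow> 0 \<le> \<beta> \<Longrightarrow> osc s \<beta> d g"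
  unfolding osc_def using V_pos(2)
  by (meson mult_right_mono order_trans add_nonneg_nonneg mult_nonneg_nonneg zero_le_numeral)

lemma osc_kernel:
  assumes us: "set us \<subseteq> {0..1}" and s: "s \<le> k" and g: "g \<in> wspace SS (V s)" "osc s \<beta> c g" and c: "0 \<le> c" "0 \<le> \<beta>"
    and A: "(\<integral>\<^sup>+x'. ennreal (V s x') \<partial>kernel_prod SS Q us x) \<le> ennreal A" "0 \<le> A"
    and B: "(\<integral>\<^sup>+x'. ennreal (V s x') \<partial>kernel_prod SS Q us y) \<le> ennreal B" "0 \<le> B"
    and N: "sets N = sets SS" "measure N (space SS) = a" "a < 1"
      "\<And>h x'. x' \<in> {x, y} \<Longrightarrow> h \<in> borel_measurable SS \<Longrightarrow> (\<integral>\<^sup>+x. h x \<partial>N) \<le> (\<integral>\<^sup>+x. h x \<partial>kernel_prod SS Q us x')"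
  shows "\<bar>TL us g x - TL us g y\<bar> \<le> c * (2 * (1 - a) + \<beta> * (A + B))"
proof -
  note kp = kernelD[OF kernel_prod_Q[OF us], simplified]
  note iA = integrable_kernel[OF kernel_prod_Q[OF us] _ V_meas V_pos(2) A(1), simplified]
  note iB = integrable_kernel[OF kernel_prod_Q[OF us] _ V_meas V_pos(2) B(1), simplified]
  have "\<bar>TL us g x - TL us g y\<bar> \<le> c * (2 * (1 - a) + \<beta> * ((\<integral>x'. V s x' \<partial>kernel_prod SS Q us x) + (\<integral>x'. V s x' \<partial>kernel_prod SS Q us y)))"
    unfolding TL_kernel_prod[OF us s g(1)]
    by (rule oscillation_bound[OF kp(1,2) kp(1,2) N(1,2,3) N(4) N(4) iA(1) iB(1) V_pos(2) wspace_meas[OF g(1)] oscD[OF g(2)] c])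
       auto
  also have "\<dots> \<le> c * (2 * (1 - a) + \<beta> * (A + B))"
    using iA(2)[OF A(2)] iB(2)[OF B(2)] c by (intro mult_left_mono add_left_mono add_mono) auto
  finally show ?thesis .
qed

lemma osc_TL:
  assumes us: "set us \<subseteq> {0..1}" and s: "s \<le> k" and g: "g \<in> wspace SS (V s)" "osc s \<beta> c g" and c: "0 \<le> c" "0 \<le> \<beta>"
  shows "osc s \<beta> (K1 ^ length us * c) (TL us g)"
  unfolding osc_def
proof (intro allI)
  fix x y
  let ?K = "K1 ^ length us"
  have K: "1 \<le> ?K" using K1 by simp
  \<comment> \<open>With the zero measure as common part, \<open>a = 0\<close>, and the coupling
    estimate becomes a plain growth bound.\<close>
  have "\<bar>TL us g x - TL us g y\<bar> \<le> c * (2 * (1 - 0) + \<beta> * (?K * V s x + ?K * V s y))"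
    by (rule osc_kernel[OF us s g c kernel_prod_growth[OF us s] _ kernel_prod_growth[OF us s] _, of _ _ "null_measure SS"])
       (use K V_pos in auto)
  also have "\<dots> \<le> c * (?K * 2 + \<beta> * (?K * V s x + ?K * V s y))"
    using K c by (intro mult_left_mono add_right_mono) auto
  finally show "\<bar>TL us g x - TL us g y\<bar> \<le> ?K * c * (2 + \<beta> * V s x + \<beta> * V s y)"
    by (simp add: algebra_simps)
qed

lemma block_contraction:
  assumes s: "s \<le> k"
  obtains \<beta> \<kappa> where "\<beta> > 0" "0 < \<kappa>" "\<kappa> < 1"
    "\<And>us g c. length us = m \<Longrightarrow> set us \<subseteq> {0..1} \<Longrightarrow> (\<forall>u\<in>set us. \<forall>v\<in>set us. \<bar>u - v\<bar> < \<epsilon>) \<Longrightarrow>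
        g \<in> wspace SS (V s) \<Longrightarrow> osc s \<beta> c g \<Longrightarrow> 0 \<le> c \<Longrightarrow> osc s \<beta> (\<kappa> * c) (TL us g)"
proof -
  define l where "l = \<rho> powr \<theta> s"
  define d where "d = b powr \<theta> s"
  have l: "0 < l" "l < 1" using \<rho> \<theta>(1)[of s] powr_less_mono2[of "\<theta> s" \<rho> 1] by (auto simp: l_def)
  have d: "0 \<le> d" by (simp add: d_def)
  define R where "R = 4 * d / (1 - l) + 1"
  have R: "R > 0" using l d by (auto simp: R_def intro!: add_nonneg_pos)
  \<comment> \<open>The minorization speaks of sublevel sets of \<open>\<phi> powr d0\<close>; the
    sublevel set of \<open>V s\<close> at \<open>R\<close> is the one at
    \<open>R powr (1 / \<theta> s)\<close>.\<close>
  obtain N a where N: "sets N = sets SS" "measure N (space SS) = a" "0 < a" "a < 1"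
    and Nle: "\<And>us y z h. length us = m \<Longrightarrow> set us \<subseteq> {0..1} \<Longrightarrow> (\<forall>u\<in>set us. \<forall>v\<in>set us. \<bar>u - v\<bar> < \<epsilon>) \<Longrightarrow>
        \<phi> z powr d0 \<le> R powr (1 / \<theta> s) \<Longrightarrow> h \<in> borel_measurable SS \<Longrightarrow> (\<integral>\<^sup>+x. h x \<partial>N) \<le> (\<integral>\<^sup>+x. h x \<partial>kernel_prod SS Q us (y, z))"
    using minorization[of "R powr (1 / \<theta> s)"] R by auto
  obtain \<beta> \<kappa> where bk: "\<beta> > 0" "0 < \<kappa>" "\<kappa> < 1"
    "\<And>S. R \<le> S \<Longrightarrow> 2 + \<beta> * (l * S + 2 * d) \<le> \<kappa> * (2 + \<beta> * S)"
    "\<And>S. 0 \<le> S \<Longrightarrow> 2 * (1 - a) + \<beta> * (l * S + 2 * d) \<le> \<kappa> * (2 + \<beta> * S)"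
    using contraction_constants[OF l d N(3,4)] unfolding R_def by blast
  show ?thesis
  proof (rule that[OF bk(1-3)])
    fix us g c assume us: "length us = m" "set us \<subseteq> {0..1}" "\<forall>u\<in>set us. \<forall>v\<in>set us. \<bar>u - v\<bar> < \<epsilon>"
      and g: "g \<in> wspace SS (V s)" "osc s \<beta> c g" and c: "0 \<le> c"
    have D: "(\<integral>\<^sup>+x'. ennreal (V s x') \<partial>kernel_prod SS Q us x) \<le> ennreal (l * V s x + d)" "0 \<le> l * V s x + d" for x
      using block_drift[OF us s, of x] l d V_pos(2)[of s x] by (auto simp: l_def d_def)
    have "\<bar>TL us g x - TL us g y\<bar> \<le> c * (\<kappa> * (2 + \<beta> * (V s x + V s y)))" for x y
    \<comment> \<open>Above the threshold the drift contracts without coupling; below it both states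
      lie in the small set, where the minorization applies.\<close>
    proof (cases "R \<le> V s x + V s y")
      case True
      have "\<bar>TL us g x - TL us g y\<bar> \<le> c * (2 * (1 - 0) + \<beta> * ((l * V s x + d) + (l * V s y + d)))"
        by (rule osc_kernel[OF us(2) s g c _ D D, of "null_measure SS"]) (use bk in auto)
      also have "\<dots> = c * (2 + \<beta> * (l * (V s x + V s y) + 2 * d))" by (simp add: algebra_simps)
      also have "\<dots> \<le> c * (\<kappa> * (2 + \<beta> * (V s x + V s y)))"
        by (rule mult_left_mono[OF bk(4)[OF True] c])
      finally show ?thesis .
    next
      case False
      have lev: "\<phi> (snd x') powr d0 \<le> R powr (1 / \<theta> s)" if "V s x' \<le> R" for x'
      proof -
        have "\<phi> (snd x') powr d0 = V s x' powr (1 / \<theta> s)"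
          using \<theta>(1)[of s] by (simp add: V_powr powr_powr)
        also have "\<dots> \<le> R powr (1 / \<theta> s)" using that V_pos(2)[of s x'] \<theta>(1)[of s] by (intro powr_mono2) auto
        finally show ?thesis .
      qed
      have xy: "V s x \<le> R" "V s y \<le> R" using False V_pos(2)[of s x] V_pos(2)[of s y] by linarith+
      have Nle': "(\<integral>\<^sup>+x. h x \<partial>N) \<le> (\<integral>\<^sup>+x. h x \<partial>kernel_prod SS Q us x')" if "x' \<in> {x, y}" "h \<in> borel_measurable SS" for h x'
        using Nle[OF us lev that(2), of x' "fst x'"] xy that(1) by auto
      have "\<bar>TL us g x - TL us g y\<bar> \<le> c * (2 * (1 - a) + \<beta> * ((l * V s x + d) + (l * V s y + d)))"
        by (rule osc_kernel[OF us(2) s g c _ D D N(1,2,4) Nle']) (use bk in auto)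
      also have "\<dots> = c * (2 * (1 - a) + \<beta> * (l * (V s x + V s y) + 2 * d))" by (simp add: algebra_simps)
      also have "\<dots> \<le> c * (\<kappa> * (2 + \<beta> * (V s x + V s y)))"
        using V_pos(2)[of s x] V_pos(2)[of s y] by (intro mult_left_mono[OF bk(5) c]) simp
      finally show ?thesis .
    qed
    then show "osc s \<beta> (\<kappa> * c) (TL us g)" unfolding osc_def by (simp add: algebra_simps)
  qed
qed

text \<open>Closeness is asked of any \<open>m\<close> consecutive entries, at every offset. The
  property thus passes to \<open>take\<close> and \<open>drop\<close>, and a list can be cut into
  blocks to which the drift and minorization conditions apply.\<close>

definition good :: "real list \<Rightarrow> bool" where
  "good us \<longleftrightarrow> set us \<subseteq> {0..1} \<and> (\<forall>i j. i \<le> j \<longrightarrow> j < length us \<longrightarrow> j < i + m \<longrightarrow> \<bar>us ! i - us ! j\<bar> < \<epsilon>)"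

lemma good_take: "good us \<Longrightarrow> good (take n us)"
  using set_take_subset[of n us] by (auto simp: good_def)

lemma good_drop:
  assumes "good us" shows "good (drop n us)"
  unfolding good_def
proof (intro conjI allI impI)
  show "set (drop n us) \<subseteq> {0..1}" using assms set_drop_subset[of n us] by (auto simp: good_def)
  fix i j assume "i \<le> j" "j < length (drop n us)" "j < i + m"
  then show "\<bar>drop n us ! i - drop n us ! j\<bar> < \<epsilon>"
    using assms by (auto simp: good_def)
qed

lemma good_block:
  assumes "good us" "length us = m" shows "\<forall>u\<in>set us. \<forall>v\<in>set us. \<bar>u - v\<bar> < \<epsilon>"
proof (intro ballI)
  fix u v assume "u \<in> set us" "v \<in> set us"
  then obtain i j where ij: "i < m" "u = us ! i" "j < m" "v = us ! j"
    using assms(2) by (auto simp: in_set_conv_nth)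
  have *: "\<bar>us ! i - us ! j\<bar> < \<epsilon>" if "i \<le> j" "j < m" for i j
    using assms that unfolding good_def by auto
  then show "\<bar>u - v\<bar> < \<epsilon>"
    using ij *[of i j] *[of j i] by (cases "i \<le> j") (auto simp: abs_minus_commute)
qed

lemma good_replicate: "u \<in> {0..1} \<Longrightarrow> good (replicate n u)"
  using \<epsilon> by (auto simp: good_def)

lemma nn_integral_kernel_prod_append:
  assumes "set us \<subseteq> {0..1}" "set vs \<subseteq> {0..1}" "h \<in> borel_measurable SS"
  shows "(\<integral>\<^sup>+x. h x \<partial>kernel_prod SS Q (us @ vs) x0) = (\<integral>\<^sup>+x. \<integral>\<^sup>+x'. h x' \<partial>kernel_prod SS Q vs x \<partial>kernel_prod SS Q us x0)"
  using assms(1)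
proof (induction us arbitrary: x0)
  case Nil
  have "(\<lambda>x. \<integral>\<^sup>+x'. h x' \<partial>kernel_prod SS Q vs x) \<in> borel_measurable SS"
    by (rule measurable_compose[OF measurable_prob_algebraD[OF kernel_prod_Q[OF assms(2)]] nn_integral_measurable_subprob_algebra[OF assms(3)]])
  then show ?case by (simp add: nn_integral_return)
next
  case (Cons u us)
  then have us: "u \<in> {0..1}" "set us \<subseteq> {0..1}" "set (us @ vs) \<subseteq> {0..1}" using assms(2) by auto
  have hm: "(\<lambda>x. \<integral>\<^sup>+x'. h x' \<partial>kernel_prod SS Q vs x) \<in> borel_measurable SS"
    by (rule measurable_compose[OF measurable_prob_algebraD[OF kernel_prod_Q[OF assms(2)]] nn_integral_measurable_subprob_algebra[OF assms(3)]])
  show ?case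
    using nn_integral_kernel_prod_Cons[OF us(1,3) assms(3)] nn_integral_kernel_prod_Cons[OF us(1,2) hm] Cons.IH[OF us(2)]
    by simp
qed

text \<open>Short lists are admitted as well, since on coarse time grids neighbouring parameters may be
  more than \<open>\<epsilon>\<close> apart.\<close>

definition adm :: "nat \<Rightarrow> real list \<Rightarrow> bool" where
  "adm n0 us \<longleftrightarrow> good us \<or> set us \<subseteq> {0..1} \<and> length us \<le> n0"

text \<open>Blocks of length \<open>m\<close> are split off at the end, so the drift is applied
  innermost and fewer than \<open>m\<close> initial steps remain, each costing a factor
  \<open>K1\<close>.\<close>

lemma moment_bound:
  assumes s: "s \<le> k"
  obtains A where "A > 0" "\<And>us x. adm n0 us \<Longrightarrow> (\<integral>\<^sup>+x'. ennreal (V s x') \<partial>kernel_prod SS Q us x) \<le> ennreal (A * V s x)"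
proof -
  define l where "l = \<rho> powr \<theta> s"
  define d where "d = b powr \<theta> s"
  have l: "0 < l" "l < 1" using \<rho> \<theta>(1)[of s] powr_less_mono2[of "\<theta> s" \<rho> 1] by (auto simp: l_def)
  have d: "0 \<le> d" by (simp add: d_def)
  \<comment> \<open>The fixed point of t \<mapsto> l t + d: with it added, the bound reproduces
    itself under one more block instead of accumulating.\<close>
  define e where "e = d / (1 - l)"
  have e: "0 \<le> e" "l * e + d = e" using l d by (auto simp: e_def field_simps)
  have G: "(\<integral>\<^sup>+x'. ennreal (V s x') \<partial>kernel_prod SS Q us x) \<le> ennreal (K1 ^ m * V s x + e)" if "good us" for us x
    using that
  proof (induction "length us" arbitrary: us rule: less_induct)
    case less
    have us: "set us \<subseteq> {0..1}" using less.prems by (simp add: good_def)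
    show ?case
    proof (cases "length us < m")
      case True
      have "K1 ^ length us * V s x \<le> K1 ^ m * V s x + e"
        using True K1 V_pos(2)[of s x] e by (intro add_increasing2 mult_right_mono power_increasing) auto
      then show ?thesis using kernel_prod_growth[OF us s, of x] by (meson ennreal_leI order_trans)
    next
      case False
      define n where "n = length us - m"
      let ?a = "take n us" and ?b = "drop n us"
      have gd: "good ?a" "good ?b" "length ?b = m" "length ?a < length us"
        using False m good_take[OF less.prems] good_drop[OF less.prems] by (auto simp: n_def)
      have st: "set ?a \<subseteq> {0..1}" "set ?b \<subseteq> {0..1}" using gd by (auto simp: good_def)
      note kp = kernelD[OF kernel_prod_Q[OF st(1)], of x, simplified]
      have "(\<integral>\<^sup>+x'. ennreal (V s x') \<partial>kernel_prod SS Q us x) = (\<integral>\<^sup>+x1. \<integral>\<^sup>+x'. ennreal (V s x') \<partial>kernel_prod SS Q ?b x1 \<partial>kernel_prod SS Q ?a x)"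
        using nn_integral_kernel_prod_append[OF st, of "\<lambda>x'. ennreal (V s x')" x] by simp
      also have "\<dots> \<le> (\<integral>\<^sup>+x1. ennreal (l * V s x1 + d) \<partial>kernel_prod SS Q ?a x)"
        unfolding l_def d_def by (intro nn_integral_mono block_drift[OF gd(3) st(2) good_block[OF gd(2,3)] s])
      also have "\<dots> \<le> ennreal (l * (K1 ^ m * V s x + e) + d)"
        using less.hyps[OF gd(4,1)] kp l d e K1 V_pos
        by (intro nn_integral_affine_le) (auto cong: measurable_cong_sets)
      also have "\<dots> \<le> ennreal (K1 ^ m * V s x + e)"
      proof (rule ennreal_leI)
        have "l * (K1 ^ m * V s x + e) + d = l * (K1 ^ m * V s x) + e" using e(2) by (simp add: distrib_left)
        also have "\<dots> \<le> 1 * (K1 ^ m * V s x) + e"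
          using l K1 V_pos(2)[of s x] by (intro add_right_mono mult_right_mono) auto
        finally show "l * (K1 ^ m * V s x + e) + d \<le> K1 ^ m * V s x + e" by simp
      qed
      finally show ?thesis .
    qed
  qed
  show ?thesis
  proof (rule that[of "K1 ^ m + e + K1 ^ n0"])
    show "0 < K1 ^ m + e + K1 ^ n0" using K1 e by (simp add: add_pos_nonneg add_pos_pos)
    fix us x assume "adm n0 us"
    then consider "good us" | "set us \<subseteq> {0..1}" "length us \<le> n0" by (auto simp: adm_def)
    then show "(\<integral>\<^sup>+x'. ennreal (V s x') \<partial>kernel_prod SS Q us x) \<le> ennreal ((K1 ^ m + e + K1 ^ n0) * V s x)"
    proof cases
      case 1
      have "K1 ^ m * V s x + e \<le> (K1 ^ m + e + K1 ^ n0) * V s x"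
        using e K1 V_ge1[of s x] mult_left_mono[OF V_ge1[of s x] e(1)] by (simp add: distrib_right add_increasing2)
      then show ?thesis using G[OF 1, of x] by (meson ennreal_leI order_trans)
    next
      case 2
      have "K1 ^ length us * V s x \<le> (K1 ^ m + e + K1 ^ n0) * V s x"
        using 2 e K1 V_pos(2)[of s x] power_increasing[OF 2(2) K1(1)]
        by (intro mult_right_mono) (auto intro: add_increasing)
      then show ?thesis using kernel_prod_growth[OF 2(1) s, of x] by (meson ennreal_leI order_trans)
    qed
  qed
qed

lemma contraction:
  assumes s: "s \<le> k"
  obtains \<beta> B r where "\<beta> > 0" "B > 0" "0 < r" "r < 1"
    "\<And>us g c. adm n0 us \<Longrightarrow> g \<in> wspace SS (V s) \<Longrightarrow> osc s \<beta> c g \<Longrightarrow> 0 \<le> c \<Longrightarrow> osc s \<beta> (B * r ^ length us * c) (TL us g)"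
proof -
  obtain \<beta> \<kappa> where bk: "\<beta> > 0" "0 < \<kappa>" "\<kappa> < 1" and
    blk: "\<And>us g c. length us = m \<Longrightarrow> set us \<subseteq> {0..1} \<Longrightarrow> (\<forall>u\<in>set us. \<forall>v\<in>set us. \<bar>u - v\<bar> < \<epsilon>) \<Longrightarrow>
        g \<in> wspace SS (V s) \<Longrightarrow> osc s \<beta> c g \<Longrightarrow> 0 \<le> c \<Longrightarrow> osc s \<beta> (\<kappa> * c) (TL us g)"
    using block_contraction[OF s] by blast
  have G: "osc s \<beta> (\<kappa> ^ (length us div m) * K1 ^ (length us mod m) * c) (TL us g)"
    if "good us" "g \<in> wspace SS (V s)" "osc s \<beta> c g" "0 \<le> c" for us g c
    using that(1)
  proof (induction "length us" arbitrary: us rule: less_induct)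
    case less
    have us: "set us \<subseteq> {0..1}" using less.prems by (simp add: good_def)
    show ?case
    proof (cases "length us < m")
      case True
      then show ?thesis using osc_TL[OF us s that(2,3,4)] bk by simp
    next
      case False
      let ?a = "take m us" and ?b = "drop m us"
      have gd: "good ?a" "good ?b" "length ?a = m" "length ?b < length us"
        using False m good_take[OF less.prems] good_drop[OF less.prems] by auto
      have st: "set ?a \<subseteq> {0..1}" "set ?b \<subseteq> {0..1}" using gd by (auto simp: good_def)
      have dm: "length us div m = Suc (length ?b div m)" "length us mod m = length ?b mod m"
        using False m le_div_geq[of m "length us"] le_mod_geq[of m "length us"] by auto
      have "osc s \<beta> (\<kappa> * (\<kappa> ^ (length ?b div m) * K1 ^ (length ?b mod m) * c)) (TL ?a (TL ?b g))"
        by (rule blk[OF gd(3) st(1) good_block[OF gd(1,3)] TL_wspace[OF st(2) s that(2)] less.hyps[OF gd(4,2)]])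
           (use bk K1 that in auto)
      moreover have "TL ?a (TL ?b g) = TL us g" by (metis append_take_drop_id foldr_append)
      ultimately show ?thesis unfolding dm by (simp add: mult.assoc)
    qed
  qed
  \<comment> \<open>A factor \<kappa> for each block of \<open>m\<close> steps becomes a factor
    \<open>r\<close> for each step.\<close>
  define r where "r = root m \<kappa>"
  have r: "0 < r" "r < 1" "r ^ m = \<kappa>" using bk m by (auto simp: r_def)
  \<comment> \<open>The first summand covers good lists, where an incomplete block costs at most
    \<open>K1 ^ m\<close> in growth and 1/\<kappa> in missing contraction. The second covers short
    lists, where \<open>r ^ n0\<close> bounds the decay from below.\<close>
  define B where "B = K1 ^ m / \<kappa> + K1 ^ n0 / r ^ n0"
  have B: "B > 0" using bk K1 r by (auto simp: B_def intro!: add_pos_pos)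
  show ?thesis
  proof (rule that[OF bk(1) B r(1,2)])
    fix us g c assume us: "adm n0 us" and g: "g \<in> wspace SS (V s)" "osc s \<beta> c g" and c: "0 \<le> (c::real)"
    let ?L = "length us"
    from us consider "good us" | "set us \<subseteq> {0..1}" "?L \<le> n0" by (auto simp: adm_def)
    then show "osc s \<beta> (B * r ^ length us * c) (TL us g)"
    proof cases
      case 1
      have "\<kappa> ^ (?L div m) * \<kappa> \<le> r ^ ?L"
      proof -
        have "r ^ ?L = r ^ (m * (?L div m)) * r ^ (?L mod m)" by (simp add: power_add[symmetric])
        also have "r ^ (m * (?L div m)) = \<kappa> ^ (?L div m)" by (simp add: power_mult r(3))
        finally have e: "r ^ ?L = \<kappa> ^ (?L div m) * r ^ (?L mod m)" .
        have "r ^ m \<le> r ^ (?L mod m)" using r m by (intro power_decreasing) (auto intro: less_imp_le)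
        then show ?thesis unfolding e r(3) using bk by (intro mult_left_mono) auto
      qed
      then have a: "\<kappa> ^ (?L div m) \<le> r ^ ?L / \<kappa>" using bk by (simp add: le_divide_eq)
      have b': "K1 ^ (?L mod m) \<le> K1 ^ m" using K1 m by (intro power_increasing) (auto intro: less_imp_le)
      have "\<kappa> ^ (?L div m) * K1 ^ (?L mod m) \<le> r ^ ?L / \<kappa> * K1 ^ m"
        using a b' bk K1 r by (intro mult_mono) auto
      also have "\<dots> \<le> B * r ^ ?L" 
      proof -
        have "r ^ ?L / \<kappa> * K1 ^ m = K1 ^ m / \<kappa> * r ^ ?L" by simp
        also have "\<dots> \<le> B * r ^ ?L" using r K1 by (intro mult_right_mono) (auto simp: B_def)
        finally show ?thesis .
      qed
      finally have "\<kappa> ^ (?L div m) * K1 ^ (?L mod m) * c \<le> B * r ^ ?L * c" by (rule mult_right_mono[OF _ c])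
      then show ?thesis using bk by (intro osc_mono[OF G[OF 1 g c]]) auto
    next
      case 2
      have "K1 ^ ?L \<le> K1 ^ n0" using 2 K1 by (intro power_increasing) auto
      also have "\<dots> \<le> K1 ^ n0 / r ^ n0 * r ^ ?L"
      proof -
        have "r ^ n0 \<le> r ^ ?L" using 2 r by (intro power_decreasing) auto
        then have "K1 ^ n0 * r ^ n0 \<le> K1 ^ n0 * r ^ ?L" using K1 by (intro mult_left_mono) auto
        then show ?thesis using r by (simp add: le_divide_eq)
      qed
      also have "\<dots> \<le> B * r ^ ?L" using r K1 bk by (simp add: B_def distrib_right)
      finally have "K1 ^ ?L * c \<le> B * r ^ ?L * c" by (rule mult_right_mono[OF _ c])
      then show ?thesis using bk by (intro osc_mono[OF osc_TL[OF 2(1) s g c]]) auto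
    qed
  qed
qed

end

section \<open>The invariant law\<close>

lemma regfun_cong_fun:
  assumes K: "regfun M w K" and eq: "\<And>g. g \<in> wspace M w \<Longrightarrow> L g = K g"
  shows "regfun M w L"
proof (rule regfunI)
  show "L (\<lambda>y. a * g y + b * h y) = a * L g + b * L h" if "g \<in> wspace M w" "h \<in> wspace M w" for g h a b
    using regfun_lin[OF K that] eq that wspace_lin[OF that] by simp
  show "(\<lambda>n. L (gs n)) \<longlonglongrightarrow> L g" if "\<And>n. gs n \<in> wball M w" "g \<in> wball M w"
    "\<And>x. x \<in> space M \<Longrightarrow> (\<lambda>n. gs n x) \<longlonglongrightarrow> g x" for gs g
    using regfun_tendsto[OF K, of 1 gs g] that eq[OF wball_wspace] by simp
qed

text \<open>Nonnegativity on indicators annihilates the negative variation, so the functional is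
  integration against the positive one.\<close>

lemma regfun_positive_measure:
  assumes L: "regfun M w L" and w: "\<And>x. x \<in> space M \<Longrightarrow> 1 \<le> w x" and wm: "w \<in> borel_measurable M"
    and pos: "\<And>A. A \<in> sets M \<Longrightarrow> 0 \<le> L (indicator A)"
  obtains N where "sets N = sets M" "finite_measure N" "integrable N w" "\<And>g. g \<in> wspace M w \<Longrightarrow> (\<integral>x. g x \<partial>N) = L g"
proof -
  let ?\<mu> = "lmeas M L"
  have sm: "signed_measure M ?\<mu>" by (rule signed_measure_lmeas[OF L w])
  obtain c where bd: "\<And>A. \<bar>?\<mu> A\<bar> \<le> c" by (rule lmeas_bounded[OF L w]) blast+
  note sm' = signed_measure_uminus[OF sm]
  have bd': "\<bar>- ?\<mu> A\<bar> \<le> c" for A using bd by simp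
  let ?n = "positive_variation M (\<lambda>A. - ?\<mu> A)"
  have "emeasure ?n A = 0" if A: "A \<in> sets M" for A
    unfolding emeasure_positive_variation[OF sm' bd' A]
    using pos by (intro antisym SUP_least) (auto simp: lmeas_def ennreal_neg)
  then have "emeasure ?n (space ?n) = 0"
    using sets.top[of M] space_positive_variation[OF sm' bd'] by simp
  then have "AE x in ?n. False" by (intro AE_I[of _ _ "space ?n"]) auto
  then have n0: "(\<integral>x. g x \<partial>?n) = 0" for g :: "_ \<Rightarrow> real"
    by (intro integral_eq_zero_AE) auto
  show ?thesis
  proof (rule that)
    show "sets (positive_variation M ?\<mu>) = sets M" by (rule sets_positive_variation[OF sm bd])
    show "finite_measure (positive_variation M ?\<mu>)" by (rule finite_measure_positive_variation[OF sm bd])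
    show "integrable (positive_variation M ?\<mu>) w" by (rule lmeas_integrable[OF L w wm])
    show "(\<integral>x. g x \<partial>positive_variation M ?\<mu>) = L g" if g: "g \<in> wspace M w" for g
    proof -
      have "signed_integral M ?\<mu> g = L g" by (rule signed_integral_lmeas[OF L w wm g])
      then show ?thesis unfolding signed_integral_def n0 by simp
    qed
  qed
qed

lemma opB_zero:
  assumes "mono_weights N W'"
  shows "opB k M W N W' e (\<lambda>u g x. 0)"
  unfolding opB_def
proof safe
  have "regop M (W s) N (W' (s + e)) 1 (\<lambda>g x. 0)" for s
    using mono_weightsD(3)[OF assms] by (auto simp: regop_def intro!: wballI regfunI)
  then show "\<exists>c>0. \<forall>s u. s + e \<le> k \<longrightarrow> u \<in> {0..1::real} \<longrightarrow> regop M (W s) N (W' (s + e)) c (\<lambda>g x. 0)"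
    by (intro exI[of _ 1]) auto
qed simp

lemma opC_zero:
  assumes "mono_weights N W'" shows "opC k M W N W' n e (\<lambda>u g x. 0)"
proof (induction n arbitrary: e)
  case (Suc n)
  have "opD k M W N e (\<lambda>u g x. 0) (\<lambda>u g x. 0)" by (simp add: opD_def)
  with Suc opB_zero[OF assms] show ?case by auto
qed (simp add: opB_zero[OF assms])

lemma opC_const:
  assumes mN: "mono_weights N W'" and A: "\<And>s. s \<le> k \<Longrightarrow> regop M (W s) N (W' s) c A" and c: "c > 0"
  shows "opC k M W N W' n 0 (\<lambda>u. A)"
proof -
  have B: "opB k M W N W' 0 (\<lambda>u. A)" using A c by (auto simp: opB_def)
  show ?thesis
  proof (cases n)
    case (Suc n')
    have "opD k M W N 0 (\<lambda>u. A) (\<lambda>u g x. 0)" by (simp add: opD_def)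
    then have "\<exists>A'. opD k M W N 0 (\<lambda>u. A) A' \<and> opC k M W N W' n' (Suc 0) A'"
      using opC_zero[OF mN] by blast
    with B Suc show ?thesis by simp
  qed (use B in simp)
qed

context density_chain
begin

text \<open>Subtracting the value at a fixed state turns the contraction of oscillations under \<open>T u\<close> into a
  contraction in norm, so \<open>1 - Sop u\<close> is invertible. For \<open>h = Y u g\<close> the equation
  \<open>h - T u h + h base = g\<close> shows that \<open>h base\<close> is the integral of \<open>g\<close> against the invariant law.\<close>

definition base :: "'y \<times> 'z" where "base = undefined"

definition Sop :: "real \<Rightarrow> ('y \<times> 'z \<Rightarrow> real) \<Rightarrow> 'y \<times> 'z \<Rightarrow> real" where
  "Sop u g x = T u g x - g base"

lemma T_funpow: "(T u ^^ n) g = TL (replicate n u) g"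
  by (induction n) auto

lemma T_funpow_wspace: "u \<in> {0..1} \<Longrightarrow> s \<le> k \<Longrightarrow> g \<in> wspace SS (V s) \<Longrightarrow> (T u ^^ n) g \<in> wspace SS (V s)"
  unfolding T_funpow by (rule TL_wspace) auto

lemma T_diff_const:
  assumes "u \<in> {0..1}" "s \<le> k" "g \<in> wspace SS (V s)"
  shows "T u (\<lambda>y. g y - c) x = T u g x - c"
  using regfun_diff[OF regopD(2)[OF T_regop[OF assms(1,2)], of x] assms(3) const_wspace] T_const[OF assms(1), of c] by simp

text \<open>\<open>T u\<close> fixes constants, so of all the subtracted values only the last one
  survives in an iterate.\<close>

lemma Sop_funpow:
  assumes "u \<in> {0..1}" "s \<le> k" "g \<in> wspace SS (V s)"
  shows "(Sop u ^^ Suc n) g = (\<lambda>x. (T u ^^ Suc n) g x - (T u ^^ n) g base)"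
proof (induction n)
  case 0
  show ?case by (simp add: Sop_def[abs_def])
next
  case (Suc n)
  have "(Sop u ^^ Suc (Suc n)) g = Sop u (\<lambda>x. (T u ^^ Suc n) g x - (T u ^^ n) g base)"
    using Suc by simp
  also have "\<dots> = (\<lambda>x. (T u ^^ Suc (Suc n)) g x - (T u ^^ Suc n) g base)"
    using T_diff_const[OF assms(1,2) T_funpow_wspace[OF assms, of "Suc n"]] by (auto simp: Sop_def[abs_def])
  finally show ?case .
qed

lemma wball_osc:
  assumes g: "g \<in> wball SS (\<lambda>x. c * V s x)" and c: "c \<ge> 0" and \<beta>: "\<beta> > 0"
  shows "osc s \<beta> (c / \<beta>) g"
  unfolding osc_def
proof (intro allI)
  fix x y
  have "\<bar>g x - g y\<bar> \<le> c * V s x + c * V s y"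
    using wball_bound[OF g, of x] wball_bound[OF g, of y] by simp
  also have "\<dots> = c / \<beta> * (\<beta> * V s x + \<beta> * V s y)" using \<beta> by (simp add: field_simps)
  also have "\<dots> \<le> c / \<beta> * (2 + \<beta> * V s x + \<beta> * V s y)" using c \<beta> by (intro mult_left_mono) auto
  finally show "\<bar>g x - g y\<bar> \<le> c / \<beta> * (2 + \<beta> * V s x + \<beta> * V s y)" .
qed

text \<open>A converse to \<open>wball_osc\<close>: once the value at \<open>base\<close> is
  subtracted, the oscillation controls the weighted norm, constants being absorbed by
  \<open>V \<ge> 1\<close>.\<close>

lemma osc_centered:
  assumes h: "osc s \<beta> c h" and hm: "h \<in> borel_measurable SS" and c: "c \<ge> 0" "\<beta> \<ge> 0"
  shows "(\<lambda>y. h y - h base) \<in> wball SS (\<lambda>y. c * (2 + \<beta> + \<beta> * V s base) * V s y)"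
proof (rule wballI)
  show "(\<lambda>y. h y - h base) \<in> borel_measurable SS" using hm by measurable
  fix y :: "'y \<times> 'z"
  have "2 + \<beta> * V s y + \<beta> * V s base \<le> 2 * V s y + \<beta> * V s y + \<beta> * V s base * V s y"
    using V_ge1[of s y] mult_left_mono[OF V_ge1[of s y], of "\<beta> * V s base"] c V_pos(2)[of s base] by simp
  then have "c * (2 + \<beta> * V s y + \<beta> * V s base) \<le> c * ((2 + \<beta> + \<beta> * V s base) * V s y)"
    using c by (intro mult_left_mono) (simp_all add: algebra_simps)
  then show "\<bar>h y - h base\<bar> \<le> c * (2 + \<beta> + \<beta> * V s base) * V s y"
    using oscD[OF h, of y base] by (simp add: mult.assoc)
qed

lemma Sop_regop:
  assumes s: "s \<le> k"
  obtains c r where "c > 0" "0 < r" "r < 1"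
    "\<And>u n. u \<in> {0..1} \<Longrightarrow> regop SS (V s) SS (V s) (c * r ^ n) (Sop u ^^ n)"
proof -
  obtain \<beta> B r where B: "\<beta> > 0" "B > 0" "0 < r" "r < 1"
    "\<And>us g c. adm 0 us \<Longrightarrow> g \<in> wspace SS (V s) \<Longrightarrow> osc s \<beta> c g \<Longrightarrow> 0 \<le> c \<Longrightarrow> osc s \<beta> (B * r ^ length us * c) (TL us g)"
    using contraction[OF s, of 0] by blast
  define D where "D = B / \<beta> * (2 + \<beta> + \<beta> * V s base)"
  have "0 < 2 + \<beta> + \<beta> * V s base" using B(1) V_pos(2)[of s base] by (simp add: add_pos_nonneg)
  then have D: "D > 0" using B(1,2) by (simp add: D_def)
  \<comment> \<open>The entry 1 is for the zeroth power. The division by \<open>r\<close> is there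
    because \<open>n\<close> factors of \<open>Sop u\<close> contain only \<open>n - 1\<close>
    contracting steps before the centering.\<close>
  define c where "c = max 1 (D * K1 / r)"
  have c: "c \<ge> 1" "D * K1 \<le> c * r" using B by (auto simp: c_def max_def field_simps)
  have "regop SS (V s) SS (V s) (c * r ^ n) (Sop u ^^ n)" if u: "u \<in> {0..1}" for u n
  proof (cases n)
    case 0
    have "regop SS (V s) SS (V s) 1 (\<lambda>g. g)" by (auto simp: regop_def intro!: regfunI)
    then have "regop SS (V s) SS (V s) c (\<lambda>g. g)" by (rule regop_weaken_const) (use c V_pos in auto)
    then show ?thesis by (simp add: 0 id_def)
  next
    case (Suc n')
    show ?thesis
      unfolding regop_def Suc
    proof safe
      fix g assume g: "g \<in> wball SS (V s)"
      have gw: "g \<in> wspace SS (V s)" by (rule wball_wspace[OF g])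
      define h where "h = (T u ^^ n') g"
      have hw: "h \<in> wspace SS (V s)" unfolding h_def by (rule T_funpow_wspace[OF u s gw])
      have "osc s \<beta> (1 / \<beta>) g" using wball_osc[of g 1 s \<beta>] g B by simp
      then have "osc s \<beta> (B * r ^ n' * (1 / \<beta>)) h"
        unfolding h_def T_funpow using B(5)[OF _ gw, of "replicate n' u" "1 / \<beta>"] B(1) good_replicate[OF u] by (simp add: adm_def)
      note cent = osc_centered[OF this wspace_meas[OF hw]]
      have h': "(\<lambda>y. h y - h base) \<in> wball SS (\<lambda>y. (D * r ^ n') * V s y)"
      proof -
        have "B * r ^ n' * (1 / \<beta>) * (2 + \<beta> + \<beta> * V s base) = D * r ^ n'" by (simp add: D_def)
        moreover have "0 \<le> B * r ^ n' * (1 / \<beta>)" "0 \<le> \<beta>" using B by auto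
        ultimately show ?thesis using cent by simp
      qed
      \<comment> \<open>Centering happens before the last step: the iterate is one application of
        \<open>T u\<close> to a centered function, whose norm the oscillation controls.\<close>
      have eq: "(Sop u ^^ Suc n') g = (\<lambda>x. T u (\<lambda>y. h y - h base) x)"
        unfolding Sop_funpow[OF u s gw] T_diff_const[OF u s hw] by (simp add: h_def)
      have "T u (\<lambda>y. h y - h base) \<in> wball SS (\<lambda>x. (D * r ^ n' * K1) * V s x)"
        using regop_wball[OF T_regop[OF u s] h'] D B by simp
      then show "(Sop u ^^ Suc n') g \<in> wball SS (\<lambda>x. c * r ^ Suc n' * V s x)"
        unfolding eq
      proof (rule wball_mono)
        fix x
        have "D * K1 * (r ^ n' * V s x) \<le> c * r * (r ^ n' * V s x)"
          using c(2) B V_pos by (intro mult_right_mono) auto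
        then show "D * r ^ n' * K1 * V s x \<le> c * r ^ Suc n' * V s x" by (simp add: ac_simps)
      qed
    next
      fix x
      have "regfun SS (V s) (\<lambda>g. (T u ^^ Suc n') g x - (T u ^^ n') g base)"
        unfolding T_funpow using u by (intro regfun_diff_fun regopD(2)[OF TL_regop[OF _ s]]) auto
      then show "regfun SS (V s) (\<lambda>g. (Sop u ^^ Suc n') g x)"
        by (rule regfun_cong_fun) (simp only: Sop_funpow[OF u s])
    qed
  qed
  then show ?thesis using that[of c r] B c by auto
qed

definition Y :: "real \<Rightarrow> ('y \<times> 'z \<Rightarrow> real) \<Rightarrow> 'y \<times> 'z \<Rightarrow> real" where "Y u = neumann (Sop u)"

lemma Y_regop: obtains c where "c > 0" "\<And>s u. s \<le> k \<Longrightarrow> u \<in> {0..1} \<Longrightarrow> regop SS (V s) SS (V s) c (Y u)"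
proof -
  have "\<exists>c>0. \<forall>u\<in>{0..1}. regop SS (V s) SS (V s) c (Y u)" if s: "s \<le> k" for s
  proof -
    obtain c r where c: "c > 0" "0 < r" "r < 1" "\<And>u n. u \<in> {0..1} \<Longrightarrow> regop SS (V s) SS (V s) (c * r ^ n) (Sop u ^^ n)"
      using Sop_regop[OF s] by blast
    then show ?thesis unfolding Y_def
      by (intro exI[of _ "c / (1 - r)"] conjI ballI neumann_regop) (auto simp: V_pos)
  qed
  then obtain c where c: "\<And>s. s \<le> k \<Longrightarrow> c s > 0" "\<And>s u. s \<le> k \<Longrightarrow> u \<in> {0..1} \<Longrightarrow> regop SS (V s) SS (V s) (c s) (Y u)"
    by metis
  show ?thesis
  \<comment> \<open>\<open>opC_inverse\<close> asks for one constant valid on all levels; the sum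
    over the levels dominates each.\<close>
  proof (rule that[of "\<Sum>s\<le>k. c s"])
    show "0 < (\<Sum>s\<le>k. c s)" using c(1) by (intro sum_pos) auto
    fix s u assume s: "s \<le> k" and u: "u \<in> {0..1::real}"
    have "c s \<le> (\<Sum>s\<le>k. c s)" using s c(1) by (intro member_le_sum) (auto intro: less_imp_le)
    from regop_weaken_const[OF c(2)[OF s u] this] show "regop SS (V s) SS (V s) (\<Sum>s\<le>k. c s) (Y u)"
      by (simp add: V_pos)
  qed
qed

lemma Y_resolvent:
  assumes "s \<le> k" "u \<in> {0..1}" "v \<in> {0..1}" "g \<in> wspace SS (V s)"
  shows "Y v g x - Y u g x = Y u (\<lambda>y. Sop v (Y v g) y - Sop u (Y v g) y) x"
proof -
  obtain c r where c: "c > 0" "0 < r" "r < 1" "\<And>u n. u \<in> {0..1} \<Longrightarrow> regop SS (V s) SS (V s) (c * r ^ n) (Sop u ^^ n)"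
    using Sop_regop[OF assms(1)] by blast
  show ?thesis unfolding Y_def
    by (rule neumann_resolvent[OF _ c(1-3) c(4)[OF assms(2)] c(4)[OF assms(3)] assms(4)]) (auto simp: V_pos)
qed

text \<open>At \<open>base\<close> the partial sums of the Neumann series telescope to the iterates
  of \<open>T u\<close>; at any other state the vanishing oscillation forces the same limit. This
  identifies \<open>Y u g base\<close> as the ergodic limit.\<close>

lemma T_funpow_limit:
  assumes u: "u \<in> {0..1}" and s: "s \<le> k" and g: "g \<in> wspace SS (V s)"
  shows "(\<lambda>n. (T u ^^ n) g x) \<longlonglongrightarrow> Y u g base"
proof -
  obtain c r where c: "c > 0" "0 < r" "r < 1" "\<And>u n. u \<in> {0..1} \<Longrightarrow> regop SS (V s) SS (V s) (c * r ^ n) (Sop u ^^ n)"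
    using Sop_regop[OF s] by blast
  have sm: "summable (\<lambda>n. (Sop u ^^ n) g base)"
    by (rule neumann_summable[OF _ c(1-3) c(4)[OF u] g]) (auto simp: V_pos)
  have part: "(\<Sum>i<Suc n. (Sop u ^^ i) g base) = (T u ^^ n) g base" for n
  proof (induction n)
    case (Suc n)
    then show ?case using fun_cong[OF Sop_funpow[OF u s g, of n], of base] by simp
  qed simp
  have lim: "(\<lambda>n. (T u ^^ n) g base) \<longlonglongrightarrow> Y u g base"
    using LIMSEQ_Suc[OF summable_LIMSEQ[OF sm]] unfolding part Y_def neumann_def .
  obtain \<beta> B r where B: "\<beta> > 0" "B > 0" "0 < r" "r < 1"
    "\<And>us g c. adm 0 us \<Longrightarrow> g \<in> wspace SS (V s) \<Longrightarrow> osc s \<beta> c g \<Longrightarrow> 0 \<le> c \<Longrightarrow> osc s \<beta> (B * r ^ length us * c) (TL us g)"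
    using contraction[OF s, of 0] by blast
  obtain d where d: "d > 0" "g \<in> wball SS (\<lambda>x. d * V s x)" using g by (rule wspaceE)
  have "(\<lambda>n. (T u ^^ n) g x - (T u ^^ n) g base) \<longlonglongrightarrow> 0"
  proof (rule Lim_null_comparison)
    have "osc s \<beta> (B * r ^ n * (d / \<beta>)) ((T u ^^ n) g)" for n
      unfolding T_funpow using B(5)[OF _ g wball_osc[OF d(2)], of "replicate n u"] d B good_replicate[OF u]
      by (simp add: adm_def)
    from oscD[OF this]
    show "\<forall>\<^sub>F n in sequentially. norm ((T u ^^ n) g x - (T u ^^ n) g base) \<le> (B * r ^ n * (d / \<beta>)) * (2 + \<beta> * V s x + \<beta> * V s base)"
      by simp
    have "(\<lambda>n. r ^ n) \<longlonglongrightarrow> 0" using B by (intro LIMSEQ_realpow_zero) auto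
    note rn = this
    have "(\<lambda>n. B * r ^ n * (d / \<beta>) * (2 + \<beta> * V s x + \<beta> * V s base)) \<longlonglongrightarrow> B * 0 * (d / \<beta>) * (2 + \<beta> * V s x + \<beta> * V s base)"
      by (intro tendsto_mult tendsto_const rn)
    then show "(\<lambda>n. B * r ^ n * (d / \<beta>) * (2 + \<beta> * V s x + \<beta> * V s base)) \<longlonglongrightarrow> 0" by simp
  qed
  from tendsto_add[OF this lim] show ?thesis by simp
qed

lemma Y_regfun: "u \<in> {0..1} \<Longrightarrow> s \<le> k \<Longrightarrow> regfun SS (V s) (\<lambda>g. Y u g x)"
  by (rule Y_regop, rule regopD(2)) auto

lemma Y_indicator:
  assumes u: "u \<in> {0..1}" and A: "A \<in> sets SS" shows "0 \<le> Y u (indicator A) base"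
proof -
  have w: "indicator A \<in> wspace SS (V 0)" by (rule wball_wspace[OF indicator_wball[OF V_ge1 A]])
  have "0 \<le> (T u ^^ n) (indicator A) base" for n
    unfolding T_funpow by (subst TL_kernel_prod[OF _ _ w]) (use u in \<open>auto intro!: integral_nonneg_AE\<close>)
  then show ?thesis by (intro LIMSEQ_le_const[OF T_funpow_limit[OF u _ w]]) auto
qed

lemma Y_one: "u \<in> {0..1} \<Longrightarrow> Y u (\<lambda>_. 1) base = 1"
proof -
  assume u: "u \<in> {0..1}"
  have "(T u ^^ n) (\<lambda>_. 1) = (\<lambda>_. 1)" for n by (induction n) (simp_all add: T_const[OF u])
  then show ?thesis using T_funpow_limit[OF u _ const_wspace[of 1 0], of base] by (simp add: LIMSEQ_const_iff)
qed

lemma Y_T: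
  assumes u: "u \<in> {0..1}" and s: "s \<le> k" and g: "g \<in> wspace SS (V s)"
  shows "Y u (T u g) base = Y u g base"
proof -
  have "(\<lambda>n. (T u ^^ n) (T u g) base) \<longlonglongrightarrow> Y u (T u g) base"
    by (rule T_funpow_limit[OF u s T_wspace[OF u s g]])
  moreover have "(\<lambda>n. (T u ^^ Suc n) g base) \<longlonglongrightarrow> Y u g base"
    by (rule LIMSEQ_Suc[OF T_funpow_limit[OF u s g]])
  ultimately show ?thesis by (auto simp: funpow_swap1 intro: LIMSEQ_unique)
qed

section \<open>Existence and uniqueness of the invariant law\<close>

lemma ind_wspace: "A \<in> sets SS \<Longrightarrow> (indicator A :: _ \<Rightarrow> real) \<in> wspace SS (V s)"
  by (rule wball_wspace[OF indicator_wball[OF V_ge1]])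

text \<open>The candidate represents the functional \<open>g \<mapsto> Y u g base\<close>, which
  inherits nonnegativity, normalization and invariance from the iterates of
  \<open>T u\<close>.\<close>

lemma invariant_exists:
  assumes u: "u \<in> {0..1}"
  obtains N where "invariant_prob SS (Q u) N" "integrable N (V k)" "\<And>g. g \<in> wspace SS (V k) \<Longrightarrow> (\<integral>x. g x \<partial>N) = Y u g base"
proof -
  obtain N where N: "sets N = sets SS" "finite_measure N" "integrable N (V k)"
    and int: "\<And>g. g \<in> wspace SS (V k) \<Longrightarrow> (\<integral>x. g x \<partial>N) = Y u g base"
    using regfun_positive_measure[OF Y_regfun[OF u, of k base] V_ge1 V_meas Y_indicator[OF u]] by auto
  interpret N: finite_measure N by fact
  have spN: "space N = UNIV" using sets_eq_imp_space_eq[OF N(1)] by simp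
  have mN: "measure N A = Y u (indicator A) base" if A: "A \<in> sets SS" for A
    using int[OF ind_wspace[OF A]] A N(1) spN by simp
  have "indicator (space SS) = (\<lambda>_::'y \<times> 'z. 1::real)" by (auto simp: fun_eq_iff)
  then have "measure N (space N) = 1"
    using mN[OF sets.top] Y_one[OF u] spN by simp
  then have pN: "prob_space N" by (intro prob_spaceI) (simp add: N.emeasure_eq_measure)
  then have NA: "N \<in> space (prob_algebra SS)" using N by (simp add: space_prob_algebra)
  have iT: "(\<integral>x. g x \<partial>(N \<bind> Q u)) = (\<integral>x. g x \<partial>N)" if g: "g \<in> wspace SS (V k)" for g
  proof -
    have "(\<integral>x. g x \<partial>(N \<bind> Q u)) = (\<integral>x. (\<integral>y. g y \<partial>Q u x) \<partial>N)"
      by (rule integral_bind_kernel(1)[OF NA Q_markov[OF u] V_meas V_ge1 V_meas V_pos(2) Q_growth[OF u order_refl] _ N(3) g])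
         (use K1 in auto)
    also have "\<dots> = (\<integral>x. T u g x \<partial>N)" by (simp add: T_def)
    also have "\<dots> = Y u (T u g) base" by (rule int[OF T_wspace[OF u order_refl g]])
    also have "\<dots> = (\<integral>x. g x \<partial>N)" using Y_T[OF u order_refl g] int[OF g] by simp
    finally show ?thesis .
  qed
  note NQ = prob_space_bind'[OF NA Q_markov[OF u]] sets_bind'[OF NA Q_markov[OF u]]
  interpret NQ: prob_space "N \<bind> Q u" by (rule NQ)
  have spNQ: "space (N \<bind> Q u) = UNIV" using sets_eq_imp_space_eq[OF NQ(2)] by simp
  have "N \<bind> Q u = N"
  proof (rule measure_eqI)
    show "sets (N \<bind> Q u) = sets N" using NQ(2) N(1) by simp
    fix A assume "A \<in> sets (N \<bind> Q u)"
    then have A: "A \<in> sets SS" using NQ(2) by simp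
    show "emeasure (N \<bind> Q u) A = emeasure N A"
      using iT[OF ind_wspace[OF A]] A N(1) NQ(2) spN spNQ
      by (simp add: N.emeasure_eq_measure NQ.emeasure_eq_measure)
  qed
  then have "invariant_prob SS (Q u) N" using NA by (simp add: invariant_prob_def)
  from that[OF this N(3) int] show ?thesis .
qed

text \<open>An arbitrary invariant law is not known to integrate any \<open>V s\<close>, so the
  argument runs with the constant weight 1: the integral of the iterates is constant, and bounded
  convergence sends it to the ergodic limit.\<close>

lemma invariant_measure:
  assumes u: "u \<in> {0..1}" and N: "invariant_prob SS (Q u) N" and A: "A \<in> sets SS"
  shows "measure N A = Y u (indicator A) base"
proof -
  have NA: "N \<in> space (prob_algebra SS)" and inv: "N \<bind> Q u = N" using N by (auto simp: invariant_prob_def)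
  have N': "sets N = sets SS" "prob_space N" using NA by (auto simp: space_prob_algebra)
  interpret N: prob_space N by fact
  have spN: "space N = UNIV" using sets_eq_imp_space_eq[OF N'(1)] by simp
  have int: "integrable N (\<lambda>_. 1::real)" by simp
  have one: "(\<integral>\<^sup>+y. ennreal 1 \<partial>Q u x) \<le> ennreal (1 * 1)" for x
    using prob_space.emeasure_space_1[OF kernelD(1)[OF Q_markov[OF u], of x]] by simp
  have iT: "(\<integral>x. g x \<partial>N) = (\<integral>x. T u g x \<partial>N)" if g: "g \<in> wspace SS (\<lambda>_. 1)" for g
  proof -
    have "(\<integral>x. g x \<partial>(N \<bind> Q u)) = (\<integral>x. (\<integral>y. g y \<partial>Q u x) \<partial>N)"
      by (rule integral_bind_kernel(1)[OF NA Q_markov[OF u], of "\<lambda>_. 1" "\<lambda>_. 1" 1])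
         (use int g one in auto)
    then show ?thesis unfolding inv by (simp add: T_def)
  qed
  have T1: "regop SS (\<lambda>_. 1) SS (\<lambda>_. 1) 1 (T u)"
    unfolding T_def[abs_def] by (rule kernel_regop[OF Q_markov[OF u]]) (use one in auto)
  have iw: "indicator A \<in> wball SS (\<lambda>_. 1::real)" using A by (intro indicator_wball) auto
  have bT: "(T u ^^ n) (indicator A) \<in> wball SS (\<lambda>_. 1)" for n
  proof (induction n)
    case (Suc n) then show ?case using regopD(1)[OF T1] by auto
  qed (use iw in simp)
  have eq: "(\<integral>x. (T u ^^ n) (indicator A) x \<partial>N) = measure N A" for n
  proof (induction n)
    case (Suc n) then show ?case using iT[OF wball_wspace[OF bT[of n]]] by simp
  qed (use A N' spN in simp)
  have "(\<lambda>n. \<integral>x. (T u ^^ n) (indicator A) x \<partial>N) \<longlonglongrightarrow> (\<integral>x. Y u (indicator A) base \<partial>N)"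
  proof (rule integral_dominated_convergence[OF _ _ int])
    show "(T u ^^ n) (indicator A) \<in> borel_measurable N" for n
      using wball_meas[OF bT[of n]] N' by (simp cong: measurable_cong_sets)
    show "AE x in N. (\<lambda>n. (T u ^^ n) (indicator A) x) \<longlonglongrightarrow> Y u (indicator A) base"
      by (intro AE_I2 T_funpow_limit[OF u _ ind_wspace[OF A, of 0]]) simp
    show "AE x in N. norm ((T u ^^ n) (indicator A) x) \<le> 1" for n
      using wball_bound[OF bT[of n]] by (intro AE_I2) auto
  qed simp
  then show ?thesis unfolding eq by (simp add: LIMSEQ_const_iff N.prob_space)
qed

lemma invariant_unique: "u \<in> {0..1} \<Longrightarrow> \<exists>!N. invariant_prob SS (Q u) N"
proof -
  assume u: "u \<in> {0..1}"
  obtain N where N: "invariant_prob SS (Q u) N" using invariant_exists[OF u] by blast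
  show ?thesis
  proof (rule ex1I[where P = "invariant_prob SS (Q u)" and a = N, OF N])
    fix N' assume N': "invariant_prob SS (Q u) N'"
    have ss: "sets N' = sets SS" "sets N = sets SS" "prob_space N'" "prob_space N"
      using N N' by (auto simp: invariant_prob_def space_prob_algebra)
    show "N' = N"
    proof (rule measure_eqI)
      show "emeasure N' A = emeasure N A" if "A \<in> sets N'" for A
        using that ss invariant_measure[OF u N', of A] invariant_measure[OF u N, of A]
        by (simp add: finite_measure.emeasure_eq_measure prob_space.finite_measure)
    qed (use ss in simp)
  qed
qed

definition stat :: "real \<Rightarrow> ('y \<times> 'z) measure" where "stat u = invariant_law SS (Q u)"

lemma stat:
  assumes u: "u \<in> {0..1}"
  shows "stat u \<in> space (prob_algebra SS)" "stat u \<bind> Q u = stat u" "integrable (stat u) (V k)"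
    and "s \<le> k \<Longrightarrow> g \<in> wspace SS (V s) \<Longrightarrow> (\<integral>x. g x \<partial>stat u) = Y u g base"
proof -
  obtain N where N: "invariant_prob SS (Q u) N" "integrable N (V k)" "\<And>g. g \<in> wspace SS (V k) \<Longrightarrow> (\<integral>x. g x \<partial>N) = Y u g base"
    using invariant_exists[OF u] by blast
  have "stat u = N" unfolding stat_def invariant_law_def by (rule the1_equality[OF invariant_unique[OF u] N(1)])
  with N show "stat u \<in> space (prob_algebra SS)" "stat u \<bind> Q u = stat u" "integrable (stat u) (V k)"
    and "s \<le> k \<Longrightarrow> g \<in> wspace SS (V s) \<Longrightarrow> (\<integral>x. g x \<partial>stat u) = Y u g base"
    by (auto simp: invariant_prob_def intro!: N(3) wspace_mono[of g SS "V s" "V k"] V_mono)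
qed

end

section \<open>Derivatives of the transition densities\<close>

text \<open>The sequence may hit \<open>u\<close>, about which \<open>at u within S\<close> says
  nothing; there the value agrees with the limit \<open>F u\<close>.\<close>

lemma tendsto_within_seq:
  assumes F: "(F \<longlongrightarrow> F u) (at u within S)" and v: "\<And>n::nat. v n \<in> S" "v \<longlonglongrightarrow> u"
  shows "(\<lambda>n. F (v n)) \<longlonglongrightarrow> F u"
  unfolding tendsto_def
proof safe
  fix G assume G: "open G" "F u \<in> G"
  then have "eventually (\<lambda>x. F x \<in> G) (at u within S)" using F by (auto simp: tendsto_def)
  then have "eventually (\<lambda>x. x \<noteq> u \<longrightarrow> x \<in> S \<longrightarrow> F x \<in> G) (nhds u)" by (simp add: eventually_at_filter)
  then have "eventually (\<lambda>n. v n \<noteq> u \<longrightarrow> v n \<in> S \<longrightarrow> F (v n) \<in> G) sequentially"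
    using v(2) by (rule eventually_compose_filterlim)
  then show "\<forall>\<^sub>F n in sequentially. F (v n) \<in> G"
    by eventually_elim (use v(1) G in auto)
qed

lemma integral_tendsto_0I:
  fixes a :: "nat \<Rightarrow> real" and e :: "nat \<Rightarrow> ennreal"
  assumes le: "\<And>n. ennreal \<bar>a n\<bar> \<le> ennreal D * e n" and e: "e \<longlonglongrightarrow> 0"
  shows "a \<longlonglongrightarrow> 0"
proof -
  have "(\<lambda>n. ennreal D * e n) \<longlonglongrightarrow> ennreal D * 0" by (rule ennreal_tendsto_cmult[OF _ e]) simp
  then have "(\<lambda>n. ennreal D * e n) \<longlonglongrightarrow> 0" by simp
  then have "(\<lambda>n. ennreal \<bar>a n\<bar>) \<longlonglongrightarrow> 0"
    by (rule tendsto_sandwich[OF _ _ tendsto_const, rotated 2]) (auto simp: le)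
  then have "(\<lambda>n. ennreal \<bar>a n\<bar>) \<longlonglongrightarrow> ennreal 0" by simp
  then have "(\<lambda>n. \<bar>a n\<bar>) \<longlonglongrightarrow> 0" by (rule tendsto_ennrealD) auto
  then show ?thesis by (simp add: tendsto_rabs_zero_iff)
qed

lemma abs_integral_le_nn: "ennreal \<bar>\<integral>x. f x \<partial>M\<bar> \<le> (\<integral>\<^sup>+x. ennreal \<bar>f x\<bar> \<partial>M)" for f :: "'a \<Rightarrow> real"
proof (cases "integrable M f")
  case True
  then show ?thesis using integral_norm_bound_ennreal[OF True] by simp
qed (simp add: not_integrable_integral_eq)

text \<open>The pointwise mean value bound is taken along Riemann sums, so that Fatou's lemma applies
  without joint measurability in the parameter and without \<open>\<sigma>\<close>-finiteness.\<close>

lemma nn_integral_mean_value: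
  fixes H H' :: "real \<Rightarrow> 'a \<Rightarrow> real"
  assumes der: "\<And>x w. x \<in> space M \<Longrightarrow> w \<in> {0..1} \<Longrightarrow> ((\<lambda>t. H t x) has_real_derivative H' w x) (at w within {0..1})"
    and cont: "\<And>x. x \<in> space M \<Longrightarrow> continuous_on {0..1} (\<lambda>w. H' w x)"
    and meas: "\<And>w. w \<in> {0..1} \<Longrightarrow> H' w \<in> borel_measurable M"
    and uv: "u \<in> {0..1}" "v \<in> {0..1}"
    and c: "\<And>w. w \<in> closed_segment u v \<Longrightarrow> (\<integral>\<^sup>+x. ennreal \<bar>H' w x\<bar> \<partial>M) \<le> c"
  shows "(\<integral>\<^sup>+x. ennreal \<bar>H v x - H u x\<bar> \<partial>M) \<le> ennreal \<bar>v - u\<bar> * c"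
proof -
  define p where "p n j = u + (v - u) * (real j / real (Suc n))" for n j
  have p_seg: "p n j \<in> closed_segment u v" if "j \<le> Suc n" for n j
  proof -
    have "0 \<le> real j / real (Suc n)" "real j / real (Suc n) \<le> 1"
      using that by (auto simp: divide_le_eq simp del: of_nat_Suc)
    moreover have "p n j = (1 - real j / real (Suc n)) * u + real j / real (Suc n) * v"
    proof -
      have "u + (v - u) * t = (1 - t) * u + t * v" for t by (simp add: algebra_simps)
      then show ?thesis unfolding p_def .
    qed
    ultimately show ?thesis unfolding closed_segment_def real_scaleR_def mem_Collect_eq by blast
  qed
  have seg_I: "closed_segment u v \<subseteq> {0..1}"
    using uv by (intro closed_segment_subset) auto
  have p_I: "p n j \<in> {0..1}" if "j \<le> Suc n" for n j using p_seg[OF that] seg_I by blast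
  define R where "R n x = (\<Sum>j<Suc n. \<bar>v - u\<bar> / real (Suc n) * \<bar>H' (p n j) x\<bar>)" for n x
  have R_meas: "R n \<in> borel_measurable M" for n
    unfolding R_def[abs_def] using meas p_I by (intro borel_measurable_sum borel_measurable_times borel_measurable_abs) auto
  have R0: "0 \<le> R n x" for n x unfolding R_def by (intro sum_nonneg) auto
  have Rint: "(\<integral>\<^sup>+x. ennreal (R n x) \<partial>M) \<le> ennreal \<bar>v - u\<bar> * c" for n
  proof -
    have m: "H' (p n j) \<in> borel_measurable M" if "j < Suc n" for j using that by (intro meas p_I) auto
    have "(\<integral>\<^sup>+x. ennreal (R n x) \<partial>M) = (\<integral>\<^sup>+x. (\<Sum>j<Suc n. ennreal (\<bar>v - u\<bar> / real (Suc n)) * ennreal \<bar>H' (p n j) x\<bar>) \<partial>M)"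
    proof (intro nn_integral_cong)
      fix x
      have "ennreal (R n x) = (\<Sum>j<Suc n. ennreal (\<bar>v - u\<bar> / real (Suc n) * \<bar>H' (p n j) x\<bar>))"
        unfolding R_def by (rule sum_ennreal[symmetric]) simp
      also have "\<dots> = (\<Sum>j<Suc n. ennreal (\<bar>v - u\<bar> / real (Suc n)) * ennreal \<bar>H' (p n j) x\<bar>)"
        by (intro sum.cong refl ennreal_mult) auto
      finally show "ennreal (R n x) = (\<Sum>j<Suc n. ennreal (\<bar>v - u\<bar> / real (Suc n)) * ennreal \<bar>H' (p n j) x\<bar>)" .
    qed
    also have "\<dots> = (\<Sum>j<Suc n. \<integral>\<^sup>+x. ennreal (\<bar>v - u\<bar> / real (Suc n)) * ennreal \<bar>H' (p n j) x\<bar> \<partial>M)"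
      by (rule nn_integral_sum) (use m in measurable)
    also have "\<dots> = (\<Sum>j<Suc n. ennreal (\<bar>v - u\<bar> / real (Suc n)) * (\<integral>\<^sup>+x. ennreal \<bar>H' (p n j) x\<bar> \<partial>M))"
      by (intro sum.cong refl nn_integral_cmult) (use m in measurable)
    also have "\<dots> \<le> (\<Sum>j<Suc n. ennreal (\<bar>v - u\<bar> / real (Suc n)) * c)"
      by (intro sum_mono mult_left_mono c p_seg) auto
    also have "\<dots> = (of_nat (Suc n) * ennreal (\<bar>v - u\<bar> / real (Suc n))) * c"
      by (simp add: mult.assoc del: of_nat_Suc)
    also have "of_nat (Suc n) * ennreal (\<bar>v - u\<bar> / real (Suc n)) = ennreal \<bar>v - u\<bar>"
      by (simp add: ennreal_of_nat_eq_real_of_nat ennreal_mult[symmetric] del: of_nat_Suc)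
    finally show ?thesis .
  qed
  \<comment> \<open>For fixed \<open>x\<close> the derivative is uniformly continuous in the
    parameter, so on a short interval it exceeds its value at the left division point by at most
    \<open>e\<close>.\<close>
  have lower: "\<forall>\<^sub>F n in sequentially. \<bar>H v x - H u x\<bar> \<le> R n x + e * \<bar>v - u\<bar>" if x: "x \<in> space M" and e: "e > 0" for x e
  proof -
    have "uniformly_continuous_on {0..1} (\<lambda>w. H' w x)"
      by (rule compact_uniformly_continuous[OF cont[OF x]]) simp
    then obtain d where d: "d > 0" "\<And>w w'. w \<in> {0..1} \<Longrightarrow> w' \<in> {0..1} \<Longrightarrow> \<bar>w' - w\<bar> < d \<Longrightarrow> \<bar>H' w' x - H' w x\<bar> < e"
      using e unfolding uniformly_continuous_on_def dist_real_def by metis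
    have "(\<lambda>n. \<bar>v - u\<bar> * inverse (real (Suc n))) \<longlonglongrightarrow> \<bar>v - u\<bar> * 0"
      by (intro tendsto_mult tendsto_const LIMSEQ_inverse_real_of_nat)
    then have "\<forall>\<^sub>F n in sequentially. \<bar>v - u\<bar> * inverse (real (Suc n)) < d"
      using d by (intro order_tendstoD(2)) auto
    then show ?thesis
    proof eventually_elim
      case (elim n)
      have step: "\<bar>H (p n (Suc j)) x - H (p n j) x\<bar> \<le> (\<bar>H' (p n j) x\<bar> + e) * (\<bar>v - u\<bar> / real (Suc n))" if j: "j < Suc n" for j
      proof -
        have dp: "p n (Suc j) - p n j = (v - u) / real (Suc n)"
          by (simp add: p_def field_simps del: of_nat_Suc) (simp add: algebra_simps)
        have pI: "p n j \<in> {0..1}" "p n (Suc j) \<in> {0..1}" using j by (auto intro!: p_I simp del: atLeastAtMost_iff)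
        let ?S = "closed_segment (p n j) (p n (Suc j))"
        have S: "?S \<subseteq> {0..1}" using pI by (intro closed_segment_subset) auto
        have "norm (H (p n (Suc j)) x - H (p n j) x) \<le> (\<bar>H' (p n j) x\<bar> + e) * norm (p n (Suc j) - p n j)"
        proof (rule field_differentiable_bound[of ?S "\<lambda>t. H t x" "\<lambda>t. H' t x"])
          show "((\<lambda>t. H t x) has_field_derivative H' z x) (at z within ?S)" if "z \<in> ?S" for z
            using S that by (intro DERIV_subset[OF der[OF x]]) auto
          show "norm (H' z x) \<le> \<bar>H' (p n j) x\<bar> + e" if z: "z \<in> ?S" for z
          proof -
            have "\<bar>z - p n j\<bar> \<le> \<bar>p n (Suc j) - p n j\<bar>"
              using z by (auto simp: closed_segment_eq_real_ivl split: if_splits)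
            also have "\<dots> = \<bar>v - u\<bar> * inverse (real (Suc n))" unfolding dp by (simp add: abs_divide divide_inverse abs_mult del: of_nat_Suc)
            also have "\<dots> < d" by (rule elim)
            finally have "\<bar>H' z x - H' (p n j) x\<bar> < e" using S z pI by (intro d(2)) auto
            then show ?thesis by simp
          qed
        qed auto
        then show ?thesis unfolding dp by (simp add: abs_divide)
      qed
      have "p n (Suc n) = v" "p n 0 = u" by (auto simp: p_def simp del: of_nat_Suc)
      then have "H v x - H u x = (\<Sum>j<Suc n. H (p n (Suc j)) x - H (p n j) x)"
        using sum_lessThan_telescope[of "\<lambda>j. H (p n j) x" "Suc n"] by simp
      also have "\<bar>\<dots>\<bar> \<le> (\<Sum>j<Suc n. (\<bar>H' (p n j) x\<bar> + e) * (\<bar>v - u\<bar> / real (Suc n)))"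
        by (rule order_trans[OF sum_abs sum_mono]) (use step in auto)
      also have "\<dots> = R n x + (\<Sum>j<Suc n. e * (\<bar>v - u\<bar> / real (Suc n)))"
        unfolding R_def sum.distrib[symmetric] by (intro sum.cong refl) (simp only: distrib_right mult.commute)
      also have "(\<Sum>j<Suc n. e * (\<bar>v - u\<bar> / real (Suc n))) = e * \<bar>v - u\<bar>"
        by (simp del: of_nat_Suc)
      finally show ?case .
    qed
  qed
  have "ennreal \<bar>H v x - H u x\<bar> \<le> liminf (\<lambda>n. ennreal (R n x))" if x: "x \<in> space M" for x
    unfolding le_Liminf_iff
  proof safe
    fix y assume y: "y < ennreal \<bar>H v x - H u x\<bar>"
    then obtain r where r: "0 \<le> r" "y = ennreal r" by (cases y) (auto simp: top_unique)
    have rl: "r < \<bar>H v x - H u x\<bar>" using y r by (simp add: ennreal_less_iff)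
    \<comment> \<open>Half of the gap divided by the length of the segment; the summand 1 keeps the
      denominator positive when \<open>u = v\<close>.\<close>
    define e where "e = (\<bar>H v x - H u x\<bar> - r) / (2 * (\<bar>v - u\<bar> + 1))"
    have e: "e > 0" unfolding e_def using rl by (intro divide_pos_pos mult_pos_pos) auto
    have "e * \<bar>v - u\<bar> < \<bar>H v x - H u x\<bar> - r"
    proof -
      have "e * \<bar>v - u\<bar> \<le> e * (\<bar>v - u\<bar> + 1)" using e by simp
      also have "\<dots> = (\<bar>H v x - H u x\<bar> - r) / 2"
      proof -
        have "a / (2 * b) * b = a / 2" if "b \<noteq> 0" for a b :: real using that by simp
        moreover have "\<bar>v - u\<bar> + 1 \<noteq> 0" by linarith
        ultimately show ?thesis unfolding e_def by blast
      qed
      also have "\<dots> < \<bar>H v x - H u x\<bar> - r" using rl by simp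
      finally show ?thesis .
    qed
    then show "\<forall>\<^sub>F n in sequentially. y < ennreal (R n x)"
      using lower[OF x e] by (elim eventually_mono) (use r R0 in \<open>auto simp: ennreal_less_iff\<close>)
  qed
  then have "(\<integral>\<^sup>+x. ennreal \<bar>H v x - H u x\<bar> \<partial>M) \<le> (\<integral>\<^sup>+x. liminf (\<lambda>n. ennreal (R n x)) \<partial>M)"
    by (rule nn_integral_mono)
  also have "\<dots> \<le> liminf (\<lambda>n. \<integral>\<^sup>+x. ennreal (R n x) \<partial>M)"
    by (rule nn_integral_liminf) (use R_meas in measurable)
  also have "\<dots> \<le> liminf (\<lambda>n. ennreal \<bar>v - u\<bar> * c)" by (rule Liminf_mono) (auto simp: Rint)
  finally show ?thesis by (simp add: Liminf_const)
qed

lemma Ck01_deriv: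
  assumes "Ck01 k g" "l < k" "u \<in> {0..1}"
  shows "(nth_deriv01 l g has_real_derivative nth_deriv01 (Suc l) g u) (at u within {0..1})"
proof -
  have "nth_deriv01 l g differentiable (at u within {0..1})"
    using assms by (auto simp: Ck01_def differentiable_on_def)
  then have "(nth_deriv01 l g has_vector_derivative vector_derivative (nth_deriv01 l g) (at u within {0..1})) (at u within {0..1})"
    by (simp add: vector_derivative_works)
  then show ?thesis by (simp add: has_real_derivative_iff_has_vector_derivative)
qed

lemma Ck01_cont: "Ck01 k g \<Longrightarrow> l \<le> k \<Longrightarrow> continuous_on {0..1} (nth_deriv01 l g)"
  by (auto simp: Ck01_def)

lemma deriv_seq:
  assumes "(F has_real_derivative D) (at u within {0..1})" "\<And>n. v n \<in> {0..1} - {u}" "v \<longlonglongrightarrow> u"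
  shows "(\<lambda>n. (F (v n) - F u) / (v n - u)) \<longlonglongrightarrow> D"
  using assms unfolding has_field_derivative_iff tendsto_at_iff_sequentially by (auto simp: o_def)

lemma approach_seq:
  assumes "u \<in> {0..1::real}"
  obtains v where "\<And>n::nat. v n \<in> {0..1} - {u}" "v \<longlonglongrightarrow> u"
proof (cases "u = 1")
  case True
  show ?thesis
  proof (rule that[of "\<lambda>n. 1 - inverse (real (Suc n))"])
    show "(\<lambda>n. 1 - inverse (real (Suc n))) \<longlonglongrightarrow> u"
      using tendsto_diff[OF tendsto_const LIMSEQ_inverse_real_of_nat, of 1] True by simp
  qed (auto simp: True inverse_eq_divide divide_le_eq)
next
  case False
  then have u: "0 \<le> u" "u < 1" using assms by auto
  show ?thesis
  proof (rule that[of "\<lambda>n. u + (1 - u) * inverse (real (Suc n))"])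
    have "(1 - u) * inverse (real (Suc n)) \<le> (1 - u) * 1" for n
      using u by (intro mult_left_mono) (auto simp: inverse_eq_divide divide_le_eq)
    moreover have "0 < (1 - u) * inverse (real (Suc n))" for n using u by (intro mult_pos_pos) auto
    moreover have "u + t \<in> {0..1} - {u}" if "0 < t" "t \<le> (1 - u) * 1" for t using that u by auto
    ultimately show "u + (1 - u) * inverse (real (Suc n)) \<in> {0..1} - {u}" for n by blast
    have "(\<lambda>n. u + (1 - u) * inverse (real (Suc n))) \<longlonglongrightarrow> u + (1 - u) * 0"
      by (intro tendsto_intros LIMSEQ_inverse_real_of_nat)
    then show "(\<lambda>n. u + (1 - u) * inverse (real (Suc n))) \<longlonglongrightarrow> u" by simp
  qed
qed

text \<open>Each derivative is the limit of difference quotients along one sequence that is the same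
  for all \<open>x\<close>.\<close>

lemma nth_deriv01_measurable:
  assumes Ck: "\<And>x. x \<in> space M \<Longrightarrow> Ck01 k (\<lambda>v. F v x)"
    and m: "\<And>u. u \<in> {0..1} \<Longrightarrow> F u \<in> borel_measurable M"
  shows "l \<le> k \<Longrightarrow> u \<in> {0..1} \<Longrightarrow> (\<lambda>x. nth_deriv01 l (\<lambda>v. F v x) u) \<in> borel_measurable M"
proof (induction l arbitrary: u)
  case 0 then show ?case using m by simp
next
  case (Suc l)
  obtain v where v: "\<And>n::nat. v n \<in> {0..1} - {u}" "v \<longlonglongrightarrow> u" using approach_seq[OF Suc.prems(2)] by blast
  show ?case
  proof (rule borel_measurable_LIMSEQ_real)
    show "(\<lambda>n. (nth_deriv01 l (\<lambda>v. F v x) (v n) - nth_deriv01 l (\<lambda>v. F v x) u) / (v n - u)) \<longlonglongrightarrow> nth_deriv01 (Suc l) (\<lambda>v. F v x) u"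
      if "x \<in> space M" for x
      using Suc.prems by (intro deriv_seq[OF Ck01_deriv[OF Ck[OF that]] v]) auto
    show "(\<lambda>x. (nth_deriv01 l (\<lambda>v. F v x) (v n) - nth_deriv01 l (\<lambda>v. F v x) u) / (v n - u)) \<in> borel_measurable M" for n
      using Suc.IH[of "v n"] Suc.IH[of u] Suc.prems v(1)[of n] by (intro borel_measurable_divide borel_measurable_diff) auto
  qed
qed

context density_chain
begin

definition fd :: "nat \<Rightarrow> real \<Rightarrow> 'z \<Rightarrow> 'z \<Rightarrow> real" where "fd l u z z' = nth_deriv01 l (\<lambda>v. f v z z') u"

definition pd :: "nat \<Rightarrow> real \<Rightarrow> 'y \<Rightarrow> 'y \<Rightarrow> 'z \<Rightarrow> real" where "pd l u y y' z = nth_deriv01 l (\<lambda>v. P v y y' z) u"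

lemma fd_meas: "l \<le> k \<Longrightarrow> u \<in> {0..1} \<Longrightarrow> fd l u z \<in> borel_measurable borel"
  unfolding fd_def[abs_def] by (intro nth_deriv01_measurable[OF f_Ck]) (auto intro: f_meas1)

lemma fd_meas': "l \<le> k \<Longrightarrow> u \<in> {0..1} \<Longrightarrow> fd l u z \<in> borel_measurable (\<gamma> z)"
  using fd_meas by (simp add: measurable_cong_sets[OF sets_\<gamma> refl])

lemma pd_meas: "l \<le> k \<Longrightarrow> u \<in> {0..1} \<Longrightarrow> pd l u y y' \<in> borel_measurable borel"
  unfolding pd_def[abs_def] by (intro nth_deriv01_measurable[OF P_Ck]) (auto intro: P_meas)

lemma fd_deriv: "l < k \<Longrightarrow> u \<in> {0..1} \<Longrightarrow> ((\<lambda>t. fd l t z z') has_real_derivative fd (Suc l) u z z') (at u within {0..1})"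
  using Ck01_deriv[OF f_Ck] unfolding fd_def by simp

lemma pd_deriv: "l < k \<Longrightarrow> u \<in> {0..1} \<Longrightarrow> ((\<lambda>t. pd l t y y' z) has_real_derivative pd (Suc l) u y y' z) (at u within {0..1})"
  using Ck01_deriv[OF P_Ck] unfolding pd_def by simp

lemma fd_cont: "l \<le> k \<Longrightarrow> continuous_on {0..1} (\<lambda>t. fd l t z z')"
  using Ck01_cont[OF f_Ck] unfolding fd_def by simp

lemma pd_cont: "l \<le> k \<Longrightarrow> continuous_on {0..1} (\<lambda>t. pd l t y y' z)"
  using Ck01_cont[OF P_Ck] unfolding pd_def by simp

text \<open>\<open>Cb\<close> serves the orders from 1 on; order 0 lies outside the bound in
  (E42)(iii) and is served by the growth constant \<open>K1\<close> of \<open>Qb\<close>.\<close>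

definition C2 :: real where "C2 = max Cb K1"

lemma C2: "C2 > 0" using K1 by (simp add: C2_def)

lemma \<phi>_powr_meas: "(\<lambda>z. \<phi> z powr d) \<in> borel_measurable borel"
  using \<phi>_meas by measurable

lemma \<phi>_powr_meas\<gamma>: "(\<lambda>z. \<phi> z powr d) \<in> borel_measurable (\<gamma> z)"
  using \<phi>_powr_meas by (simp add: measurable_cong_sets[OF sets_\<gamma> refl])

lemma fd_bound:
  assumes sl: "s + l \<le> k" and d: "0 \<le> d" "d \<le> d1 + real s * q" and u: "u \<in> {0..1}"
  shows "(\<integral>\<^sup>+z'. ennreal (\<phi> z' powr d * \<bar>fd l u z z'\<bar>) \<partial>\<gamma> z) \<le> ennreal (C2 * \<phi> z powr (d + q * real l))"
proof (cases "l = 0")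
  case True
  have "d \<le> d0" using d level_le[of s] sl by simp
  have "(\<integral>\<^sup>+z'. ennreal (\<phi> z' powr d * \<bar>fd l u z z'\<bar>) \<partial>\<gamma> z) = (\<integral>\<^sup>+z'. ennreal (f u z z') * ennreal (\<phi> z' powr d) \<partial>\<gamma> z)"
    using f_nonneg[OF u] by (intro nn_integral_cong) (simp add: True fd_def ennreal_mult[symmetric] mult.commute)
  also have "\<dots> = (\<integral>\<^sup>+z'. ennreal (\<phi> z' powr d) \<partial>Qb u z)"
    by (intro nn_integral_Qb[OF u, symmetric] measurable_compose[OF \<phi>_powr_meas measurable_ennreal])
  also have "\<dots> \<le> ennreal (K1 * \<phi> z powr d)" by (rule Qb_growth[OF u d(1) \<open>d \<le> d0\<close>])
  also have "\<dots> \<le> ennreal (C2 * \<phi> z powr d)" by (intro ennreal_leI mult_right_mono) (auto simp: C2_def)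
  finally show ?thesis using True by simp
next
  case False
  have "real s * q \<le> real (k - l) * q" using sl q by (intro mult_right_mono) auto
  then have "(\<integral>\<^sup>+z'. ennreal (\<phi> z' powr d * \<bar>fd l u z z'\<bar>) \<partial>\<gamma> z) \<le> ennreal (Cb * \<phi> z powr (d + q * real l))"
    unfolding fd_def using False sl d u by (intro f_bound) auto
  also have "\<dots> \<le> ennreal (C2 * \<phi> z powr (d + q * real l))" by (intro ennreal_leI mult_right_mono) (auto simp: C2_def)
  finally show ?thesis .
qed

section \<open>Differentiability of the densities in weighted L1\<close>

definition err :: "nat \<Rightarrow> nat \<Rightarrow> real \<Rightarrow> 'z \<Rightarrow> real \<Rightarrow> ennreal" where
  "err s l u z w = (\<integral>\<^sup>+z'. ennreal (\<phi> z' powr (d1 + real s * q) * \<bar>fd l w z z' - fd l u z z'\<bar>) \<partial>\<gamma> z)"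

text \<open>(E42)(iii) grants continuity of the \<open>l\<close>-th derivative under the weight with
  index \<open>k - l\<close>; the smaller indices follow from \<open>\<phi> \<ge> 1\<close>. The
  rest is the substitution w = u + h, with one-sided limits at the endpoints.\<close>

lemma err_tendsto:
  assumes sl: "s + l \<le> k" and u: "u \<in> {0..1}"
  shows "(err s l u z \<longlongrightarrow> 0) (at u within {0..1})"
proof -
  let ?F = "\<lambda>h. \<integral>\<^sup>+z'. ennreal (\<phi> z' powr (d1 + q * real (k - l)) * \<bar>fd l (u + h) z z' - fd l u z z'\<bar>) \<partial>\<gamma> z"
  have F: "(?F \<longlongrightarrow> 0) (at 0 within {h. u + h \<in> {0..1}})"
    using f_cont[of "k - l" u z] sl u by (simp add: fd_def)
  have le: "err s l u z w \<le> ?F (w - u)" for w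
    unfolding err_def
  proof (intro nn_integral_mono ennreal_leI)
    fix z' assume "z' \<in> space (\<gamma> z)"
    have "real s * q \<le> real (k - l) * q" using sl q by (intro mult_right_mono) auto
    then have "d1 + real s * q \<le> d1 + q * real (k - l)" by (simp add: mult.commute)
    then have "\<phi> z' powr (d1 + real s * q) \<le> \<phi> z' powr (d1 + q * real (k - l))"
      using \<phi>_ge1 by (intro powr_mono) auto
    then show "\<phi> z' powr (d1 + real s * q) * \<bar>fd l w z z' - fd l u z z'\<bar>
        \<le> \<phi> z' powr (d1 + q * real (k - l)) * \<bar>fd l (u + (w - u)) z z' - fd l u z z'\<bar>"
      by (simp add: mult_right_mono)
  qed
  have lim: "filterlim (\<lambda>w. w - u) (at 0 within {h. u + h \<in> {0..1}}) (at u within {0..1})"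
    unfolding filterlim_at
  proof safe
    show "((\<lambda>w. w - u) \<longlongrightarrow> 0) (at u within {0..1})"
      using tendsto_diff[OF tendsto_ident_at tendsto_const, of u u "{0..1}"] by simp
    show "\<forall>\<^sub>F w in at u within {0..1}. w - u \<in> {h. u + h \<in> {0..1}} \<and> w - u \<noteq> 0"
      by (auto simp: eventually_at_filter intro!: always_eventually)
  qed
  show ?thesis
  proof (rule tendsto_sandwich[OF _ _ tendsto_const filterlim_compose[OF F lim]])
    show "\<forall>\<^sub>F w in at u within {0..1}. err s l u z w \<le> ?F (w - u)"
      by (intro always_eventually allI le)
  qed simp
qed

lemma err_refl: "err s l u z u = 0" by (simp add: err_def)

lemma err_seq:
  assumes "s + l \<le> k" "u \<in> {0..1}" "\<And>n. v n \<in> {0..1}" "v \<longlonglongrightarrow> u"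
  shows "(\<lambda>n. err s l u z (v n)) \<longlonglongrightarrow> 0"
  using tendsto_within_seq[of "err s l u z" u "{0..1}" v] err_tendsto[OF assms(1,2)] assms(3,4) err_refl by simp

text \<open>Pointwise differentiability is upgraded to differentiability in weighted L1: the error
  of the quotient is bounded by the largest deviation of the derivative on the segment, which
  \<open>err_tendsto\<close> makes small.\<close>

lemma quotient_seq:
  assumes sl: "s + Suc l \<le> k" and u: "u \<in> {0..1}" and v: "\<And>n. v n \<in> {0..1} - {u}" "v \<longlonglongrightarrow> u"
  shows "(\<lambda>n. \<integral>\<^sup>+z'. ennreal (\<phi> z' powr (d1 + real s * q) * \<bar>(fd l (v n) z z' - fd l u z z') / (v n - u) - fd (Suc l) u z z'\<bar>) \<partial>\<gamma> z) \<longlonglongrightarrow> 0"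
proof -
  let ?d = "d1 + real s * q"
  let ?G = "\<lambda>w. \<integral>\<^sup>+z'. ennreal (\<phi> z' powr ?d * \<bar>(fd l w z z' - fd l u z z') / (w - u) - fd (Suc l) u z z'\<bar>) \<partial>\<gamma> z"
  have lk: "l < k" "Suc l \<le> k" "l \<le> k" using sl by auto
  have key: "?G w \<le> c" if w: "w \<in> {0..1} - {u}" and c: "\<And>t. t \<in> closed_segment u w \<Longrightarrow> err s (Suc l) u z t \<le> c" for w c
  proof -
    \<comment> \<open>Subtracting the linear part makes the increment of \<open>H\<close> equal to
      \<open>w - u\<close> times the weighted error of the difference quotient, while its derivative
      is the deviation measured by \<open>err\<close>.\<close>
    define H where "H t z' = \<phi> z' powr ?d * (fd l t z z' - t * fd (Suc l) u z z')" for t z'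
    define H' where "H' t z' = \<phi> z' powr ?d * (fd (Suc l) t z z' - fd (Suc l) u z z')" for t z'
    have "(\<integral>\<^sup>+z'. ennreal \<bar>H w z' - H u z'\<bar> \<partial>\<gamma> z) \<le> ennreal \<bar>w - u\<bar> * c"
    proof (rule nn_integral_mean_value[where H' = H'])
      show "((\<lambda>t. H t x) has_real_derivative H' t x) (at t within {0..1})" if "t \<in> {0..1}" for t x
        unfolding H_def H'_def using fd_deriv[OF lk(1) that, of z x] by (auto intro!: derivative_eq_intros)
      show "continuous_on {0..1} (\<lambda>t. H' t x)" for x
        unfolding H'_def by (intro continuous_intros fd_cont lk)
      show "H' t \<in> borel_measurable (\<gamma> z)" if "t \<in> {0..1}" for t
        unfolding H'_def[abs_def] 
          by (intro borel_measurable_times borel_measurable_diff \<phi>_powr_meas\<gamma> fd_meas' lk that u)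
      show "(\<integral>\<^sup>+x. ennreal \<bar>H' t x\<bar> \<partial>\<gamma> z) \<le> c" if "t \<in> closed_segment u w" for t
        using c[OF that] by (simp add: H'_def err_def abs_mult)
    qed (use u w in auto)
    moreover have "(\<integral>\<^sup>+z'. ennreal \<bar>H w z' - H u z'\<bar> \<partial>\<gamma> z) = ennreal \<bar>w - u\<bar> * ?G w"
    proof -
      have "ennreal \<bar>H w z' - H u z'\<bar> = ennreal \<bar>w - u\<bar> * ennreal (\<phi> z' powr ?d * \<bar>(fd l w z z' - fd l u z z') / (w - u) - fd (Suc l) u z z'\<bar>)" for z'
      proof -
        have "H w z' - H u z' = \<phi> z' powr ?d * ((w - u) * ((fd l w z z' - fd l u z z') / (w - u) - fd (Suc l) u z z'))"
        proof -
          have cancel: "(w - u) * ((a - b) / (w - u) - D) = (a - b) - (w - u) * D" for a b D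
          proof -
            have nz: "w - u \<noteq> 0" using w by simp
            show ?thesis
              unfolding right_diff_distrib[of "w - u" "(a - b) / (w - u)" D]
              by (simp only: times_divide_eq_right nonzero_mult_div_cancel_left[OF nz])
          qed
          show ?thesis unfolding H_def cancel by (simp add: algebra_simps)
        qed
        then have "\<bar>H w z' - H u z'\<bar> = \<bar>w - u\<bar> * (\<phi> z' powr ?d * \<bar>(fd l w z z' - fd l u z z') / (w - u) - fd (Suc l) u z z'\<bar>)"
          by (simp add: abs_mult ac_simps)
        then show ?thesis by (simp add: ennreal_mult)
      qed
      then show ?thesis
        using fd_meas'[OF lk(3), of w z] fd_meas'[OF lk(3) u, of z] fd_meas'[OF lk(2) u, of z] w
        by (subst nn_integral_cmult[symmetric])
           (auto intro!: measurable_compose[OF _ measurable_ennreal] borel_measurable_times borel_measurable_abs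
              borel_measurable_diff borel_measurable_divide \<phi>_powr_meas\<gamma>)
    qed
    ultimately have "ennreal \<bar>w - u\<bar> * ?G w \<le> ennreal \<bar>w - u\<bar> * c" by simp
    then show ?thesis using w by (subst (asm) ennreal_mult_le_mult_iff) auto
  qed
  show ?thesis
  proof (rule order_tendstoI)
    fix a :: ennreal assume "a < 0" then show "\<forall>\<^sub>F n in sequentially. a < ?G (v n)" by simp
  next
    fix a :: ennreal assume "0 < a"
    then obtain c where c: "0 < c" "c < a" using dense by blast
    have "\<forall>\<^sub>F t in at u within {0..1}. err s (Suc l) u z t < c"
      using err_tendsto[OF sl u, of z] c by (intro order_tendstoD(2)) auto
    then obtain e where e: "e > 0" "\<And>t. t \<in> {0..1} \<Longrightarrow> t \<noteq> u \<Longrightarrow> dist t u < e \<Longrightarrow> err s (Suc l) u z t < c"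
      unfolding eventually_at by metis
    have "\<forall>\<^sub>F n in sequentially. dist (v n) u < e" using v(2) e(1) by (rule tendstoD)
    then show "\<forall>\<^sub>F n in sequentially. ?G (v n) < a"
    proof eventually_elim
      case (elim n)
      have "?G (v n) \<le> c"
      proof (rule key[OF v(1)])
        fix t assume t: "t \<in> closed_segment u (v n)"
        have "closed_segment u (v n) \<subseteq> {0..1}" using u v(1)[of n] by (intro closed_segment_subset) auto
        moreover have "dist t u \<le> dist (v n) u" using t by (auto simp: closed_segment_eq_real_ivl dist_real_def split: if_splits)
        ultimately show "err s (Suc l) u z t \<le> c"
          using e(2)[of t] t elim err_refl by (cases "t = u") (auto intro: less_imp_le)
      qed
      then show ?case using c by simp
    qed
  qed
qed

end

section \<open>Smoothness of the stationary path laws\<close>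

text \<open>Compare with the larger base. On paths this turns a product of weights at two different
  times into a sum.\<close>

lemma powr_mix:
  fixes a b :: real assumes "1 \<le> a" "1 \<le> b" "0 \<le> \<alpha>" "0 \<le> \<beta>"
  shows "a powr \<alpha> * b powr \<beta> \<le> a powr (\<alpha> + \<beta>) + b powr (\<alpha> + \<beta>)"
proof (cases "a \<le> b")
  case True
  have "a powr \<alpha> * b powr \<beta> \<le> b powr \<alpha> * b powr \<beta>"
    using assms True by (intro mult_right_mono powr_mono2) auto
  then show ?thesis using assms by (simp add: powr_add add_increasing)
next
  case False
  have "a powr \<alpha> * b powr \<beta> \<le> a powr \<alpha> * a powr \<beta>"
    using assms False by (intro mult_left_mono powr_mono2) auto
  then show ?thesis using assms by (simp add: powr_add add_increasing2)
qed

lemma regop_subst: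
  assumes F: "F \<in> N \<rightarrow>\<^sub>M M" and w: "\<And>x. x \<in> space N \<Longrightarrow> w (F x) \<le> c * w' x"
  shows "regop M w N w' c (\<lambda>g x. g (F x))"
  unfolding regop_def
proof safe
  fix g assume g: "g \<in> wball M w"
  show "(\<lambda>x. g (F x)) \<in> wball N (\<lambda>x. c * w' x)"
  proof (rule wballI)
    show "(\<lambda>x. g (F x)) \<in> borel_measurable N" by (rule measurable_compose[OF F wball_meas[OF g]])
    show "\<bar>g (F x)\<bar> \<le> c * w' x" if "x \<in> space N" for x
      using wball_bound[OF g measurable_space[OF F that]] w[OF that] by simp
  qed
next
  fix x assume "x \<in> space N"
  then have "F x \<in> space M" by (rule measurable_space[OF F])
  then show "regfun M w (\<lambda>g. g (F x))" by (auto intro!: regfunI)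
qed

lemma opC_cong:
  assumes A: "opC k M W N W' n 0 A"
    and eq: "\<And>s u g x. s \<le> k \<Longrightarrow> u \<in> {0..1} \<Longrightarrow> g \<in> wspace M (W s) \<Longrightarrow> x \<in> space N \<Longrightarrow> B u g x = A u g x"
  shows "opC k M W N W' n 0 B"
proof -
  have B: "opB k M W N W' 0 B" if A: "opB k M W N W' 0 A"
    unfolding opB_def
  proof safe
    obtain c where c: "c > 0" "\<And>s u. s + 0 \<le> k \<Longrightarrow> u \<in> {0..1} \<Longrightarrow> regop M (W s) N (W' (s + 0)) c (A u)"
      using A by (rule opB_regop) blast
    then show "\<exists>c>0. \<forall>s u. s + 0 \<le> k \<longrightarrow> u \<in> {0..1} \<longrightarrow> regop M (W s) N (W' (s + 0)) c (B u)"
      using eq by (intro exI[of _ c]) (auto intro!: regop_cong[OF c(2)[simplified]])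
    fix s u x v and g :: "nat \<Rightarrow> _" assume a: "s + 0 \<le> k" "u \<in> {0..1::real}" "x \<in> space N" "\<forall>n::nat. v n \<in> {0..1::real}" "v \<longlonglongrightarrow> u" "\<forall>n. g n \<in> wball M (W s)"
    then have "(\<lambda>n. A (v n) (g n) x - A u (g n) x) \<longlonglongrightarrow> 0" by (intro opB_contD[OF A]) auto
    moreover have "B (v n) (g n) x = A (v n) (g n) x" "B u (g n) x = A u (g n) x" for n
      using a by (auto intro!: eq[of s] wball_wspace)
    ultimately show "(\<lambda>n. B (v n) (g n) x - B u (g n) x) \<longlonglongrightarrow> 0" by simp
  qed
  show ?thesis
  proof (cases n)
    case 0 then show ?thesis using A B by simp
  next
    case (Suc n')
    then obtain A' where A': "opD k M W N 0 A A'" "opC k M W N W' n' (Suc 0) A'" and AB: "opB k M W N W' 0 A" using A by auto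
    have "opD k M W N 0 B A'"
      unfolding opD_def
    proof safe
      fix s u x v and g :: "nat \<Rightarrow> _" assume a: "s + Suc 0 \<le> k" "u \<in> {0..1::real}" "x \<in> space N" "\<forall>n::nat. v n \<in> {0..1::real} - {u}" "v \<longlonglongrightarrow> u" "\<forall>n. g n \<in> wball M (W s)"
      then have "(\<lambda>n. (A (v n) (g n) x - A u (g n) x) / (v n - u) - A' u (g n) x) \<longlonglongrightarrow> 0" by (intro opDD[OF A'(1)]) auto
      moreover have "B (v n) (g n) x = A (v n) (g n) x" "B u (g n) x = A u (g n) x" for n
        using a by (auto intro!: eq[of s] wball_wspace)
      ultimately show "(\<lambda>n. (B (v n) (g n) x - B u (g n) x) / (v n - u) - A' u (g n) x) \<longlonglongrightarrow> 0" by simp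
    qed
    with B[OF AB] A'(2) Suc show ?thesis by auto
  qed
qed

context density_chain
begin

section \<open>Path spaces and the factors of the one-step operator\<close>

abbreviation PS :: "nat \<Rightarrow> (nat \<Rightarrow> 'y \<times> 'z) measure" where "PS i \<equiv> power_space SS i"

abbreviation PW :: "nat \<Rightarrow> nat \<Rightarrow> (nat \<Rightarrow> 'y \<times> 'z) \<Rightarrow> real" where "PW i s \<equiv> sum_weight (V s) i"

lemma comp_meas: "a < i \<Longrightarrow> (\<lambda>x. x a) \<in> PS i \<rightarrow>\<^sub>M SS"
  by (rule measurable_component_singleton) simp

lemma PW_meas: "PW i s \<in> borel_measurable (PS i)"
  unfolding sum_weight_def[abs_def]
  by (intro borel_measurable_sum measurable_compose[OF comp_meas V_meas]) simp

lemma V_le_PW: "a < i \<Longrightarrow> V s (x a) \<le> PW i s x"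
  unfolding sum_weight_def by (intro member_le_sum) (auto simp: V_pos)

lemma PW_ge1: "1 \<le> i \<Longrightarrow> 1 \<le> PW i s x"
  using V_le_PW[of 0 i s x] V_ge1[of s "x 0"] by simp

lemma mono_weights_PW: "1 \<le> i \<Longrightarrow> mono_weights (PS i) (PW i)"
  using PW_meas PW_ge1 by (auto simp: mono_weights_def sum_weight_def intro!: sum_mono V_mono)

lemma upd_meas2: "(\<lambda>(x, y). x(i := y)) \<in> PS i \<Otimes>\<^sub>M SS \<rightarrow>\<^sub>M PS (Suc i)"
  using measurable_add_dim[of i "{0..<i}" "\<lambda>_. SS"] by (simp add: atLeastLessThanSuc insert_commute)

lemma upd_meas: "x \<in> space (PS i) \<Longrightarrow> (\<lambda>y. x(i := y)) \<in> SS \<rightarrow>\<^sub>M PS (Suc i)"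
  using measurable_compose[OF measurable_Pair1' upd_meas2] by simp

lemma upd_space: "x \<in> space (PS i) \<Longrightarrow> x(i := y) \<in> space (PS (Suc i))"
  using measurable_space[OF upd_meas, of x i y] by simp

lemma PW_upd: "PW (Suc i) s (x(i := y)) = PW i s x + V s y"
  by (simp add: sum_weight_def)

text \<open>The factor produced by a derivative sits at one coordinate but multiplies the weights of
  all; \<open>powr_mix\<close> moves each product to level \<open>s + l\<close>, at the price of
  \<open>j\<close> extra copies of the weight at coordinate \<open>a\<close>.\<close>

lemma PW_mix: "a < j \<Longrightarrow> PW j s x * \<phi> (snd (x a)) powr (q * real l) \<le> (real j + 1) * PW j (s + l) x"
proof -
  assume a: "a < j"
  have e: "d1 + real s * q + q * real l = d1 + real (s + l) * q" by (simp add: algebra_simps)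
  have "V s (x c) * \<phi> (snd (x a)) powr (q * real l) \<le> V (s + l) (x c) + V (s + l) (x a)" for c
    using powr_mix[OF \<phi>_ge1[of "snd (x c)"] \<phi>_ge1[of "snd (x a)"], of "d1 + real s * q" "q * real l"] d1 q
    unfolding V_split e by simp
  then have "PW j s x * \<phi> (snd (x a)) powr (q * real l) \<le> (\<Sum>c<j. V (s + l) (x c) + V (s + l) (x a))"
    unfolding sum_weight_def sum_distrib_right by (intro sum_mono)
  also have "\<dots> = PW j (s + l) x + real j * V (s + l) (x a)" by (simp add: sum.distrib sum_weight_def)
  also have "\<dots> \<le> PW j (s + l) x + real j * PW j (s + l) x"
    using V_le_PW[OF a] by (intro add_left_mono mult_left_mono) auto
  finally show ?thesis by (simp add: algebra_simps)
qed

lemma section_meas: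
  assumes "g \<in> borel_measurable (PS (Suc i))" "x \<in> space (PS i)"
  shows "(\<lambda>z'. g (x(i := (y', z')))) \<in> borel_measurable borel"
  by (rule SS_measurableD[OF measurable_compose[OF upd_meas[OF assms(2)] assms(1)]])

lemma section_meas\<gamma>:
  assumes "g \<in> borel_measurable (PS (Suc i))" "x \<in> space (PS i)"
  shows "(\<lambda>z'. g (x(i := (y', z')))) \<in> borel_measurable (\<gamma> z)"
  using section_meas[OF assms] by (simp add: measurable_cong_sets[OF sets_\<gamma> refl])

text \<open>The sum form keeps the past and the new coordinate apart, as the uniform estimate
  \<open>LT_bound\<close> demands. The product form has a constant depending on the path, which is
  enough for convergence at a fixed path.\<close>

lemma section_bound:
  assumes "g \<in> wball (PS (Suc i)) (PW (Suc i) s)" "x \<in> space (PS i)"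
  shows "\<bar>g (x(i := (y', z')))\<bar> \<le> PW i s x + \<phi> z' powr (d1 + real s * q)"
    "\<bar>g (x(i := (y', z')))\<bar> \<le> (PW i s x + 1) * \<phi> z' powr (d1 + real s * q)"
proof -
  show *: "\<bar>g (x(i := (y', z')))\<bar> \<le> PW i s x + \<phi> z' powr (d1 + real s * q)"
    using wball_bound[OF assms(1) upd_space[OF assms(2)], of "(y', z')"] by (simp add: PW_upd V_split)
  have "0 \<le> PW i s x" by (simp add: sum_weight_def sum_nonneg V_pos)
  moreover have "1 \<le> \<phi> z' powr (d1 + real s * q)" using d1 q by (intro \<phi>_powr_ge1) simp
  ultimately have "PW i s x * 1 \<le> PW i s x * \<phi> z' powr (d1 + real s * q)" by (intro mult_left_mono)
  with * show "\<bar>g (x(i := (y', z')))\<bar> \<le> (PW i s x + 1) * \<phi> z' powr (d1 + real s * q)" by (simp add: algebra_simps)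
qed

text \<open>The one-step operator factors as \<open>LT i 0 u \<circ> MT i 0 u\<close>: multiplication by the transition
  probability \<open>P u\<close>, then integration of the new coordinate against the density. The index \<open>l\<close> counts
  derivatives in \<open>u\<close>.\<close>

definition LT :: "nat \<Rightarrow> nat \<Rightarrow> real \<Rightarrow> ((nat \<Rightarrow> 'y \<times> 'z) \<Rightarrow> real) \<Rightarrow> (nat \<Rightarrow> 'y \<times> 'z) \<Rightarrow> real" where
  "LT i l u g x = (\<Sum>y'\<in>UNIV. \<integral>z'. g (x(i := (y', z'))) * fd l u (snd (x (i - 1))) z' \<partial>\<gamma> (snd (x (i - 1))))"

lemma LT_integrable:
  assumes sl: "s + l \<le> k" and u: "u \<in> {0..1}" and g: "g \<in> wspace (PS (Suc i)) (PW (Suc i) s)" and x: "x \<in> space (PS i)"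
  shows "integrable (\<gamma> z) (\<lambda>z'. g (x(i := (y', z'))) * fd l u z z')"
proof -
  have lk: "l \<le> k" using sl by simp
  obtain c where c: "c > 0" "g \<in> wball (PS (Suc i)) (\<lambda>x. c * PW (Suc i) s x)" using g by (rule wspaceE)
  have g': "(\<lambda>x. (1/c) * g x) \<in> wball (PS (Suc i)) (PW (Suc i) s)" using wball_scale[OF c(2), of "1/c"] c by simp
  have bd: "\<bar>g (x(i := (y', z')))\<bar> \<le> c * (PW i s x + 1) * \<phi> z' powr (d1 + real s * q)" for z'
    using section_bound(2)[OF g' x, of y' z'] c(1) by (simp add: abs_mult field_simps)
  have c0: "0 \<le> c * (PW i s x + 1)" using c by (simp add: sum_weight_def sum_nonneg V_pos add_nonneg_nonneg)
  have m: "(\<lambda>z'. g (x(i := (y', z'))) * fd l u z z') \<in> borel_measurable (\<gamma> z)"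
    using wball_meas[OF c(2)] by (intro borel_measurable_times section_meas\<gamma> x fd_meas' lk u)
  have "(\<integral>\<^sup>+z'. ennreal (norm (g (x(i := (y', z'))) * fd l u z z')) \<partial>\<gamma> z)
      \<le> (\<integral>\<^sup>+z'. ennreal (c * (PW i s x + 1)) * ennreal (\<phi> z' powr (d1 + real s * q) * \<bar>fd l u z z'\<bar>) \<partial>\<gamma> z)"
  proof (rule nn_integral_mono)
    fix z'
    have "norm (g (x(i := (y', z'))) * fd l u z z') \<le> c * (PW i s x + 1) * (\<phi> z' powr (d1 + real s * q) * \<bar>fd l u z z'\<bar>)"
      using mult_right_mono[OF bd[of z'], of "\<bar>fd l u z z'\<bar>"] by (simp add: abs_mult mult.assoc)
    then have "ennreal (norm (g (x(i := (y', z'))) * fd l u z z')) \<le> ennreal (c * (PW i s x + 1) * (\<phi> z' powr (d1 + real s * q) * \<bar>fd l u z z'\<bar>))"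
      by (rule ennreal_leI)
    then show "ennreal (norm (g (x(i := (y', z'))) * fd l u z z'))
        \<le> ennreal (c * (PW i s x + 1)) * ennreal (\<phi> z' powr (d1 + real s * q) * \<bar>fd l u z z'\<bar>)"
      using c0 by (subst (asm) ennreal_mult) auto
  qed
  also have "\<dots> = ennreal (c * (PW i s x + 1)) * (\<integral>\<^sup>+z'. ennreal (\<phi> z' powr (d1 + real s * q) * \<bar>fd l u z z'\<bar>) \<partial>\<gamma> z)"
    by (intro nn_integral_cmult measurable_compose[OF _ measurable_ennreal] borel_measurable_times borel_measurable_abs
        \<phi>_powr_meas\<gamma> fd_meas' lk u)
  also have "\<dots> \<le> ennreal (c * (PW i s x + 1)) * ennreal (C2 * \<phi> z powr (d1 + real s * q + q * real l))"
    using d1 q by (intro mult_left_mono fd_bound[OF sl _ _ u]) auto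
  also have "\<dots> < \<infinity>" by (simp add: ennreal_mult_less_top)
  finally show ?thesis by (rule integrableI_bounded[OF m])
qed

text \<open>The common core of continuity and differentiability: kernels that vanish in weighted L1
  make the integrals vanish whatever test functions from the ball are inserted.\<close>

lemma LT_null:
  assumes x: "x \<in> space (PS i)" and g: "\<And>n. g n \<in> wball (PS (Suc i)) (PW (Suc i) s)"
    and \<kappa>m: "\<And>n. \<kappa> n \<in> borel_measurable (\<gamma> z)"
    and \<kappa>: "(\<lambda>n. \<integral>\<^sup>+z'. ennreal (\<phi> z' powr (d1 + real s * q) * \<bar>\<kappa> n z'\<bar>) \<partial>\<gamma> z) \<longlonglongrightarrow> 0"
  shows "(\<lambda>n. \<Sum>y'\<in>UNIV. \<integral>z'. g n (x(i := (y', z'))) * \<kappa> n z' \<partial>\<gamma> z) \<longlonglongrightarrow> 0"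
proof (rule tendsto_null_sum)
  fix y' :: 'y
  have c0: "0 \<le> PW i s x + 1" by (simp add: sum_weight_def sum_nonneg V_pos)
  show "(\<lambda>n. \<integral>z'. g n (x(i := (y', z'))) * \<kappa> n z' \<partial>\<gamma> z) \<longlonglongrightarrow> 0"
  proof (rule integral_tendsto_0I[OF _ \<kappa>])
    fix n
    have "ennreal \<bar>\<integral>z'. g n (x(i := (y', z'))) * \<kappa> n z' \<partial>\<gamma> z\<bar> \<le> (\<integral>\<^sup>+z'. ennreal \<bar>g n (x(i := (y', z'))) * \<kappa> n z'\<bar> \<partial>\<gamma> z)"
      by (rule abs_integral_le_nn)
    also have "\<dots> \<le> (\<integral>\<^sup>+z'. ennreal (PW i s x + 1) * ennreal (\<phi> z' powr (d1 + real s * q) * \<bar>\<kappa> n z'\<bar>) \<partial>\<gamma> z)"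
    proof (rule nn_integral_mono)
      fix z'
      have "\<bar>g n (x(i := (y', z'))) * \<kappa> n z'\<bar> \<le> (PW i s x + 1) * (\<phi> z' powr (d1 + real s * q) * \<bar>\<kappa> n z'\<bar>)"
        using mult_right_mono[OF section_bound(2)[OF g x, of n y' z'], of "\<bar>\<kappa> n z'\<bar>"] by (simp add: abs_mult mult.assoc)
      then have "ennreal \<bar>g n (x(i := (y', z'))) * \<kappa> n z'\<bar> \<le> ennreal ((PW i s x + 1) * (\<phi> z' powr (d1 + real s * q) * \<bar>\<kappa> n z'\<bar>))"
        by (rule ennreal_leI)
      then show "ennreal \<bar>g n (x(i := (y', z'))) * \<kappa> n z'\<bar> \<le> ennreal (PW i s x + 1) * ennreal (\<phi> z' powr (d1 + real s * q) * \<bar>\<kappa> n z'\<bar>)"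
        using c0 by (subst (asm) ennreal_mult) auto
    qed
    also have "\<dots> = ennreal (PW i s x + 1) * (\<integral>\<^sup>+z'. ennreal (\<phi> z' powr (d1 + real s * q) * \<bar>\<kappa> n z'\<bar>) \<partial>\<gamma> z)"
      by (intro nn_integral_cmult measurable_compose[OF _ measurable_ennreal] borel_measurable_times borel_measurable_abs
          \<phi>_powr_meas\<gamma> \<kappa>m)
    finally show "ennreal \<bar>\<integral>z'. g n (x(i := (y', z'))) * \<kappa> n z' \<partial>\<gamma> z\<bar>
        \<le> ennreal (PW i s x + 1) * (\<integral>\<^sup>+z'. ennreal (\<phi> z' powr (d1 + real s * q) * \<bar>\<kappa> n z'\<bar>) \<partial>\<gamma> z)" .
  qed
qed

lemma LT_cont:
  assumes sl: "s + l \<le> k" and u: "u \<in> {0..1}" and x: "x \<in> space (PS i)" and v: "\<And>n. v n \<in> {0..1}" "v \<longlonglongrightarrow> u"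
    and g: "\<And>n. g n \<in> wball (PS (Suc i)) (PW (Suc i) s)"
  shows "(\<lambda>n. LT i l (v n) (g n) x - LT i l u (g n) x) \<longlonglongrightarrow> 0"
proof -
  let ?z = "snd (x (i - 1))"
  have lk: "l \<le> k" using sl by simp
  have "(\<lambda>n. \<Sum>y'\<in>UNIV. \<integral>z'. g n (x(i := (y', z'))) * (fd l (v n) ?z z' - fd l u ?z z') \<partial>\<gamma> ?z) \<longlonglongrightarrow> 0"
  proof (rule LT_null[OF x g])
    show "(\<lambda>z'. fd l (v n) ?z z' - fd l u ?z z') \<in> borel_measurable (\<gamma> ?z)" for n
      by (intro borel_measurable_diff fd_meas' lk v u)
    show "(\<lambda>n. \<integral>\<^sup>+z'. ennreal (\<phi> z' powr (d1 + real s * q) * \<bar>fd l (v n) ?z z' - fd l u ?z z'\<bar>) \<partial>\<gamma> ?z) \<longlonglongrightarrow> 0"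
      using err_seq[OF sl u v, of ?z] by (simp add: err_def)
  qed
  moreover have "LT i l (v n) (g n) x - LT i l u (g n) x =
      (\<Sum>y'\<in>UNIV. \<integral>z'. g n (x(i := (y', z'))) * (fd l (v n) ?z z' - fd l u ?z z') \<partial>\<gamma> ?z)" for n
    unfolding LT_def sum_subtractf[symmetric] right_diff_distrib
    by (intro sum.cong refl Bochner_Integration.integral_diff[symmetric] LT_integrable[OF sl _ wball_wspace[OF g] x] v u)
  ultimately show ?thesis by simp
qed

lemma LT_deriv:
  assumes sl: "s + Suc l \<le> k" and u: "u \<in> {0..1}" and x: "x \<in> space (PS i)" and v: "\<And>n. v n \<in> {0..1} - {u}" "v \<longlonglongrightarrow> u"
    and g: "\<And>n. g n \<in> wball (PS (Suc i)) (PW (Suc i) s)"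
  shows "(\<lambda>n. (LT i l (v n) (g n) x - LT i l u (g n) x) / (v n - u) - LT i (Suc l) u (g n) x) \<longlonglongrightarrow> 0"
proof -
  let ?z = "snd (x (i - 1))"
  have lk: "l \<le> k" "Suc l \<le> k" "s + l \<le> k" using sl by auto
  have v': "v n \<in> {0..1}" for n using v by blast
  let ?\<kappa> = "\<lambda>n z'. (fd l (v n) ?z z' - fd l u ?z z') / (v n - u) - fd (Suc l) u ?z z'"
  have "(\<lambda>n. \<Sum>y'\<in>UNIV. \<integral>z'. g n (x(i := (y', z'))) * ?\<kappa> n z' \<partial>\<gamma> ?z) \<longlonglongrightarrow> 0"
  proof (rule LT_null[OF x g])
    show "?\<kappa> n \<in> borel_measurable (\<gamma> ?z)" for n
      by (intro borel_measurable_diff borel_measurable_divide borel_measurable_const fd_meas' lk v' u)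
    show "(\<lambda>n. \<integral>\<^sup>+z'. ennreal (\<phi> z' powr (d1 + real s * q) * \<bar>?\<kappa> n z'\<bar>) \<partial>\<gamma> ?z) \<longlonglongrightarrow> 0"
      by (rule quotient_seq[OF sl u v])
  qed
  moreover have "(LT i l (v n) (g n) x - LT i l u (g n) x) / (v n - u) - LT i (Suc l) u (g n) x =
      (\<Sum>y'\<in>UNIV. \<integral>z'. g n (x(i := (y', z'))) * ?\<kappa> n z' \<partial>\<gamma> ?z)" for n
  proof -
    have i1: "integrable (\<gamma> ?z) (\<lambda>z'. g n (x(i := (y', z'))) * fd l w ?z z')" if "w \<in> {0..1}" for w y'
      by (rule LT_integrable[OF lk(3) that wball_wspace[OF g] x])
    have i2: "integrable (\<gamma> ?z) (\<lambda>z'. g n (x(i := (y', z'))) * fd (Suc l) u ?z z')" for y'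
      by (rule LT_integrable[OF sl u wball_wspace[OF g] x])
    have e: "(\<integral>z'. g n (x(i := (y', z'))) * ?\<kappa> n z' \<partial>\<gamma> ?z) =
      ((\<integral>z'. g n (x(i := (y', z'))) * fd l (v n) ?z z' \<partial>\<gamma> ?z) - (\<integral>z'. g n (x(i := (y', z'))) * fd l u ?z z' \<partial>\<gamma> ?z)) / (v n - u)
       - (\<integral>z'. g n (x(i := (y', z'))) * fd (Suc l) u ?z z' \<partial>\<gamma> ?z)" for y'
      using i1[OF v'[of n], of y'] i1[OF u, of y'] i2[of y']
      by (simp add: right_diff_distrib Bochner_Integration.integral_diff integral_divide_zero[symmetric] del: integral_divide_zero)
    show ?thesis unfolding LT_def e by (simp add: sum_subtractf sum_divide_distrib diff_divide_distrib)
  qed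
  ultimately show ?thesis by simp
qed

text \<open>The measures \<open>\<gamma> z\<close> may fail to be \<sigma>-finite, so measurability
  in the past comes from the Markov kernel \<open>Qb\<close> at order 0 and from difference
  quotients afterwards.\<close>

lemma LT_meas:
  assumes i: "1 \<le> i"
  shows "s + l \<le> k \<Longrightarrow> u \<in> {0..1} \<Longrightarrow> g \<in> wball (PS (Suc i)) (PW (Suc i) s) \<Longrightarrow> LT i l u g \<in> borel_measurable (PS i)"
proof (induction l arbitrary: u)
  case 0
  note u = \<open>u \<in> {0..1}\<close> and g = \<open>g \<in> _\<close>
  have gm: "g \<in> borel_measurable (PS (Suc i))" by (rule wball_meas[OF g])
  have Bk: "(\<lambda>x. distr (Qb u (snd (x (i - 1)))) (PS (Suc i)) (\<lambda>z'. x(i := (y', z')))) \<in> PS i \<rightarrow>\<^sub>M prob_algebra (PS (Suc i))" for y'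
  proof (rule measurable_distr_prob_space2)
    have "(\<lambda>x. snd (x (i - 1))) \<in> PS i \<rightarrow>\<^sub>M borel"
      by (rule measurable_compose[OF comp_meas measurable_snd]) (use i in simp)
    then show "(\<lambda>x. Qb u (snd (x (i - 1)))) \<in> PS i \<rightarrow>\<^sub>M prob_algebra borel" by (rule measurable_compose[OF _ Qb_markov[OF u]])
    have "(\<lambda>p. (fst p, (y', snd p))) \<in> PS i \<Otimes>\<^sub>M borel \<rightarrow>\<^sub>M PS i \<Otimes>\<^sub>M SS" by measurable
    from measurable_compose[OF this upd_meas2] show "(\<lambda>(x, z'). x(i := (y', z'))) \<in> PS i \<Otimes>\<^sub>M borel \<rightarrow>\<^sub>M PS (Suc i)"
      by (simp add: case_prod_unfold)
  qed
  have "LT i 0 u g x = (\<Sum>y'\<in>UNIV. \<integral>p. g p \<partial>distr (Qb u (snd (x (i - 1)))) (PS (Suc i)) (\<lambda>z'. x(i := (y', z'))))" if x: "x \<in> space (PS i)" for x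
    unfolding LT_def
  proof (intro sum.cong refl)
    fix y'
    have "(\<lambda>z'. x(i := (y', z'))) \<in> Qb u (snd (x (i - 1))) \<rightarrow>\<^sub>M PS (Suc i)"
      using SS_measurableD[OF upd_meas[OF x]] by (simp add: measurable_cong_sets[OF Qb_prob(2)[OF u] refl])
    then have "(\<integral>p. g p \<partial>distr (Qb u (snd (x (i - 1)))) (PS (Suc i)) (\<lambda>z'. x(i := (y', z')))) = (\<integral>z'. g (x(i := (y', z'))) \<partial>Qb u (snd (x (i - 1))))"
      by (rule integral_distr[OF _ gm])
    also have "\<dots> = (\<integral>z'. g (x(i := (y', z'))) * fd 0 u (snd (x (i - 1))) z' \<partial>\<gamma> (snd (x (i - 1))))"
      by (subst integral_Qb[OF u section_meas[OF gm x]]) (simp add: fd_def mult.commute)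
    finally show "(\<integral>z'. g (x(i := (y', z'))) * fd 0 u (snd (x (i - 1))) z' \<partial>\<gamma> (snd (x (i - 1)))) =
        (\<integral>p. g p \<partial>distr (Qb u (snd (x (i - 1)))) (PS (Suc i)) (\<lambda>z'. x(i := (y', z'))))" by simp
  qed
  moreover have "(\<lambda>x. \<Sum>y'\<in>UNIV. \<integral>p. g p \<partial>distr (Qb u (snd (x (i - 1)))) (PS (Suc i)) (\<lambda>z'. x(i := (y', z')))) \<in> borel_measurable (PS i)"
    by (intro borel_measurable_sum measurable_compose[OF measurable_prob_algebraD[OF Bk] integral_measurable_subprob_algebra[OF gm]])
  ultimately show ?case by (simp cong: measurable_cong)
next
  case (Suc l)
  obtain v where v: "\<And>n::nat. v n \<in> {0..1} - {u}" "v \<longlonglongrightarrow> u" using approach_seq[OF Suc.prems(2)] by blast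
  show ?case
  proof (rule borel_measurable_LIMSEQ_real)
    show "(\<lambda>x. (LT i l (v n) g x - LT i l u g x) / (v n - u)) \<in> borel_measurable (PS i)" for n
      using Suc.IH[of "v n"] Suc.IH[of u] Suc.prems v(1)[of n] by (intro borel_measurable_divide borel_measurable_diff) auto
    show "(\<lambda>n. (LT i l (v n) g x - LT i l u g x) / (v n - u)) \<longlonglongrightarrow> LT i (Suc l) u g x" if "x \<in> space (PS i)" for x
      using LT_deriv[OF Suc.prems(1,2) that v Suc.prems(3)] by (simp add: LIM_zero_iff)
  qed
qed

lemma LT_bound:
  assumes i: "1 \<le> i" and sl: "s + l \<le> k" and u: "u \<in> {0..1}" and g: "g \<in> wball (PS (Suc i)) (PW (Suc i) s)" and x: "x \<in> space (PS i)"
  shows "\<bar>LT i l u g x\<bar> \<le> real CARD('y) * C2 * (real i + 2) * PW i (s + l) x"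
proof -
  let ?z = "snd (x (i - 1))" and ?d = "d1 + real s * q"
  have lk: "l \<le> k" using sl by simp
  have A0: "0 \<le> PW i s x" by (simp add: sum_weight_def sum_nonneg V_pos)
  have one: "\<bar>\<integral>z'. g (x(i := (y', z'))) * fd l u ?z z' \<partial>\<gamma> ?z\<bar> \<le> C2 * (real i + 2) * PW i (s + l) x" for y'
  proof -
    have "ennreal \<bar>\<integral>z'. g (x(i := (y', z'))) * fd l u ?z z' \<partial>\<gamma> ?z\<bar> \<le> (\<integral>\<^sup>+z'. ennreal \<bar>g (x(i := (y', z'))) * fd l u ?z z'\<bar> \<partial>\<gamma> ?z)"
      by (rule abs_integral_le_nn)
    \<comment> \<open>The weights of the past are paired with exponent 0 and the new coordinate with
      exponent d1 + s q; both lie in the range of exponents that (E42)(iii) admits.\<close>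
    also have "\<dots> \<le> (\<integral>\<^sup>+z'. ennreal (PW i s x) * ennreal (\<phi> z' powr 0 * \<bar>fd l u ?z z'\<bar>) + ennreal (\<phi> z' powr ?d * \<bar>fd l u ?z z'\<bar>) \<partial>\<gamma> ?z)"
    proof (rule nn_integral_mono)
      fix z'
      have p0: "\<phi> z' powr 0 = 1" using \<phi>_ge1[of z'] by simp
      have "\<bar>g (x(i := (y', z'))) * fd l u ?z z'\<bar> \<le> PW i s x * (\<phi> z' powr 0 * \<bar>fd l u ?z z'\<bar>) + \<phi> z' powr ?d * \<bar>fd l u ?z z'\<bar>"
        using mult_right_mono[OF section_bound(1)[OF g x, of y' z'], of "\<bar>fd l u ?z z'\<bar>"] p0 by (simp add: abs_mult distrib_right)
      then have "ennreal \<bar>g (x(i := (y', z'))) * fd l u ?z z'\<bar> \<le> ennreal (PW i s x * (\<phi> z' powr 0 * \<bar>fd l u ?z z'\<bar>) + \<phi> z' powr ?d * \<bar>fd l u ?z z'\<bar>)"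
        by (rule ennreal_leI)
      also have "\<dots> = ennreal (PW i s x) * ennreal (\<phi> z' powr 0 * \<bar>fd l u ?z z'\<bar>) + ennreal (\<phi> z' powr ?d * \<bar>fd l u ?z z'\<bar>)"
        using A0 by (subst ennreal_plus) (auto simp: ennreal_mult)
      finally show "ennreal \<bar>g (x(i := (y', z'))) * fd l u ?z z'\<bar> \<le> ennreal (PW i s x) * ennreal (\<phi> z' powr 0 * \<bar>fd l u ?z z'\<bar>) + ennreal (\<phi> z' powr ?d * \<bar>fd l u ?z z'\<bar>)" .
    qed
    also have "\<dots> = ennreal (PW i s x) * (\<integral>\<^sup>+z'. ennreal (\<phi> z' powr 0 * \<bar>fd l u ?z z'\<bar>) \<partial>\<gamma> ?z) + (\<integral>\<^sup>+z'. ennreal (\<phi> z' powr ?d * \<bar>fd l u ?z z'\<bar>) \<partial>\<gamma> ?z)"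
    proof -
      have m: "(\<lambda>z'. ennreal (\<phi> z' powr d * \<bar>fd l u ?z z'\<bar>)) \<in> borel_measurable (\<gamma> ?z)" for d
        by (intro measurable_compose[OF _ measurable_ennreal] borel_measurable_times borel_measurable_abs \<phi>_powr_meas\<gamma> fd_meas' lk u)
      show ?thesis
        by (simp only: nn_integral_add[OF borel_measurable_times_ennreal[OF measurable_const m] m] nn_integral_cmult[OF m] space_borel UNIV_I)
    qed
    also have "\<dots> \<le> ennreal (PW i s x) * ennreal (C2 * \<phi> ?z powr (0 + q * real l)) + ennreal (C2 * \<phi> ?z powr (?d + q * real l))"
      using d1 q by (intro add_mono mult_left_mono fd_bound[OF sl _ _ u]) auto
    also have "\<dots> = ennreal (C2 * (PW i s x * \<phi> ?z powr (q * real l) + \<phi> ?z powr (?d + q * real l)))"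
    proof -
      have "ennreal (PW i s x) * ennreal (C2 * \<phi> ?z powr (0 + q * real l)) = ennreal (PW i s x * (C2 * \<phi> ?z powr (0 + q * real l)))"
        using A0 C2 by (simp add: ennreal_mult)
      then show ?thesis using A0 C2 by (simp add: ennreal_plus[symmetric] algebra_simps del: ennreal_plus)
    qed
    finally have "\<bar>\<integral>z'. g (x(i := (y', z'))) * fd l u ?z z' \<partial>\<gamma> ?z\<bar> \<le> C2 * (PW i s x * \<phi> ?z powr (q * real l) + \<phi> ?z powr (?d + q * real l))"
      using A0 C2 by (subst (asm) ennreal_le_iff) auto
    also have "\<dots> \<le> C2 * ((real i + 1) * PW i (s + l) x + PW i (s + l) x)"
    proof (intro mult_left_mono add_mono)
      show "PW i s x * \<phi> ?z powr (q * real l) \<le> (real i + 1) * PW i (s + l) x" using i by (intro PW_mix) simp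
      have e: "?d + q * real l = d1 + real (s + l) * q" by (simp add: algebra_simps)
      have "\<phi> ?z powr (?d + q * real l) = V (s + l) (x (i - 1))" unfolding V_split e ..
      then show "\<phi> ?z powr (?d + q * real l) \<le> PW i (s + l) x" using V_le_PW[of "i - 1" i "s + l" x] i by simp
    qed (use C2 in simp)
    finally show ?thesis by (simp add: algebra_simps)
  qed
  have "\<bar>LT i l u g x\<bar> \<le> (\<Sum>y'\<in>(UNIV::'y set). C2 * (real i + 2) * PW i (s + l) x)"
    unfolding LT_def by (rule order_trans[OF sum_abs sum_mono[OF one]])
  then show ?thesis by simp
qed

lemma LT_regfun:
  assumes sl: "s + l \<le> k" and u: "u \<in> {0..1}" and x: "x \<in> space (PS i)"
  shows "regfun (PS (Suc i)) (PW (Suc i) s) (\<lambda>g. LT i l u g x)"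
proof (rule regfunI)
  let ?z = "snd (x (i - 1))"
  have lk: "l \<le> k" using sl by simp
  fix g h a b assume gh: "g \<in> wspace (PS (Suc i)) (PW (Suc i) s)" "h \<in> wspace (PS (Suc i)) (PW (Suc i) s)"
  have "(\<integral>z'. (a * g (x(i := (y', z'))) + b * h (x(i := (y', z')))) * fd l u ?z z' \<partial>\<gamma> ?z) =
     a * (\<integral>z'. g (x(i := (y', z'))) * fd l u ?z z' \<partial>\<gamma> ?z) + b * (\<integral>z'. h (x(i := (y', z'))) * fd l u ?z z' \<partial>\<gamma> ?z)" for y'
    using LT_integrable[OF sl u gh(1) x, of ?z y'] LT_integrable[OF sl u gh(2) x, of ?z y']
    by (simp add: distrib_right mult.assoc)
  then show "LT i l u (\<lambda>x. a * g x + b * h x) x = a * LT i l u g x + b * LT i l u h x"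
    unfolding LT_def by (simp add: sum.distrib sum_distrib_left)
next
  let ?z = "snd (x (i - 1))" and ?d = "d1 + real s * q"
  have lk: "l \<le> k" using sl by simp
  fix gs g assume gs: "\<And>n. gs n \<in> wball (PS (Suc i)) (PW (Suc i) s)" "g \<in> wball (PS (Suc i)) (PW (Suc i) s)"
    and lim: "\<And>x. x \<in> space (PS (Suc i)) \<Longrightarrow> (\<lambda>n. gs n x) \<longlonglongrightarrow> g x"
  show "(\<lambda>n. LT i l u (gs n) x) \<longlonglongrightarrow> LT i l u g x"
    unfolding LT_def
  proof (intro tendsto_sum integral_dominated_convergence)
    fix y'
    show "integrable (\<gamma> ?z) (\<lambda>z'. (PW i s x + 1) * (\<phi> z' powr ?d * \<bar>fd l u ?z z'\<bar>))"
    proof (intro integrable_mult_right integrableI_bounded)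
      show "(\<lambda>z'. \<phi> z' powr ?d * \<bar>fd l u ?z z'\<bar>) \<in> borel_measurable (\<gamma> ?z)"
        by (intro borel_measurable_times borel_measurable_abs \<phi>_powr_meas\<gamma> fd_meas' lk u)
      have "(\<integral>\<^sup>+z'. ennreal (norm (\<phi> z' powr ?d * \<bar>fd l u ?z z'\<bar>)) \<partial>\<gamma> ?z) \<le> ennreal (C2 * \<phi> ?z powr (?d + q * real l))"
        using fd_bound[OF sl, of ?d u ?z] d1 q u by simp
      then show "(\<integral>\<^sup>+z'. ennreal (norm (\<phi> z' powr ?d * \<bar>fd l u ?z z'\<bar>)) \<partial>\<gamma> ?z) < \<infinity>" by (auto intro: le_less_trans)
    qed
    show "(\<lambda>z'. g (x(i := (y', z'))) * fd l u ?z z') \<in> borel_measurable (\<gamma> ?z)"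
      by (intro borel_measurable_times section_meas\<gamma> wball_meas[OF gs(2)] x fd_meas' lk u)
    show "(\<lambda>z'. gs n (x(i := (y', z'))) * fd l u ?z z') \<in> borel_measurable (\<gamma> ?z)" for n
      by (intro borel_measurable_times section_meas\<gamma> wball_meas[OF gs(1)] x fd_meas' lk u)
    show "AE z' in \<gamma> ?z. (\<lambda>n. gs n (x(i := (y', z'))) * fd l u ?z z') \<longlonglongrightarrow> g (x(i := (y', z'))) * fd l u ?z z'"
      by (intro AE_I2 tendsto_mult tendsto_const lim upd_space x)
    show "AE z' in \<gamma> ?z. norm (gs n (x(i := (y', z'))) * fd l u ?z z') \<le> (PW i s x + 1) * (\<phi> z' powr ?d * \<bar>fd l u ?z z'\<bar>)" for n
    proof (rule AE_I2)
      fix z'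
      show "norm (gs n (x(i := (y', z'))) * fd l u ?z z') \<le> (PW i s x + 1) * (\<phi> z' powr ?d * \<bar>fd l u ?z z'\<bar>)"
        using mult_right_mono[OF section_bound(2)[OF gs(1) x, of n y' z'], of "\<bar>fd l u ?z z'\<bar>"] by (simp add: abs_mult mult.assoc)
    qed
  qed
qed

lemma LT_opC:
  assumes i: "1 \<le> i"
  shows "opC k (PS (Suc i)) (PW (Suc i)) (PS i) (PW i) k 0 (LT i 0)"
proof (rule opC_seqI[of 0 k _ _ _ _ _ "LT i"])
  fix l assume "l \<le> 0 + k"
  show "opB k (PS (Suc i)) (PW (Suc i)) (PS i) (PW i) l (LT i l)"
    unfolding opB_def
  proof safe
    have "regop (PS (Suc i)) (PW (Suc i) s) (PS i) (PW i (s + l)) (real CARD('y) * C2 * (real i + 2)) (LT i l u)"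
      if "s + l \<le> k" "u \<in> {0..1}" for s u
      unfolding regop_def
      using LT_regfun[OF that] LT_bound[OF i that] LT_meas[OF i that] by (auto intro!: wballI)
    moreover have "real CARD('y) * C2 * (real i + 2) > 0" using C2 by (intro mult_pos_pos) auto
    ultimately show "\<exists>c>0. \<forall>s u. s + l \<le> k \<longrightarrow> u \<in> {0..1} \<longrightarrow> regop (PS (Suc i)) (PW (Suc i) s) (PS i) (PW i (s + l)) c (LT i l u)"
      by blast
  qed (use LT_cont in blast)
next
  fix l assume "l < 0 + k"
  show "opD k (PS (Suc i)) (PW (Suc i)) (PS i) l (LT i l) (LT i (Suc l))"
    unfolding opD_def by (intro allI impI LT_deriv) blast+
qed

definition MT :: "nat \<Rightarrow> nat \<Rightarrow> real \<Rightarrow> ((nat \<Rightarrow> 'y \<times> 'z) \<Rightarrow> real) \<Rightarrow> (nat \<Rightarrow> 'y \<times> 'z) \<Rightarrow> real" where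
  "MT i l u g x = g x * pd l u (fst (x (i - 1))) (fst (x i)) (snd (x i))"

lemma pd_PS_meas:
  assumes "l \<le> k" "u \<in> {0..1}"
  shows "(\<lambda>x. pd l u (fst (x (i - 1))) (fst (x i)) (snd (x i))) \<in> borel_measurable (PS (Suc i))"
proof (rule measurable_compose_countable'[where f = "\<lambda>y x. pd l u y (fst (x i)) (snd (x i))" and g = "\<lambda>x. fst (x (i - 1))" and I = UNIV])
  have c: "(\<lambda>x. fst (x a)) \<in> PS (Suc i) \<rightarrow>\<^sub>M count_space UNIV" if "a \<le> i" for a
    by (rule measurable_compose[OF comp_meas measurable_fst]) (use that in simp)
  show "(\<lambda>x. fst (x (i - 1))) \<in> PS (Suc i) \<rightarrow>\<^sub>M count_space UNIV" by (rule c) simp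
  have "(\<lambda>p. pd l u y (fst p) (snd p)) \<in> borel_measurable SS" for y
    by (rule SS_measurableI) (use pd_meas[OF assms] in simp)
  from measurable_compose[OF comp_meas[of i "Suc i"] this]
  show "(\<lambda>x. pd l u y (fst (x i)) (snd (x i))) \<in> borel_measurable (PS (Suc i))" for y by simp
qed (auto intro: countable_finite)

text \<open>The operator multiplies by a scalar at each path, so uniformity over test functions only
  uses that they are bounded by \<open>PW\<close> there.\<close>

lemma MT_opC:
  shows "opC k (PS (Suc i)) (PW (Suc i)) (PS (Suc i)) (PW (Suc i)) k 0 (MT i 0)"
proof (rule opC_seqI[of 0 k _ _ _ _ _ "MT i"])
  fix l assume "l \<le> 0 + k"
  then have lk: "l \<le> k" by simp
  show "opB k (PS (Suc i)) (PW (Suc i)) (PS (Suc i)) (PW (Suc i)) l (MT i l)"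
    unfolding opB_def
  proof safe
    let ?c = "C * (real (Suc i) + 1)"
    have "regop (PS (Suc i)) (PW (Suc i) s) (PS (Suc i)) (PW (Suc i) (s + l)) ?c (MT i l u)"
      if u: "u \<in> {0..1}" for s u
      unfolding regop_def
    proof safe
      fix g assume g: "g \<in> wball (PS (Suc i)) (PW (Suc i) s)"
      show "MT i l u g \<in> wball (PS (Suc i)) (\<lambda>x. ?c * PW (Suc i) (s + l) x)"
      proof (rule wballI)
        show "MT i l u g \<in> borel_measurable (PS (Suc i))"
          unfolding MT_def[abs_def] by (intro borel_measurable_times wball_meas[OF g] pd_PS_meas lk u)
        fix x assume x: "x \<in> space (PS (Suc i))"
        have "\<bar>MT i l u g x\<bar> \<le> PW (Suc i) s x * (C * \<phi> (snd (x i)) powr (q * real l))"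
          unfolding MT_def abs_mult pd_def using wball_bound[OF g x] P_bound[OF lk u] C
          by (intro mult_mono) (auto simp: sum_weight_def sum_nonneg V_pos)
        also have "\<dots> \<le> C * ((real (Suc i) + 1) * PW (Suc i) (s + l) x)"
          using mult_left_mono[OF PW_mix[of i "Suc i" s x l], of C] C by (simp add: mult.left_commute)
        finally show "\<bar>MT i l u g x\<bar> \<le> ?c * PW (Suc i) (s + l) x" by (simp add: mult.assoc)
      qed
    next
      fix x assume x: "x \<in> space (PS (Suc i))"
      show "regfun (PS (Suc i)) (PW (Suc i) s) (\<lambda>g. MT i l u g x)"
        unfolding MT_def using x by (intro regfunI) (auto simp: algebra_simps intro!: tendsto_intros)
    qed
    moreover have "?c > 0" using C by (intro mult_pos_pos) auto
    ultimately show "\<exists>c>0. \<forall>s u. s + l \<le> k \<longrightarrow> u \<in> {0..1} \<longrightarrow> regop (PS (Suc i)) (PW (Suc i) s) (PS (Suc i)) (PW (Suc i) (s + l)) c (MT i l u)"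
      by blast
    fix s u x v and g :: "nat \<Rightarrow> _" assume a: "u \<in> {0..1::real}" "x \<in> space (PS (Suc i))"
      "\<forall>n::nat. v n \<in> {0..1::real}" "v \<longlonglongrightarrow> u" "\<forall>n. g n \<in> wball (PS (Suc i)) (PW (Suc i) s)"
    let ?p = "\<lambda>w. pd l w (fst (x (i - 1))) (fst (x i)) (snd (x i))"
    show "(\<lambda>n. MT i l (v n) (g n) x - MT i l u (g n) x) \<longlonglongrightarrow> 0"
    proof (rule Lim_null_comparison)
      show "\<forall>\<^sub>F n in sequentially. norm (MT i l (v n) (g n) x - MT i l u (g n) x) \<le> PW (Suc i) s x * \<bar>?p (v n) - ?p u\<bar>"
        using wball_bound[OF a(5)[rule_format] a(2)]
        by (intro always_eventually allI) (auto simp: MT_def right_diff_distrib[symmetric] abs_mult intro!: mult_right_mono)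
      have "(\<lambda>n. ?p (v n)) \<longlonglongrightarrow> ?p u"
        by (rule continuous_on_tendsto_compose[OF pd_cont[OF lk] a(4,1)]) (use a(3) in auto)
      then have "(\<lambda>n. PW (Suc i) s x * \<bar>?p (v n) - ?p u\<bar>) \<longlonglongrightarrow> PW (Suc i) s x * \<bar>?p u - ?p u\<bar>"
        by (intro tendsto_intros)
      then show "(\<lambda>n. PW (Suc i) s x * \<bar>?p (v n) - ?p u\<bar>) \<longlonglongrightarrow> 0" by simp
    qed
  qed
next
  fix l assume "l < 0 + k"
  then have lk: "l < k" by simp
  show "opD k (PS (Suc i)) (PW (Suc i)) (PS (Suc i)) l (MT i l) (MT i (Suc l))"
    unfolding opD_def
  proof safe
    fix s u x v and g :: "nat \<Rightarrow> _" assume a: "u \<in> {0..1::real}" "x \<in> space (PS (Suc i))"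
      "\<forall>n::nat. v n \<in> {0..1::real} - {u}" "v \<longlonglongrightarrow> u" "\<forall>n. g n \<in> wball (PS (Suc i)) (PW (Suc i) s)"
    let ?p = "\<lambda>l w. pd l w (fst (x (i - 1))) (fst (x i)) (snd (x i))"
    show "(\<lambda>n. (MT i l (v n) (g n) x - MT i l u (g n) x) / (v n - u) - MT i (Suc l) u (g n) x) \<longlonglongrightarrow> 0"
    proof (rule Lim_null_comparison)
      have "(MT i l (v n) (g n) x - MT i l u (g n) x) / (v n - u) - MT i (Suc l) u (g n) x =
          g n x * ((?p l (v n) - ?p l u) / (v n - u) - ?p (Suc l) u)" for n
        by (simp add: MT_def right_diff_distrib)
      then show "\<forall>\<^sub>F n in sequentially. norm ((MT i l (v n) (g n) x - MT i l u (g n) x) / (v n - u) - MT i (Suc l) u (g n) x)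
          \<le> PW (Suc i) s x * \<bar>(?p l (v n) - ?p l u) / (v n - u) - ?p (Suc l) u\<bar>"
        using wball_bound[OF a(5)[rule_format] a(2)]
        by (intro always_eventually allI) (auto simp: abs_mult intro!: mult_right_mono)
      have "(\<lambda>n. (?p l (v n) - ?p l u) / (v n - u)) \<longlonglongrightarrow> ?p (Suc l) u"
        by (rule deriv_seq[OF pd_deriv[OF lk a(1)] _ a(4)]) (use a(3) in auto)
      then have "(\<lambda>n. PW (Suc i) s x * \<bar>(?p l (v n) - ?p l u) / (v n - u) - ?p (Suc l) u\<bar>) \<longlonglongrightarrow> PW (Suc i) s x * \<bar>?p (Suc l) u - ?p (Suc l) u\<bar>"
        by (intro tendsto_mult tendsto_const tendsto_rabs tendsto_diff)
      then show "(\<lambda>n. PW (Suc i) s x * \<bar>(?p l (v n) - ?p l u) / (v n - u) - ?p (Suc l) u\<bar>) \<longlonglongrightarrow> 0" by simp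
    qed
  qed
qed

definition TT :: "nat \<Rightarrow> real \<Rightarrow> ((nat \<Rightarrow> 'y \<times> 'z) \<Rightarrow> real) \<Rightarrow> (nat \<Rightarrow> 'y \<times> 'z) \<Rightarrow> real" where
  "TT i u g x = (\<integral>y. g (x(i := y)) \<partial>Q u (x (i - 1)))"

text \<open>The kernel that appends one coordinate to a path, as in the Ionescu-Tulcea
  construction.\<close>

definition ext :: "nat \<Rightarrow> real \<Rightarrow> (nat \<Rightarrow> 'y \<times> 'z) \<Rightarrow> (nat \<Rightarrow> 'y \<times> 'z) measure" where
  "ext i u x = distr (Q u (x (i - 1))) (PS (Suc i)) (\<lambda>y. x(i := y))"

lemma upd_measQ: "u \<in> {0..1} \<Longrightarrow> x \<in> space (PS i) \<Longrightarrow> (\<lambda>y. x(i := y)) \<in> Q u x' \<rightarrow>\<^sub>M PS (Suc i)"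
  using upd_meas kernelD(2)[OF Q_markov] by (simp cong: measurable_cong_sets)

lemma ext_markov: "1 \<le> i \<Longrightarrow> u \<in> {0..1} \<Longrightarrow> ext i u \<in> PS i \<rightarrow>\<^sub>M prob_algebra (PS (Suc i))"
  unfolding ext_def[abs_def]
  by (intro measurable_distr_prob_space2[OF measurable_compose[OF comp_meas Q_markov] upd_meas2]) auto

lemma integral_ext:
  "u \<in> {0..1} \<Longrightarrow> x \<in> space (PS i) \<Longrightarrow> g \<in> borel_measurable (PS (Suc i)) \<Longrightarrow> (\<integral>p. g p \<partial>ext i u x) = TT i u g x"
  unfolding ext_def TT_def by (rule integral_distr[OF upd_measQ])

lemma nn_integral_ext:
  "u \<in> {0..1} \<Longrightarrow> x \<in> space (PS i) \<Longrightarrow> h \<in> borel_measurable (PS (Suc i)) \<Longrightarrow>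
    (\<integral>\<^sup>+p. h p \<partial>ext i u x) = (\<integral>\<^sup>+y. h (x(i := y)) \<partial>Q u (x (i - 1)))"
  unfolding ext_def by (rule nn_integral_distr[OF upd_measQ]) auto

lemma ext_growth:
  assumes i: "1 \<le> i" and u: "u \<in> {0..1}" and s: "s \<le> k" and x: "x \<in> space (PS i)"
  shows "(\<integral>\<^sup>+p. ennreal (PW (Suc i) s p) \<partial>ext i u x) \<le> ennreal ((1 + K1) * PW i s x)"
proof -
  have A0: "0 \<le> PW i s x" by (simp add: sum_weight_def sum_nonneg V_pos)
  have "(\<integral>\<^sup>+p. ennreal (PW (Suc i) s p) \<partial>ext i u x) = (\<integral>\<^sup>+y. ennreal (1 * V s y + PW i s x) \<partial>Q u (x (i - 1)))"
    by (subst nn_integral_ext[OF u x measurable_compose[OF PW_meas measurable_ennreal]]) (simp add: PW_upd add.commute)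
  also have "\<dots> \<le> ennreal (1 * (K1 * V s (x (i - 1))) + PW i s x)"
    using Q_growth[OF u s, of "x (i - 1)"] kernelD(1,2)[OF Q_markov[OF u], of "x (i - 1)"] K1 V_pos A0
    by (intro nn_integral_affine_le) (auto cong: measurable_cong_sets)
  also have "\<dots> \<le> ennreal ((1 + K1) * PW i s x)"
    using V_le_PW[of "i - 1" i s x] i K1 by (intro ennreal_leI) (simp add: distrib_right)
  finally show ?thesis .
qed

lemma TT_regfun:
  assumes i: "1 \<le> i" and u: "u \<in> {0..1}" and s: "s \<le> k" and x: "x \<in> space (PS i)"
  shows "regfun (PS (Suc i)) (PW (Suc i) s) (\<lambda>g. TT i u g x)"
proof (rule regfun_cong_fun)
  show "regfun (PS (Suc i)) (PW (Suc i) s) (\<lambda>g. \<integral>p. g p \<partial>ext i u x)"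
  proof (rule regfun_integral[OF kernelD(2)[OF ext_markov[OF i u] x]])
    show "integrable (ext i u x) (PW (Suc i) s)"
      by (rule integrable_kernel(1)[OF ext_markov[OF i u] x, where c = "(1 + K1) * PW i s x"])
         (use ext_growth[OF i u s x] in \<open>auto intro: PW_meas simp: sum_weight_def sum_nonneg V_pos\<close>)
  qed
  show "TT i u g x = (\<integral>p. g p \<partial>ext i u x)" if "g \<in> wspace (PS (Suc i)) (PW (Suc i) s)" for g
    using integral_ext[OF u x wspace_meas[OF that]] by simp
qed

text \<open>Both sides have the dominated continuity property in \<open>g\<close>, so indicators
  suffice. For these all integrands are nonnegative, and the factorization is read off from extended
  integrals.\<close>

lemma TT_eq:
  assumes i: "1 \<le> i" and u: "u \<in> {0..1}" and s: "s \<le> k" and x: "x \<in> space (PS i)"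
    and g: "g \<in> wspace (PS (Suc i)) (PW (Suc i) s)"
  shows "TT i u g x = LT i 0 u (MT i 0 u g) x"
proof (rule regfun_eq_indicatorI[where L = "\<lambda>g. TT i u g x" and K = "\<lambda>g. LT i 0 u (MT i 0 u g) x"
      and M = "PS (Suc i)" and w = "PW (Suc i) s"])
  show "regfun (PS (Suc i)) (PW (Suc i) s) (\<lambda>g. TT i u g x)" by (rule TT_regfun[OF i u s x])
  show "g \<in> wspace (PS (Suc i)) (PW (Suc i) s)" by (rule g)
  obtain c where c: "c > 0" "\<And>s u. s + 0 \<le> k \<Longrightarrow> u \<in> {0..1} \<Longrightarrow> regop (PS (Suc i)) (PW (Suc i) s) (PS (Suc i)) (PW (Suc i) (s + 0)) c (MT i 0 u)"
    using opC_opB[OF MT_opC] by (rule opB_regop) blast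
  show "regfun (PS (Suc i)) (PW (Suc i) s) (\<lambda>g. LT i 0 u (MT i 0 u g) x)"
  proof (rule regfun_comp[where L = "\<lambda>g. LT i 0 u g x" and A = "MT i 0 u" and c = c])
    show "regfun (PS (Suc i)) (PW (Suc i) s) (\<lambda>g. LT i 0 u g x)" using s by (intro LT_regfun u x) simp
    show "regop (PS (Suc i)) (PW (Suc i) s) (PS (Suc i)) (PW (Suc i) s) c (MT i 0 u)" using c(2)[of s u] s u by simp
  qed (use c(1) in \<open>auto simp: sum_weight_def sum_nonneg V_pos\<close>)
  show "1 \<le> PW (Suc i) s p" for p by (rule PW_ge1) simp
  fix A assume A: "A \<in> sets (PS (Suc i))"
  define y0 z0 where "y0 = fst (x (i - 1))" and "z0 = snd (x (i - 1))"
  have x0: "x (i - 1) = (y0, z0)" by (simp add: y0_def z0_def)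
  \<comment> \<open>For \<open>i = 0\<close> truncated subtraction would make the update overwrite
    the state that the kernel starts from.\<close>
  have i1: "i - 1 \<noteq> i" using i by simp
  have im: "(indicator A :: _ \<Rightarrow> real) \<in> borel_measurable (PS (Suc i))" "(indicator A :: _ \<Rightarrow> ennreal) \<in> borel_measurable (PS (Suc i))"
    using A by auto
  interpret Qp: prob_space "Q u (x (i - 1))" by (rule kernelD(1)[OF Q_markov[OF u]]) simp
  let ?r = "\<lambda>y' z'. P u y0 y' z' * f u z0 z' * indicator A (x(i := (y', z')))"
  have rm: "?r y' \<in> borel_measurable (\<gamma> z0)" for y'
    using P_meas[OF u] f_meas1[OF u] by (intro borel_measurable_times section_meas\<gamma> im x)
      (simp_all add: measurable_cong_sets[OF sets_\<gamma> refl])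
  have r0: "0 \<le> ?r y' z'" for y' z' using P_pos[OF u, of y0 y' z'] f_nonneg[OF u, of z0 z'] by simp
  have hm: "(\<lambda>y. indicator A (x(i := y)) :: ennreal) \<in> borel_measurable SS"
    by (rule measurable_compose[OF upd_meas[OF x] im(2)])
  have sum_eq: "(\<integral>\<^sup>+y. indicator A (x(i := y)) \<partial>Q u (y0, z0)) = (\<Sum>y'\<in>UNIV. \<integral>\<^sup>+z'. ennreal (?r y' z') \<partial>\<gamma> z0)"
    unfolding nn_integral_Q[OF u hm]
  proof (intro sum.cong refl)
    fix y'
    have "(\<lambda>z'. ennreal (P u y0 y' z') * indicator A (x(i := (y', z')))) \<in> borel_measurable borel"
      by (intro borel_measurable_times_ennreal measurable_compose[OF P_meas[OF u] measurable_ennreal] SS_measurableD[OF hm])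
    then have "(\<integral>\<^sup>+z'. ennreal (P u y0 y' z') * indicator A (x(i := (y', z'))) \<partial>Qb u z0)
        = (\<integral>\<^sup>+z'. ennreal (f u z0 z') * (ennreal (P u y0 y' z') * indicator A (x(i := (y', z')))) \<partial>\<gamma> z0)"
      by (rule nn_integral_Qb[OF u])
    also have "\<dots> = (\<integral>\<^sup>+z'. ennreal (?r y' z') \<partial>\<gamma> z0)"
      using P_pos[OF u, of y0 y'] f_nonneg[OF u, of z0]
      by (intro nn_integral_cong) (auto simp: indicator_def ennreal_mult[symmetric] less_imp_le mult.commute)
    finally show "(\<integral>\<^sup>+z'. ennreal (P u y0 y' z') * indicator A (x(i := (y', z'))) \<partial>Qb u z0) = (\<integral>\<^sup>+z'. ennreal (?r y' z') \<partial>\<gamma> z0)" .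
  qed
  have L1: "ennreal (TT i u (indicator A) x) = (\<integral>\<^sup>+y. indicator A (x(i := y)) \<partial>Q u (y0, z0))"
  proof -
    have m: "(\<lambda>y. indicator A (x(i := y)) :: real) \<in> borel_measurable (Q u (x (i - 1)))"
      by (rule measurable_compose[OF upd_measQ[OF u x] im(1)])
    have "integrable (Q u (x (i - 1))) (\<lambda>y. indicator A (x(i := y)) :: real)"
      by (rule Qp.integrable_const_bound[of _ 1]) (use m in \<open>auto simp: indicator_def\<close>)
    from nn_integral_eq_integral[OF this] have "(\<integral>\<^sup>+y. ennreal (indicator A (x(i := y))) \<partial>Q u (x (i - 1))) = ennreal (TT i u (indicator A) x)"
      unfolding TT_def by simp
    then show ?thesis unfolding x0[symmetric] by (simp add: ennreal_indicator)
  qed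
  have fin: "(\<integral>\<^sup>+z'. ennreal (?r y' z') \<partial>\<gamma> z0) < \<infinity>" for y'
  proof -
    have "(\<integral>\<^sup>+z'. ennreal (?r y' z') \<partial>\<gamma> z0) \<le> (\<Sum>y'\<in>UNIV. \<integral>\<^sup>+z'. ennreal (?r y' z') \<partial>\<gamma> z0)"
      by (intro member_le_sum) auto
    also have "\<dots> = ennreal (TT i u (indicator A) x)" using L1 sum_eq by simp
    finally show ?thesis by (auto intro: le_less_trans)
  qed
  have int: "integrable (\<gamma> z0) (?r y')" for y'
  proof (rule integrableI_bounded[OF rm])
    show "(\<integral>\<^sup>+z'. ennreal (norm (?r y' z')) \<partial>\<gamma> z0) < \<infinity>"
      using fin[of y'] unfolding real_norm_def abs_of_nonneg[OF r0] .
  qed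
  have "LT i 0 u (MT i 0 u (indicator A)) x = (\<Sum>y'\<in>UNIV. \<integral>z'. ?r y' z' \<partial>\<gamma> z0)"
    unfolding LT_def MT_def y0_def z0_def using i1
    by (intro sum.cong refl Bochner_Integration.integral_cong) (auto simp: fd_def pd_def)
  moreover have "ennreal (\<Sum>y'\<in>UNIV. \<integral>z'. ?r y' z' \<partial>\<gamma> z0) = (\<Sum>y'\<in>UNIV. \<integral>\<^sup>+z'. ennreal (?r y' z') \<partial>\<gamma> z0)"
    using nn_integral_eq_integral[OF int] r0
    by (subst sum_ennreal[symmetric]) (auto intro!: Bochner_Integration.integral_nonneg)
  moreover have "0 \<le> (\<Sum>y'\<in>UNIV. \<integral>z'. ?r y' z' \<partial>\<gamma> z0)" by (intro sum_nonneg Bochner_Integration.integral_nonneg r0)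
  moreover have "0 \<le> TT i u (indicator A) x" unfolding TT_def by (intro Bochner_Integration.integral_nonneg) simp
  ultimately show "TT i u (indicator A) x = LT i 0 u (MT i 0 u (indicator A)) x"
    using L1 sum_eq by (metis ennreal_inj)
qed

lemma TT_opC:
  assumes i: "1 \<le> i"
  shows "opC k (PS (Suc i)) (PW (Suc i)) (PS i) (PW i) k 0 (TT i)"
proof (rule opC_cong)
  show "opC k (PS (Suc i)) (PW (Suc i)) (PS i) (PW i) k 0 (\<lambda>u g. LT i 0 u (MT i 0 u g))"
    using opC_comp[OF mono_weights_PW mono_weights_PW mono_weights_PW LT_opC[OF i] MT_opC] i by simp
qed (rule TT_eq[OF i])

section \<open>Smoothness of the one-step, inverse and path operators\<close>

definition single :: "'y \<times> 'z \<Rightarrow> nat \<Rightarrow> 'y \<times> 'z" where "single x = (\<lambda>i\<in>{0..<1}. x)"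

lemma single_meas: "single \<in> SS \<rightarrow>\<^sub>M PS 1"
  unfolding single_def[abs_def] by (rule measurable_restrict) simp

lemma PW_single: "PW 1 s (single x) = V s x"
  by (simp add: sum_weight_def single_def)

lemma single_opC: "opC k (PS 1) (PW 1) SS V n 0 (\<lambda>u g x. g (single x))"
  by (rule opC_const[OF mono_weights_V regop_subst[OF single_meas, of _ 1]]) (auto simp: PW_single[simplified])

text \<open>This reuses the path operator: \<open>T u\<close> is \<open>TT 1 u\<close> applied to
  functions of the new coordinate only and evaluated at a path of length 1.\<close>

lemma T_opC: "opC k SS V SS V k 0 T"
proof -
  have "regop SS (V s) (PS (Suc 1)) (PW (Suc 1) s) 1 (\<lambda>g p. g (p 1))" for s
    by (rule regop_subst) (use comp_meas[of 1 "Suc 1"] V_le_PW[of 1 "Suc 1"] in auto)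
  then have E: "opC k SS V (PS (Suc 1)) (PW (Suc 1)) k 0 (\<lambda>u g p. g (p 1))"
    by (intro opC_const[of _ _ _ _ _ 1] mono_weights_PW) auto
  have "opC k SS V (PS 1) (PW 1) k 0 (\<lambda>u g. TT 1 u (\<lambda>p. g (p 1)))"
    using opC_comp[OF mono_weights_V mono_weights_PW mono_weights_PW TT_opC E] by simp
  then have "opC k SS V SS V k 0 (\<lambda>u g x. TT 1 u (\<lambda>p. g (p 1)) (single x))"
    using opC_comp[OF mono_weights_V mono_weights_PW mono_weights_V single_opC] by simp
  moreover have "(\<lambda>u g x. TT 1 u (\<lambda>p. g (p 1)) (single x)) = T"
    by (simp add: fun_eq_iff TT_def T_def single_def)
  ultimately show ?thesis by simp
qed

text \<open>The subtracted evaluation is a constant family in \<open>u\<close>;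
  \<open>V k base\<close> bounds it on every level.\<close>

lemma Sop_opC: "opC k SS V SS V k 0 Sop"
proof -
  have "regop SS (V s) SS (V s) (V k base) (\<lambda>g x. - g base)" if "s \<le> k" for s
    unfolding regop_def
  proof safe
    fix g assume g: "g \<in> wball SS (V s)"
    show "(\<lambda>x. - g base) \<in> wball SS (\<lambda>x. V k base * V s x)"
    proof (rule wballI)
      fix x :: "'y \<times> 'z"
      have "\<bar>g base\<bar> * 1 \<le> V k base * V s x"
        using wball_bound[OF g, of base] V_mono[OF that, of base] V_ge1[of s x] V_pos(2)[of k base]
        by (intro mult_mono) auto
      then show "\<bar>- g base\<bar> \<le> V k base * V s x" by simp
    qed simp
  next
    show "regfun SS (V s) (\<lambda>g. - g base)"
    proof (rule regfunI)
      show "(\<lambda>n. - gs n base) \<longlonglongrightarrow> - g base" if "\<And>x. x \<in> space SS \<Longrightarrow> (\<lambda>n. gs n x) \<longlonglongrightarrow> g x"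
        for gs :: "nat \<Rightarrow> 'y \<times> 'z \<Rightarrow> real" and g
        by (intro tendsto_minus that) simp
    qed simp
  qed
  then have "opC k SS V SS V k 0 (\<lambda>u g x. - g base)"
    by (intro opC_const[of _ _ _ _ _ "V k base"] mono_weights_V) (auto simp: V_pos)
  from opC_add[OF mono_weights_V T_opC this] show ?thesis
    by (simp add: Sop_def[abs_def])
qed

lemma Y_opC: "opC k SS V SS V k 0 Y"
proof -
  obtain c where c: "c > 0" "\<And>s u. s \<le> k \<Longrightarrow> u \<in> {0..1} \<Longrightarrow> regop SS (V s) SS (V s) c (Y u)"
    by (rule Y_regop) blast
  show ?thesis
    by (rule opC_inverse[OF mono_weights_V c(2) c(1) _ Sop_opC]) (auto intro: Y_resolvent)
qed

text \<open>The coordinates are integrated out from the last one backwards, so each new kernel is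
  the innermost factor.\<close>

primrec PT :: "nat \<Rightarrow> real \<Rightarrow> ((nat \<Rightarrow> 'y \<times> 'z) \<Rightarrow> real) \<Rightarrow> (nat \<Rightarrow> 'y \<times> 'z) \<Rightarrow> real" where
  "PT 0 u g = g"
| "PT (Suc j) u g = PT j u (TT (Suc j) u g)"

lemma PT_opC: "opC k (PS (Suc j)) (PW (Suc j)) (PS 1) (PW 1) k 0 (PT j)"
proof (induction j)
  case 0
  have "regop (PS 1) (PW 1 s) (PS 1) (PW 1 s) 1 (\<lambda>g. g)" for s by (auto simp: regop_def intro!: regfunI)
  then have "opC k (PS 1) (PW 1) (PS 1) (PW 1) k 0 (\<lambda>u g. g)"
    by (intro opC_const[of _ _ _ _ _ 1] mono_weights_PW) auto
  then show ?case by (simp add: fun_eq_iff)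
next
  case (Suc j)
  show ?case
    using opC_comp[OF mono_weights_PW mono_weights_PW mono_weights_PW Suc TT_opC[of "Suc j"]] by simp
qed

definition path_op :: "nat \<Rightarrow> real \<Rightarrow> ((nat \<Rightarrow> 'y \<times> 'z) \<Rightarrow> real) \<Rightarrow> 'y \<times> 'z \<Rightarrow> real" where
  "path_op j u g x = PT j u g (single x)"

lemma path_op_opC: "opC k (PS (Suc j)) (PW (Suc j)) SS V k 0 (path_op j)"
  using opC_comp[OF mono_weights_PW mono_weights_PW mono_weights_V single_opC PT_opC[of j]]
  by (simp add: path_op_def[abs_def])

lemma Y_path_opC: "opC k (PS (Suc j)) (PW (Suc j)) SS V k 0 (\<lambda>u g. Y u (path_op j u g))"
  using opC_comp[OF mono_weights_PW mono_weights_V mono_weights_V Y_opC path_op_opC[of j]] by simp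

lemma opC_wspace:
  assumes A: "opC k M W N W' n 0 A" and N: "mono_weights N W'" and s: "s \<le> k" and u: "u \<in> {0..1}" and g: "g \<in> wspace M (W s)"
  shows "A u g \<in> wspace N (W' s)"
proof -
  obtain c where c: "c > 0" "\<And>s u. s + 0 \<le> k \<Longrightarrow> u \<in> {0..1} \<Longrightarrow> regop M (W s) N (W' (s + 0)) c (A u)"
    using opC_opB[OF A] by (rule opB_regop) blast
  show ?thesis
    using c(2)[of s u] s u c(1) g mono_weightsD(3)[OF N] by (intro regop_wspace[of M "W s" N "W' s" c "A u"]) auto
qed

section \<open>Path laws as integrals of path operators\<close>

lemma bind_ext:
  assumes L: "L \<in> space (prob_algebra (PS i))" "integrable L (PW i s)" and i: "1 \<le> i" and u: "u \<in> {0..1}" and s: "s \<le> k"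
    and g: "g \<in> wspace (PS (Suc i)) (PW (Suc i) s)"
  shows "(\<integral>p. g p \<partial>(L \<bind> ext i u)) = (\<integral>x. TT i u g x \<partial>L)" "integrable (L \<bind> ext i u) (PW (Suc i) s)"
    "L \<bind> ext i u \<in> space (prob_algebra (PS (Suc i)))"
proof -
  note b = integral_bind_kernel[OF L(1) ext_markov[OF i u] PW_meas PW_ge1 PW_meas _ ext_growth[OF i u s] _ L(2) g]
  have spL: "space L = space (PS i)" using L(1) by (auto simp: space_prob_algebra dest: sets_eq_imp_space_eq)
  have "(\<integral>p. g p \<partial>(L \<bind> ext i u)) = (\<integral>x. (\<integral>p. g p \<partial>ext i u x) \<partial>L)"
    using b(1) K1 by (simp add: sum_weight_def sum_nonneg V_pos)
  also have "\<dots> = (\<integral>x. TT i u g x \<partial>L)"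
    using integral_ext[OF u _ wspace_meas[OF g]] spL by (intro Bochner_Integration.integral_cong) auto
  finally show "(\<integral>p. g p \<partial>(L \<bind> ext i u)) = (\<integral>x. TT i u g x \<partial>L)" .
  show "integrable (L \<bind> ext i u) (PW (Suc i) s)"
    using b(2) K1 by (simp add: sum_weight_def sum_nonneg V_pos)
  show "L \<bind> ext i u \<in> space (prob_algebra (PS (Suc i)))"
    using prob_space_bind'[OF L(1) ext_markov[OF i u]] sets_bind'[OF L(1) ext_markov[OF i u]] by (simp add: space_prob_algebra)
qed

lemma PW_le: "s \<le> t \<Longrightarrow> PW i s x \<le> PW i t x"
  unfolding sum_weight_def by (intro sum_mono V_mono)

text \<open>The recursion of the Ionescu-Tulcea construction, whose extension kernels are recognized
  as \<open>ext\<close>.\<close>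

lemma path_law_rec:
  assumes u: "u \<in> {0..1}"
  shows "path_law SS (stat u) (Q u) 1 = distr (stat u) (PS 1) single"
    and "path_law SS (stat u) (Q u) (Suc (Suc j)) = path_law SS (stat u) (Q u) (Suc j) \<bind> ext (Suc j) u"
proof -
  let ?P = "\<lambda>i x. case i of 0 \<Rightarrow> stat u | Suc i' \<Rightarrow> Q u (x i')"
  have st: "stat u \<in> space (prob_algebra SS)" by (rule stat(1)[OF u])
  have Pm: "?P i \<in> PS i \<rightarrow>\<^sub>M prob_algebra SS" for i
  proof (cases i)
    case 0 then show ?thesis using st by simp
  next
    case (Suc i')
    then show ?thesis using measurable_compose[OF comp_meas Q_markov[OF u], of i' i] by simp
  qed
  interpret I: Ionescu_Tulcea ?P "\<lambda>_. SS"
  proof (rule Ionescu_Tulcea.intro)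
    show "?P i \<in> PS i \<rightarrow>\<^sub>M subprob_algebra SS" for i by (rule measurable_prob_algebraD[OF Pm])
    show "prob_space (?P i x)" if "x \<in> space (PS i)" for i x by (rule kernelD(1)[OF Pm that])
  qed
  have eP: "I.eP (Suc i) = ext (Suc i) u" for i
    by (simp add: fun_eq_iff I.eP_def ext_def)
  have und: "(\<lambda>_. undefined) \<in> space (PS 0)" by (simp add: space_PiM)
  have "path_law SS (stat u) (Q u) 1 = return (PS 0) (\<lambda>_. undefined) \<bind> I.eP 0"
    unfolding path_law_def by simp
  also have "\<dots> = I.eP 0 (\<lambda>_. undefined)"
    using und by (rule bind_return[OF I.measurable_eP])
  also have "\<dots> = distr (stat u) (PS 1) single"
    unfolding I.eP_def by (intro distr_cong) (auto simp: single_def fun_eq_iff restrict_def)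
  finally show "path_law SS (stat u) (Q u) 1 = distr (stat u) (PS 1) single" .
  show "path_law SS (stat u) (Q u) (Suc (Suc j)) = path_law SS (stat u) (Q u) (Suc j) \<bind> ext (Suc j) u"
    using eP[of j] unfolding path_law_def by simp
qed

text \<open>Supplies a test function where \<open>bind_ext\<close> is used only for its
  integrability and probability claims.\<close>

lemma PS_zero: "(\<lambda>_. 0) \<in> wspace (PS i) (PW i s)"
  by (rule wspaceI[of 1], simp, rule wballI) (auto simp: sum_weight_def sum_nonneg V_pos)

lemma path_law:
  assumes u: "u \<in> {0..1}"
  shows "path_law SS (stat u) (Q u) (Suc j) \<in> space (prob_algebra (PS (Suc j))) \<and>
    integrable (path_law SS (stat u) (Q u) (Suc j)) (PW (Suc j) k) \<and>
    (\<forall>s\<le>k. \<forall>g\<in>wspace (PS (Suc j)) (PW (Suc j) s).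
       (\<integral>p. g p \<partial>path_law SS (stat u) (Q u) (Suc j)) = (\<integral>x. path_op j u g x \<partial>stat u))"
proof (induction j)
  note st = stat[OF u]
  have st': "sets (stat u) = sets SS" "prob_space (stat u)" using st(1) by (auto simp: space_prob_algebra)
  have sm: "single \<in> stat u \<rightarrow>\<^sub>M PS 1" using single_meas st'(1) by (simp cong: measurable_cong_sets)
  have one: "Suc 0 = 1" by simp
  case 0
  have "distr (stat u) (PS 1) single \<in> space (prob_algebra (PS 1))"
    using prob_space.prob_space_distr[OF st'(2) sm] by (simp add: space_prob_algebra)
  moreover have "integrable (distr (stat u) (PS 1) single) (PW 1 k)"
    using st(3) by (subst integrable_distr_eq[OF sm PW_meas]) (simp only: PW_single)
  moreover have "(\<integral>p. g p \<partial>distr (stat u) (PS 1) single) = (\<integral>x. path_op 0 u g x \<partial>stat u)"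
    if "g \<in> wspace (PS 1) (PW 1 s)" for g s
    using integral_distr[OF sm wspace_meas[OF that]] by (simp add: path_op_def)
  ultimately show ?case unfolding one path_law_rec(1)[OF u] by blast
next
  case (Suc j)
  have L: "path_law SS (stat u) (Q u) (Suc j) \<in> space (prob_algebra (PS (Suc j)))"
    "integrable (path_law SS (stat u) (Q u) (Suc j)) (PW (Suc j) k)" using Suc.IH by blast+
  have j1: "1 \<le> Suc j" by simp
  have "(\<integral>p. g p \<partial>(path_law SS (stat u) (Q u) (Suc j) \<bind> ext (Suc j) u)) = (\<integral>x. path_op (Suc j) u g x \<partial>stat u)"
    if s: "s \<le> k" and g: "g \<in> wspace (PS (Suc (Suc j))) (PW (Suc (Suc j)) s)" for s g
  proof -
    have gk: "g \<in> wspace (PS (Suc (Suc j))) (PW (Suc (Suc j)) k)"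
      by (rule wspace_mono[OF g PW_le[OF s]])
    have "(\<integral>p. g p \<partial>(path_law SS (stat u) (Q u) (Suc j) \<bind> ext (Suc j) u)) = (\<integral>x. TT (Suc j) u g x \<partial>path_law SS (stat u) (Q u) (Suc j))"
      by (rule bind_ext(1)[OF L j1 u order_refl gk])
    also have "\<dots> = (\<integral>x. path_op j u (TT (Suc j) u g) x \<partial>stat u)"
      using Suc.IH s opC_wspace[OF TT_opC[OF j1] mono_weights_PW[OF j1] s u g] by blast
    finally show ?thesis by (simp add: path_op_def)
  qed
  with bind_ext(2,3)[OF L j1 u order_refl PS_zero] show ?case unfolding path_law_rec(2)[OF u] by blast
qed

lemma path_op_wspace: "s \<le> k \<Longrightarrow> u \<in> {0..1} \<Longrightarrow> g \<in> wspace (PS (Suc j)) (PW (Suc j) s) \<Longrightarrow> path_op j u g \<in> wspace SS (V s)"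
  by (rule opC_wspace[OF path_op_opC mono_weights_V])

lemma path_law_Y:
  assumes u: "u \<in> {0..1}" and s: "s \<le> k" and g: "g \<in> wspace (PS (Suc j)) (PW (Suc j) s)"
  shows "(\<integral>p. g p \<partial>path_law SS (stat u) (Q u) (Suc j)) = Y u (path_op j u g) base"
  using path_law[OF u, of j] s g stat(4)[OF u s path_op_wspace[OF s u g]] by simp

text \<open>The path law is the set function of
  \<open>g \<mapsto> Y u (path_op j' u g) base\<close>, whose smoothness is
  \<open>Y_path_opC\<close>.\<close>

lemma stationary_smooth:
  assumes j: "1 \<le> j"
  shows "Ck01_weighted k (PS j) (PW j 0) (\<lambda>u. measure (stationary_path_law SS Q u j))"
proof -
  obtain j' where j': "j = Suc j'" using j by (cases j) auto
  show ?thesis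
    unfolding j'
  proof (rule opC_Ck01_weighted[OF mono_weights_PW Y_path_opC, where x = base])
    fix u :: real assume u: "u \<in> {0..1}"
    let ?L = "path_law SS (stat u) (Q u) (Suc j')"
    have L: "sets ?L = sets (PS (Suc j'))" using path_law[OF u, of j'] by (simp add: space_prob_algebra)
    have "measure ?L A = lmeas (PS (Suc j')) (\<lambda>g. Y u (path_op j' u g) base) A" for A
    proof (cases "A \<in> sets (PS (Suc j'))")
      case True
      have "(\<integral>p. indicator A p \<partial>?L) = measure ?L A"
        using True L sets.sets_into_space[OF True] sets_eq_imp_space_eq[OF L] by (simp add: Int_absorb2)
      then show ?thesis
        using True path_law_Y[OF u, of 0 "indicator A" j'] indicator_wball[of "PS (Suc j')" "PW (Suc j') 0" A] PW_ge1[of "Suc j'" 0]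
        by (simp add: lmeas_def wball_wspace)
    next
      case False
      then show ?thesis using L by (simp add: lmeas_def measure_notin_sets)
    qed
    then show "measure (stationary_path_law SS Q u (Suc j')) = lmeas (PS (Suc j')) (\<lambda>g. Y u (path_op j' u g) base)"
      by (auto simp: stationary_path_law_def stat_def)
  qed simp_all
qed

end

section \<open>Local stationarity\<close>

lemma opC_lipschitz:
  assumes A: "opC k M W N W' n 0 A" and n: "1 \<le> n" "1 \<le> k"
  obtains c where "c > 0"
    "\<And>g u v x. g \<in> wball M (W 0) \<Longrightarrow> u \<in> {0..1} \<Longrightarrow> v \<in> {0..1} \<Longrightarrow> x \<in> space N \<Longrightarrow> \<bar>A v g x - A u g x\<bar> \<le> c * W' 1 x * \<bar>v - u\<bar>"
proof -
  obtain n' where n': "n = Suc n'" using n by (cases n) auto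
  obtain A' where A': "opD k M W N 0 A A'" "opC k M W N W' n' (Suc 0) A'" using A unfolding n' by auto
  obtain c where c: "c > 0" "\<And>s u. s + Suc 0 \<le> k \<Longrightarrow> u \<in> {0..1} \<Longrightarrow> regop M (W s) N (W' (s + Suc 0)) c (A' u)"
    using opC_opB[OF A'(2)] by (rule opB_regop) blast
  have c0: "regop M (W 0) N (W' 1) c (A' u)" if "u \<in> {0..1}" for u using c(2)[of 0 u] that n by simp
  show ?thesis
    by (rule that[OF c(1)]) (rule opD_lipschitz[OF A'(1) _ c0], use n in auto)
qed

lemma rectangle_eqI:
  assumes N: "finite_measure N" "sets N = sets (A \<Otimes>\<^sub>M B)" "sets N' = sets (A \<Otimes>\<^sub>M B)"
    and eq: "\<And>a b. a \<in> sets A \<Longrightarrow> b \<in> sets B \<Longrightarrow> emeasure N (a \<times> b) = emeasure N' (a \<times> b)"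
  shows "N = N'"
proof (rule measure_eqI_generator_eq[OF Int_stable_pair_measure_generator[of A B] pair_measure_closed, of N N' "\<lambda>_. space A \<times> space B"])
  interpret finite_measure N by fact
  show "sets N = sigma_sets (space A \<times> space B) {a \<times> b |a b. a \<in> sets A \<and> b \<in> sets B}"
    "sets N' = sigma_sets (space A \<times> space B) {a \<times> b |a b. a \<in> sets A \<and> b \<in> sets B}"
    using N by (simp_all add: sets_pair_measure)
  show "emeasure N (space A \<times> space B) \<noteq> \<infinity>" by simp
qed (use eq in auto)

context density_chain
begin

definition marginal_law :: "(nat \<Rightarrow> 'w measure) \<Rightarrow> (nat \<Rightarrow> nat \<Rightarrow> 'w \<Rightarrow> 'y \<times> 'z) \<Rightarrow> nat \<Rightarrow> nat \<Rightarrow> ('y \<times> 'z) measure" where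
  "marginal_law \<Omega> X n t = distr (\<Omega> n) SS (X n t)"

primrec WT :: "nat \<Rightarrow> nat \<Rightarrow> nat \<Rightarrow> ((nat \<Rightarrow> 'y \<times> 'z) \<Rightarrow> real) \<Rightarrow> (nat \<Rightarrow> 'y \<times> 'z) \<Rightarrow> real" where
  "WT n t 0 g = g"
| "WT n t (Suc j) g = WT n t j (TT (Suc j) (real (t + Suc j) / real n) g)"

text \<open>The parameters of the steps from time \<open>a\<close> to time \<open>t\<close>. The
  step into time \<open>i\<close> uses \<open>i / n\<close>, hence the range begins at
  \<open>Suc a\<close>.\<close>

definition grid :: "nat \<Rightarrow> nat \<Rightarrow> nat \<Rightarrow> real list" where
  "grid n a t = map (\<lambda>i. real i / real n) [Suc a..<Suc t]"

lemma grid_Cons: "a < t \<Longrightarrow> grid n a t = (real (Suc a) / real n) # grid n (Suc a) t"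
  unfolding grid_def by (subst upt_conv_Cons) auto

lemma grid_snoc: "grid n 0 (Suc t) = grid n 0 t @ [real (Suc t) / real n]"
  unfolding grid_def by simp

lemma grid_refl: "grid n t t = []" by (simp add: grid_def)

lemma length_grid: "length (grid n a t) = t - a" by (simp add: grid_def del: upt_Suc)

lemma frac_I: "1 \<le> n \<Longrightarrow> i \<le> n \<Longrightarrow> real i / real n \<in> {0..1}"
  by (auto simp: divide_le_eq)

lemma grid_I: "1 \<le> n \<Longrightarrow> t \<le> n \<Longrightarrow> set (grid n a t) \<subseteq> {0..1}"
  unfolding grid_def using frac_I[of n] by fastforce

text \<open>From this \<open>n\<close> on, \<open>m\<close> consecutive grid points differ by less
  than \<epsilon>; for smaller \<open>n\<close> every grid list has length at most
  \<open>n0\<close>.\<close>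

definition n0 :: nat where "n0 = nat \<lceil>real m / \<epsilon>\<rceil>"

lemma adm_grid:
  assumes n: "1 \<le> n" "t \<le> n" shows "adm n0 (grid n a t)"
proof (cases "n0 \<le> n")
  case True
  have "real m / \<epsilon> \<le> real n0" unfolding n0_def using \<epsilon> by (simp add: real_nat_ceiling_ge)
  with True have "real m / \<epsilon> \<le> real n" by (meson of_nat_mono order_trans)
  then have mn: "real m / real n \<le> \<epsilon>" using \<epsilon> n by (simp add: divide_le_eq mult.commute)
  have "good (grid n a t)"
    unfolding good_def
  proof (intro conjI allI impI)
    show "set (grid n a t) \<subseteq> {0..1}" by (rule grid_I[OF n])
    fix i j assume ij: "i \<le> j" "j < length (grid n a t)" "j < i + m"
    have g: "grid n a t ! c = real (Suc a + c) / real n" if "c < length (grid n a t)" for c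
      using that by (simp add: grid_def del: upt_Suc)
    have "\<bar>grid n a t ! i - grid n a t ! j\<bar> = (real j - real i) / real n"
      using g[of i] g[OF ij(2)] ij by (simp add: diff_divide_distrib[symmetric] abs_divide)
    also have "\<dots> < real m / real n" using ij n by (intro divide_strict_right_mono) auto
    finally show "\<bar>grid n a t ! i - grid n a t ! j\<bar> < \<epsilon>" using mn by simp
  qed
  then show ?thesis by (simp add: adm_def)
next
  case False
  with n have "t - a \<le> n0" by linarith
  then show ?thesis using grid_I[OF n] by (simp add: adm_def length_grid)
qed

lemma WT_regop:
  assumes s: "s \<le> k"
  obtains D where "D > 0" "\<And>n t. 1 \<le> n \<Longrightarrow> t + j \<le> n \<Longrightarrow> regop (PS (Suc j)) (PW (Suc j) s) (PS 1) (PW 1 s) D (WT n t j)"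
proof -
  have "\<exists>D>0. \<forall>n t. 1 \<le> n \<longrightarrow> t + j \<le> n \<longrightarrow> regop (PS (Suc j)) (PW (Suc j) s) (PS 1) (PW 1 s) D (WT n t j)"
  proof (induction j)
    case 0
    have "regop (PS 1) (PW 1 s) (PS 1) (PW 1 s) 1 (\<lambda>g. g)" by (auto simp: regop_def intro!: regfunI)
    moreover have "WT n t 0 = (\<lambda>g. g)" for n t by (simp add: fun_eq_iff)
    ultimately show ?case by (intro exI[of _ 1]) simp
  next
    case (Suc j)
    then obtain D where D: "D > 0" "\<And>n t. 1 \<le> n \<Longrightarrow> t + j \<le> n \<Longrightarrow> regop (PS (Suc j)) (PW (Suc j) s) (PS 1) (PW 1 s) D (WT n t j)" by auto
    obtain c where c: "c > 0" "\<And>s u. s + 0 \<le> k \<Longrightarrow> u \<in> {0..1} \<Longrightarrow> regop (PS (Suc (Suc j))) (PW (Suc (Suc j)) s) (PS (Suc j)) (PW (Suc j) (s + 0)) c (TT (Suc j) u)"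
      using opC_opB[OF TT_opC[of "Suc j"]] by (auto elim: opB_regop)
    have "regop (PS (Suc (Suc j))) (PW (Suc (Suc j)) s) (PS 1) (PW 1 s) (c * D) (WT n t (Suc j))"
      if "1 \<le> n" "t + Suc j \<le> n" for n t
    proof -
      have u: "real (t + Suc j) / real n \<in> {0..1}" by (rule frac_I[OF that])
      have "regop (PS (Suc (Suc j))) (PW (Suc (Suc j)) s) (PS (Suc j)) (PW (Suc j) s) c (TT (Suc j) (real (t + Suc j) / real n))"
        using c(2)[OF _ u, of s] s by simp
      moreover have "regop (PS (Suc j)) (PW (Suc j) s) (PS 1) (PW 1 s) D (WT n t j)" using D(2) that by simp
      moreover have "0 \<le> PW (Suc j) s x" for x by (simp add: sum_weight_def sum_nonneg V_pos)
      ultimately have "regop (PS (Suc (Suc j))) (PW (Suc (Suc j)) s) (PS 1) (PW 1 s) (c * D) (\<lambda>g. WT n t j (TT (Suc j) (real (t + Suc j) / real n) g))"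
        by (intro regop_comp[where N = "PS (Suc j)" and w' = "PW (Suc j) s"] c(1))
      then show ?thesis unfolding WT.simps(2)[symmetric, abs_def] .
    qed
    moreover have "0 < c * D" using c(1) D(1) by simp
    ultimately show ?case by blast
  qed
  then show ?thesis using that by blast
qed

text \<open>Freezing the kernels over a window costs one power of the weight, \<open>V 1\<close> instead of \<open>V 0\<close>.\<close>

lemma WT_PT:
  obtains D where "D > 0" "\<And>n t u g p. 1 \<le> n \<Longrightarrow> t + j \<le> n \<Longrightarrow> u \<in> {0..1} \<Longrightarrow> g \<in> wball (PS (Suc j)) (PW (Suc j) 0) \<Longrightarrow>
    p \<in> space (PS 1) \<Longrightarrow> \<bar>WT n t j g p - PT j u g p\<bar> \<le> D * (\<bar>u - real t / real n\<bar> + 1 / real n) * PW 1 1 p"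
proof -
  have "\<exists>D>0. \<forall>n t u. \<forall>g\<in>wball (PS (Suc j)) (PW (Suc j) 0). \<forall>p\<in>space (PS 1). 1 \<le> n \<longrightarrow> t + j \<le> n \<longrightarrow> u \<in> {0..1} \<longrightarrow>
     \<bar>WT n t j g p - PT j u g p\<bar> \<le> D * (\<bar>u - real t / real n\<bar> + 1 / real n) * PW 1 1 p"
  proof (induction j)
    case 0
    show ?case by (intro exI[of _ 1]) (auto simp: sum_weight_def V_pos)
  next
    case (Suc j)
    then obtain D where D: "D > 0" "\<And>n t u g p. g \<in> wball (PS (Suc j)) (PW (Suc j) 0) \<Longrightarrow> p \<in> space (PS 1) \<Longrightarrow> 1 \<le> n \<Longrightarrow> t + j \<le> n \<Longrightarrow> u \<in> {0..1} \<Longrightarrow>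
       \<bar>WT n t j g p - PT j u g p\<bar> \<le> D * (\<bar>u - real t / real n\<bar> + 1 / real n) * PW 1 1 p" by blast
    have k1: "1 \<le> k" by (rule k)
    obtain c where c: "c > 0" "\<And>s u. s + 0 \<le> k \<Longrightarrow> u \<in> {0..1} \<Longrightarrow> regop (PS (Suc (Suc j))) (PW (Suc (Suc j)) s) (PS (Suc j)) (PW (Suc j) (s + 0)) c (TT (Suc j) u)"
      using opC_opB[OF TT_opC[of "Suc j"]] by (auto elim: opB_regop)
    obtain d where d: "d > 0" "\<And>g u v x. g \<in> wball (PS (Suc (Suc j))) (PW (Suc (Suc j)) 0) \<Longrightarrow> u \<in> {0..1} \<Longrightarrow> v \<in> {0..1} \<Longrightarrow> x \<in> space (PS (Suc j)) \<Longrightarrow>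
        \<bar>TT (Suc j) v g x - TT (Suc j) u g x\<bar> \<le> d * PW (Suc j) 1 x * \<bar>v - u\<bar>"
      using opC_lipschitz[OF TT_opC[of "Suc j"] k k] by auto
    obtain E where E: "E > 0" "\<And>n t. 1 \<le> n \<Longrightarrow> t + j \<le> n \<Longrightarrow> regop (PS (Suc j)) (PW (Suc j) 1) (PS 1) (PW 1 1) E (WT n t j)"
      using WT_regop[OF k1, of j] by auto
    \<comment> \<open>The first summand is the price of replacing the last kernel, whose parameter
      is within \<open>Suc j\<close> times the error term of \<open>u\<close>; the second carries
      the induction hypothesis through \<open>TT\<close> of norm \<open>c\<close>.\<close>
    define F where "F = d * real (Suc j) * E + c * D"
    have F: "F > 0" unfolding F_def using d E c D by (intro add_pos_pos mult_pos_pos) auto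
    have "\<bar>WT n t (Suc j) g p - PT (Suc j) u g p\<bar> \<le> F * (\<bar>u - real t / real n\<bar> + 1 / real n) * PW 1 1 p"
      if g: "g \<in> wball (PS (Suc (Suc j))) (PW (Suc (Suc j)) 0)" and p: "p \<in> space (PS 1)" and n: "1 \<le> n" "t + Suc j \<le> n" and u: "u \<in> {0..1}" for n t u g p
    proof -
      let ?v = "real (t + Suc j) / real n" and ?\<delta> = "\<bar>u - real t / real n\<bar> + 1 / real n"
      have v: "?v \<in> {0..1}" by (rule frac_I[OF n])
      have n': "t + j \<le> n" using n by simp
      have \<delta>: "\<bar>?v - u\<bar> \<le> real (Suc j) * ?\<delta>" "0 < ?\<delta>"
      proof -
        have "?v = real t / real n + real (Suc j) * (1 / real n)" by (simp add: add_divide_distrib)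
        moreover have "\<bar>a + d - u\<bar> \<le> \<bar>u - a\<bar> + d" if "0 \<le> d" for a d :: real using that by linarith
        ultimately have "\<bar>?v - u\<bar> \<le> \<bar>u - real t / real n\<bar> + real (Suc j) * (1 / real n)" by simp
        also have "\<dots> \<le> real (Suc j) * \<bar>u - real t / real n\<bar> + real (Suc j) * (1 / real n)"
          using mult_right_mono[of 1 "real (Suc j)" "\<bar>u - real t / real n\<bar>"] by simp
        finally show "\<bar>?v - u\<bar> \<le> real (Suc j) * ?\<delta>" by (simp only: distrib_left)
        show "0 < ?\<delta>" using n by (intro add_nonneg_pos) auto
      qed
      have TTb: "TT (Suc j) w g \<in> wball (PS (Suc j)) (\<lambda>x. c * PW (Suc j) 0 x)" if "w \<in> {0..1}" for w
        using regopD(1)[OF c(2)[OF _ that, of 0] g] by simp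
      have TTw: "TT (Suc j) w g \<in> wspace (PS (Suc j)) (PW (Suc j) 1)" if "w \<in> {0..1}" for w
        by (rule wspace_mono[OF wspaceI[OF c(1) TTb[OF that]]]) (rule PW_le, simp)
      let ?diff = "\<lambda>x. TT (Suc j) ?v g x - TT (Suc j) u g x"
      have "?diff \<in> wball (PS (Suc j)) (\<lambda>x. (d * (real (Suc j) * ?\<delta>)) * PW (Suc j) 1 x)"
      proof (rule wballI)
        show "?diff \<in> borel_measurable (PS (Suc j))"
          by (intro borel_measurable_diff wball_meas[OF TTb[OF v]] wball_meas[OF TTb[OF u]])
        fix x assume x: "x \<in> space (PS (Suc j))"
        have "\<bar>?diff x\<bar> \<le> d * PW (Suc j) 1 x * \<bar>?v - u\<bar>" by (rule d(2)[OF g u v x])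
        also have "\<dots> \<le> d * PW (Suc j) 1 x * (real (Suc j) * ?\<delta>)"
          using \<delta>(1) d(1) by (intro mult_left_mono) (auto simp: sum_weight_def sum_nonneg V_pos)
        finally show "\<bar>?diff x\<bar> \<le> (d * (real (Suc j) * ?\<delta>)) * PW (Suc j) 1 x" by (simp only: ac_simps)
      qed
      moreover have "0 < d * (real (Suc j) * ?\<delta>)" using d \<delta> by (intro mult_pos_pos) auto
      ultimately have "\<bar>WT n t j ?diff p\<bar> \<le> (d * (real (Suc j) * ?\<delta>)) * (E * PW 1 1 p)"
        by (rule regop_bound[OF E(2)[OF n(1) n'] _ _ p])
      moreover have "WT n t j ?diff p = WT n t j (TT (Suc j) ?v g) p - WT n t j (TT (Suc j) u g) p"
        by (rule regfun_diff[OF regopD(2)[OF E(2)[OF n(1) n'] p] TTw[OF v] TTw[OF u]])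
      ultimately have 1: "\<bar>WT n t j (TT (Suc j) ?v g) p - WT n t j (TT (Suc j) u g) p\<bar> \<le> (d * (real (Suc j) * ?\<delta>)) * (E * PW 1 1 p)" by simp
      let ?h = "\<lambda>x. (1/c) * TT (Suc j) u g x"
      have h: "?h \<in> wball (PS (Suc j)) (PW (Suc j) 0)" using wball_scale[OF TTb[OF u], of "1/c"] c by simp
      have "WT n t j ?h p = (1/c) * WT n t j (TT (Suc j) u g) p"
        by (rule regfun_scale[OF regopD(2)[OF E(2)[OF n(1) n'] p] TTw[OF u]])
      moreover have "PT j u ?h p = (1/c) * PT j u (TT (Suc j) u g) p"
      proof -
        obtain c' where c': "c' > 0" "\<And>s u. s + 0 \<le> k \<Longrightarrow> u \<in> {0..1} \<Longrightarrow> regop (PS (Suc j)) (PW (Suc j) s) (PS 1) (PW 1 (s + 0)) c' (PT j u)"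
          using opC_opB[OF PT_opC[of j]] by (auto elim: opB_regop)
        show ?thesis by (rule regfun_scale[OF regopD(2)[OF c'(2)[OF _ u, of 0] p] wspaceI[OF c(1) TTb[OF u]]]) simp
      qed
      ultimately have "\<bar>(1/c) * (WT n t j (TT (Suc j) u g) p - PT j u (TT (Suc j) u g) p)\<bar> \<le> D * ?\<delta> * PW 1 1 p"
        using D(2)[OF h p n(1) n' u] by (simp only: right_diff_distrib)
      then have 2: "\<bar>WT n t j (TT (Suc j) u g) p - PT j u (TT (Suc j) u g) p\<bar> \<le> c * (D * ?\<delta> * PW 1 1 p)"
        using c(1) by (simp add: abs_mult divide_le_eq mult.commute)
      have "\<bar>WT n t (Suc j) g p - PT (Suc j) u g p\<bar> \<le> (d * (real (Suc j) * ?\<delta>)) * (E * PW 1 1 p) + c * (D * ?\<delta> * PW 1 1 p)"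
        using 1 2 by simp
      also have "\<dots> = F * ?\<delta> * PW 1 1 p" unfolding F_def by (simp only: distrib_left distrib_right ac_simps)
      finally show ?thesis .
    qed
    then show ?case using F by blast
  qed
  then show ?thesis using that by blast
qed

lemma Y_const: "u \<in> {0..1} \<Longrightarrow> Y u (\<lambda>_. c) base = c"
  using regfun_scale[OF Y_regfun[of u 0 base] const_wspace[of 1], of c] Y_one[of u] by simp

lemma Y_lipschitz:
  obtains D where "D > 0" "\<And>g u v c. g \<in> wball SS (\<lambda>x. c * V 0 x) \<Longrightarrow> c > 0 \<Longrightarrow> u \<in> {0..1} \<Longrightarrow> v \<in> {0..1} \<Longrightarrow>
    \<bar>Y v g base - Y u g base\<bar> \<le> D * c * \<bar>v - u\<bar>"
proof -
  obtain d where d: "d > 0" "\<And>g u v x. g \<in> wball SS (V 0) \<Longrightarrow> u \<in> {0..1} \<Longrightarrow> v \<in> {0..1} \<Longrightarrow> x \<in> space SS \<Longrightarrow>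
      \<bar>Y v g x - Y u g x\<bar> \<le> d * V 1 x * \<bar>v - u\<bar>"
    using opC_lipschitz[OF Y_opC k k] by blast
  show ?thesis
  proof (rule that[of "d * V 1 base"])
    show "0 < d * V 1 base" using d V_pos by simp
    fix g u v c assume g: "g \<in> wball SS (\<lambda>x. c * V 0 x)" and c: "(c::real) > 0" and u: "u \<in> {0..1::real}" and v: "v \<in> {0..1::real}"
    let ?h = "\<lambda>x. (1/c) * g x"
    have h: "?h \<in> wball SS (V 0)" using wball_scale[OF g, of "1/c"] c by simp
    have e: "Y w ?h base = (1/c) * Y w g base" if "w \<in> {0..1}" for w
      by (rule regfun_scale[OF Y_regfun[OF that, of 0] wspaceI[OF c g]]) simp
    have "\<bar>(1/c) * (Y v g base - Y u g base)\<bar> \<le> d * V 1 base * \<bar>v - u\<bar>"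
      using d(2)[OF h u v, of base] unfolding e[OF u] e[OF v] right_diff_distrib by simp
    then show "\<bar>Y v g base - Y u g base\<bar> \<le> d * V 1 base * c * \<bar>v - u\<bar>"
      using c by (simp add: abs_mult divide_le_eq ac_simps)
  qed
qed

text \<open>Between two grid points the marginal law \<open>stat (i/n)\<close> moves by \<open>O(1/n)\<close>, and the products of
  kernels contract this error geometrically.\<close>

lemma grid_telescope:
  obtains D where "D > 0" "\<And>n t h c. 1 \<le> n \<Longrightarrow> t \<le> n \<Longrightarrow> h \<in> wball SS (\<lambda>x. c * V 0 x) \<Longrightarrow> c > 0 \<Longrightarrow>
    \<bar>Y 0 (TL (grid n 0 t) h) base - Y (real t / real n) h base\<bar> \<le> D * c / real n"
proof -
  obtain \<beta> B r where B: "\<beta> > 0" "B > 0" "0 < r" "r < 1"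
    "\<And>us g c. adm n0 us \<Longrightarrow> g \<in> wspace SS (V 0) \<Longrightarrow> osc 0 \<beta> c g \<Longrightarrow> 0 \<le> c \<Longrightarrow> osc 0 \<beta> (B * r ^ length us * c) (TL us g)"
    using contraction[of 0 n0] by blast
  obtain L where L: "L > 0" "\<And>g u v c. g \<in> wball SS (\<lambda>x. c * V 0 x) \<Longrightarrow> c > 0 \<Longrightarrow> u \<in> {0..1} \<Longrightarrow> v \<in> {0..1} \<Longrightarrow>
      \<bar>Y v g base - Y u g base\<bar> \<le> L * c * \<bar>v - u\<bar>" by (rule Y_lipschitz) blast
  define G where "G = B / \<beta> * (2 + \<beta> + \<beta> * V 0 base)"
  have "0 < 2 + \<beta> + \<beta> * V 0 base" using B(1) V_pos(2)[of 0 base] by (simp add: add_pos_nonneg)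
  then have G: "G > 0" using B by (simp add: G_def)
  show ?thesis
  proof (rule that[of "L * G / (1 - r)"])
    show "0 < L * G / (1 - r)" using L G B by simp
    fix n t :: nat and h and c :: real assume n: "1 \<le> n" "t \<le> n" and h: "h \<in> wball SS (\<lambda>x. c * V 0 x)" and c: "c > 0"
    have hw: "h \<in> wspace SS (V 0)" by (rule wspaceI[OF c h])
    \<comment> \<open>Start in the invariant law at \<open>i / n\<close> and follow the kernels of
      the array up to time \<open>t\<close>: \<open>a 0\<close> is the value for the array,
      \<open>a t\<close> the stationary one.\<close>
    define a where "a i = Y (real i / real n) (TL (grid n i t) h) base" for i
    have step: "\<bar>a i - a (Suc i)\<bar> \<le> L * G * c / real n * r ^ (t - i)" if i: "i < t" for i
    proof -
      have u: "real i / real n \<in> {0..1}" "real (Suc i) / real n \<in> {0..1}"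
        using i n by (auto intro!: frac_I simp del: of_nat_Suc)
      define H where "H = TL (grid n i t) h"
      have H: "H = T (real (Suc i) / real n) (TL (grid n (Suc i) t) h)"
        unfolding H_def grid_Cons[OF i] by simp
      have gw: "TL (grid n (Suc i) t) h \<in> wspace SS (V 0)" by (rule TL_wspace[OF grid_I[OF n] _ hw]) simp
      have Hw: "H \<in> wspace SS (V 0)" unfolding H_def by (rule TL_wspace[OF grid_I[OF n] _ hw]) simp
      \<comment> \<open>The law at \<open>Suc i / n\<close> is invariant under its own kernel, so
        both terms of the difference integrate the same function \<open>H\<close>.\<close>
      have aS: "a (Suc i) = Y (real (Suc i) / real n) H base"
        unfolding a_def H by (rule Y_T[OF u(2) _ gw, symmetric]) simp
      have "osc 0 \<beta> (B * r ^ length (grid n i t) * (c / \<beta>)) H"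
        unfolding H_def using B c by (intro B(5)[OF adm_grid[OF n] hw wball_osc[OF h]]) auto
      then have "osc 0 \<beta> (B * r ^ (t - i) * (c / \<beta>)) H" by (simp add: length_grid)
      note cent = osc_centered[OF this wspace_meas[OF Hw]]
      have "B * r ^ (t - i) * (c / \<beta>) * (2 + \<beta> + \<beta> * V 0 base) = G * c * r ^ (t - i)" by (simp add: G_def)
      then have Hc: "(\<lambda>y. H y - H base) \<in> wball SS (\<lambda>y. (G * c * r ^ (t - i)) * V 0 y)"
        using cent B c by simp
      have pos: "0 < G * c * r ^ (t - i)" using G c B by simp
      \<comment> \<open>Constants are integrated exactly, so \<open>H\<close> may be centered before
        the Lipschitz bound; this is what brings in the geometric factor.\<close>
      have YH: "Y w (\<lambda>y. H y - H base) base = Y w H base - H base" if "w \<in> {0..1}" for w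
        using regfun_diff[OF Y_regfun[OF that, of 0] Hw const_wspace] Y_const[OF that] by simp
      have "\<bar>Y (real i / real n) H base - Y (real (Suc i) / real n) H base\<bar> \<le> L * (G * c * r ^ (t - i)) * \<bar>real i / real n - real (Suc i) / real n\<bar>"
        using L(2)[OF Hc pos u(2) u(1)] by (simp add: YH[OF u(1)] YH[OF u(2)] del: of_nat_Suc)
      also have "\<bar>real i / real n - real (Suc i) / real n\<bar> = 1 / real n"
        by (simp add: diff_divide_distrib[symmetric])
      finally show ?thesis unfolding aS by (simp add: a_def H_def ac_simps)
    qed
    have "a 0 - a t = (\<Sum>i<t. a i - a (Suc i))"
      using sum_lessThan_telescope'[of a t] by simp
    then have "\<bar>a 0 - a t\<bar> \<le> (\<Sum>i<t. L * G * c / real n * r ^ (t - i))"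
      using order_trans[OF sum_abs sum_mono, of "{..<t}" "\<lambda>i. a i - a (Suc i)" "\<lambda>i. L * G * c / real n * r ^ (t - i)"] step by auto
    also have "\<dots> = L * G * c / real n * (\<Sum>i<t. r ^ (t - i))" by (simp add: sum_distrib_left)
    also have "\<dots> \<le> L * G * c / real n * (1 / (1 - r))"
    proof (rule mult_left_mono)
      have "(\<Sum>i<t. r ^ (t - i)) = (\<Sum>i<t. r ^ Suc i)"
        by (subst sum.nat_diff_reindex[symmetric]) (auto intro!: sum.cong)
      also have "\<dots> \<le> (\<Sum>i<t. r ^ i)" using B by (intro sum_mono) (simp add: mult_left_le_one_le)
      also have "\<dots> \<le> (\<Sum>i. r ^ i)" using B by (intro sum_le_suminf summable_geometric) auto
      also have "\<dots> = 1 / (1 - r)" using B by (simp add: suminf_geometric)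
      finally show "(\<Sum>i<t. r ^ (t - i)) \<le> 1 / (1 - r)" .
    qed (use L G c in simp)
    finally show "\<bar>Y 0 (TL (grid n 0 t) h) base - Y (real t / real n) h base\<bar> \<le> L * G / (1 - r) * c / real n"
      by (simp add: a_def grid_refl ac_simps)
  qed
qed

section \<open>Laws of windows of the array\<close>

context
  fixes \<Omega> :: "nat \<Rightarrow> 'w measure" and X :: "nat \<Rightarrow> nat \<Rightarrow> 'w \<Rightarrow> 'y \<times> 'z" and n :: nat
  assumes mk: "markov_array SS Q \<Omega> X" and n: "1 \<le> n"
begin

lemma X_prob: "prob_space (\<Omega> n)" using mk n by (auto simp: markov_array_def)

lemma X_meas: "t \<le> n \<Longrightarrow> X n t \<in> \<Omega> n \<rightarrow>\<^sub>M SS" using mk n by (auto simp: markov_array_def)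

lemma X_init: "distr (\<Omega> n) SS (X n 0) = stat 0" using mk n by (auto simp: markov_array_def stat_def)

lemma X_markov: "1 \<le> t \<Longrightarrow> t \<le> n \<Longrightarrow> A \<in> sets SS \<Longrightarrow> AE \<omega> in \<Omega> n.
        real_cond_exp (\<Omega> n) (past_algebra SS \<Omega> X n t) (\<lambda>\<omega>'. indicator A (X n t \<omega>')) \<omega>
          = measure (Q (real t / real n) (X n (t - 1) \<omega>)) A"
  using mk n by (auto simp: markov_array_def)

lemma win_meas: "t + j \<le> Suc n \<Longrightarrow> (\<lambda>\<omega>. \<lambda>i\<in>{0..<j}. X n (t + i) \<omega>) \<in> \<Omega> n \<rightarrow>\<^sub>M PS j"
  by (intro measurable_restrict X_meas) auto

lemma window_prob: "t + j \<le> Suc n \<Longrightarrow> window_law SS \<Omega> X n t j \<in> space (prob_algebra (PS j))"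
  using prob_space.prob_space_distr[OF X_prob win_meas] by (simp add: window_law_def space_prob_algebra)

text \<open>The Markov property conditions on the entire past, and the window up to time t + j - 1
  is a function of that past. Its events therefore belong to \<open>past_algebra\<close>, where the
  conditional expectation may be integrated.\<close>

lemma past_rectangle:
  assumes t: "t + j \<le> n" and j: "1 \<le> j" and Bs: "B \<in> sets (PS j)" and A: "A \<in> sets SS"
  shows "(\<integral>\<omega>. indicator B (\<lambda>i\<in>{0..<j}. X n (t + i) \<omega>) * indicator A (X n (t + j) \<omega>) \<partial>\<Omega> n) =
    (\<integral>\<omega>. indicator B (\<lambda>i\<in>{0..<j}. X n (t + i) \<omega>) * measure (Q (real (t + j) / real n) (X n (t + j - 1) \<omega>)) A \<partial>\<Omega> n)"
proof -
  interpret prob_space "\<Omega> n" by (rule X_prob)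
  let ?F = "past_algebra SS \<Omega> X n (t + j)"
  let ?W = "\<lambda>\<omega>. \<lambda>s\<in>{0..<t + j}. X n s \<omega>" and ?w = "\<lambda>\<omega>. \<lambda>i\<in>{0..<j}. X n (t + i) \<omega>"
  have Wm: "?W \<in> \<Omega> n \<rightarrow>\<^sub>M PS (t + j)" using t by (intro measurable_restrict X_meas) auto
  have sub: "subalgebra (\<Omega> n) ?F"
    unfolding subalgebra_def past_algebra_def
    using measurable_sets[OF Wm] measurable_space[OF Wm] by (auto simp: sets_vimage_algebra2[of ?W "space (\<Omega> n)" "PS (t + j)"] Pi_iff)
  interpret fs: finite_measure_subalgebra "\<Omega> n" ?F by unfold_locales (rule sub)
  have Wspace: "?W \<in> space (\<Omega> n) \<rightarrow> space (PS (t + j))" using measurable_space[OF Wm] by auto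
  have shift: "(\<lambda>p. \<lambda>i\<in>{0..<j}. p (t + i)) \<in> PS (t + j) \<rightarrow>\<^sub>M PS j"
    by (intro measurable_restrict comp_meas) auto
  \<comment> \<open>The window is a shifted restriction of the past, so its event is the preimage of
    a measurable set of pasts.\<close>
  have S: "?w -` B \<inter> space (\<Omega> n) \<in> sets ?F"
  proof -
    have "(\<lambda>p. \<lambda>i\<in>{0..<j}. p (t + i)) -` B \<inter> space (PS (t + j)) \<in> sets (PS (t + j))" by (rule measurable_sets[OF shift Bs])
    then have "?W -` ((\<lambda>p. \<lambda>i\<in>{0..<j}. p (t + i)) -` B \<inter> space (PS (t + j))) \<inter> space (\<Omega> n) \<in> sets ?F"
      unfolding past_algebra_def by (rule in_vimage_algebra)
    moreover have "?w \<omega> = (\<lambda>i\<in>{0..<j}. ?W \<omega> (t + i))" for \<omega> by (auto simp: fun_eq_iff restrict_def)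
    then have "?W -` ((\<lambda>p. \<lambda>i\<in>{0..<j}. p (t + i)) -` B \<inter> space (PS (t + j))) \<inter> space (\<Omega> n) = ?w -` B \<inter> space (\<Omega> n)"
      using Wspace by (auto simp: Pi_iff simp del: restrict_apply)
    ultimately show ?thesis by simp
  qed
  have ind: "indicator (?w -` B \<inter> space (\<Omega> n)) \<omega> = (indicator B (?w \<omega>) :: real)" if "\<omega> \<in> space (\<Omega> n)" for \<omega>
    using that by (auto simp: indicator_def)
  have Zm: "(\<lambda>\<omega>. indicator A (X n (t + j) \<omega>) :: real) \<in> borel_measurable (\<Omega> n)"
    using measurable_compose[OF X_meas[OF t], of "indicator A" borel] A by simp
  have int: "integrable (\<Omega> n) (\<lambda>\<omega>. indicator A (X n (t + j) \<omega>) :: real)"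
    by (rule integrable_const_bound[of _ 1, OF _ Zm]) (auto simp: indicator_def)
  have "(\<integral>\<omega>. indicator B (?w \<omega>) * (indicator A (X n (t + j) \<omega>) :: real) \<partial>\<Omega> n) = (\<integral>\<omega>\<in>?w -` B \<inter> space (\<Omega> n). indicator A (X n (t + j) \<omega>) \<partial>\<Omega> n)"
    unfolding set_lebesgue_integral_def using ind by (intro Bochner_Integration.integral_cong) (auto simp del: restrict_apply)
  also have "\<dots> = (\<integral>\<omega>\<in>?w -` B \<inter> space (\<Omega> n). real_cond_exp (\<Omega> n) ?F (\<lambda>\<omega>'. indicator A (X n (t + j) \<omega>')) \<omega> \<partial>\<Omega> n)"
    by (rule fs.real_cond_exp_intA[OF int S])
  also have "\<dots> = (\<integral>\<omega>. indicator B (?w \<omega>) * measure (Q (real (t + j) / real n) (X n (t + j - 1) \<omega>)) A \<partial>\<Omega> n)"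
    unfolding set_lebesgue_integral_def
  proof (rule integral_cong_AE)
    have wB: "(\<lambda>\<omega>. indicator B (?w \<omega>) :: real) \<in> borel_measurable (\<Omega> n)"
      using measurable_compose[OF win_meas, of t j "indicator B" borel] Bs t by simp
    have u: "real (t + j) / real n \<in> {0..1}" by (rule frac_I[OF n t])
    have "(\<lambda>\<omega>. measure (Q (real (t + j) / real n) (X n (t + j - 1) \<omega>)) A) \<in> borel_measurable (\<Omega> n)"
      using t by (intro measurable_compose[OF X_meas measurable_compose[OF measurable_prob_algebraD[OF Q_markov[OF u]] measurable_measure_subprob_algebra[OF A]]]) auto
    with wB show "(\<lambda>\<omega>. indicator B (?w \<omega>) * measure (Q (real (t + j) / real n) (X n (t + j - 1) \<omega>)) A) \<in> borel_measurable (\<Omega> n)"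
      by (rule borel_measurable_times)
    have "?w -` B \<inter> space (\<Omega> n) \<in> sets (\<Omega> n)" using S sub by (auto simp: subalgebra_def)
    then show "(\<lambda>\<omega>. indicator (?w -` B \<inter> space (\<Omega> n)) \<omega> *\<^sub>R real_cond_exp (\<Omega> n) ?F (\<lambda>\<omega>'. indicator A (X n (t + j) \<omega>')) \<omega>) \<in> borel_measurable (\<Omega> n)"
      by (intro borel_measurable_scaleR borel_measurable_indicator borel_measurable_cond_exp2)
    show "AE \<omega> in \<Omega> n. indicator (?w -` B \<inter> space (\<Omega> n)) \<omega> *\<^sub>R real_cond_exp (\<Omega> n) ?F (\<lambda>\<omega>'. indicator A (X n (t + j) \<omega>')) \<omega> =
      indicator B (?w \<omega>) * measure (Q (real (t + j) / real n) (X n (t + j - 1) \<omega>)) A"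
      using X_markov[of "t + j" A] j t A AE_space by (auto simp: ind elim!: eventually_elim2)
  qed
  finally show ?thesis .
qed

text \<open>The joint law of a window and the next state is determined on rectangles, which
  \<open>past_rectangle\<close> handles; appending the state to the window pushes both sides forward
  to the claim.\<close>

lemma window_step:
  assumes t: "t + j \<le> n" and j: "1 \<le> j"
  shows "window_law SS \<Omega> X n t (Suc j) = window_law SS \<Omega> X n t j \<bind> ext j (real (t + j) / real n)"
proof -
  interpret P: prob_space "\<Omega> n" by (rule X_prob)
  let ?u = "real (t + j) / real n"
  have u: "?u \<in> {0..1}" by (rule frac_I[OF n t])
  let ?w = "\<lambda>\<omega>. \<lambda>i\<in>{0..<j}. X n (t + i) \<omega>"
  have wm: "?w \<in> \<Omega> n \<rightarrow>\<^sub>M PS j" using t by (intro win_meas) simp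
  have Zm: "X n (t + j) \<in> \<Omega> n \<rightarrow>\<^sub>M SS" by (rule X_meas[OF t])
  let ?L = "window_law SS \<Omega> X n t j"
  have L: "?L \<in> space (prob_algebra (PS j))" using t by (intro window_prob) simp
  have L': "sets ?L = sets (PS j)" "prob_space ?L" using L by (auto simp: space_prob_algebra)
  have spL: "space ?L = space (PS j)" using L'(1) by (rule sets_eq_imp_space_eq)
  define J where "J = distr (\<Omega> n) (PS j \<Otimes>\<^sub>M SS) (\<lambda>\<omega>. (?w \<omega>, X n (t + j) \<omega>))"
  define G where "G x = distr (Q ?u (x (j - 1))) (PS j \<Otimes>\<^sub>M SS) (\<lambda>y. (x, y))" for x :: "nat \<Rightarrow> 'y \<times> 'z"
  have Gm: "G \<in> PS j \<rightarrow>\<^sub>M prob_algebra (PS j \<Otimes>\<^sub>M SS)"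
    unfolding G_def[abs_def]
  proof (rule measurable_distr_prob_space2)
    show "(\<lambda>x. Q ?u (x (j - 1))) \<in> PS j \<rightarrow>\<^sub>M prob_algebra SS"
      using j by (intro measurable_compose[OF comp_meas Q_markov[OF u]]) simp
  qed simp
  have pairm: "(\<lambda>\<omega>. (?w \<omega>, X n (t + j) \<omega>)) \<in> \<Omega> n \<rightarrow>\<^sub>M PS j \<Otimes>\<^sub>M SS" by (intro measurable_Pair wm Zm)
  have JG: "J = ?L \<bind> G"
  proof (rule rectangle_eqI)
    show "finite_measure J" unfolding J_def by (rule prob_space.finite_measure[OF P.prob_space_distr[OF pairm]])
    show "sets J = sets (PS j \<Otimes>\<^sub>M SS)" by (simp add: J_def)
    show "sets (?L \<bind> G) = sets (PS j \<Otimes>\<^sub>M SS)" by (rule sets_bind'[OF L Gm])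
    fix B A assume BA: "B \<in> sets (PS j)" "A \<in> sets SS"
    let ?I = "\<lambda>\<omega>. indicator B (?w \<omega>) * measure (Q ?u (X n (t + j - 1) \<omega>)) A :: real"
    have wB: "(\<lambda>\<omega>. indicator B (?w \<omega>) :: real) \<in> borel_measurable (\<Omega> n)"
      using measurable_compose[OF wm, of "indicator B" borel] BA by simp
    have mQ: "(\<lambda>x. measure (Q ?u x) A) \<in> borel_measurable SS"
      by (rule measurable_compose[OF measurable_prob_algebraD[OF Q_markov[OF u]] measurable_measure_subprob_algebra[OF BA(2)]])
    have Im: "?I \<in> borel_measurable (\<Omega> n)"
      using wB t by (intro borel_measurable_times measurable_compose[OF X_meas mQ]) auto
    have Ii: "integrable (\<Omega> n) ?I"
      using Im kernelD(1)[OF Q_markov[OF u], THEN prob_space.prob_le_1]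
      by (intro P.integrable_const_bound[of _ 1]) (auto simp: indicator_def)
    have Zr: "(\<lambda>\<omega>. indicator A (X n (t + j) \<omega>) :: real) \<in> borel_measurable (\<Omega> n)"
      using measurable_compose[OF Zm, of "indicator A" borel] BA by simp
    have Ri: "integrable (\<Omega> n) (\<lambda>\<omega>. indicator B (?w \<omega>) * indicator A (X n (t + j) \<omega>) :: real)"
      using wB Zr by (intro P.integrable_const_bound[of _ 1] borel_measurable_times) (auto simp: indicator_def)
    have "emeasure J (B \<times> A) = (\<integral>\<^sup>+\<omega>. indicator (B \<times> A) (?w \<omega>, X n (t + j) \<omega>) \<partial>\<Omega> n)"
      unfolding J_def using BA
      by (subst nn_integral_indicator[symmetric]) (auto simp del: nn_integral_indicator intro!: nn_integral_distr[OF pairm])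
    also have "\<dots> = (\<integral>\<^sup>+\<omega>. ennreal (indicator B (?w \<omega>) * indicator A (X n (t + j) \<omega>)) \<partial>\<Omega> n)"
      by (intro nn_integral_cong) (auto simp: indicator_def)
    also have "\<dots> = ennreal (\<integral>\<omega>. indicator B (?w \<omega>) * indicator A (X n (t + j) \<omega>) \<partial>\<Omega> n)"
      by (rule nn_integral_eq_integral[OF Ri]) simp
    also have "\<dots> = ennreal (\<integral>\<omega>. ?I \<omega> \<partial>\<Omega> n)" by (subst past_rectangle[OF t j BA]) simp
    also have "\<dots> = (\<integral>\<^sup>+\<omega>. ennreal (?I \<omega>) \<partial>\<Omega> n)" by (rule nn_integral_eq_integral[OF Ii, symmetric]) simp
    also have "\<dots> = (\<integral>\<^sup>+\<omega>. emeasure (G (?w \<omega>)) (B \<times> A) \<partial>\<Omega> n)"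
    proof (rule nn_integral_cong)
      fix \<omega> assume \<omega>: "\<omega> \<in> space (\<Omega> n)"
      have wS: "?w \<omega> \<in> space (PS j)" by (rule measurable_space[OF wm \<omega>])
      have wj: "?w \<omega> (j - 1) = X n (t + j - 1) \<omega>" using j by simp
      interpret Qk: prob_space "Q ?u (X n (t + j - 1) \<omega>)" by (rule kernelD(1)[OF Q_markov[OF u]]) simp
      have "(\<lambda>y. (?w \<omega>, y)) \<in> Q ?u (X n (t + j - 1) \<omega>) \<rightarrow>\<^sub>M PS j \<Otimes>\<^sub>M SS"
        using measurable_Pair1'[OF wS, of SS] kernelD(2)[OF Q_markov[OF u], of "X n (t + j - 1) \<omega>"] by (simp cong: measurable_cong_sets)
      then have "emeasure (G (?w \<omega>)) (B \<times> A) = emeasure (Q ?u (X n (t + j - 1) \<omega>)) ((\<lambda>y. (?w \<omega>, y)) -` (B \<times> A) \<inter> space (Q ?u (X n (t + j - 1) \<omega>)))"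
        unfolding G_def wj using BA by (intro emeasure_distr) auto
      also have "(\<lambda>y. (?w \<omega>, y)) -` (B \<times> A) \<inter> space (Q ?u (X n (t + j - 1) \<omega>)) = (if ?w \<omega> \<in> B then A else {})"
        using kernelD(3)[OF Q_markov[OF u], of "X n (t + j - 1) \<omega>"] by (auto simp del: restrict_apply)
      also have "emeasure (Q ?u (X n (t + j - 1) \<omega>)) (if ?w \<omega> \<in> B then A else {}) = ennreal (?I \<omega>)"
        unfolding Qk.emeasure_eq_measure indicator_def by (cases "?w \<omega> \<in> B") (simp_all del: restrict_apply of_nat_add)
      finally show "ennreal (?I \<omega>) = emeasure (G (?w \<omega>)) (B \<times> A)" by (rule sym)
    qed
    also have "\<dots> = (\<integral>\<^sup>+x. emeasure (G x) (B \<times> A) \<partial>?L)"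
    proof -
      have "(\<lambda>x. emeasure (G x) (B \<times> A)) \<in> borel_measurable (PS j)"
        by (rule measurable_compose[OF measurable_prob_algebraD[OF Gm] measurable_emeasure_subprob_algebra[OF pair_measureI[OF BA]]])
      then show ?thesis unfolding window_law_def by (subst nn_integral_distr[OF wm]) simp_all
    qed
    also have "\<dots> = emeasure (?L \<bind> G) (B \<times> A)"
      using BA by (intro emeasure_bind_prob_algebra[OF L Gm, symmetric]) auto
    finally show "emeasure J (B \<times> A) = emeasure (?L \<bind> G) (B \<times> A)" .
  qed
  have up: "(\<lambda>(x, y). x(j := y)) \<in> PS j \<Otimes>\<^sub>M SS \<rightarrow>\<^sub>M PS (Suc j)" by (rule upd_meas2)
  have "window_law SS \<Omega> X n t (Suc j) = distr J (PS (Suc j)) (\<lambda>(x, y). x(j := y))"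
    unfolding window_law_def J_def distr_distr[OF up pairm]
    by (intro distr_cong) (auto simp: fun_eq_iff restrict_def)
  also have "\<dots> = ?L \<bind> (\<lambda>x. distr (G x) (PS (Suc j)) (\<lambda>(x, y). x(j := y)))"
    unfolding JG
  proof (rule distr_bind[OF _ _ up])
    show "G \<in> ?L \<rightarrow>\<^sub>M subprob_algebra (PS j \<Otimes>\<^sub>M SS)"
      using measurable_prob_algebraD[OF Gm] L'(1) by (simp cong: measurable_cong_sets)
    show "space ?L \<noteq> {}" by (rule prob_space.not_empty[OF L'(2)])
  qed
  also have "\<dots> = ?L \<bind> ext j ?u"
  proof (rule bind_cong[OF refl])
    fix x assume "x \<in> space ?L"
    then have x: "x \<in> space (PS j)" using spL by simp
    have "(\<lambda>y. (x, y)) \<in> Q ?u (x (j - 1)) \<rightarrow>\<^sub>M PS j \<Otimes>\<^sub>M SS"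
      using measurable_Pair1'[OF x, of SS] kernelD(2)[OF Q_markov[OF u], of "x (j - 1)"] by (simp cong: measurable_cong_sets)
    then show "distr (G x) (PS (Suc j)) (\<lambda>(x, y). x(j := y)) = ext j ?u x"
      unfolding G_def ext_def by (subst distr_distr[OF up]) (auto simp: comp_def)
  qed
  finally show ?thesis .
qed

end

end

lemma wball_integral_le:
  assumes N: "sets N = sets M" and w: "integrable N w" and g: "g \<in> wball M (\<lambda>x. c * w x)" and c: "c > 0"
  shows "\<bar>\<integral>x. g x \<partial>N\<bar> \<le> c * (\<integral>x. w x \<partial>N)"
proof -
  have sp: "space N = space M" using N by (rule sets_eq_imp_space_eq)
  note ig = wspace_integrable[OF N w wspaceI[OF c g]]
  have "\<bar>\<integral>x. g x \<partial>N\<bar> \<le> (\<integral>x. \<bar>g x\<bar> \<partial>N)" by (rule integral_abs_bound)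
  also have "\<dots> \<le> (\<integral>x. c * w x \<partial>N)"
    using wball_bound[OF g] sp w ig by (intro integral_mono) auto
  finally show ?thesis by simp
qed

context density_chain
begin

section \<open>Marginal laws and the final estimate\<close>

lemma marginal_prob:
  assumes mk: "markov_array SS Q \<Omega> X" and n: "1 \<le> n" and t: "t \<le> n"
  shows "marginal_law \<Omega> X n t \<in> space (prob_algebra SS)"
  using prob_space.prob_space_distr[OF X_prob[OF mk n] X_meas[OF mk n t]] by (simp add: marginal_law_def space_prob_algebra)

text \<open>This is \<open>past_rectangle\<close> for a window of length 1 and the sure event, which
  leaves only the transition into the next state.\<close>

lemma marginal_step:
  assumes mk: "markov_array SS Q \<Omega> X" and n: "1 \<le> n" and t: "Suc t \<le> n"
  shows "marginal_law \<Omega> X n (Suc t) = marginal_law \<Omega> X n t \<bind> Q (real (Suc t) / real n)"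
proof (rule measure_eqI)
  let ?u = "real (Suc t) / real n"
  interpret P: prob_space "\<Omega> n" by (rule X_prob[OF mk n])
  have u: "?u \<in> {0..1}" by (rule frac_I[OF n t])
  have Xm: "X n t \<in> \<Omega> n \<rightarrow>\<^sub>M SS" "X n (Suc t) \<in> \<Omega> n \<rightarrow>\<^sub>M SS" using t by (auto intro!: X_meas[OF mk n])
  have L: "marginal_law \<Omega> X n t \<in> space (prob_algebra SS)" using t by (intro marginal_prob[OF mk n]) simp
  show "sets (marginal_law \<Omega> X n (Suc t)) = sets (marginal_law \<Omega> X n t \<bind> Q ?u)"
    using sets_bind'[OF L Q_markov[OF u]] by (simp add: marginal_law_def)
  fix A assume "A \<in> sets (marginal_law \<Omega> X n (Suc t))"
  then have A: "A \<in> sets SS" by (simp add: marginal_law_def)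
  have mQ: "(\<lambda>x. measure (Q ?u x) A) \<in> borel_measurable SS"
    by (rule measurable_compose[OF measurable_prob_algebraD[OF Q_markov[OF u]] measurable_measure_subprob_algebra[OF A]])
  have eQ: "(\<lambda>x. emeasure (Q ?u x) A) \<in> borel_measurable SS"
    by (rule measurable_compose[OF measurable_prob_algebraD[OF Q_markov[OF u]] measurable_emeasure_subprob_algebra[OF A]])
  have Ii: "integrable (\<Omega> n) (\<lambda>\<omega>. measure (Q ?u (X n t \<omega>)) A)"
    using measurable_compose[OF Xm(1) mQ] kernelD(1)[OF Q_markov[OF u], THEN prob_space.prob_le_1]
    by (intro P.integrable_const_bound[of _ 1]) auto
  have Zi: "integrable (\<Omega> n) (\<lambda>\<omega>. indicator A (X n (Suc t) \<omega>) :: real)"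
    using measurable_compose[OF Xm(2), of "indicator A" borel] A
    by (intro P.integrable_const_bound[of _ 1]) (auto simp: indicator_def)
  have one: "indicator (space (PS 1)) (\<lambda>i\<in>{0..<1}. X n (t + i) \<omega>) = (1 :: real)" if "\<omega> \<in> space (\<Omega> n)" for \<omega>
    using measurable_space[OF win_meas[OF mk n, of t 1] that] t by (simp del: restrict_apply One_nat_def)
  have "(\<integral>\<omega>. indicator A (X n (Suc t) \<omega>) \<partial>\<Omega> n) =
      (\<integral>\<omega>. indicator (space (PS 1)) (\<lambda>i\<in>{0..<1}. X n (t + i) \<omega>) * (indicator A (X n (t + 1) \<omega>) :: real) \<partial>\<Omega> n)"
    using one by (intro Bochner_Integration.integral_cong) (simp_all del: restrict_apply One_nat_def, simp)
  also have "\<dots> = (\<integral>\<omega>. indicator (space (PS 1)) (\<lambda>i\<in>{0..<1}. X n (t + i) \<omega>) * measure (Q (real (t + 1) / real n) (X n (t + 1 - 1) \<omega>)) A \<partial>\<Omega> n)"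
    using t by (intro past_rectangle[OF mk n _ _ _ A]) auto
  also have "\<dots> = (\<integral>\<omega>. measure (Q (real (t + 1) / real n) (X n (t + 1 - 1) \<omega>)) A \<partial>\<Omega> n)"
    using one by (intro Bochner_Integration.integral_cong) (simp_all del: restrict_apply One_nat_def)
  finally have eq: "(\<integral>\<omega>. indicator A (X n (Suc t) \<omega>) \<partial>\<Omega> n) = (\<integral>\<omega>. measure (Q ?u (X n t \<omega>)) A \<partial>\<Omega> n)" by simp
  have "emeasure (marginal_law \<Omega> X n (Suc t)) A = (\<integral>\<^sup>+\<omega>. indicator A (X n (Suc t) \<omega>) \<partial>\<Omega> n)"
    unfolding marginal_law_def using A
    by (subst nn_integral_indicator[symmetric]) (auto simp del: nn_integral_indicator intro!: nn_integral_distr[OF Xm(2)])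
  also have "\<dots> = (\<integral>\<^sup>+\<omega>. ennreal (indicator A (X n (Suc t) \<omega>)) \<partial>\<Omega> n)" by (simp add: ennreal_indicator)
  also have "\<dots> = ennreal (\<integral>\<omega>. indicator A (X n (Suc t) \<omega>) \<partial>\<Omega> n)" by (rule nn_integral_eq_integral[OF Zi]) simp
  also have "\<dots> = (\<integral>\<^sup>+\<omega>. ennreal (measure (Q ?u (X n t \<omega>)) A) \<partial>\<Omega> n)"
    unfolding eq by (rule nn_integral_eq_integral[OF Ii, symmetric]) simp
  also have "\<dots> = (\<integral>\<^sup>+\<omega>. emeasure (Q ?u (X n t \<omega>)) A \<partial>\<Omega> n)"
    using kernelD(1)[OF Q_markov[OF u]] by (intro nn_integral_cong) (simp add: finite_measure.emeasure_eq_measure prob_space.finite_measure)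
  also have "\<dots> = (\<integral>\<^sup>+x. emeasure (Q ?u x) A \<partial>marginal_law \<Omega> X n t)"
    unfolding marginal_law_def by (subst nn_integral_distr[OF Xm(1)]) (simp_all add: eQ del: of_nat_Suc)
  also have "\<dots> = emeasure (marginal_law \<Omega> X n t \<bind> Q ?u) A"
    by (rule emeasure_bind_prob_algebra[OF L Q_markov[OF u] A, symmetric])
  finally show "emeasure (marginal_law \<Omega> X n (Suc t)) A = emeasure (marginal_law \<Omega> X n t \<bind> Q ?u) A" .
qed

lemma marginal:
  assumes mk: "markov_array SS Q \<Omega> X" and n: "1 \<le> n" and t: "t \<le> n"
  shows "integrable (marginal_law \<Omega> X n t) (V k)"
    and "g \<in> wspace SS (V k) \<Longrightarrow> (\<integral>x. g x \<partial>marginal_law \<Omega> X n t) = Y 0 (TL (grid n 0 t) g) base"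
proof -
  have "integrable (marginal_law \<Omega> X n t) (V k) \<and> (\<forall>g\<in>wspace SS (V k). (\<integral>x. g x \<partial>marginal_law \<Omega> X n t) = Y 0 (TL (grid n 0 t) g) base)"
    using t
  proof (induction t)
    case 0
    have "marginal_law \<Omega> X n 0 = stat 0" by (simp add: marginal_law_def X_init[OF mk n])
    then show ?case using stat(3)[of 0] stat(4)[of 0 k] by (simp add: grid_refl)
  next
    case (Suc t)
    let ?u = "real (Suc t) / real n"
    have u: "?u \<in> {0..1}" by (rule frac_I[OF n Suc.prems])
    have L: "marginal_law \<Omega> X n t \<in> space (prob_algebra SS)" using Suc.prems by (intro marginal_prob[OF mk n]) simp
    have IH: "integrable (marginal_law \<Omega> X n t) (V k)" "\<And>g. g \<in> wspace SS (V k) \<Longrightarrow> (\<integral>x. g x \<partial>marginal_law \<Omega> X n t) = Y 0 (TL (grid n 0 t) g) base"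
      using Suc by auto
    have b: "(\<integral>x. g x \<partial>(marginal_law \<Omega> X n t \<bind> Q ?u)) = (\<integral>x. (\<integral>y. g y \<partial>Q ?u x) \<partial>marginal_law \<Omega> X n t)" "integrable (marginal_law \<Omega> X n t \<bind> Q ?u) (V k)"
      if "g \<in> wspace SS (V k)" for g
      using integral_bind_kernel[OF L Q_markov[OF u] V_meas V_ge1 V_meas V_pos(2) Q_growth[OF u order_refl] _ IH(1) that] K1 by auto
    have "(\<integral>x. g x \<partial>(marginal_law \<Omega> X n t \<bind> Q ?u)) = Y 0 (TL (grid n 0 (Suc t)) g) base" if g: "g \<in> wspace SS (V k)" for g
    proof -
      have "(\<integral>x. g x \<partial>(marginal_law \<Omega> X n t \<bind> Q ?u)) = (\<integral>x. T ?u g x \<partial>marginal_law \<Omega> X n t)"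
        unfolding b(1)[OF g] T_def ..
      also have "\<dots> = Y 0 (TL (grid n 0 t) (T ?u g)) base" by (rule IH(2)[OF T_wspace[OF u order_refl g]])
      finally show ?thesis by (simp add: grid_snoc)
    qed
    then show ?case using b(2)[OF const_wspace] unfolding marginal_step[OF mk n Suc.prems] by blast
  qed
  then show "integrable (marginal_law \<Omega> X n t) (V k)"
    and "g \<in> wspace SS (V k) \<Longrightarrow> (\<integral>x. g x \<partial>marginal_law \<Omega> X n t) = Y 0 (TL (grid n 0 t) g) base" by blast+
qed

lemma V_wspace: "s \<le> t \<Longrightarrow> V s \<in> wspace SS (V t)"
  by (rule wspaceI[of 1], simp, rule wballI) (use V_mono[of s t] V_pos(2)[of s] in \<open>auto intro: V_meas\<close>)

text \<open>Freezing the kernels costs the weight \<open>V 1\<close>; this bound, uniform in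
  \<open>n\<close> and \<open>t\<close> thanks to \<open>adm_grid\<close>, pays for it.\<close>

lemma marginal_moment:
  obtains A where "A > 0" "\<And>(\<Omega> :: nat \<Rightarrow> 'w measure) X n t. markov_array SS Q \<Omega> X \<Longrightarrow> 1 \<le> n \<Longrightarrow> t \<le> n \<Longrightarrow> (\<integral>x. V 1 x \<partial>marginal_law \<Omega> X n t) \<le> A"
proof -
  obtain A where A: "A > 0" "\<And>us x. adm n0 us \<Longrightarrow> (\<integral>\<^sup>+x'. ennreal (V 1 x') \<partial>kernel_prod SS Q us x) \<le> ennreal (A * V 1 x)"
    using moment_bound[OF k, of n0] by blast
  obtain c where c: "c > 0" "\<And>s u. s \<le> k \<Longrightarrow> u \<in> {0..1} \<Longrightarrow> regop SS (V s) SS (V s) c (Y u)" by (rule Y_regop) blast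
  show ?thesis
  proof (rule that[of "A * (c * V 1 base)"])
    show "0 < A * (c * V 1 base)" using A c V_pos by simp
    fix \<Omega> :: "nat \<Rightarrow> 'w measure" and X and n t :: nat assume mk: "markov_array SS Q \<Omega> X" and n: "1 \<le> n" "t \<le> n"
    let ?us = "grid n 0 t"
    have us: "set ?us \<subseteq> {0..1}" by (rule grid_I[OF n])
    have V1: "V 1 \<in> wspace SS (V 1)" "V 1 \<in> wspace SS (V k)" using k by (auto intro!: V_wspace)
    have "TL ?us (V 1) \<in> wball SS (\<lambda>x. A * V 1 x)"
    proof (rule wballI)
      show "TL ?us (V 1) \<in> borel_measurable SS" by (rule wspace_meas[OF TL_wspace[OF us k V1(1)]])
      fix x :: "'y \<times> 'z"
      have "0 \<le> A * V 1 x" using A V_pos(2)[of 1 x] by simp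
      then have "(\<integral>y. V 1 y \<partial>kernel_prod SS Q ?us x) \<le> A * V 1 x"
        by (intro integrable_kernel(2)[OF kernel_prod_Q[OF us] _ V_meas V_pos(2) A(2)[OF adm_grid[OF n]]]) simp
      moreover have "0 \<le> (\<integral>y. V 1 y \<partial>kernel_prod SS Q ?us x)" by (intro Bochner_Integration.integral_nonneg V_pos)
      ultimately show "\<bar>TL ?us (V 1) x\<bar> \<le> A * V 1 x" unfolding TL_kernel_prod[OF us k V1(1)] by simp
    qed
    then have "\<bar>Y 0 (TL ?us (V 1)) base\<bar> \<le> A * (c * V 1 base)"
      using A(1) by (intro regop_bound[OF c(2)[OF k]]) auto
    then show "(\<integral>x. V 1 x \<partial>marginal_law \<Omega> X n t) \<le> A * (c * V 1 base)" using marginal(2)[OF mk n V1(2)] by simp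
  qed
qed

lemma window_law_WT:
  assumes mk: "markov_array SS Q \<Omega> X" and n: "1 \<le> n" and t: "t + j \<le> n"
  shows "integrable (window_law SS \<Omega> X n t (Suc j)) (PW (Suc j) k)"
    and "g \<in> wspace (PS (Suc j)) (PW (Suc j) k) \<Longrightarrow>
      (\<integral>p. g p \<partial>window_law SS \<Omega> X n t (Suc j)) = (\<integral>x. WT n t j g (single x) \<partial>marginal_law \<Omega> X n t)"
proof -
  have "integrable (window_law SS \<Omega> X n t (Suc j)) (PW (Suc j) k) \<and> (\<forall>g\<in>wspace (PS (Suc j)) (PW (Suc j) k).
      (\<integral>p. g p \<partial>window_law SS \<Omega> X n t (Suc j)) = (\<integral>x. WT n t j g (single x) \<partial>marginal_law \<Omega> X n t))"
    using t
  proof (induction j)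
    have one: "Suc 0 = 1" by simp
    case 0
    have Xm: "X n t \<in> \<Omega> n \<rightarrow>\<^sub>M SS" using 0 by (intro X_meas[OF mk n]) simp
    have w1: "window_law SS \<Omega> X n t 1 = distr (marginal_law \<Omega> X n t) (PS 1) single"
      unfolding window_law_def marginal_law_def distr_distr[OF single_meas Xm]
      by (intro distr_cong) (auto simp: single_def fun_eq_iff restrict_def)
    have sm: "single \<in> marginal_law \<Omega> X n t \<rightarrow>\<^sub>M PS 1" unfolding marginal_law_def using single_meas by simp
    have "integrable (distr (marginal_law \<Omega> X n t) (PS 1) single) (PW 1 k)"
      using marginal(1)[OF mk n] 0 by (subst integrable_distr_eq[OF sm PW_meas]) (simp only: PW_single add_0_right)
    moreover have "(\<integral>p. g p \<partial>distr (marginal_law \<Omega> X n t) (PS 1) single) = (\<integral>x. WT n t 0 g (single x) \<partial>marginal_law \<Omega> X n t)"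
      if "g \<in> wspace (PS 1) (PW 1 k)" for g
      using integral_distr[OF sm wspace_meas[OF that]] by simp
    ultimately show ?case unfolding one w1 by blast
  next
    case (Suc j)
    let ?L = "window_law SS \<Omega> X n t (Suc j)" and ?u = "real (t + Suc j) / real n"
    have IH: "integrable ?L (PW (Suc j) k)" "\<And>g. g \<in> wspace (PS (Suc j)) (PW (Suc j) k) \<Longrightarrow> (\<integral>p. g p \<partial>?L) = (\<integral>x. WT n t j g (single x) \<partial>marginal_law \<Omega> X n t)"
      using Suc by auto
    have L: "?L \<in> space (prob_algebra (PS (Suc j)))" using Suc.prems by (intro window_prob[OF mk n]) simp
    have j1: "1 \<le> Suc j" by simp
    have u: "?u \<in> {0..1}" by (rule frac_I[OF n Suc.prems])
    have "(\<integral>p. g p \<partial>(?L \<bind> ext (Suc j) ?u)) = (\<integral>x. WT n t (Suc j) g (single x) \<partial>marginal_law \<Omega> X n t)"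
      if g: "g \<in> wspace (PS (Suc (Suc j))) (PW (Suc (Suc j)) k)" for g
      using bind_ext(1)[OF L IH(1) j1 u order_refl g] IH(2)[OF opC_wspace[OF TT_opC[OF j1] mono_weights_PW[OF j1] order_refl u g]]
      by (simp only: WT.simps)
    with bind_ext(2)[OF L IH(1) j1 u order_refl PS_zero] show ?case unfolding window_step[OF mk n Suc.prems j1] by blast
  qed
  then show "integrable (window_law SS \<Omega> X n t (Suc j)) (PW (Suc j) k)"
    and "g \<in> wspace (PS (Suc j)) (PW (Suc j) k) \<Longrightarrow>
      (\<integral>p. g p \<partial>window_law SS \<Omega> X n t (Suc j)) = (\<integral>x. WT n t j g (single x) \<partial>marginal_law \<Omega> X n t)" by blast+
qed

text \<open>Three errors add up: freezing the kernels over the window (\<open>D * A\<close>), the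
  distance of the marginal law from the invariant law at \<open>t / n\<close>
  (\<open>E * c\<close>), and the move from \<open>t / n\<close> to \<open>u\<close>
  (\<open>L * c\<close>).\<close>

lemma window_bound:
  obtains D where "D > 0" "\<And>(\<Omega> :: nat \<Rightarrow> 'w measure) X n t u g. markov_array SS Q \<Omega> X \<Longrightarrow> 1 \<le> n \<Longrightarrow> t + j \<le> n \<Longrightarrow> u \<in> {0..1} \<Longrightarrow>
    g \<in> wball (PS (Suc j)) (PW (Suc j) 0) \<Longrightarrow>
    \<bar>(\<integral>p. g p \<partial>window_law SS \<Omega> X n t (Suc j)) - (\<integral>p. g p \<partial>stationary_path_law SS Q u (Suc j))\<bar> \<le> D * (\<bar>u - real t / real n\<bar> + 1 / real n)"
proof -
  obtain D where D: "D > 0" "\<And>n t u g p. 1 \<le> n \<Longrightarrow> t + j \<le> n \<Longrightarrow> u \<in> {0..1} \<Longrightarrow> g \<in> wball (PS (Suc j)) (PW (Suc j) 0) \<Longrightarrow>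
    p \<in> space (PS 1) \<Longrightarrow> \<bar>WT n t j g p - PT j u g p\<bar> \<le> D * (\<bar>u - real t / real n\<bar> + 1 / real n) * PW 1 1 p"
    by (rule WT_PT[of j]) blast
  obtain E where E: "E > 0" "\<And>n t h c. 1 \<le> n \<Longrightarrow> t \<le> n \<Longrightarrow> h \<in> wball SS (\<lambda>x. c * V 0 x) \<Longrightarrow> c > 0 \<Longrightarrow>
    \<bar>Y 0 (TL (grid n 0 t) h) base - Y (real t / real n) h base\<bar> \<le> E * c / real n"
    by (rule grid_telescope) blast
  obtain L where L: "L > 0" "\<And>g u v c. g \<in> wball SS (\<lambda>x. c * V 0 x) \<Longrightarrow> c > 0 \<Longrightarrow> u \<in> {0..1} \<Longrightarrow> v \<in> {0..1} \<Longrightarrow>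
    \<bar>Y v g base - Y u g base\<bar> \<le> L * c * \<bar>v - u\<bar>" by (rule Y_lipschitz) blast
  obtain A where A: "A > 0" "\<And>(\<Omega> :: nat \<Rightarrow> 'w measure) X n t. markov_array SS Q \<Omega> X \<Longrightarrow> 1 \<le> n \<Longrightarrow> t \<le> n \<Longrightarrow> (\<integral>x. V 1 x \<partial>marginal_law \<Omega> X n t) \<le> A"
    by (rule marginal_moment) blast
  obtain c where c: "c > 0" "\<And>s u. s + 0 \<le> k \<Longrightarrow> u \<in> {0..1} \<Longrightarrow> regop (PS (Suc j)) (PW (Suc j) s) SS (V (s + 0)) c (path_op j u)"
    using opC_opB[OF path_op_opC[of j]] by (auto elim: opB_regop)
  obtain B where B: "B > 0" "\<And>n t. 1 \<le> n \<Longrightarrow> t + j \<le> n \<Longrightarrow> regop (PS (Suc j)) (PW (Suc j) k) (PS 1) (PW 1 k) B (WT n t j)"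
    using WT_regop[OF order_refl, of j] by auto
  show ?thesis
  proof (rule that[of "D * A + E * c + L * c"])
    show "0 < D * A + E * c + L * c" using D(1) A(1) E(1) c(1) L(1) by (simp add: add_pos_pos)
    fix \<Omega> :: "nat \<Rightarrow> 'w measure" and X and n t :: nat and u g
    assume mk: "markov_array SS Q \<Omega> X" and n: "1 \<le> n" "t + j \<le> n" and u: "u \<in> {0..1::real}"
      and g: "g \<in> wball (PS (Suc j)) (PW (Suc j) 0)"
    have tn: "t \<le> n" using n by simp
    have tu: "real t / real n \<in> {0..1}" by (rule frac_I[OF n(1) tn])
    let ?\<delta> = "\<bar>u - real t / real n\<bar> + 1 / real n" and ?\<mu> = "marginal_law \<Omega> X n t"
    have \<delta>: "0 < ?\<delta>" using n by (intro add_nonneg_pos) auto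
    have \<mu>s: "sets ?\<mu> = sets SS" by (simp add: marginal_law_def)
    define h where "h = path_op j u g"
    have h: "h \<in> wball SS (\<lambda>x. c * V 0 x)" unfolding h_def using regopD(1)[OF c(2)[OF _ u, of 0] g] by simp
    have hk: "h \<in> wspace SS (V k)" by (rule wspace_mono[OF wspaceI[OF c(1) h]]) (rule V_mono, simp)
    have g0: "g \<in> wspace (PS (Suc j)) (PW (Suc j) 0)" by (rule wball_wspace[OF g])
    have gk: "g \<in> wspace (PS (Suc j)) (PW (Suc j) k)" by (rule wspace_mono[OF g0 PW_le]) simp
    let ?w = "\<lambda>x. WT n t j g (single x)"
    have WTw: "WT n t j g \<in> wspace (PS 1) (PW 1 k)"
      using B n gk by (intro regop_wspace[OF B(2)]) (auto simp: sum_weight_def V_pos)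
    have wm: "?w \<in> borel_measurable SS" by (rule measurable_compose[OF single_meas wspace_meas[OF WTw]])
    have "(\<lambda>x. ?w x - h x) \<in> wball SS (\<lambda>x. (D * ?\<delta>) * V 1 x)"
    proof (rule wballI)
      show "(\<lambda>x. ?w x - h x) \<in> borel_measurable SS" by (rule borel_measurable_diff[OF wm wball_meas[OF h]])
      fix x :: "'y \<times> 'z" assume x: "x \<in> space SS"
      show "\<bar>?w x - h x\<bar> \<le> (D * ?\<delta>) * V 1 x"
        using D(2)[OF n u g measurable_space[OF single_meas x]] unfolding h_def path_op_def PW_single .
    qed
    moreover have iV1: "integrable ?\<mu> (V 1)"
      by (rule wspace_integrable[OF \<mu>s marginal(1)[OF mk n(1) tn] V_wspace[OF k]])
    moreover have D\<delta>: "0 < D * ?\<delta>" using D(1) \<delta> by (rule mult_pos_pos)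
    ultimately have "\<bar>\<integral>x. ?w x - h x \<partial>?\<mu>\<bar> \<le> (D * ?\<delta>) * (\<integral>x. V 1 x \<partial>?\<mu>)" by (intro wball_integral_le[OF \<mu>s])
    also have "\<dots> \<le> (D * ?\<delta>) * A" using D\<delta> A(2)[OF mk n(1) tn] by (intro mult_left_mono) auto
    finally have 1: "\<bar>\<integral>x. ?w x - h x \<partial>?\<mu>\<bar> \<le> (D * ?\<delta>) * A" .
    have wk: "?w \<in> wspace SS (V k)"
    proof -
      obtain e where e: "e > 0" "WT n t j g \<in> wball (PS 1) (\<lambda>p. e * PW 1 k p)" using WTw by (rule wspaceE)
      show ?thesis
        by (rule wspaceI[OF e(1)], rule wballI[OF wm])
          (use wball_bound[OF e(2) measurable_space[OF single_meas]] in \<open>simp only: PW_single\<close>)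
    qed
    have "(\<integral>x. ?w x - h x \<partial>?\<mu>) = (\<integral>x. ?w x \<partial>?\<mu>) - (\<integral>x. h x \<partial>?\<mu>)"
      by (intro Bochner_Integration.integral_diff wspace_integrable[OF \<mu>s marginal(1)[OF mk n(1) tn]] wk hk)
    moreover have "(\<integral>x. ?w x \<partial>?\<mu>) = (\<integral>p. g p \<partial>window_law SS \<Omega> X n t (Suc j))"
      by (rule window_law_WT(2)[OF mk n gk, symmetric])
    moreover have "(\<integral>x. h x \<partial>?\<mu>) = Y 0 (TL (grid n 0 t) h) base" by (rule marginal(2)[OF mk n(1) tn hk])
    moreover have "(\<integral>p. g p \<partial>stationary_path_law SS Q u (Suc j)) = Y u h base"
      using path_law_Y[OF u _ g0] by (simp add: stationary_path_law_def stat_def h_def)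
    moreover have "\<bar>Y 0 (TL (grid n 0 t) h) base - Y (real t / real n) h base\<bar> \<le> E * c * (1 / real n)"
      using E(2)[OF n(1) tn h c(1)] by simp
    moreover have "\<bar>Y (real t / real n) h base - Y u h base\<bar> \<le> L * c * \<bar>u - real t / real n\<bar>"
      using L(2)[OF h c(1) u tu] by (simp add: abs_minus_commute)
    moreover have "E * c * (1 / real n) \<le> E * c * ?\<delta>" "L * c * \<bar>u - real t / real n\<bar> \<le> L * c * ?\<delta>"
      using E(1) L(1) c(1) by (intro mult_left_mono; simp)+
    moreover have "(D * A + E * c + L * c) * ?\<delta> = (D * ?\<delta>) * A + E * c * ?\<delta> + L * c * ?\<delta>"
      by (simp only: distrib_right ac_simps)
    ultimately show "\<bar>(\<integral>p. g p \<partial>window_law SS \<Omega> X n t (Suc j)) - (\<integral>p. g p \<partial>stationary_path_law SS Q u (Suc j))\<bar> \<le> (D * A + E * c + L * c) * ?\<delta>"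
      using 1 by linarith
  qed
qed

lemma measure_diff_lmeas:
  assumes N: "sets N = sets M" and N': "sets N' = sets M"
  shows "measure N A - measure N' A = lmeas M (\<lambda>g. (\<integral>x. g x \<partial>N) - (\<integral>x. g x \<partial>N')) A"
proof (cases "A \<in> sets M")
  case True
  have "A \<inter> space N = A" "A \<inter> space N' = A" 
    using True N N' sets.sets_into_space[of A N] sets.sets_into_space[of A N'] by auto
  then show ?thesis using True N N' by (simp add: lmeas_def)
qed (use N N' in \<open>simp add: lmeas_def measure_notin_sets\<close>)

lemma array_locally_stationary:
  fixes \<Omega> :: "nat \<Rightarrow> 'w measure"
  assumes mk: "markov_array SS Q \<Omega> X"
  shows "locally_stationary SS (V 0) Q \<Omega> X"
  unfolding locally_stationary_def
proof (intro allI impI)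
  fix j :: nat assume "1 \<le> j"
  then obtain j' where j': "j = Suc j'" by (cases j) auto
  obtain D where D: "D > 0" "\<And>(\<Omega> :: nat \<Rightarrow> 'w measure) X n t u g. markov_array SS Q \<Omega> X \<Longrightarrow> 1 \<le> n \<Longrightarrow> t + j' \<le> n \<Longrightarrow> u \<in> {0..1} \<Longrightarrow>
    g \<in> wball (PS (Suc j')) (PW (Suc j') 0) \<Longrightarrow>
    \<bar>(\<integral>p. g p \<partial>window_law SS \<Omega> X n t (Suc j')) - (\<integral>p. g p \<partial>stationary_path_law SS Q u (Suc j'))\<bar> \<le> D * (\<bar>u - real t / real n\<bar> + 1 / real n)"
    by (rule window_bound[of j']) blast
  have "weighted_norm (PS j) (PW j 0) (\<lambda>A. measure (window_law SS \<Omega> X n t j) A - measure (stationary_path_law SS Q u j) A)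
     \<le> ereal (D * (\<bar>u - real t / real n\<bar> + 1 / real n))"
    if u: "u \<in> {0..1}" and n: "1 \<le> n" and t: "t + j \<le> n + 1" for u n t
  proof -
    let ?W = "window_law SS \<Omega> X n t (Suc j')" and ?S = "stationary_path_law SS Q u (Suc j')"
    have t': "t + j' \<le> n" using t by (simp add: j')
    have S: "?S \<in> space (prob_algebra (PS (Suc j')))" "integrable ?S (PW (Suc j') k)"
      using path_law[OF u, of j'] by (auto simp: stationary_path_law_def stat_def)
    have s: "sets ?W = sets (PS (Suc j'))" "sets ?S = sets (PS (Suc j'))"
      using S(1) by (auto simp: window_law_def space_prob_algebra)
    have "PW (Suc j') 0 \<in> wspace (PS (Suc j')) (PW (Suc j') k)"
      by (rule wspaceI[of 1], simp, rule wballI[OF PW_meas])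
        (use PW_le[of 0 k "Suc j'"] in \<open>auto simp: sum_weight_def sum_nonneg V_pos\<close>)
    note i = wspace_integrable[OF s(1) window_law_WT(1)[OF mk n t'] this] wspace_integrable[OF s(2) S(2) this]
    have "weighted_norm (PS (Suc j')) (PW (Suc j') 0) (\<lambda>A. measure ?W A - measure ?S A) =
        (SUP g\<in>wball (PS (Suc j')) (PW (Suc j') 0). ereal ((\<integral>x. g x \<partial>?W) - (\<integral>x. g x \<partial>?S)))"
      unfolding measure_diff_lmeas[OF s]
      by (rule weighted_norm_lmeas[OF regfun_diff_fun[OF regfun_integral[OF s(1) i(1)] regfun_integral[OF s(2) i(2)]] PW_ge1 PW_meas]) simp
    also have "\<dots> \<le> ereal (D * (\<bar>u - real t / real n\<bar> + 1 / real n))"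
      using D(2)[OF mk n t' u] by (intro SUP_least) (force simp: abs_le_iff)
    finally show ?thesis unfolding j' .
  qed
  then show "\<exists>D>0. \<forall>u\<in>{0..1}. \<forall>n\<ge>1. \<forall>t\<ge>1. t + j \<le> n + 1 \<longrightarrow>
     weighted_norm (PS j) (PW j 0) (\<lambda>A. measure (window_law SS \<Omega> X n t j) A - measure (stationary_path_law SS Q u j) A)
     \<le> ereal (D * (\<bar>u - real t / real n\<bar> + 1 / real n))" using D(1) by blast
qed

end

text \<open>The first conjunct guarantees that \<open>invariant_law\<close>, a definite description,
  denotes the law that the other two conjuncts speak of.\<close>

theorem proposition6:
  fixes P :: "real \<Rightarrow> 'y::finite \<Rightarrow> 'y \<Rightarrow> 'z::metric_space \<Rightarrow> real"
    and f :: "real \<Rightarrow> 'z \<Rightarrow> 'z \<Rightarrow> real"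
    and \<gamma> :: "'z \<Rightarrow> 'z measure"
    and Qb :: "real \<Rightarrow> 'z \<Rightarrow> 'z measure"
    and Q :: "real \<Rightarrow> 'y \<times> 'z \<Rightarrow> ('y \<times> 'z) measure"
    and k m :: nat
    and \<phi> :: "'z \<Rightarrow> real"
    and d0 d1 q \<epsilon> \<rho> b K Cb C :: real
    and \<eta> :: "real \<Rightarrow> real"
    and \<nu> :: "real \<Rightarrow> 'z measure"
  assumes P_meas: "\<And>u y y'. u \<in> {0..1} \<Longrightarrow> P u y y' \<in> borel_measurable borel"
    and P_nonneg: "\<And>u y y' z. u \<in> {0..1} \<Longrightarrow> P u y y' z \<ge> 0"
    and P_stoch: "\<And>u y z. u \<in> {0..1} \<Longrightarrow> (\<Sum>y'\<in>UNIV. P u y y' z) = 1"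
    and f_meas: "(\<lambda>(u, z, z'). f u z z') \<in>
          borel_measurable (restrict_space borel {0..1} \<Otimes>\<^sub>M (borel \<Otimes>\<^sub>M borel))"
    and f_nonneg: "\<And>u z z'. u \<in> {0..1} \<Longrightarrow> f u z z' \<ge> 0"
    and \<gamma>_kernel: "nonneg_kernel borel borel \<gamma>"
    and Qb_eq: "Qb = density_kernel f \<gamma>"
    and Qb_markov: "\<And>u. u \<in> {0..1} \<Longrightarrow> Qb u \<in> measurable borel (prob_algebra borel)"
    and Q_eq: "Q = joint_kernel P Qb"
    and k: "k \<ge> 1"
    and E41: "\<And>y1 y2 z2. Ck01 k (\<lambda>u. P u y1 y2 z2)"
             "\<And>u y1 y2 z2. u \<in> {0..1} \<Longrightarrow> P u y1 y2 z2 > 0"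
    and \<phi>_meas: "\<phi> \<in> borel_measurable borel"
    and \<phi>_ge1: "\<And>z. \<phi> z \<ge> 1"
    and E42_i_const: "m \<ge> 1" "d0 \<ge> 1" "\<epsilon> > 0" "K > 0" "b > 0" "0 < \<rho>" "\<rho> < 1"
          "\<And>r. r > 0 \<Longrightarrow> \<eta> r > 0"
          "\<And>r. r > 0 \<Longrightarrow> \<nu> r \<in> space (prob_algebra borel)"
    and E42_i_drift: "\<And>us z. length us = m \<Longrightarrow> set us \<subseteq> {0..1} \<Longrightarrow>
          (\<forall>u\<in>set us. \<forall>v\<in>set us. \<bar>u - v\<bar> < \<epsilon>) \<Longrightarrow>
          (\<integral>\<^sup>+ z'. ennreal (\<phi> z' powr d0) \<partial>kernel_prod borel Qb us z)
            \<le> ennreal (\<rho> * \<phi> z powr d0 + b)"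
    and E42_i_minor: "\<And>r us z A. r > 0 \<Longrightarrow> length us = m \<Longrightarrow> set us \<subseteq> {0..1} \<Longrightarrow>
          (\<forall>u\<in>set us. \<forall>v\<in>set us. \<bar>u - v\<bar> < \<epsilon>) \<Longrightarrow>
          \<phi> z powr d0 \<le> r \<Longrightarrow> A \<in> sets borel \<Longrightarrow>
          measure (kernel_prod borel Qb us z) A \<ge> \<eta> r * measure (\<nu> r) A"
    and E42_i_growth: "\<And>u z. u \<in> {0..1} \<Longrightarrow>
          (\<integral>\<^sup>+ z'. ennreal (\<phi> z' powr d0) \<partial>Qb u z) \<le> ennreal (K * \<phi> z powr d0)"
    and E42_ii: "\<And>z z'. Ck01 k (\<lambda>u. f u z z')"
    and E42_iii_const: "d1 > 0" "q \<ge> 0" "Cb > 0" "d1 + real k * q \<le> d0"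
    and E42_iii_bound: "\<And>l d u z. 1 \<le> l \<Longrightarrow> l \<le> k \<Longrightarrow>
          0 \<le> d \<Longrightarrow> d \<le> d1 + real (k - l) * q \<Longrightarrow> u \<in> {0..1} \<Longrightarrow>
          (\<integral>\<^sup>+ z'. ennreal (\<phi> z' powr d * \<bar>nth_deriv01 l (\<lambda>v. f v z z') u\<bar>) \<partial>\<gamma> z)
            \<le> ennreal (Cb * \<phi> z powr (d + q * real l))"
    and E42_iii_cont: "\<And>s u z. s \<le> k \<Longrightarrow> u \<in> {0..1} \<Longrightarrow>
          ((\<lambda>h. \<integral>\<^sup>+ z'. ennreal (\<phi> z' powr (d1 + q * real s) *
                \<bar>nth_deriv01 (k - s) (\<lambda>v. f v z z') (u + h)
                  - nth_deriv01 (k - s) (\<lambda>v. f v z z') u\<bar>) \<partial>\<gamma> z) \<longlongrightarrow> 0)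
            (at 0 within {h. u + h \<in> {0..1}})"
    and E43: "C > 0"
          "\<And>l u y y' z. l \<le> k \<Longrightarrow> u \<in> {0..1} \<Longrightarrow>
             \<bar>nth_deriv01 l (\<lambda>v. P v y y' z) u\<bar> \<le> C * \<phi> z powr (q * real l)"
  shows "(\<forall>u\<in>{0..1}. \<exists>!\<pi>. invariant_prob state_space (Q u) \<pi>) \<and>
    (\<forall>(\<Omega> :: nat \<Rightarrow> 'w measure) X. markov_array state_space Q \<Omega> X \<longrightarrow>
       locally_stationary state_space (\<lambda>(y, z). \<phi> z powr d1) Q \<Omega> X) \<and>
    (\<forall>j\<ge>1. Ck01_weighted k (power_space state_space j)
       (sum_weight (\<lambda>(y, z). \<phi> z powr d1) j)
       (\<lambda>u. measure (stationary_path_law state_space Q u j)))"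
proof -
  interpret density_chain P f \<gamma> Qb Q k m \<phi> d0 d1 q \<epsilon> \<rho> b K Cb C \<eta> \<nu>
    by unfold_locales (fact assms)+
  have V0: "(\<lambda>(y, z). \<phi> z powr d1) = V 0" by (simp add: V_def)
  show ?thesis
    unfolding V0 using invariant_unique array_locally_stationary stationary_smooth by blast
qed

end
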